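(* Let $\mathfrak g=\mathfrak g_2$ be the complex simple Lie algebra of type $G_2$ and let $V$ be a non-trivial, simple (finite-dimensional) $\mathfrak g$-module; such a $V$ is automatically self-dual with $V[0]\neq\{0\}$. Then $V[0]$ is irreducible under the Casimir algebra $\mathcal C_{\mathfrak g}$ if, and only if, $V$ is a fundamental representation or the second Cartan power of a fundamental representation, i.e. its highest weight is one of $\varpi_1,\varpi_2,2\varpi_1,2\varpi_2$, where $\varpi_1,\varpi_2$ are the fundamental weights of $\mathfrak g_2$.
   Context: $V[0]$ is the zero weight space. Let $\mathfrak h\subset\mathfrak g$ be a Cartan subalgebra with root system $R$, $\langle\cdot,\cdot\rangle$ a fixed nonzero multiple of the Killing form, and for $\alpha\in R$ let $e_\alpha\in\mathfrak g_\alpha$, $f_\alpha\in\mathfrak g_{-\alpha}$ with $[e_\alpha,f_\alpha]=\alpha^\vee$ and $\kappa_\alpha=\frac{\langle\alpha,\alpha\rangle}{2}(e_\alpha f_\alpha+f_\alpha e_\alpha)\in U\mathfrak g$. The Casimir algebra $\mathcal C_{\mathfrak g}\subseteq U\mathfrak g$ is the subalgebra generated by all $\kappa_\alpha$, $\alpha\in R$, and by $\mathfrak h$. The $p$-th Cartan power of the simple module of highest weight $\varpi$ is the simple module of highest weight $p\varpi$. *)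

theory Defs
  imports Complex_Main
begin

section \<open>Complex vector spaces and Lie algebras\<close>

class complex_vector = ab_group_add +
  fixes scaleC :: "complex \<Rightarrow> 'a \<Rightarrow> 'a"  (infixr \<open>*\<^sub>C\<close> 75)
  assumes scaleC_add_right: "a *\<^sub>C (x + y) = a *\<^sub>C x + a *\<^sub>C y"
    and scaleC_add_left: "(a + b) *\<^sub>C x = a *\<^sub>C x + b *\<^sub>C x"
    and scaleC_scaleC: "a *\<^sub>C (b *\<^sub>C x) = (a * b) *\<^sub>C x"
    and scaleC_one: "1 *\<^sub>C x = x"

global_interpretation cvec: vector_space "scaleC :: complex \<Rightarrow> 'a \<Rightarrow> 'a::complex_vector"
  by unfold_locales
    (simp_all add: scaleC_add_right scaleC_add_left scaleC_scaleC scaleC_one)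

definition finite_dim :: "'a::complex_vector itself \<Rightarrow> bool" where
  "finite_dim _ \<longleftrightarrow> (\<exists>B::'a set. finite B \<and> cvec.span B = UNIV)"

definition clinear :: "('a::complex_vector \<Rightarrow> 'b::complex_vector) \<Rightarrow> bool" where
  "clinear f \<longleftrightarrow> Vector_Spaces.linear scaleC scaleC f"

text \<open>The trace of an endomorphism of a finite-dimensional space, computed in some basis.\<close>

definition trace_end :: "('a::complex_vector \<Rightarrow> 'a) \<Rightarrow> complex" where
  "trace_end f =
     (let B = (SOME B. cvec.independent B \<and> cvec.span B = UNIV)
      in \<Sum>b\<in>B. cvec.representation B (f b) b)"

class lie_algebra = complex_vector +
  fixes bracket :: "'a \<Rightarrow> 'a \<Rightarrow> 'a"
  assumes bracket_add_left: "bracket (x + y) z = bracket x z + bracket y z"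
    and bracket_add_right: "bracket x (y + z) = bracket x y + bracket x z"
    and bracket_scale_left: "bracket (c *\<^sub>C x) y = c *\<^sub>C bracket x y"
    and bracket_scale_right: "bracket x (c *\<^sub>C y) = c *\<^sub>C bracket x y"
    and bracket_self: "bracket x x = 0"
    and jacobi: "bracket x (bracket y z) + bracket y (bracket z x) + bracket z (bracket x y) = 0"

definition lie_ideal :: "'g::lie_algebra set \<Rightarrow> bool" where
  "lie_ideal I \<longleftrightarrow> cvec.subspace I \<and> (\<forall>x. \<forall>y\<in>I. bracket x y \<in> I)"

definition simple_lie_algebra :: "'g::lie_algebra itself \<Rightarrow> bool" where
  "simple_lie_algebra _ \<longleftrightarrow>
     finite_dim TYPE('g) \<and> (\<exists>x y::'g. bracket x y \<noteq> 0) \<and>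
     (\<forall>I::'g set. lie_ideal I \<longrightarrow> I = {0} \<or> I = UNIV)"

definition killing_form :: "'g::lie_algebra \<Rightarrow> 'g \<Rightarrow> complex" where
  "killing_form x y = trace_end (\<lambda>z. bracket x (bracket y z))"

section \<open>Cartan subalgebras and roots\<close>

text \<open>The definition for (semi)simple complex Lie algebras: a maximal commutative subalgebra
  acting diagonalizably in the adjoint representation.\<close>

definition cartan_subalgebra :: "'g::lie_algebra set \<Rightarrow> bool" where
  "cartan_subalgebra h \<longleftrightarrow>
     cvec.subspace h \<and>
     (\<forall>x\<in>h. \<forall>y\<in>h. bracket x y = 0) \<and>
     (\<forall>x. (\<forall>t\<in>h. bracket t x = 0) \<longrightarrow> x \<in> h) \<and>
     (\<forall>t\<in>h. cvec.span {x. \<exists>c. bracket t x = c *\<^sub>C x} = UNIV)"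

text \<open>Elements of the dual of \<open>h\<close> are functions on the whole type, set to \<open>0\<close> outside \<open>h\<close>, so that
  functionals which agree on \<open>h\<close> are equal.\<close>

definition dual_of :: "'g::complex_vector set \<Rightarrow> ('g \<Rightarrow> complex) set" where
  "dual_of h = {\<mu>. (\<forall>s\<in>h. \<forall>t\<in>h. \<mu> (s + t) = \<mu> s + \<mu> t) \<and>
                   (\<forall>c. \<forall>t\<in>h. \<mu> (c *\<^sub>C t) = c * \<mu> t) \<and>
                   (\<forall>x. x \<notin> h \<longrightarrow> \<mu> x = 0)}"

definition root_space :: "'g::lie_algebra set \<Rightarrow> ('g \<Rightarrow> complex) \<Rightarrow> 'g set" where
  "root_space h \<alpha> = {x. \<forall>t\<in>h. bracket t x = \<alpha> t *\<^sub>C x}"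

definition roots :: "'g::lie_algebra set \<Rightarrow> ('g \<Rightarrow> complex) set" where
  "roots h = {\<alpha> \<in> dual_of h. \<alpha> \<noteq> (\<lambda>_. 0) \<and> root_space h \<alpha> \<noteq> {0}}"

definition killing_multiple :: "('g::lie_algebra \<Rightarrow> 'g \<Rightarrow> complex) \<Rightarrow> bool" where
  "killing_multiple B \<longleftrightarrow> (\<exists>c. c \<noteq> 0 \<and> B = (\<lambda>x y. c * killing_form x y))"

text \<open>The element of \<open>h\<close> that represents a functional with respect to the form \<open>B\<close>, the
  form induced on the dual of \<open>h\<close>, and the coroot \<open>2 t\<^sub>\<alpha> / \<langle>\<alpha>, \<alpha>\<rangle>\<close> of a root.\<close>

definition form_dual :: "('g \<Rightarrow> 'g \<Rightarrow> complex) \<Rightarrow> 'g set \<Rightarrow> ('g \<Rightarrow> complex) \<Rightarrow> 'g" where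
  "form_dual B h \<mu> = (THE t. t \<in> h \<and> (\<forall>s\<in>h. B t s = \<mu> s))"

definition dual_form ::
  "('g \<Rightarrow> 'g \<Rightarrow> complex) \<Rightarrow> 'g set \<Rightarrow> ('g \<Rightarrow> complex) \<Rightarrow> ('g \<Rightarrow> complex) \<Rightarrow> complex" where
  "dual_form B h \<mu> \<nu> = B (form_dual B h \<mu>) (form_dual B h \<nu>)"

definition coroot ::
  "('g::lie_algebra \<Rightarrow> 'g \<Rightarrow> complex) \<Rightarrow> 'g set \<Rightarrow> ('g \<Rightarrow> complex) \<Rightarrow> 'g" where
  "coroot B h \<alpha> = (2 / dual_form B h \<alpha> \<alpha>) *\<^sub>C form_dual B h \<alpha>"

definition positive_roots ::
  "'g::lie_algebra set \<Rightarrow> ('g \<Rightarrow> complex) \<Rightarrow> ('g \<Rightarrow> complex) \<Rightarrow> ('g \<Rightarrow> complex) set" where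
  "positive_roots h \<alpha>\<^sub>1 \<alpha>\<^sub>2 =
     {\<alpha> \<in> roots h. \<exists>m n::nat. \<alpha> = (\<lambda>t. of_nat m * \<alpha>\<^sub>1 t + of_nat n * \<alpha>\<^sub>2 t)}"

definition simple_roots ::
  "'g::lie_algebra set \<Rightarrow> ('g \<Rightarrow> complex) \<Rightarrow> ('g \<Rightarrow> complex) \<Rightarrow> bool" where
  "simple_roots h \<alpha>\<^sub>1 \<alpha>\<^sub>2 \<longleftrightarrow>
     \<alpha>\<^sub>1 \<in> roots h \<and> \<alpha>\<^sub>2 \<in> roots h \<and>
     (\<forall>c d. (\<lambda>t. c * \<alpha>\<^sub>1 t + d * \<alpha>\<^sub>2 t) = (\<lambda>_. 0) \<longrightarrow> c = 0 \<and> d = 0) \<and>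
     (\<forall>\<alpha>\<in>roots h. \<alpha> \<in> positive_roots h \<alpha>\<^sub>1 \<alpha>\<^sub>2 \<or> (\<lambda>t. - \<alpha> t) \<in> positive_roots h \<alpha>\<^sub>1 \<alpha>\<^sub>2)"

text \<open>The root system of \<open>h\<close> is of type \<open>G\<^sub>2\<close>, with base \<open>\<alpha>\<^sub>1\<close> (short) and \<open>\<alpha>\<^sub>2\<close> (long).\<close>

definition g2_base ::
  "('g::lie_algebra \<Rightarrow> 'g \<Rightarrow> complex) \<Rightarrow> 'g set \<Rightarrow> ('g \<Rightarrow> complex) \<Rightarrow> ('g \<Rightarrow> complex) \<Rightarrow> bool" where
  "g2_base B h \<alpha>\<^sub>1 \<alpha>\<^sub>2 \<longleftrightarrow>
     simple_roots h \<alpha>\<^sub>1 \<alpha>\<^sub>2 \<and>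
     \<alpha>\<^sub>1 (coroot B h \<alpha>\<^sub>2) = -1 \<and> \<alpha>\<^sub>2 (coroot B h \<alpha>\<^sub>1) = -3"

definition fundamental_weights ::
  "('g::lie_algebra \<Rightarrow> 'g \<Rightarrow> complex) \<Rightarrow> 'g set \<Rightarrow> ('g \<Rightarrow> complex) \<Rightarrow> ('g \<Rightarrow> complex) \<Rightarrow>
   ('g \<Rightarrow> complex) \<Rightarrow> ('g \<Rightarrow> complex) \<Rightarrow> bool" where
  "fundamental_weights B h \<alpha>\<^sub>1 \<alpha>\<^sub>2 \<omega>\<^sub>1 \<omega>\<^sub>2 \<longleftrightarrow>
     \<omega>\<^sub>1 \<in> dual_of h \<and> \<omega>\<^sub>2 \<in> dual_of h \<and>
     \<omega>\<^sub>1 (coroot B h \<alpha>\<^sub>1) = 1 \<and> \<omega>\<^sub>1 (coroot B h \<alpha>\<^sub>2) = 0 \<and>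
     \<omega>\<^sub>2 (coroot B h \<alpha>\<^sub>1) = 0 \<and> \<omega>\<^sub>2 (coroot B h \<alpha>\<^sub>2) = 1"

section \<open>Modules\<close>

definition lie_module :: "('g::lie_algebra \<Rightarrow> 'v::complex_vector \<Rightarrow> 'v) \<Rightarrow> bool" where
  "lie_module \<rho> \<longleftrightarrow>
     (\<forall>x. clinear (\<rho> x)) \<and> (\<forall>v. clinear (\<lambda>x. \<rho> x v)) \<and>
     (\<forall>x y v. \<rho> (bracket x y) v = \<rho> x (\<rho> y v) - \<rho> y (\<rho> x v))"

definition simple_module :: "('g::lie_algebra \<Rightarrow> 'v::complex_vector \<Rightarrow> 'v) \<Rightarrow> bool" where
  "simple_module \<rho> \<longleftrightarrow>
     lie_module \<rho> \<and> (\<exists>v::'v. v \<noteq> 0) \<and>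
     (\<forall>W. cvec.subspace W \<and> (\<forall>x. \<forall>w\<in>W. \<rho> x w \<in> W) \<longrightarrow> W = {0} \<or> W = UNIV)"

definition nontrivial_module :: "('g::lie_algebra \<Rightarrow> 'v::complex_vector \<Rightarrow> 'v) \<Rightarrow> bool" where
  "nontrivial_module \<rho> \<longleftrightarrow> (\<exists>x v. \<rho> x v \<noteq> 0)"

definition linear_functionals :: "('v::complex_vector \<Rightarrow> complex) set" where
  "linear_functionals = {f. Vector_Spaces.linear scaleC (*) f}"

text \<open>Isomorphic to the dual module, on which \<open>x\<close> acts by \<open>f \<mapsto> (w \<mapsto> - f (x w))\<close>.\<close>

definition self_dual :: "('g::lie_algebra \<Rightarrow> 'v::complex_vector \<Rightarrow> 'v) \<Rightarrow> bool" where
  "self_dual \<rho> \<longleftrightarrow>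
     (\<exists>\<Phi> :: 'v \<Rightarrow> 'v \<Rightarrow> complex.
        bij_betw \<Phi> UNIV linear_functionals \<and>
        (\<forall>v w u. \<Phi> (v + w) u = \<Phi> v u + \<Phi> w u) \<and>
        (\<forall>c v u. \<Phi> (c *\<^sub>C v) u = c * \<Phi> v u) \<and>
        (\<forall>x v u. \<Phi> (\<rho> x v) u = - \<Phi> v (\<rho> x u)))"

definition weight_space ::
  "('g::lie_algebra \<Rightarrow> 'v::complex_vector \<Rightarrow> 'v) \<Rightarrow> 'g set \<Rightarrow> ('g \<Rightarrow> complex) \<Rightarrow> 'v set" where
  "weight_space \<rho> h \<mu> = {v. \<forall>t\<in>h. \<rho> t v = \<mu> t *\<^sub>C v}"

definition has_highest_weight ::
  "('g::lie_algebra \<Rightarrow> 'v::complex_vector \<Rightarrow> 'v) \<Rightarrow> 'g set \<Rightarrow>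
   ('g \<Rightarrow> complex) \<Rightarrow> ('g \<Rightarrow> complex) \<Rightarrow> ('g \<Rightarrow> complex) \<Rightarrow> bool" where
  "has_highest_weight \<rho> h \<alpha>\<^sub>1 \<alpha>\<^sub>2 \<mu> \<longleftrightarrow>
     \<mu> \<in> dual_of h \<and>
     (\<exists>v \<in> weight_space \<rho> h \<mu>. v \<noteq> 0 \<and>
        (\<forall>\<alpha> \<in> positive_roots h \<alpha>\<^sub>1 \<alpha>\<^sub>2. \<forall>x \<in> root_space h \<alpha>. \<rho> x v = 0))"

section \<open>The universal enveloping algebra\<close>

text \<open>\<open>U(g)\<close> is given by generators and relations: algebra expressions over \<open>g\<close> modulo the least
  congruence that contains the laws of unital associative complex algebras, linearity of
  \<open>g \<rightarrow> U(g)\<close>, and \<open>[x, y] = x y - y x\<close>.\<close>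

datatype 'g uexp = Scal complex | Gen 'g | Plus "'g uexp" "'g uexp" | Times "'g uexp" "'g uexp"

inductive ueq :: "'g::lie_algebra uexp \<Rightarrow> 'g uexp \<Rightarrow> bool" where
  refl: "ueq a a"
| sym: "ueq a b \<Longrightarrow> ueq b a"
| trans: "ueq a b \<Longrightarrow> ueq b c \<Longrightarrow> ueq a c"
| cong_Plus: "ueq a a' \<Longrightarrow> ueq b b' \<Longrightarrow> ueq (Plus a b) (Plus a' b')"
| cong_Times: "ueq a a' \<Longrightarrow> ueq b b' \<Longrightarrow> ueq (Times a b) (Times a' b')"
| plus_assoc: "ueq (Plus (Plus a b) c) (Plus a (Plus b c))"
| plus_comm: "ueq (Plus a b) (Plus b a)"
| plus_zero: "ueq (Plus (Scal 0) a) a"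
| plus_neg: "ueq (Plus (Times (Scal (- 1)) a) a) (Scal 0)"
| times_assoc: "ueq (Times (Times a b) c) (Times a (Times b c))"
| times_one_left: "ueq (Times (Scal 1) a) a"
| times_one_right: "ueq (Times a (Scal 1)) a"
| distrib_right: "ueq (Times (Plus a b) c) (Plus (Times a c) (Times b c))"
| distrib_left: "ueq (Times a (Plus b c)) (Plus (Times a b) (Times a c))"
| scal_plus: "ueq (Scal (s + t)) (Plus (Scal s) (Scal t))"
| scal_times: "ueq (Scal (s * t)) (Times (Scal s) (Scal t))"
| scal_central: "ueq (Times (Scal s) a) (Times a (Scal s))"
| gen_add: "ueq (Gen (x + y)) (Plus (Gen x) (Gen y))"
| gen_scale: "ueq (Gen (s *\<^sub>C x)) (Times (Scal s) (Gen x))"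
| gen_bracket: "ueq (Gen (bracket x y))
    (Plus (Times (Gen x) (Gen y)) (Times (Scal (- 1)) (Times (Gen y) (Gen x))))"

quotient_type (overloaded) 'g uea = "'g::lie_algebra uexp" / ueq
  by (intro equivpI reflpI sympI transpI) (blast intro: ueq.refl ueq.sym ueq.trans)+

instantiation uea :: (lie_algebra) "{ring, one, complex_vector}"
begin

lift_definition zero_uea :: "'a uea" is "Scal 0" .
lift_definition one_uea :: "'a uea" is "Scal 1" .
lift_definition plus_uea :: "'a uea \<Rightarrow> 'a uea \<Rightarrow> 'a uea" is Plus by (rule ueq.cong_Plus)
lift_definition times_uea :: "'a uea \<Rightarrow> 'a uea \<Rightarrow> 'a uea" is Times by (rule ueq.cong_Times)
lift_definition scaleC_uea :: "complex \<Rightarrow> 'a uea \<Rightarrow> 'a uea" is "\<lambda>s. Times (Scal s)"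
  by (intro ueq.cong_Times ueq.refl)
lift_definition uminus_uea :: "'a uea \<Rightarrow> 'a uea" is "Times (Scal (- 1))"
  by (intro ueq.cong_Times ueq.refl)
definition minus_uea :: "'a uea \<Rightarrow> 'a uea \<Rightarrow> 'a uea" where "minus_uea a b = a + (- b)"

instance
proof
  fix a b c :: "'a uea" and s t :: complex
  show "a + b + c = a + (b + c)" by transfer (rule ueq.plus_assoc)
  show "a + b = b + a" by transfer (rule ueq.plus_comm)
  show "0 + a = a" by transfer (rule ueq.plus_zero)
  show "- a + a = 0" by transfer (rule ueq.plus_neg)
  show "a - b = a + - b" by (rule minus_uea_def)
  show "a * b * c = a * (b * c)" by transfer (rule ueq.times_assoc)
  show "(a + b) * c = a * c + b * c" by transfer (rule ueq.distrib_right)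
  show "a * (b + c) = a * b + a * c" by transfer (rule ueq.distrib_left)
  show "s *\<^sub>C (a + b) = s *\<^sub>C a + s *\<^sub>C b" by transfer (rule ueq.distrib_left)
  show "(s + t) *\<^sub>C a = s *\<^sub>C a + t *\<^sub>C a"
    by transfer (blast intro: ueq.intros(3,4,5) ueq.refl ueq.scal_plus ueq.distrib_right)
  show "s *\<^sub>C (t *\<^sub>C a) = (s * t) *\<^sub>C a"
    by transfer (blast intro: ueq.trans ueq.sym ueq.times_assoc ueq.cong_Times ueq.refl
        ueq.scal_times)
  show "1 *\<^sub>C a = a" by transfer (rule ueq.times_one_left)
qed

end

fun counit :: "'g uexp \<Rightarrow> complex" where
  "counit (Scal s) = s"
| "counit (Gen x) = 0"
| "counit (Plus a b) = counit a + counit b"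
| "counit (Times a b) = counit a * counit b"

lemma counit_ueq: "ueq a b \<Longrightarrow> counit a = counit b"
  by (induction rule: ueq.induct) (simp_all add: algebra_simps)

instance uea :: (lie_algebra) ring_1
proof
  fix a :: "'a uea"
  show "1 * a = a" by transfer (rule ueq.times_one_left)
  show "a * 1 = a" by transfer (rule ueq.times_one_right)
  show "(0::'a uea) \<noteq> 1" by transfer (auto dest: counit_ueq)
qed

lift_definition \<iota> :: "'g::lie_algebra \<Rightarrow> 'g uea" is Gen .

lemma \<iota>_add: "\<iota> (x + y) = \<iota> x + \<iota> y"
  by transfer (rule ueq.gen_add)

lemma \<iota>_scale: "\<iota> (s *\<^sub>C x) = s *\<^sub>C \<iota> x"
  by transfer (rule ueq.gen_scale)

lemma \<iota>_bracket: "\<iota> (bracket x y) = \<iota> x * \<iota> y - \<iota> y * \<iota> x"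
  unfolding diff_conv_add_uminus by transfer (rule ueq.gen_bracket)

lemma uea_scale_left: "(s *\<^sub>C a) * b = s *\<^sub>C (a * (b :: 'g::lie_algebra uea))"
  by transfer (rule ueq.times_assoc)

lemma uea_scale_right: "a * (s *\<^sub>C b) = s *\<^sub>C (a * (b :: 'g::lie_algebra uea))"
  by transfer (meson ueq.trans ueq.sym ueq.times_assoc ueq.cong_Times ueq.refl ueq.scal_central)

fun uexp_act :: "('g \<Rightarrow> 'v::complex_vector \<Rightarrow> 'v) \<Rightarrow> 'g uexp \<Rightarrow> 'v \<Rightarrow> 'v" where
  "uexp_act \<rho> (Scal s) v = s *\<^sub>C v"
| "uexp_act \<rho> (Gen x) v = \<rho> x v"
| "uexp_act \<rho> (Plus a b) v = uexp_act \<rho> a v + uexp_act \<rho> b v"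
| "uexp_act \<rho> (Times a b) v = uexp_act \<rho> a (uexp_act \<rho> b v)"

text \<open>The action of \<open>U(g)\<close> on a \<open>g\<close>-module; by the lemmas below it does not depend on the
  representing expression and is the extension of \<open>\<rho>\<close> to a module structure over \<open>U(g)\<close>.\<close>

definition uea_act :: "('g::lie_algebra \<Rightarrow> 'v::complex_vector \<Rightarrow> 'v) \<Rightarrow> 'g uea \<Rightarrow> 'v \<Rightarrow> 'v" where
  "uea_act \<rho> a = uexp_act \<rho> (rep_uea a)"

lemma lie_moduleD:
  assumes "lie_module \<rho>"
  shows "\<rho> x (v + w) = \<rho> x v + \<rho> x w" "\<rho> x (s *\<^sub>C v) = s *\<^sub>C \<rho> x v"
    "\<rho> (x + y) v = \<rho> x v + \<rho> y v" "\<rho> (s *\<^sub>C x) v = s *\<^sub>C \<rho> x v"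
    "\<rho> (bracket x y) v = \<rho> x (\<rho> y v) - \<rho> y (\<rho> x v)"
  using assms unfolding lie_module_def clinear_def Vector_Spaces.linear_def
    module_hom_def module_hom_axioms_def
  by blast+

lemma uexp_act_linear:
  assumes "lie_module \<rho>"
  shows "uexp_act \<rho> a (v + w) = uexp_act \<rho> a v + uexp_act \<rho> a w"
    and "uexp_act \<rho> a (s *\<^sub>C v) = s *\<^sub>C uexp_act \<rho> a v"
proof -
  show "uexp_act \<rho> a (v + w) = uexp_act \<rho> a v + uexp_act \<rho> a w"
    by (induction a arbitrary: v w)
      (simp_all add: lie_moduleD[OF assms] scaleC_add_right algebra_simps)
  show "uexp_act \<rho> a (s *\<^sub>C v) = s *\<^sub>C uexp_act \<rho> a v"
    by (induction a arbitrary: v)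
      (simp_all add: lie_moduleD[OF assms] scaleC_add_right scaleC_scaleC mult.commute)
qed

lemma uexp_act_ueq:
  assumes "lie_module \<rho>" "ueq a b"
  shows "uexp_act \<rho> a v = uexp_act \<rho> b v"
  using assms(2)
  by (induction arbitrary: v rule: ueq.induct)
    (simp_all add: lie_moduleD[OF assms(1)] uexp_act_linear[OF assms(1)] scaleC_add_left
      scaleC_scaleC scaleC_one algebra_simps)

lemma uea_act_abs:
  "lie_module \<rho> \<Longrightarrow> uea_act \<rho> (abs_uea a) v = uexp_act \<rho> a v"
  unfolding uea_act_def
  by (rule uexp_act_ueq) (simp_all add: Quotient3_rep_abs[OF Quotient3_uea] ueq.refl)

lemma uea_act_simps:
  assumes "lie_module \<rho>"
  shows "uea_act \<rho> (\<iota> x) v = \<rho> x v"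
    and "uea_act \<rho> 1 v = v"
    and "uea_act \<rho> (a + b) v = uea_act \<rho> a v + uea_act \<rho> b v"
    and "uea_act \<rho> (a * b) v = uea_act \<rho> a (uea_act \<rho> b v)"
    and "uea_act \<rho> (s *\<^sub>C a) v = s *\<^sub>C uea_act \<rho> a v"
proof -
  show "uea_act \<rho> (\<iota> x) v = \<rho> x v" "uea_act \<rho> 1 v = v"
    by (simp_all add: \<iota>.abs_eq one_uea.abs_eq uea_act_abs[OF assms] scaleC_one)
  obtain p q where [simp]: "a = abs_uea p" "b = abs_uea q"
    by (metis Quotient3_abs_rep[OF Quotient3_uea])
  show "uea_act \<rho> (a + b) v = uea_act \<rho> a v + uea_act \<rho> b v"
    "uea_act \<rho> (a * b) v = uea_act \<rho> a (uea_act \<rho> b v)"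
    "uea_act \<rho> (s *\<^sub>C a) v = s *\<^sub>C uea_act \<rho> a v"
    by (simp_all add: plus_uea.abs_eq times_uea.abs_eq scaleC_uea.abs_eq uea_act_abs[OF assms])
qed

section \<open>The Casimir algebra\<close>

definition unital_subalgebra :: "'g::lie_algebra uea set \<Rightarrow> bool" where
  "unital_subalgebra A \<longleftrightarrow> cvec.subspace A \<and> 1 \<in> A \<and> (\<forall>a\<in>A. \<forall>b\<in>A. a * b \<in> A)"

definition generated_subalgebra :: "'g::lie_algebra uea set \<Rightarrow> 'g uea set" where
  "generated_subalgebra S = \<Inter> {A. unital_subalgebra A \<and> S \<subseteq> A}"

definition root_vectors ::
  "('g::lie_algebra \<Rightarrow> 'g \<Rightarrow> complex) \<Rightarrow> 'g set \<Rightarrow>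
   (('g \<Rightarrow> complex) \<Rightarrow> 'g) \<Rightarrow> (('g \<Rightarrow> complex) \<Rightarrow> 'g) \<Rightarrow> bool" where
  "root_vectors B h e f \<longleftrightarrow>
     (\<forall>\<alpha>\<in>roots h. e \<alpha> \<in> root_space h \<alpha> \<and> f \<alpha> \<in> root_space h (\<lambda>t. - \<alpha> t) \<and>
        bracket (e \<alpha>) (f \<alpha>) = coroot B h \<alpha>)"

definition kappa ::
  "('g::lie_algebra \<Rightarrow> 'g \<Rightarrow> complex) \<Rightarrow> 'g set \<Rightarrow>
   (('g \<Rightarrow> complex) \<Rightarrow> 'g) \<Rightarrow> (('g \<Rightarrow> complex) \<Rightarrow> 'g) \<Rightarrow> ('g \<Rightarrow> complex) \<Rightarrow> 'g uea" where
  "kappa B h e f \<alpha> =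
     (dual_form B h \<alpha> \<alpha> / 2) *\<^sub>C (\<iota> (e \<alpha>) * \<iota> (f \<alpha>) + \<iota> (f \<alpha>) * \<iota> (e \<alpha>))"

definition casimir_algebra ::
  "('g::lie_algebra \<Rightarrow> 'g \<Rightarrow> complex) \<Rightarrow> 'g set \<Rightarrow>
   (('g \<Rightarrow> complex) \<Rightarrow> 'g) \<Rightarrow> (('g \<Rightarrow> complex) \<Rightarrow> 'g) \<Rightarrow> 'g uea set" where
  "casimir_algebra B h e f = generated_subalgebra (kappa B h e f ` roots h \<union> \<iota> ` h)"

definition invariant_subspace ::
  "'g::lie_algebra uea set \<Rightarrow> ('g \<Rightarrow> 'v::complex_vector \<Rightarrow> 'v) \<Rightarrow> 'v set \<Rightarrow> bool" where
  "invariant_subspace A \<rho> W \<longleftrightarrow> cvec.subspace W \<and> (\<forall>a\<in>A. \<forall>w\<in>W. uea_act \<rho> a w \<in> W)"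

definition irreducible_under ::
  "'g::lie_algebra uea set \<Rightarrow> ('g \<Rightarrow> 'v::complex_vector \<Rightarrow> 'v) \<Rightarrow> 'v set \<Rightarrow> bool" where
  "irreducible_under A \<rho> W \<longleftrightarrow>
     invariant_subspace A \<rho> W \<and> W \<noteq> {0} \<and>
     (\<forall>W'\<subseteq>W. invariant_subspace A \<rho> W' \<longrightarrow> W' = {0} \<or> W' = W)"

end

theory Submission
  imports Defs "HOL-Computational_Algebra.Fundamental_Theorem_Algebra"
    "HOL-Library.Product_Plus"
begin

text \<open>
  The short simple root \<open>\<alpha>\<^sub>1\<close> and the highest root \<open>\<theta> = 3\<alpha>\<^sub>1 + 2\<alpha>\<^sub>2\<close> are
  orthogonal, their \<open>sl\<^sub>2\<close>-triples commute, and the product of the two reflections is \<open>-1\<close>. Hence the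
  product of the two Weyl operators \<open>exp e exp(-f) exp e\<close>, called \<open>parity\<close> below, exchanges the weights
  \<open>\<mu>\<close> and \<open>-\<mu>\<close>. Conjugation by it carries \<open>e\<^sub>\<alpha>\<close> to \<open>c f\<^sub>\<alpha>\<close> and \<open>f\<^sub>\<alpha>\<close> to \<open>c\<^sup>-\<^sup>1 e\<^sub>\<alpha>\<close>, so that it commutes with all
  \<open>\<kappa>\<^sub>\<alpha>\<close> (\<open>parity_kap\<close>). If the zero weight space contains eigenvectors of the parity operator for both
  eigenvalues \<open>1\<close> and \<open>-1\<close>, it is therefore reducible under the Casimir algebra (\<open>not_irreducible\<close>).

  The eigenvalues can be read off from highest weights: a vector killed by \<open>e\<^sub>1\<close> and \<open>e\<^sub>\<theta>\<close>, of weights \<open>2j\<close>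
  and \<open>2i\<close> for the two triples, contributes a zero weight vector of parity \<open>(-1)\<close> to the power \<open>i + j\<close>
  (\<open>parity_middle\<close>). Let \<open>a \<varpi>\<^sub>1 + b \<varpi>\<^sub>2\<close> be the highest weight. Unless \<open>(a, b)\<close> is one of \<open>(0,0)\<close>, \<open>(1,0)\<close>,
  \<open>(0,1)\<close>, \<open>(2,0)\<close>, \<open>(0,2)\<close>, there are two such vectors with different parities within a few steps of
  the highest weight vector (\<open>reducible\<close>). One such vector always exists, so the zero weight space is
  never zero (\<open>V0_nonzero\<close>).

  In the four remaining cases \<open>f\<^sub>1 e\<^sub>1\<close> and \<open>f\<^sub>2 e\<^sub>2\<close>, which on the zero weight space are multiples of
  \<open>\<kappa>\<close> for the simple roots, already act irreducibly. The zero weight spaces have dimensions \<open>1\<close>, \<open>2\<close>, \<open>3\<close>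
  and \<open>5\<close>. The matrices of these operators are computed from the highest weight vector downwards: a
  vector of lower weight that \<open>e\<^sub>1\<close> and \<open>e\<^sub>2\<close> kill is zero (\<open>singular_zero\<close>), so every relation between
  lowering words can be verified by raising.

  Self-duality uses the parity operator once more. It maps the highest weight vector to a vector of
  weight \<open>-\<Lambda>\<close>, hence the dual module has a singular vector of weight \<open>\<Lambda>\<close> too; in the sum of the
  module and its dual the pair of singular vectors generates the graph of an isomorphism
  (\<open>self_dual_module\<close>).

  The structure theory that this rests on is developed for the definitions at hand: weights and
  \<open>sl\<^sub>2\<close>-strings, the nondegeneracy of the Killing form (from the integrality of
  root strings), coroots, one-dimensional root spaces, the list of the roots of \<open>G\<^sub>2\<close>,
  exponentials of nilpotent operators, and highest weight vectors of simple modules.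
\<close>

section \<open>Linear algebra over the complex numbers\<close>

lemmas cv_simps = cvec.scale_right_distrib cvec.scale_left_distrib cvec.scale_scale
  cvec.scale_right_diff_distrib cvec.scale_left_diff_distrib cvec.scale_minus_left
  cvec.scale_minus_right

text \<open>Reduces an identity between vectors to one between complex numbers, which ordinary arithmetic
  can decide: apply an arbitrary linear functional to both sides.\<close>

lemma functional_separates:
  fixes x y :: "'v::complex_vector"
  assumes "\<And>\<phi>. (\<And>u v. \<phi> (u + v) = \<phi> u + \<phi> v) \<Longrightarrow> (\<And>u v. \<phi> (u - v) = \<phi> u - \<phi> v) \<Longrightarrow>
      (\<And>v. \<phi> (- v) = - \<phi> v) \<Longrightarrow> (\<And>c v. \<phi> (c *\<^sub>C v) = (c::complex) * \<phi> v) \<Longrightarrow> \<phi> 0 = 0 \<Longrightarrow> \<phi> x = \<phi> y"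
  shows "x = y"
proof (rule ccontr)
  assume "x \<noteq> y"
  then have "cvec.independent {x - y}" by (simp add: cvec.independent_insert)
  define B where "B = cvec.extend_basis {x - y}"
  have B: "cvec.independent B" "cvec.span B = UNIV" "x - y \<in> B"
    using \<open>cvec.independent {x - y}\<close> cvec.independent_extend_basis cvec.span_extend_basis
      cvec.extend_basis_superset[of "{x - y}"] unfolding B_def by blast+
  define \<phi> where "\<phi> v = cvec.representation B v (x - y)" for v
  have a: "\<phi> (u + v) = \<phi> u + \<phi> v" for u v
    unfolding \<phi>_def using B by (simp add: cvec.representation_add)
  have b: "\<phi> (u - v) = \<phi> u - \<phi> v" for u v
    unfolding \<phi>_def using B by (simp add: cvec.representation_diff)
  have c: "\<phi> (c *\<^sub>C v) = c * \<phi> v" for c v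
    unfolding \<phi>_def using B by (simp add: cvec.representation_scale)
  have d: "\<phi> 0 = 0" by (metis b diff_self)
  have "\<phi> (- v) = - \<phi> v" for v using b[of 0 v] d by simp
  then have "\<phi> x = \<phi> y" using assms[of \<phi>] a b c d by blast
  then have "\<phi> (x - y) = 0" using b by simp
  moreover have "\<phi> (x - y) = 1" unfolding \<phi>_def using B by (simp add: cvec.representation_basis)
  ultimately show False by simp
qed

lemma clinearI:
  "(\<And>u v. f (u + v) = f u + f v) \<Longrightarrow> (\<And>c v. f (c *\<^sub>C v) = c *\<^sub>C f v) \<Longrightarrow> clinear f"
  unfolding clinear_def by unfold_locales

lemma clinearD:
  assumes "clinear f"
  shows "f (u + v) = f u + f v" "f (c *\<^sub>C v) = c *\<^sub>C f v" "f 0 = 0" "f (u - v) = f u - f v"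
    "f (- v) = - f v"
proof -
  interpret Vector_Spaces.linear scaleC scaleC f using assms unfolding clinear_def .
  show "f (u + v) = f u + f v" "f (c *\<^sub>C v) = c *\<^sub>C f v" "f 0 = 0" "f (u - v) = f u - f v"
    "f (- v) = - f v"
    by (simp_all add: add scale zero diff neg)
qed

lemma clinear_sum: "clinear f \<Longrightarrow> f (\<Sum>i\<in>I. g i) = (\<Sum>i\<in>I. f (g i))"
  by (induction I rule: infinite_finite_induct) (simp_all add: clinearD[of f])

lemma clinear_comp: "clinear f \<Longrightarrow> clinear g \<Longrightarrow> clinear (\<lambda>x. f (g x))"
  by (rule clinearI) (simp_all add: clinearD[of f] clinearD[of g])

lemma clinear_funpow: "clinear f \<Longrightarrow> clinear ((f :: 'v \<Rightarrow> 'v::complex_vector) ^^ n)"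
proof (induction n)
  case 0
  show ?case by (rule clinearI) simp_all
next
  case (Suc n)
  then show ?case using clinear_comp[of f "f ^^ n"] by (simp add: comp_def)
qed

lemma eigenspace_subspace: "clinear f \<Longrightarrow> cvec.subspace {x. f x = c *\<^sub>C x}"
  unfolding cvec.subspace_def
  by (auto simp: clinearD[of f] cvec.scale_right_distrib cvec.scale_left_commute)

lemma finite_dim_independent:
  fixes S :: "'v::complex_vector set"
  assumes "finite_dim TYPE('v)" "cvec.independent S"
  shows "finite S"
  using assms cvec.independent_span_bound unfolding finite_dim_def by blast

text \<open>Stated for sequences rather than sets: when the powers \<open>(T ^^ i) x\<close> repeat, the relation
  between equal members counts as a dependence.\<close>

lemma finite_dim_dependence:
  fixes x :: "nat \<Rightarrow> 'v::complex_vector"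
  assumes fd: "finite_dim TYPE('v)"
  shows "\<exists>n c. (\<exists>i\<le>n. c i \<noteq> 0) \<and> (\<Sum>i\<le>n. c i *\<^sub>C x i) = 0"
proof (cases "inj x")
  case False
  then obtain i j where ij: "i < j" "x i = x j"
    by (metis injI linorder_neqE_nat)
  have "(\<Sum>k\<le>j. (if k = i then 1 else if k = j then -1 else 0) *\<^sub>C x k) =
    (\<Sum>k\<in>{i,j}. (if k = i then 1 else if k = j then -1 else 0) *\<^sub>C x k)"
    by (rule sum.mono_neutral_right) (use ij in auto)
  also have "\<dots> = 0" using ij by simp
  finally show ?thesis
    by (intro exI[of _ j] exI[of _ "\<lambda>k. if k = i then 1 else if k = j then -1 else 0"]) auto
next
  case True
  then have "infinite (range x)" using finite_imageD by blast
  then have "cvec.dependent (range x)" using finite_dim_independent[OF fd] by blast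
  then obtain t u where t: "finite t" "t \<subseteq> range x" "(\<Sum>v\<in>t. u v *\<^sub>C v) = 0" "\<exists>v\<in>t. u v \<noteq> 0"
    unfolding cvec.dependent_explicit by blast
  define J where "J = x -` t"
  have J: "finite J" "x ` J = t" unfolding J_def using t True finite_vimageI by auto
  define c where "c i = (if i \<in> J then u (x i) else 0)" for i
  obtain n where n: "J \<subseteq> {..n}" using J(1) finite_nat_set_iff_bounded_le by (metis atMost_iff subsetI)
  have "(\<Sum>i\<le>n. c i *\<^sub>C x i) = (\<Sum>i\<in>J. c i *\<^sub>C x i)"
    by (rule sum.mono_neutral_right) (use n in \<open>auto simp: c_def\<close>)
  also have "\<dots> = (\<Sum>i\<in>J. u (x i) *\<^sub>C x i)" by (rule sum.cong) (auto simp: c_def)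
  also have "\<dots> = (\<Sum>v\<in>x ` J. u v *\<^sub>C v)"
    by (subst sum.reindex) (use True in \<open>auto simp: inj_on_def\<close>)
  finally have "(\<Sum>i\<le>n. c i *\<^sub>C x i) = 0" using t J by simp
  moreover obtain v where "v \<in> t" "u v \<noteq> 0" using t by blast
  then obtain i where "i \<in> J" "c i \<noteq> 0" using J by (auto simp: c_def)
  ultimately show ?thesis using n by blast
qed

definition poly_apply :: "complex poly \<Rightarrow> ('v \<Rightarrow> 'v) \<Rightarrow> 'v \<Rightarrow> 'v::complex_vector" where
  "poly_apply p T x = (\<Sum>i\<le>degree p. coeff p i *\<^sub>C (T ^^ i) x)"

lemma poly_apply_bound:
  "degree p \<le> n \<Longrightarrow> poly_apply p T x = (\<Sum>i\<le>n. coeff p i *\<^sub>C (T ^^ i) x)"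
  unfolding poly_apply_def by (rule sum.mono_neutral_left) (auto simp: coeff_eq_0)

lemma poly_apply_linear_factor:
  assumes "clinear T"
  shows "poly_apply ([:- c, 1:] * q) T x = T (poly_apply q T x) - c *\<^sub>C poly_apply q T x"
proof -
  have T: "T ((T ^^ i) x) = (T ^^ Suc i) x" for i by simp
  define n where "n = degree q"
  have 1: "poly_apply q T x = (\<Sum>i\<le>Suc n. coeff q i *\<^sub>C (T ^^ i) x)"
    by (rule poly_apply_bound) (simp add: n_def)
  have "T (poly_apply q T x) = (\<Sum>i\<le>n. coeff q i *\<^sub>C (T ^^ Suc i) x)"
    unfolding poly_apply_def n_def clinear_sum[OF assms] by (simp add: clinearD[OF assms])
  also have "\<dots> = (\<Sum>i\<le>Suc n. coeff (pCons 0 q) i *\<^sub>C (T ^^ i) x)"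
    by (simp only: sum.atMost_Suc_shift coeff_pCons_0 coeff_pCons_Suc) simp
  finally have 2: "T (poly_apply q T x) = \<dots>" .
  have "poly_apply ([:- c, 1:] * q) T x
      = (\<Sum>i\<le>Suc n. coeff ([:- c, 1:] * q) i *\<^sub>C (T ^^ i) x)"
    by (rule poly_apply_bound) (use degree_mult_le[of "[:- c, 1:]" q] in \<open>simp add: n_def\<close>)
  also have "\<dots> = (\<Sum>i\<le>Suc n. coeff (pCons 0 q) i *\<^sub>C (T ^^ i) x - c *\<^sub>C (coeff q i *\<^sub>C (T ^^ i) x))"
    by (rule sum.cong) (simp_all add: cv_simps algebra_simps)
  also have "\<dots> = T (poly_apply q T x) - c *\<^sub>C poly_apply q T x"
    by (subst 2, subst 1) (simp only: sum_subtractf cvec.scale_sum_right)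
  finally show ?thesis .
qed

lemma poly_apply_closed:
  assumes "cvec.subspace U" "\<And>x. x \<in> U \<Longrightarrow> T x \<in> U" "x \<in> U"
  shows "poly_apply p T x \<in> U"
proof -
  have "(T ^^ i) x \<in> U" for i by (induction i) (use assms in auto)
  then show ?thesis unfolding poly_apply_def
    by (intro cvec.subspace_sum cvec.subspace_scale assms)
qed

text \<open>Take a polynomial of least degree that annihilates a given nonzero vector \<open>x\<close>; it has a root
  \<open>c\<close>, and the complementary factor sends \<open>x\<close> to an eigenvector for \<open>c\<close>.\<close>

lemma eigenvector_exists:
  fixes T :: "'v::complex_vector \<Rightarrow> 'v"
  assumes fd: "finite_dim TYPE('v)" and T: "clinear T" and U: "cvec.subspace U"
    and inv: "\<And>x. x \<in> U \<Longrightarrow> T x \<in> U" and "U \<noteq> {0}"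
  shows "\<exists>c. \<exists>v\<in>U. v \<noteq> 0 \<and> T v = c *\<^sub>C v"
proof -
  obtain x where x: "x \<in> U" "x \<noteq> 0" using \<open>U \<noteq> {0}\<close> cvec.subspace_0[OF U] by auto
  define P where "P p \<longleftrightarrow> p \<noteq> 0 \<and> poly_apply p T x = 0" for p
  have "\<exists>p. P p"
  proof -
    obtain n c where c: "\<exists>i\<le>n. c i \<noteq> 0" "(\<Sum>i\<le>n. c i *\<^sub>C (T ^^ i) x) = 0"
      using finite_dim_dependence[OF fd, of "\<lambda>i. (T ^^ i) x"] by auto
    define p where "p = (\<Sum>i\<le>n. monom (c i) i)"
    have co: "coeff p i = (if i \<le> n then c i else 0)" for i
      unfolding p_def by (simp add: coeff_sum)
    have "degree p \<le> n" by (rule degree_le) (simp add: co)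
    then have "poly_apply p T x = 0" using c(2) by (simp add: poly_apply_bound co)
    moreover have "p \<noteq> 0" using c(1) co by (metis coeff_0)
    ultimately show ?thesis unfolding P_def by blast
  qed
  then obtain p where p: "P p" and least: "\<And>q. P q \<Longrightarrow> degree p \<le> degree q"
    using ex_has_least_nat[of P _ degree] by auto
  have "degree p \<noteq> 0"
  proof
    assume "degree p = 0"
    then obtain a where a: "p = [:a:]" by (metis degree_eq_zeroE)
    then have "a *\<^sub>C x = 0" "a \<noteq> 0" using p unfolding P_def poly_apply_def by auto
    then show False using x by (simp add: cvec.scale_eq_0_iff)
  qed
  then obtain c where "poly p c = 0"
    using fundamental_theorem_of_algebra[of p] by (auto simp: constant_degree)
  then obtain q where q: "p = [:- c, 1:] * q" by (metis dvdE poly_eq_0_iff_dvd)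
  have "q \<noteq> 0" using p q unfolding P_def by auto
  then have "degree p = Suc (degree q)" unfolding q by (subst degree_mult_eq) auto
  then have "\<not> P q" using least by fastforce
  then have "poly_apply q T x \<noteq> 0" using \<open>q \<noteq> 0\<close> unfolding P_def by blast
  moreover have "T (poly_apply q T x) = c *\<^sub>C poly_apply q T x"
    using p poly_apply_linear_factor[OF T, of c q x] unfolding P_def q by simp
  ultimately show ?thesis
    by (intro exI[of _ c] bexI[of _ "poly_apply q T x"] conjI) (auto intro: poly_apply_closed U inv x)
qed

subsection \<open>Joint eigenvectors\<close>

text \<open>A subspace that is stable under a family of operators contains the joint eigencomponents of
  each of its vectors: applying \<open>T i - \<chi>\<^sub>0 i\<close> removes the component of \<open>\<chi>\<^sub>0\<close> and rescales the others.\<close>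

lemma joint_eigencomponents_in_subspace:
  fixes T :: "'i \<Rightarrow> 'v::complex_vector \<Rightarrow> 'v" and x :: "('j \<Rightarrow> 'v)" and \<chi> :: "'j \<Rightarrow> 'i \<Rightarrow> complex"
  assumes lin: "\<And>i. i \<in> I \<Longrightarrow> clinear (T i)" and U: "cvec.subspace U"
    and inv: "\<And>i u. i \<in> I \<Longrightarrow> u \<in> U \<Longrightarrow> T i u \<in> U"
    and fin: "finite M"
    and eig: "\<And>j i. j \<in> M \<Longrightarrow> i \<in> I \<Longrightarrow> T i (x j) = \<chi> j i *\<^sub>C x j"
    and dis: "\<And>j k. j \<in> M \<Longrightarrow> k \<in> M \<Longrightarrow> j \<noteq> k \<Longrightarrow> \<exists>i\<in>I. \<chi> j i \<noteq> \<chi> k i"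
    and mem: "(\<Sum>j\<in>M. x j) \<in> U"
  shows "\<forall>j\<in>M. x j \<in> U"
  using fin eig dis mem
proof (induction M arbitrary: x rule: finite_induct)
  case empty
  then show ?case by simp
next
  case (insert m M)
  have "x j \<in> U" if j: "j \<in> M" for j
  proof -
    obtain i where i: "i \<in> I" "\<chi> j i \<noteq> \<chi> m i"
      using insert.prems(2)[of j m] j insert.hyps by auto
    define y where "y k = (\<chi> k i - \<chi> m i) *\<^sub>C x k" for k
    have "(\<Sum>k\<in>M. y k) = (\<Sum>k\<in>insert m M. y k)"
      using insert.hyps by (simp add: y_def)
    also have "\<dots> = (\<Sum>k\<in>insert m M. T i (x k) - \<chi> m i *\<^sub>C x k)"
      by (rule sum.cong) (use insert.prems(1)[OF _ i(1)] in \<open>simp_all add: y_def cv_simps\<close>)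
    also have "\<dots> = T i (\<Sum>k\<in>insert m M. x k) - \<chi> m i *\<^sub>C (\<Sum>k\<in>insert m M. x k)"
      by (simp only: sum_subtractf clinear_sum[OF lin[OF i(1)]] cvec.scale_sum_right)
    finally have "(\<Sum>k\<in>M. y k) \<in> U"
      using cvec.subspace_diff[OF U inv[OF i(1) insert.prems(3)] cvec.subspace_scale[OF U insert.prems(3)]]
      by simp
    moreover have "T i' (y k) = \<chi> k i' *\<^sub>C y k" if "k \<in> M" "i' \<in> I" for k i'
      using insert.prems(1)[of k i'] that
      by (simp add: y_def clinearD[OF lin[OF that(2)]] cvec.scale_left_commute mult.commute)
    ultimately have "\<forall>k\<in>M. y k \<in> U" using insert.IH[of y] insert.prems(2) by blast
    then have "(1 / (\<chi> j i - \<chi> m i)) *\<^sub>C y j \<in> U" using j U cvec.subspace_scale by blast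
    then show ?thesis using i by (simp add: y_def)
  qed
  moreover from this have "(\<Sum>k\<in>insert m M. x k) - (\<Sum>k\<in>M. x k) \<in> U"
    using cvec.subspace_diff[OF U insert.prems(3)] cvec.subspace_sum[OF U] by blast
  then have "x m \<in> U" using insert.hyps by simp
  ultimately show ?case by blast
qed

lemma span_Union_decompose:
  assumes sub: "\<And>s. s \<in> S \<Longrightarrow> cvec.subspace (E s)" and x: "x \<in> cvec.span (\<Union>s\<in>S. E s)"
  obtains M y where "finite M" "M \<subseteq> S" "\<And>s. s \<in> M \<Longrightarrow> y s \<in> E s" "x = (\<Sum>s\<in>M. y s)"
proof -
  have "\<exists>M y. finite M \<and> M \<subseteq> S \<and> (\<forall>s\<in>M. y s \<in> E s) \<and> x = (\<Sum>s\<in>M. y s)"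
    using x
  proof (induction rule: cvec.span_induct_alt)
    case base
    show ?case by (rule exI[of _ "{}"]) auto
  next
    case (step c u w)
    then obtain M y where M: "finite M" "M \<subseteq> S" "\<forall>s\<in>M. y s \<in> E s" "w = (\<Sum>s\<in>M. y s)" by blast
    obtain s where s: "s \<in> S" "u \<in> E s" using step by blast
    define z where "z r = (if r = s then c *\<^sub>C u else 0) + (if r \<in> M then y r else 0)" for r
    have "(\<Sum>r\<in>insert s M. z r) = c *\<^sub>C u + w"
    proof -
      have "(\<Sum>r\<in>insert s M. if r \<in> M then y r else 0) = (\<Sum>r\<in>M. y r)"
        by (rule sum.mono_neutral_cong_right) (use M in auto)
      moreover have "(\<Sum>r\<in>insert s M. if r = s then c *\<^sub>C u else 0) = c *\<^sub>C u"
        using M by simp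
      ultimately show ?thesis using M(4) unfolding z_def sum.distrib by simp
    qed
    moreover have "\<forall>r\<in>insert s M. z r \<in> E r"
    proof
      fix r assume r: "r \<in> insert s M"
      then have "cvec.subspace (E r)" using sub s M by blast
      then show "z r \<in> E r" unfolding z_def
        by (intro cvec.subspace_add) (use s M cvec.subspace_scale cvec.subspace_0 in auto)
    qed
    ultimately show ?case using M s
      by (intro exI[of _ "insert s M"] exI[of _ z]) auto
  qed
  then show ?thesis using that by blast
qed

text \<open>Induction on the family. A joint eigenvector of the operators treated so far lies in one of
  their joint eigenspaces, which the next operator preserves; hence its components with respect
  to the next operator stay in that eigenspace.\<close>

lemma commuting_diagonalizable_joint_eigenvectors:
  fixes T :: "'i \<Rightarrow> 'v::complex_vector \<Rightarrow> 'v"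
  assumes "finite I" and lin: "\<And>i. i \<in> I \<Longrightarrow> clinear (T i)"
    and comm: "\<And>i j x. i \<in> I \<Longrightarrow> j \<in> I \<Longrightarrow> T i (T j x) = T j (T i x)"
    and diag: "\<And>i. i \<in> I \<Longrightarrow> cvec.span {x. \<exists>c. T i x = c *\<^sub>C x} = UNIV"
  shows "cvec.span {x. \<forall>i\<in>I. \<exists>c. T i x = c *\<^sub>C x} = UNIV"
  using assms
proof (induction I rule: finite_induct)
  case empty
  then show ?case by simp
next
  case (insert m I)
  let ?J = "{x. \<forall>i\<in>insert m I. \<exists>c. T i x = c *\<^sub>C x}"
  have "y \<in> cvec.span ?J" if y: "\<forall>i\<in>I. \<exists>c. T i y = c *\<^sub>C y" for y
  proof -
    obtain \<chi> where \<chi>: "\<forall>i\<in>I. T i y = \<chi> i *\<^sub>C y" using y by metis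
    define U where "U = {x. \<forall>i\<in>I. T i x = \<chi> i *\<^sub>C x}"
    have lin: "\<And>i. i \<in> I \<Longrightarrow> clinear (T i)" "clinear (T m)" using insert.prems by auto
    have "U = (\<Inter>i\<in>I. {x. T i x = \<chi> i *\<^sub>C x})" unfolding U_def by blast
    then have U: "cvec.subspace U"
      using eigenspace_subspace[OF lin(1)] by (simp add: cvec.subspace_Inter)
    have inv: "T m u \<in> U" if "u \<in> U" for u
      unfolding U_def
    proof safe
      fix i assume i: "i \<in> I"
      then have "T i u = \<chi> i *\<^sub>C u" using that unfolding U_def by blast
      then show "T i (T m u) = \<chi> i *\<^sub>C T m u"
        using insert.prems(2)[of i m u] i by (simp add: clinearD[OF lin(2)])
    qed
    define E where "E c = {x. T m x = c *\<^sub>C x}" for c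
    have E: "cvec.subspace (E c)" for c unfolding E_def using eigenspace_subspace[OF lin(2)] .
    have "y \<in> cvec.span (\<Union>c\<in>UNIV. E c)"
      using insert.prems(3)[of m] unfolding E_def by (simp add: UNION_eq)
    then obtain M z where M: "finite M" "\<And>c. c \<in> M \<Longrightarrow> z c \<in> E c" "y = (\<Sum>c\<in>M. z c)"
      using span_Union_decompose[of UNIV E y] E by metis
    have "\<forall>c\<in>M. z c \<in> U"
    proof (rule joint_eigencomponents_in_subspace[where I = "{m}" and T = T and \<chi> = "\<lambda>c _. c"])
      show "(\<Sum>c\<in>M. z c) \<in> U" using M \<chi> by (simp add: U_def)
    qed (use lin U inv M in \<open>auto simp: E_def\<close>)
    then have "\<forall>c\<in>M. z c \<in> ?J" using M(2) unfolding U_def E_def by blast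
    then show ?thesis unfolding M(3) by (meson cvec.span_sum cvec.span_base)
  qed
  then have "{x. \<forall>i\<in>I. \<exists>c. T i x = c *\<^sub>C x} \<subseteq> cvec.span ?J" by blast
  then have "cvec.span {x. \<forall>i\<in>I. \<exists>c. T i x = c *\<^sub>C x} \<subseteq> cvec.span ?J"
    by (rule cvec.span_minimal[OF _ cvec.subspace_span])
  moreover have "cvec.span {x. \<forall>i\<in>I. \<exists>c. T i x = c *\<^sub>C x} = UNIV"
    by (rule insert.IH) (use insert.prems in auto)
  ultimately show ?case by auto
qed

subsection \<open>The trace\<close>

lemma representation_sum_basis:
  assumes "cvec.independent B" "cvec.span B = UNIV" "finite B"
  shows "(\<Sum>b\<in>B. cvec.representation B x b *\<^sub>C b) = x"
  using assms cvec.sum_representation_eq[of B x B] by simp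

lemma representation_linear:
  assumes "cvec.independent B" "cvec.span B = UNIV"
  shows "cvec.representation B (x + y) b = cvec.representation B x b + cvec.representation B y b"
    "cvec.representation B (c *\<^sub>C x) b = c * cvec.representation B x b"
    "cvec.representation B (\<Sum>i\<in>I. g i) b = (\<Sum>i\<in>I. cvec.representation B (g i) b)"
  using assms by (simp_all add: cvec.representation_add cvec.representation_scale cvec.representation_sum)

text \<open>The trace of \<open>f\<close> is the double sum of the products of the coefficients of \<open>f\<close> from \<open>B\<close> to \<open>C\<close>
  with those of the base change from \<open>C\<close> to \<open>B\<close>, whichever of the two bases one starts from.\<close>

lemma trace_end_basis:
  fixes f :: "'v::complex_vector \<Rightarrow> 'v"
  assumes f: "clinear f" and C: "cvec.independent C" "cvec.span C = UNIV" "finite C"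
  shows "trace_end f = (\<Sum>b\<in>C. cvec.representation C (f b) b)"
proof -
  define B where "B = (SOME B::'v set. cvec.independent B \<and> cvec.span B = UNIV)"
  have B: "cvec.independent B" "cvec.span B = UNIV"
    using someI[of "\<lambda>B::'v set. cvec.independent B \<and> cvec.span B = UNIV" C] C
    unfolding B_def by auto
  have finB: "finite B" using cvec.independent_span_bound[OF C(3) B(1)] C(2) by simp
  have "trace_end f = (\<Sum>b\<in>B. cvec.representation B (f b) b)"
    unfolding trace_end_def Let_def B_def ..
  also have "\<dots> = (\<Sum>b\<in>B. \<Sum>c\<in>C. cvec.representation C (f b) c * cvec.representation B c b)"
  proof (rule sum.cong)
    fix b
    have "cvec.representation B (f b) b
        = cvec.representation B (\<Sum>c\<in>C. cvec.representation C (f b) c *\<^sub>C c) b"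
      using representation_sum_basis[OF C] by simp
    then show "cvec.representation B (f b) b
        = (\<Sum>c\<in>C. cvec.representation C (f b) c * cvec.representation B c b)"
      by (simp add: representation_linear[OF B])
  qed simp
  also have "\<dots> = (\<Sum>c\<in>C. \<Sum>b\<in>B. cvec.representation C (f b) c * cvec.representation B c b)"
    by (rule sum.swap)
  also have "\<dots> = (\<Sum>c\<in>C. cvec.representation C (f c) c)"
  proof (rule sum.cong)
    fix c
    have "cvec.representation C (f c) c
        = cvec.representation C (f (\<Sum>b\<in>B. cvec.representation B c b *\<^sub>C b)) c"
      using representation_sum_basis[OF B finB] by simp
    then show "(\<Sum>b\<in>B. cvec.representation C (f b) c * cvec.representation B c b)
        = cvec.representation C (f c) c"
      by (simp add: clinear_sum[OF f] clinearD[OF f] representation_linear[OF C(1,2)] mult.commute)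
  qed simp
  finally show ?thesis .
qed

lemma finite_dim_basis:
  assumes "finite_dim TYPE('v::complex_vector)"
  obtains C :: "'v::complex_vector set" where "cvec.independent C" "cvec.span C = UNIV" "finite C"
proof -
  have "cvec.independent (cvec.extend_basis {} :: 'v set)" "cvec.span (cvec.extend_basis {} :: 'v set) = UNIV"
    by (rule cvec.independent_extend_basis[OF cvec.independent_empty],
        rule cvec.span_extend_basis[OF cvec.independent_empty])
  then obtain C :: "'v set" where "cvec.independent C" "cvec.span C = UNIV" by auto
  then show ?thesis using that[of C] finite_dim_independent[OF assms, of C] by simp
qed

lemma trace_end_commute:
  fixes f g :: "'v::complex_vector \<Rightarrow> 'v"
  assumes fd: "finite_dim TYPE('v)" and f: "clinear f" and g: "clinear g"
  shows "trace_end (\<lambda>x. f (g x)) = trace_end (\<lambda>x. g (f x))"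
proof -
  obtain C :: "'v set" where C: "cvec.independent C" "cvec.span C = UNIV" "finite C"
    using finite_dim_basis[OF fd] .
  let ?r = "cvec.representation C"
  have *: "?r (f (g b)) b = (\<Sum>c\<in>C. ?r (g b) c * ?r (f c) b)"
    if "clinear f" for f g :: "'v \<Rightarrow> 'v" and b
  proof -
    have "?r (f (g b)) b = ?r (f (\<Sum>c\<in>C. ?r (g b) c *\<^sub>C c)) b"
      using representation_sum_basis[OF C] by simp
    then show ?thesis
      by (simp add: clinear_sum[OF that] clinearD[OF that] representation_linear[OF C(1,2)])
  qed
  have "trace_end (\<lambda>x. f (g x)) = (\<Sum>b\<in>C. \<Sum>c\<in>C. ?r (g b) c * ?r (f c) b)"
    by (simp add: trace_end_basis[OF clinear_comp[OF f g] C] *[OF f])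
  also have "\<dots> = (\<Sum>c\<in>C. \<Sum>b\<in>C. ?r (f c) b * ?r (g b) c)"
    by (subst sum.swap) (simp add: mult.commute)
  also have "\<dots> = trace_end (\<lambda>x. g (f x))"
    by (simp add: trace_end_basis[OF clinear_comp[OF g f] C] *[OF g])
  finally show ?thesis .
qed

lemma trace_end_linear:
  fixes f g :: "'v::complex_vector \<Rightarrow> 'v"
  assumes fd: "finite_dim TYPE('v)" and f: "clinear f" and g: "clinear g"
  shows "trace_end (\<lambda>x. f x + g x) = trace_end f + trace_end g"
    "trace_end (\<lambda>x. c *\<^sub>C f x) = c * trace_end f"
proof -
  obtain C :: "'v set" where C: "cvec.independent C" "cvec.span C = UNIV" "finite C"
    using finite_dim_basis[OF fd] .
  have 1: "clinear (\<lambda>x. f x + g x)" "clinear (\<lambda>x. c *\<^sub>C f x)"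
    by (intro clinearI; simp add: clinearD[OF f] clinearD[OF g] cv_simps algebra_simps)+
  show "trace_end (\<lambda>x. f x + g x) = trace_end f + trace_end g"
    "trace_end (\<lambda>x. c *\<^sub>C f x) = c * trace_end f"
    unfolding trace_end_basis[OF 1(1) C] trace_end_basis[OF 1(2) C] trace_end_basis[OF f C]
      trace_end_basis[OF g C]
    by (simp_all add: representation_linear[OF C(1,2)] sum.distrib sum_distrib_left)
qed

section \<open>Weights of modules over a toral subalgebra\<close>

lemma bracket_antisym: "bracket x y = - bracket y (x::'g::lie_algebra)"
proof -
  have "bracket (x + y) (x + y) = bracket x x + bracket x y + (bracket y x + bracket y y)"
    by (simp only: bracket_add_left bracket_add_right ac_simps)
  then have "bracket x y + bracket y x = 0" by (simp add: bracket_self)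
  then show ?thesis by (simp add: eq_neg_iff_add_eq_0)
qed

lemma adjoint_lie_module: "lie_module (bracket :: 'g::lie_algebra \<Rightarrow> 'g \<Rightarrow> 'g)"
proof -
  have "bracket (bracket x y) v = bracket x (bracket y v) - bracket y (bracket x v)" for x y v :: 'g
  proof -
    have "bracket (bracket x y) v = - bracket v (bracket x y)" by (rule bracket_antisym)
    also have "\<dots> = bracket x (bracket y v) + bracket y (bracket v x)"
      using jacobi[of x y v] by (simp add: neg_eq_iff_add_eq_0 add.commute add.left_commute)
    also have "bracket y (bracket v x) = - bracket y (bracket x v)"
      using bracket_antisym[of v x] bracket_scale_right[of y "-1" "bracket x v"] by simp
    finally show ?thesis by simp
  qed
  then show ?thesis unfolding lie_module_def
    by (auto intro!: clinearI simp: bracket_add_left bracket_add_right bracket_scale_left bracket_scale_right)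
qed

lemma lie_module_clinear: "lie_module \<rho> \<Longrightarrow> clinear (\<rho> x)" "lie_module \<rho> \<Longrightarrow> clinear (\<lambda>x. \<rho> x v)"
  unfolding lie_module_def by auto

lemma lie_module_simps:
  assumes "lie_module \<rho>"
  shows "\<rho> x (u + v) = \<rho> x u + \<rho> x v" "\<rho> x (c *\<^sub>C v) = c *\<^sub>C \<rho> x v" "\<rho> x 0 = 0"
    "\<rho> x (u - v) = \<rho> x u - \<rho> x v" "\<rho> x (- v) = - \<rho> x v"
    "\<rho> (x + y) v = \<rho> x v + \<rho> y v" "\<rho> (c *\<^sub>C x) v = c *\<^sub>C \<rho> x v" "\<rho> 0 v = 0"
    "\<rho> (x - y) v = \<rho> x v - \<rho> y v" "\<rho> (- x) v = - \<rho> x v"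
    "\<rho> (bracket x y) v = \<rho> x (\<rho> y v) - \<rho> y (\<rho> x v)"
  using clinearD[OF lie_module_clinear(1)[OF assms, of x]]
    clinearD[OF lie_module_clinear(2)[OF assms, of v]] lie_moduleD(5)[OF assms] by auto

lemmas bracket_simps = lie_module_simps(1-10)[OF adjoint_lie_module]

lemma lie_module_commute: "lie_module \<rho> \<Longrightarrow> \<rho> x (\<rho> y v) = \<rho> y (\<rho> x v) + \<rho> (bracket x y) v"
  by (simp add: lie_module_simps)

lemma dual_ofD:
  assumes "\<mu> \<in> dual_of h"
  shows "s \<in> h \<Longrightarrow> t \<in> h \<Longrightarrow> \<mu> (s + t) = \<mu> s + \<mu> t" "t \<in> h \<Longrightarrow> \<mu> (c *\<^sub>C t) = c * \<mu> t"
    "x \<notin> h \<Longrightarrow> \<mu> x = 0"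
  using assms unfolding dual_of_def by auto

lemma dual_of_add: "\<mu> \<in> dual_of h \<Longrightarrow> \<nu> \<in> dual_of h \<Longrightarrow> (\<lambda>t. \<mu> t + \<nu> t) \<in> dual_of h"
  unfolding dual_of_def by (auto simp: algebra_simps)

lemma dual_of_scale: "\<mu> \<in> dual_of h \<Longrightarrow> (\<lambda>t. c * \<mu> t) \<in> dual_of h"
  unfolding dual_of_def by (auto simp: algebra_simps)

lemma dual_of_uminus: "\<mu> \<in> dual_of h \<Longrightarrow> (\<lambda>t. - \<mu> t) \<in> dual_of h"
  unfolding dual_of_def by (auto simp: algebra_simps)

lemma dual_of_zero: "(\<lambda>t. 0) \<in> dual_of h"
  unfolding dual_of_def by auto

lemma dual_of_eqI:
  assumes "\<mu> \<in> dual_of h" "\<nu> \<in> dual_of h" "\<And>t. t \<in> h \<Longrightarrow> \<mu> t = \<nu> t"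
  shows "\<mu> = \<nu>"
  using assms by (intro ext) (metis dual_ofD(3))

lemma root_space_adjoint: "root_space h \<alpha> = weight_space bracket h \<alpha>"
  unfolding root_space_def weight_space_def ..

lemma root_vector_shifts_weight:
  assumes mod: "lie_module \<rho>" and "x \<in> root_space h \<alpha>" "v \<in> weight_space \<rho> h \<mu>"
  shows "\<rho> x v \<in> weight_space \<rho> h (\<lambda>t. \<mu> t + \<alpha> t)"
  unfolding weight_space_def
proof safe
  fix t assume t: "t \<in> h"
  have "\<rho> t (\<rho> x v) = \<rho> x (\<rho> t v) + \<rho> (bracket t x) v" by (rule lie_module_commute[OF mod])
  also have "bracket t x = \<alpha> t *\<^sub>C x" using assms(2) t unfolding root_space_def by blast
  also have "\<rho> t v = \<mu> t *\<^sub>C v" using assms(3) t unfolding weight_space_def by blast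
  finally show "\<rho> t (\<rho> x v) = (\<mu> t + \<alpha> t) *\<^sub>C \<rho> x v"
    by (simp add: lie_module_simps[OF mod] cv_simps)
qed

lemma injective_sequence_leaves_finite_set:
  assumes "finite S" "inj g"
  shows "\<exists>N. \<forall>n\<ge>N. g (n::nat) \<notin> S"
proof -
  have "finite (g -` S)" using assms finite_vimageI by blast
  then obtain N where "\<forall>n\<in>g -` S. n < N" using finite_nat_set_iff_bounded by metis
  then show ?thesis by (intro exI[of _ N]) (meson leD vimageI2)
qed

text \<open>Only the sum of the weight spaces is required to be everything, so that the notion covers both
  the adjoint representation and the modules under study.\<close>

locale weight_module =
  fixes h :: "'g::lie_algebra set" and \<rho> :: "'g \<Rightarrow> 'v::complex_vector \<Rightarrow> 'v"
  assumes h_subspace: "cvec.subspace h"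
    and mod: "lie_module \<rho>" and fd: "finite_dim TYPE('v)"
    and weights_span: "cvec.span (\<Union>\<mu>\<in>dual_of h. weight_space \<rho> h \<mu>) = UNIV"
begin

lemmas act = lie_module_simps[OF mod]

lemma weight_space_subspace: "cvec.subspace (weight_space \<rho> h \<mu>)"
  unfolding cvec.subspace_def weight_space_def
  by (auto simp: act cvec.scale_right_distrib cvec.scale_left_commute)

lemma weight_spaceD: "v \<in> weight_space \<rho> h \<mu> \<Longrightarrow> t \<in> h \<Longrightarrow> \<rho> t v = \<mu> t *\<^sub>C v"
  unfolding weight_space_def by blast

lemma weight_space_0: "0 \<in> weight_space \<rho> h \<mu>"
  using cvec.subspace_0[OF weight_space_subspace] .

lemma weight_decompose:
  obtains M y where "finite M" "M \<subseteq> dual_of h" "\<And>\<mu>. \<mu> \<in> M \<Longrightarrow> y \<mu> \<in> weight_space \<rho> h \<mu>"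
    "x = (\<Sum>\<mu>\<in>M. y \<mu>)"
proof -
  have "x \<in> cvec.span (\<Union>\<mu>\<in>dual_of h. weight_space \<rho> h \<mu>)" using weights_span by simp
  then obtain M y where "finite M" "M \<subseteq> dual_of h" "\<And>\<mu>. \<mu> \<in> M \<Longrightarrow> y \<mu> \<in> weight_space \<rho> h \<mu>"
    "x = (\<Sum>\<mu>\<in>M. y \<mu>)"
    by (rule span_Union_decompose[rotated]) (use weight_space_subspace in auto)
  then show ?thesis by (rule that)
qed

lemma weight_components_in_subspace:
  assumes U: "cvec.subspace U" "\<And>t u. t \<in> h \<Longrightarrow> u \<in> U \<Longrightarrow> \<rho> t u \<in> U"
    and M: "finite M" "M \<subseteq> dual_of h" "\<And>\<mu>. \<mu> \<in> M \<Longrightarrow> y \<mu> \<in> weight_space \<rho> h \<mu>"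
    and "(\<Sum>\<mu>\<in>M. y \<mu>) \<in> U"
  shows "\<forall>\<mu>\<in>M. y \<mu> \<in> U"
proof (rule joint_eigencomponents_in_subspace[where I = h and T = \<rho> and \<chi> = "\<lambda>\<mu>. \<mu>"])
  show "clinear (\<rho> t)" for t using lie_module_clinear(1)[OF mod] .
  show "\<exists>t\<in>h. \<mu> t \<noteq> \<nu> t" if "\<mu> \<in> M" "\<nu> \<in> M" "\<mu> \<noteq> \<nu>" for \<mu> \<nu>
    using dual_of_eqI[of \<mu> h \<nu>] that M(2) by auto
qed (use assms weight_spaceD in auto)

lemma weight_vectors_independent:
  assumes M: "finite M" "M \<subseteq> dual_of h" "\<And>\<mu>. \<mu> \<in> M \<Longrightarrow> y \<mu> \<in> weight_space \<rho> h \<mu>"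
    and "(\<Sum>\<mu>\<in>M. y \<mu>) = 0" and "\<mu> \<in> M"
  shows "y \<mu> = 0"
  using weight_components_in_subspace[of "{0}" M y] assms
  by (auto simp: act cvec.subspace_single_0)

lemma weight_unique:
  assumes "v \<in> weight_space \<rho> h \<mu>" "v \<in> weight_space \<rho> h \<nu>" "\<mu> \<in> dual_of h" "\<nu> \<in> dual_of h" "v \<noteq> 0"
  shows "\<mu> = \<nu>"
proof (rule dual_of_eqI[OF assms(3,4)])
  fix t assume "t \<in> h"
  then have "(\<mu> t - \<nu> t) *\<^sub>C v = 0"
    using weight_spaceD[OF assms(1)] weight_spaceD[OF assms(2)]
    by (simp add: cvec.scale_left_diff_distrib del: cvec.scale_eq_0_iff cvec.scale_cancel_right)
  then show "\<mu> t = \<nu> t" using assms(5) by (simp add: cvec.scale_eq_0_iff)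
qed

text \<open>Group a linear combination of weight vectors by weight. Weight vectors of different weights are
  independent, so that all groups except the one of weight \<open>\<mu>\<close> add up to zero.\<close>

lemma weight_space_spanned:
  assumes S: "S \<subseteq> (\<Union>\<nu>\<in>dual_of h. weight_space \<rho> h \<nu>)" and x: "x \<in> cvec.span S"
    and mu: "\<mu> \<in> dual_of h" "x \<in> weight_space \<rho> h \<mu>"
  shows "x \<in> cvec.span (S \<inter> weight_space \<rho> h \<mu>)"
proof -
  define E where "E \<nu> = cvec.span (S \<inter> weight_space \<rho> h \<nu>)" for \<nu>
  have "S \<subseteq> (\<Union>\<nu>\<in>dual_of h. E \<nu>)"
  proof
    fix s assume s: "s \<in> S"
    then obtain \<nu> where \<nu>: "\<nu> \<in> dual_of h" "s \<in> weight_space \<rho> h \<nu>" using S by auto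
    then have "s \<in> E \<nu>" unfolding E_def using s by (intro cvec.span_base) auto
    then show "s \<in> (\<Union>\<nu>\<in>dual_of h. E \<nu>)" using \<nu> by auto
  qed
  then have "x \<in> cvec.span (\<Union>\<nu>\<in>dual_of h. E \<nu>)"
    by (rule subsetD[OF cvec.span_mono x])
  then obtain M y where M: "finite M" "M \<subseteq> dual_of h" "\<And>\<nu>. \<nu> \<in> M \<Longrightarrow> y \<nu> \<in> E \<nu>" "x = (\<Sum>\<nu>\<in>M. y \<nu>)"
    by (rule span_Union_decompose[rotated]) (auto simp: E_def cvec.subspace_span)
  have EW: "E \<nu> \<subseteq> weight_space \<rho> h \<nu>" for \<nu>
    unfolding E_def by (rule cvec.span_minimal) (auto simp: weight_space_subspace)
  define z where "z \<nu> = (if \<nu> \<in> M then y \<nu> else 0) - (if \<nu> = \<mu> then x else 0)" for \<nu>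
  have zW: "z \<nu> \<in> weight_space \<rho> h \<nu>" if "\<nu> \<in> insert \<mu> M" for \<nu>
    unfolding z_def using M(3)[of \<nu>] EW[of \<nu>] mu weight_space_0
    by (intro cvec.subspace_diff weight_space_subspace) auto
  have "(\<Sum>\<nu>\<in>insert \<mu> M. if \<nu> \<in> M then y \<nu> else 0) = (\<Sum>\<nu>\<in>M. y \<nu>)"
    by (rule sum.mono_neutral_cong_right) (use M in auto)
  then have "(\<Sum>\<nu>\<in>insert \<mu> M. z \<nu>) = 0"
    unfolding z_def sum_subtractf using M by simp
  then have "z \<mu> = 0"
    using weight_vectors_independent[of "insert \<mu> M" z \<mu>] M mu zW by auto
  then have "x = (if \<mu> \<in> M then y \<mu> else 0)" unfolding z_def by auto
  then show ?thesis using M(3)[of \<mu>] cvec.span_zero unfolding E_def by auto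
qed

text \<open>A finite basis involves finitely many weights, and every weight occurs among them because weight
  vectors of different weights are independent.\<close>

lemma finite_weights: "finite {\<mu> \<in> dual_of h. weight_space \<rho> h \<mu> \<noteq> {0}}"
proof -
  obtain C :: "'v set" where C: "cvec.span C = UNIV" "finite C"
    using finite_dim_basis[OF fd] by metis
  have "\<exists>M. finite M \<and> M \<subseteq> dual_of h \<and> x \<in> cvec.span (\<Union>\<mu>\<in>M. weight_space \<rho> h \<mu>)" for x
  proof -
    obtain M y where M: "finite M" "M \<subseteq> dual_of h" "\<And>\<mu>. \<mu> \<in> M \<Longrightarrow> y \<mu> \<in> weight_space \<rho> h \<mu>"
      "x = (\<Sum>\<mu>\<in>M. y \<mu>)" by (rule weight_decompose[where x = x], rule that)
    have "x \<in> cvec.span (\<Union>\<mu>\<in>M. weight_space \<rho> h \<mu>)"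
      unfolding M(4) by (intro cvec.span_sum cvec.span_base) (use M(3) in auto)
    then show ?thesis using M by auto
  qed
  then obtain M where M: "\<And>x. finite (M x)" "\<And>x. M x \<subseteq> dual_of h"
    "\<And>x. x \<in> cvec.span (\<Union>\<mu>\<in>M x. weight_space \<rho> h \<mu>)" by metis
  define N where "N = (\<Union>x\<in>C. M x)"
  define S where "S = (\<Union>\<mu>\<in>N. weight_space \<rho> h \<mu>)"
  have "C \<subseteq> cvec.span S"
  proof
    fix x assume "x \<in> C"
    then have "(\<Union>\<mu>\<in>M x. weight_space \<rho> h \<mu>) \<subseteq> S" unfolding S_def N_def by blast
    then show "x \<in> cvec.span S" by (rule subsetD[OF cvec.span_mono M(3)])
  qed
  then have S: "cvec.span S = UNIV"
    using C(1) cvec.span_minimal[OF _ cvec.subspace_span, of C S] by auto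
  have "{\<mu> \<in> dual_of h. weight_space \<rho> h \<mu> \<noteq> {0}} \<subseteq> N"
  proof (rule subsetI, rule ccontr)
    fix \<mu> assume "\<mu> \<in> {\<mu> \<in> dual_of h. weight_space \<rho> h \<mu> \<noteq> {0}}" "\<mu> \<notin> N"
    then have mu: "\<mu> \<in> dual_of h" "weight_space \<rho> h \<mu> \<noteq> {0}" "\<mu> \<notin> N" by auto
    then obtain x where x: "x \<in> weight_space \<rho> h \<mu>" "x \<noteq> 0" using weight_space_0 by blast
    have "x \<in> cvec.span (S \<inter> weight_space \<rho> h \<mu>)"
    proof (rule weight_space_spanned[OF _ _ mu(1) x(1)])
      show "S \<subseteq> (\<Union>\<nu>\<in>dual_of h. weight_space \<rho> h \<nu>)" using M(2) unfolding S_def N_def by blast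
    qed (simp add: S)
    moreover
    have "S \<inter> weight_space \<rho> h \<mu> \<subseteq> {0}"
    proof
      fix v assume v: "v \<in> S \<inter> weight_space \<rho> h \<mu>"
      then obtain \<nu> where "\<nu> \<in> N" "v \<in> weight_space \<rho> h \<nu>" unfolding S_def by blast
      moreover have "\<nu> \<in> dual_of h" using \<open>\<nu> \<in> N\<close> M(2) unfolding N_def by blast
      ultimately show "v \<in> {0}" using weight_unique[of v \<nu> \<mu>] v mu by auto
    qed
    from subsetD[OF cvec.span_minimal[OF this cvec.subspace_single_0] calculation]
    show False using x(2) by simp
  qed
  moreover have "finite N" unfolding N_def using C M by blast
  ultimately show ?thesis using finite_subset by blast
qed

lemmas root_vector_act = root_vector_shifts_weight[OF mod]

lemma root_vector_funpow:
  assumes "x \<in> root_space h \<alpha>" "v \<in> weight_space \<rho> h \<mu>"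
  shows "(\<rho> x ^^ n) v \<in> weight_space \<rho> h (\<lambda>t. \<mu> t + of_nat n * \<alpha> t)"
proof (induction n)
  case 0
  then show ?case using assms by simp
next
  case (Suc n)
  have "(\<lambda>t. \<mu> t + of_nat n * \<alpha> t + \<alpha> t) = (\<lambda>t. \<mu> t + of_nat (Suc n) * \<alpha> t)"
    by (simp add: algebra_simps)
  then show ?case using root_vector_act[OF assms(1) Suc] by simp
qed

lemma clinear_act_funpow: "clinear (\<rho> x ^^ n)"
  by (rule clinear_funpow[OF lie_module_clinear(1)[OF mod]])

text \<open>The weights \<open>\<mu> + n \<alpha>\<close> are pairwise different, but only finitely many weights occur.\<close>

lemma root_vector_nilpotent:
  assumes x: "x \<in> root_space h \<alpha>" and al: "\<alpha> \<in> dual_of h" "\<alpha> \<noteq> (\<lambda>_. 0)"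
  shows "\<exists>N. \<forall>n\<ge>N. \<forall>v. (\<rho> x ^^ n) v = 0"
proof -
  let ?P = "{\<mu> \<in> dual_of h. weight_space \<rho> h \<mu> \<noteq> {0}}"
  define g where "g \<mu> n = (\<lambda>t. \<mu> t + of_nat n * \<alpha> t)" for \<mu> and n :: nat
  obtain t where t: "\<alpha> t \<noteq> 0" using al(2) by auto
  have "\<exists>N. \<forall>n\<ge>N. g \<mu> n \<notin> ?P" for \<mu>
  proof (rule injective_sequence_leaves_finite_set[OF finite_weights])
    show "inj (g \<mu>)"
    proof (rule injI)
      fix m n assume "g \<mu> m = g \<mu> n"
      then have "g \<mu> m t = g \<mu> n t" by simp
      then show "m = n" using t unfolding g_def by simp
    qed
  qed
  then obtain N where N: "\<And>\<mu> n. n \<ge> N \<mu> \<Longrightarrow> g \<mu> n \<notin> ?P" by metis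
  define K where "K = Max (insert 0 (N ` ?P))"
  have K: "N \<mu> \<le> K" if "\<mu> \<in> ?P" for \<mu>
    unfolding K_def by (rule Max_ge) (use finite_weights that in auto)
  have "(\<rho> x ^^ n) v = 0" if n: "n \<ge> K" for n v
  proof -
    obtain M y where M: "finite M" "M \<subseteq> dual_of h" "\<And>\<mu>. \<mu> \<in> M \<Longrightarrow> y \<mu> \<in> weight_space \<rho> h \<mu>"
      "v = (\<Sum>\<mu>\<in>M. y \<mu>)" by (rule weight_decompose[where x = v], rule that)
    have "(\<rho> x ^^ n) (y \<mu>) = 0" if "\<mu> \<in> M" for \<mu>
    proof (cases "y \<mu> = 0")
      case True
      then show ?thesis using clinearD(3)[OF clinear_act_funpow] by simp
    next
      case False
      then have "\<mu> \<in> ?P" using M that by blast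
      then have "g \<mu> n \<notin> ?P" using N K n le_trans by blast
      moreover have "g \<mu> n \<in> dual_of h"
        unfolding g_def using \<open>\<mu> \<in> ?P\<close> al dual_of_add dual_of_scale by blast
      ultimately have "weight_space \<rho> h (g \<mu> n) = {0}" by blast
      then show ?thesis using root_vector_funpow[OF x M(3)[OF that], of n] unfolding g_def by auto
    qed
    then show ?thesis unfolding M(4) clinear_sum[OF clinear_act_funpow] by simp
  qed
  then show ?thesis by blast
qed

lemma root_vector_top:
  assumes x: "x \<in> root_space h \<alpha>" "\<alpha> \<in> dual_of h" "\<alpha> \<noteq> (\<lambda>_. 0)" and v: "v \<noteq> 0"
  shows "\<exists>n. (\<rho> x ^^ n) v \<noteq> 0 \<and> \<rho> x ((\<rho> x ^^ n) v) = 0"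
proof -
  obtain N where N: "(\<rho> x ^^ N) v = 0" using root_vector_nilpotent[OF x] by blast
  define m where "m = (LEAST n. (\<rho> x ^^ n) v = 0)"
  have m: "(\<rho> x ^^ m) v = 0" unfolding m_def using N by (rule LeastI)
  have "m \<noteq> 0" using m v by (metis funpow_0)
  then obtain n where n: "m = Suc n" using not0_implies_Suc by blast
  then have "(\<rho> x ^^ n) v \<noteq> 0" using not_less_Least[of n "\<lambda>n. (\<rho> x ^^ n) v = 0"] unfolding m_def by auto
  then show ?thesis using m n by auto
qed

subsection \<open>Root strings\<close>

lemma raise_lowered:
  assumes x: "x \<in> root_space h \<alpha>" and y: "y \<in> root_space h (\<lambda>t. - \<alpha> t)" and t: "bracket x y \<in> h"
    and w: "w \<in> weight_space \<rho> h \<mu>" "\<rho> x w = 0"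
  shows "\<rho> x ((\<rho> y ^^ Suc k) w)
    = (of_nat (Suc k) * (\<mu> (bracket x y) - of_nat k * \<alpha> (bracket x y) / 2)) *\<^sub>C (\<rho> y ^^ k) w"
proof (induction k)
  case 0
  show ?case using lie_module_commute[OF mod, of x y w] w(2) weight_spaceD[OF w(1) t]
    by (simp add: act)
next
  case (Suc k)
  let ?t = "bracket x y"
  have "\<rho> ?t ((\<rho> y ^^ Suc k) w) = (\<mu> ?t - of_nat (Suc k) * \<alpha> ?t) *\<^sub>C (\<rho> y ^^ Suc k) w"
    using weight_spaceD[OF root_vector_funpow[OF y w(1), of "Suc k"] t] by simp
  moreover have "\<rho> x ((\<rho> y ^^ Suc (Suc k)) w)
      = \<rho> y (\<rho> x ((\<rho> y ^^ Suc k) w)) + \<rho> ?t ((\<rho> y ^^ Suc k) w)"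
    using lie_module_commute[OF mod, of x y "(\<rho> y ^^ Suc k) w"] by simp
  ultimately have "\<rho> x ((\<rho> y ^^ Suc (Suc k)) w)
      = (of_nat (Suc k) * (\<mu> ?t - of_nat k * \<alpha> ?t / 2)) *\<^sub>C (\<rho> y ^^ Suc k) w
        + (\<mu> ?t - of_nat (Suc k) * \<alpha> ?t) *\<^sub>C (\<rho> y ^^ Suc k) w"
    unfolding Suc by (simp add: act)
  also have "\<dots> = (of_nat (Suc (Suc k)) * (\<mu> ?t - of_nat (Suc k) * \<alpha> ?t / 2)) *\<^sub>C (\<rho> y ^^ Suc k) w"
    unfolding cvec.scale_left_distrib[symmetric] by (rule arg_cong2[where f = scaleC]) (simp_all add: field_simps)
  finally show ?case .
qed

text \<open>The relation of \<open>raise_lowered\<close> at the end of the string, where \<open>y\<close> kills the last vector, forces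
  the coefficient to vanish.\<close>

lemma highest_vector_level:
  assumes x: "x \<in> root_space h \<alpha>" and y: "y \<in> root_space h (\<lambda>t. - \<alpha> t)" and t: "bracket x y \<in> h"
    and al: "\<alpha> \<in> dual_of h" "\<alpha> \<noteq> (\<lambda>_. 0)"
    and w: "w \<in> weight_space \<rho> h \<mu>" "\<rho> x w = 0" "w \<noteq> 0"
  shows "\<exists>n. 2 * \<mu> (bracket x y) = of_nat n * \<alpha> (bracket x y) \<and> (\<forall>k\<le>n. (\<rho> y ^^ k) w \<noteq> 0)
    \<and> (\<rho> y ^^ Suc n) w = 0"
proof -
  have "(\<lambda>t. - \<alpha> t) \<noteq> (\<lambda>_. 0)" using al(2) by (auto simp: fun_eq_iff)
  then obtain n where n: "(\<rho> y ^^ n) w \<noteq> 0" "\<rho> y ((\<rho> y ^^ n) w) = 0"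
    using root_vector_top[OF y dual_of_uminus[OF al(1)] _ w(3)] by blast
  have "(of_nat (Suc n) * (\<mu> (bracket x y) - of_nat n * \<alpha> (bracket x y) / 2)) *\<^sub>C (\<rho> y ^^ n) w = 0"
    using raise_lowered[OF x y t w(1,2), of n] n(2) by (simp add: act)
  then have "\<mu> (bracket x y) - of_nat n * \<alpha> (bracket x y) / 2 = 0"
    using n(1) unfolding cvec.scale_eq_0_iff mult_eq_0_iff by (metis of_nat_neq_0)
  then have "2 * \<mu> (bracket x y) = of_nat n * \<alpha> (bracket x y)" by (simp add: field_simps)
  moreover have "(\<rho> y ^^ k) w \<noteq> 0" if "k \<le> n" for k
  proof
    assume k: "(\<rho> y ^^ k) w = 0"
    have "(\<rho> y ^^ n) w = (\<rho> y ^^ (n - k)) ((\<rho> y ^^ k) w)"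
      using that by (metis comp_apply funpow_add le_add_diff_inverse2)
    then show False using n(1) k clinearD(3)[OF clinear_act_funpow] by simp
  qed
  ultimately show ?thesis using n(2) by auto
qed

text \<open>Climb from a vector of weight \<open>\<mu>\<close> to the top of its \<open>\<alpha>\<close>-string and apply
  \<open>highest_vector_level\<close> there. If \<open>\<alpha>([x, y]) = 0\<close>, the conclusion says \<open>\<mu>([x, y]) = 0\<close>; this case gives
  the nondegeneracy of the Killing form.\<close>

lemma string_integrality:
  assumes x: "x \<in> root_space h \<alpha>" and y: "y \<in> root_space h (\<lambda>t. - \<alpha> t)" and t: "bracket x y \<in> h"
    and al: "\<alpha> \<in> dual_of h" "\<alpha> \<noteq> (\<lambda>_. 0)"
    and mu: "weight_space \<rho> h \<mu> \<noteq> {0}"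
  shows "\<exists>k::int. 2 * \<mu> (bracket x y) = of_int k * \<alpha> (bracket x y)"
proof -
  obtain v where v: "v \<in> weight_space \<rho> h \<mu>" "v \<noteq> 0" using mu weight_space_0 by blast
  obtain n where n: "(\<rho> x ^^ n) v \<noteq> 0" "\<rho> x ((\<rho> x ^^ n) v) = 0"
    using root_vector_top[OF x al v(2)] by blast
  obtain m where "2 * (\<mu> (bracket x y) + of_nat n * \<alpha> (bracket x y)) = of_nat m * \<alpha> (bracket x y)"
    using highest_vector_level[OF x y t al root_vector_funpow[OF x v(1), of n] n(2,1)] by blast
  then have "2 * \<mu> (bracket x y) = of_int (int m - 2 * int n) * \<alpha> (bracket x y)"
    by (simp add: algebra_simps)
  then show ?thesis by blast
qed

end

section \<open>Exponentials of nilpotent operators\<close>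

text \<open>\<open>T\<^sup>k / k!\<close>, the terms of the exponential series.\<close>

definition divided_power :: "('v \<Rightarrow> 'v) \<Rightarrow> nat \<Rightarrow> 'v \<Rightarrow> 'v::complex_vector" where
  "divided_power T k v = (1 / fact k) *\<^sub>C (T ^^ k) v"

text \<open>The exponential of a nilpotent operator; the sum stops at the index of nilpotency.\<close>

definition exp_nil :: "('v \<Rightarrow> 'v) \<Rightarrow> 'v \<Rightarrow> 'v::complex_vector" where
  "exp_nil T v = (\<Sum>k<(LEAST N. \<forall>v. (T ^^ N) v = 0). divided_power T k v)"

lemma divided_power_Suc:
  assumes "clinear T"
  shows "T (divided_power T k v) = of_nat (Suc k) *\<^sub>C divided_power T (Suc k) v"
  unfolding divided_power_def using clinearD[OF assms] by (simp add: field_simps del: of_nat_Suc)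

lemma divided_power_linear:
  assumes "clinear T"
  shows "divided_power T k (u + v) = divided_power T k u + divided_power T k v"
    "divided_power T k (c *\<^sub>C v) = c *\<^sub>C divided_power T k v"
  unfolding divided_power_def using clinearD[OF clinear_funpow[OF assms, of k]]
  by (simp_all add: cv_simps mult.commute)

lemma funpow_eq_0_mono:
  fixes T :: "'v \<Rightarrow> 'v::complex_vector"
  assumes T: "clinear T" and "(T ^^ m) v = 0" "m \<le> n"
  shows "(T ^^ n) v = 0"
proof -
  have "(T ^^ n) v = (T ^^ (n - m)) ((T ^^ m) v)"
    using assms(3) by (metis comp_apply funpow_add le_add_diff_inverse2)
  then show ?thesis using assms(2) clinearD(3)[OF clinear_funpow[OF T]] by simp
qed

lemma exp_nil_eq:
  assumes T: "clinear T" and N: "\<forall>v. (T ^^ N) v = 0" and m: "(T ^^ m) v = 0"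
  shows "exp_nil T v = (\<Sum>k<m. divided_power T k v)"
proof -
  define L where "L = (LEAST N. \<forall>v. (T ^^ N) v = 0)"
  have L: "\<forall>v. (T ^^ L) v = 0" unfolding L_def using N by (rule LeastI)
  have "(\<Sum>k<L. divided_power T k v) = (\<Sum>k<min L m. divided_power T k v)"
    by (rule sum.mono_neutral_right) (use funpow_eq_0_mono[OF T m] in \<open>auto simp: divided_power_def\<close>)
  also have "\<dots> = (\<Sum>k<m. divided_power T k v)"
    by (rule sum.mono_neutral_left) (use funpow_eq_0_mono[OF T L[rule_format]] in \<open>auto simp: divided_power_def\<close>)
  finally show ?thesis unfolding exp_nil_def L_def .
qed

lemma exp_nil_linear:
  assumes T: "clinear T"
  shows "clinear (exp_nil T)"
  by (rule clinearI)
    (simp_all add: exp_nil_def divided_power_linear[OF T] sum.distrib cvec.scale_sum_right)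

text \<open>Apply to \<open>exp T v\<close> the last power of \<open>T\<close> that does not kill \<open>v\<close>: only the first term survives.\<close>

lemma exp_nil_eq_0:
  assumes T: "clinear T" and N: "\<forall>v. (T ^^ N) v = 0" and 0: "exp_nil T v = 0"
  shows "v = 0"
proof (rule ccontr)
  assume "v \<noteq> 0"
  define m where "m = (LEAST n. (T ^^ n) v = 0)"
  have m: "(T ^^ m) v = 0" unfolding m_def using N[rule_format] by (rule LeastI)
  have "m \<noteq> 0" using m \<open>v \<noteq> 0\<close> by (metis funpow_0)
  then obtain n where n: "m = Suc n" using not0_implies_Suc by blast
  then have nz: "(T ^^ n) v \<noteq> 0" using not_less_Least[of n "\<lambda>n. (T ^^ n) v = 0"] unfolding m_def by auto
  have "exp_nil T v = (\<Sum>k<Suc n. divided_power T k v)" using exp_nil_eq[OF T N m] n by simp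
  then have "0 = (T ^^ n) (\<Sum>k<Suc n. divided_power T k v)"
    using 0 clinearD(3)[OF clinear_funpow[OF T]] by simp
  also have "\<dots> = (\<Sum>k<Suc n. (1 / fact k) *\<^sub>C (T ^^ (n + k)) v)"
    by (simp only: clinear_sum[OF clinear_funpow[OF T]] divided_power_def
        clinearD(2)[OF clinear_funpow[OF T]] funpow_add comp_apply)
  also have "\<dots> = (T ^^ n) v + (\<Sum>k<n. (1 / fact (Suc k)) *\<^sub>C (T ^^ (n + Suc k)) v)"
    by (subst sum.lessThan_Suc_shift) simp
  also have "(\<Sum>k<n. (1 / fact (Suc k)) *\<^sub>C (T ^^ (n + Suc k)) v) = 0"
    by (rule sum.neutral) (simp add: funpow_eq_0_mono[OF T m] n del: funpow.simps fact_Suc)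
  finally show False using nz by simp
qed

lemma sum_square_eq_triangle:
  fixes g :: "nat \<Rightarrow> nat \<Rightarrow> 'v::comm_monoid_add"
  assumes "\<And>k l. k \<ge> N \<Longrightarrow> g k l = 0" "\<And>k l. l \<ge> N \<Longrightarrow> g k l = 0"
  shows "(\<Sum>k<N. \<Sum>l<N. g k l) = (\<Sum>n<2 * N. \<Sum>k\<le>n. g k (n - k))"
proof -
  have "(\<Sum>n<2 * N. \<Sum>k\<le>n. g k (n - k)) = (\<Sum>(k, l)\<in>{(k, l). k + l < 2 * N}. g k l)"
    by (rule sum.triangle_reindex[symmetric])
  also have "\<dots> = (\<Sum>(k, l)\<in>{..<N} \<times> {..<N}. g k l)"
  proof (rule sum.mono_neutral_right)
    show "finite {(k, l). k + l < 2 * N}"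
      by (rule finite_subset[of _ "{..<2 * N} \<times> {..<2 * N}"]) auto
  qed (auto, (metis assms leI)+)
  finally show ?thesis by (simp add: sum.cartesian_product)
qed

text \<open>An element \<open>x\<close> acts on the expression \<open>\<rho> y v\<close> as a derivation: through the bracket on \<open>y\<close> and
  through \<open>\<rho>\<close> on \<open>v\<close>.\<close>

lemma divided_power_Leibniz:
  assumes mod: "lie_module \<rho>"
  shows "divided_power (\<rho> x) n (\<rho> y v)
    = (\<Sum>k\<le>n. \<rho> (divided_power (bracket x) k y) (divided_power (\<rho> x) (n - k) v))"
proof (induction n)
  case 0
  then show ?case by (simp add: divided_power_def)
next
  case (Suc n)
  note lin = lie_module_clinear(1)[OF mod, of x] lie_module_clinear(1)[OF adjoint_lie_module, of x]
  note act = lie_module_simps(1-10)[OF mod]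
  define g where "g k l = \<rho> (divided_power (bracket x) k y) (divided_power (\<rho> x) l v)" for k l
  have "of_nat (Suc n) *\<^sub>C divided_power (\<rho> x) (Suc n) (\<rho> y v) = \<rho> x (\<Sum>k\<le>n. g k (n - k))"
    using divided_power_Suc[OF lin(1), of n "\<rho> y v"] Suc unfolding g_def by (simp del: of_nat_Suc)
  also have "\<dots> = (\<Sum>k\<le>n. of_nat (Suc n - k) *\<^sub>C g k (Suc n - k) + of_nat (Suc k) *\<^sub>C g (Suc k) (n - k))"
    unfolding clinear_sum[OF lin(1)]
  proof (rule sum.cong)
    fix k assume "k \<in> {..n}"
    then have k: "Suc n - k = Suc (n - k)" by (simp add: Suc_diff_le)
    have "\<rho> x (g k (n - k)) = \<rho> (divided_power (bracket x) k y) (\<rho> x (divided_power (\<rho> x) (n - k) v))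
        + \<rho> (bracket x (divided_power (bracket x) k y)) (divided_power (\<rho> x) (n - k) v)"
      unfolding g_def by (rule lie_module_commute[OF mod])
    then show "\<rho> x (g k (n - k))
        = of_nat (Suc n - k) *\<^sub>C g k (Suc n - k) + of_nat (Suc k) *\<^sub>C g (Suc k) (n - k)"
      unfolding k divided_power_Suc[OF lin(1)] divided_power_Suc[OF lin(2)] g_def
      by (simp only: act)
  qed simp
  also have "\<dots> = (\<Sum>k\<le>n. of_nat (Suc n - k) *\<^sub>C g k (Suc n - k)) + (\<Sum>k\<le>n. of_nat (Suc k) *\<^sub>C g (Suc k) (n - k))"
    by (rule sum.distrib)
  also have "(\<Sum>k\<le>n. of_nat (Suc n - k) *\<^sub>C g k (Suc n - k)) = (\<Sum>k\<le>Suc n. of_nat (Suc n - k) *\<^sub>C g k (Suc n - k))"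
    by simp
  also have "(\<Sum>k\<le>n. of_nat (Suc k) *\<^sub>C g (Suc k) (n - k)) = (\<Sum>k\<le>Suc n. of_nat k *\<^sub>C g k (Suc n - k))"
    by (simp only: sum.atMost_Suc_shift diff_Suc_Suc) simp
  also have "(\<Sum>k\<le>Suc n. of_nat (Suc n - k) *\<^sub>C g k (Suc n - k)) + (\<Sum>k\<le>Suc n. of_nat k *\<^sub>C g k (Suc n - k))
      = (\<Sum>k\<le>Suc n. of_nat (Suc n) *\<^sub>C g k (Suc n - k))"
    unfolding sum.distrib[symmetric]
    by (rule sum.cong) (simp_all add: cvec.scale_left_distrib[symmetric] of_nat_diff del: of_nat_Suc)
  finally have "of_nat (Suc n) *\<^sub>C divided_power (\<rho> x) (Suc n) (\<rho> y v)
      = of_nat (Suc n) *\<^sub>C (\<Sum>k\<le>Suc n. g k (Suc n - k))"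
    by (simp only: cvec.scale_sum_right)
  then show ?case unfolding g_def using cvec.scale_left_imp_eq of_nat_neq_0 by blast
qed

text \<open>The exponential of a derivation is multiplicative; here the product is \<open>(y, v) \<mapsto> \<rho> y v\<close>.\<close>

lemma exp_nil_conjugate:
  assumes mod: "lie_module \<rho>" and N: "\<forall>v. (\<rho> x ^^ N) v = 0" and N': "\<forall>y. (bracket x ^^ N') y = 0"
  shows "exp_nil (\<rho> x) (\<rho> y v) = \<rho> (exp_nil (bracket x) y) (exp_nil (\<rho> x) v)"
proof -
  note lin = lie_module_clinear(1)[OF mod, of x] lie_module_clinear(1)[OF adjoint_lie_module, of x]
  note act = lie_module_simps(1-10)[OF mod]
  define K where "K = max N N'"
  have K: "\<forall>v. (\<rho> x ^^ k) v = 0" "\<forall>y. (bracket x ^^ k) y = 0" if "k \<ge> K" for k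
    using that by (auto simp: K_def intro: funpow_eq_0_mono[OF lin(1) N[rule_format]]
        funpow_eq_0_mono[OF lin(2) N'[rule_format]])
  define g where "g k l = \<rho> (divided_power (bracket x) k y) (divided_power (\<rho> x) l v)" for k l
  have "exp_nil (\<rho> x) (\<rho> y v) = (\<Sum>n<2 * K. \<Sum>k\<le>n. g k (n - k))"
    unfolding g_def divided_power_Leibniz[OF mod, symmetric]
    by (rule exp_nil_eq[OF lin(1) N]) (use K(1)[of "2 * K"] in auto)
  also have "\<dots> = (\<Sum>k<K. \<Sum>l<K. g k l)"
    by (rule sum_square_eq_triangle[symmetric]) (use K in \<open>auto simp: g_def divided_power_def act\<close>)
  also have "\<dots> = \<rho> (\<Sum>k<K. divided_power (bracket x) k y) (\<Sum>l<K. divided_power (\<rho> x) l v)"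
    unfolding g_def clinear_sum[OF lie_module_clinear(1)[OF mod]] clinear_sum[OF lie_module_clinear(2)[OF mod]]
    by (rule sum.swap)
  also have "\<dots> = \<rho> (exp_nil (bracket x) y) (exp_nil (\<rho> x) v)"
    using exp_nil_eq[OF lin(1) N, of K v] exp_nil_eq[OF lin(2) N', of K y] K by simp
  finally show ?thesis .
qed

lemma exp_nil_inverse:
  assumes T: "clinear T" and N: "\<forall>v. (T ^^ N) v = 0"
  shows "exp_nil T (exp_nil (\<lambda>v. - T v) v) = v"
proof -
  let ?S = "\<lambda>v. - T v"
  have S: "clinear ?S" by (rule clinearI) (simp_all add: clinearD[OF T])
  have Sk: "(?S ^^ k) v = (-1) ^ k *\<^sub>C (T ^^ k) v" for k v
    by (induction k) (simp_all add: clinearD[OF T])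
  have NS: "\<forall>v. (?S ^^ N) v = 0" using N Sk by simp
  have dS: "divided_power ?S k v = (-1) ^ k *\<^sub>C divided_power T k v" for k
    unfolding divided_power_def Sk by (simp add: mult.commute)
  define g where "g k l = divided_power T k (divided_power ?S l v)" for k l
  have g: "g k l = ((-1) ^ l / (fact k * fact l)) *\<^sub>C (T ^^ (k + l)) v" for k l
    unfolding g_def dS divided_power_linear[OF T]
    unfolding divided_power_def clinearD(2)[OF clinear_funpow[OF T]]
    by (simp add: funpow_add)
  have Nk: "(T ^^ k) v = 0" if "k \<ge> N" for k v using funpow_eq_0_mono[OF T N[rule_format] that] .
  have "exp_nil T (exp_nil ?S v) = (\<Sum>k<N. \<Sum>l<N. g k l)"
  proof -
    have "exp_nil ?S v = (\<Sum>l<N. divided_power ?S l v)" by (rule exp_nil_eq[OF S NS]) (use NS in auto)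
    moreover have "exp_nil T u = (\<Sum>k<N. divided_power T k u)" for u
      by (rule exp_nil_eq[OF T N]) (use N in auto)
    moreover have lin: "clinear (divided_power T k)" for k
      by (rule clinearI) (simp_all add: divided_power_linear[OF T])
    ultimately show ?thesis unfolding g_def by (simp add: clinear_sum[OF lin])
  qed
  also have "\<dots> = (\<Sum>n<2 * N. \<Sum>k\<le>n. g k (n - k))"
    by (rule sum_square_eq_triangle) (use Nk in \<open>auto simp: g\<close>)
  also have "\<dots> = (\<Sum>n<2 * N. if n = 0 then v else 0)"
  proof (rule sum.cong)
    fix n
    have "(\<Sum>k\<le>n. g k (n - k)) = (\<Sum>k\<le>n. ((-1) ^ (n - k) / (fact k * fact (n - k)))) *\<^sub>C (T ^^ n) v"
      unfolding g cvec.scale_sum_left by (rule sum.cong) auto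
    also have "(\<Sum>k\<le>n. ((-1) ^ (n - k) / (fact k * fact (n - k))) :: complex)
        = (\<Sum>k\<le>n. of_nat (n choose k) * 1 ^ k * (-1) ^ (n - k)) / fact n"
      unfolding sum_divide_distrib by (rule sum.cong) (simp_all add: binomial_fact)
    also have "\<dots> = (if n = 0 then 1 else 0)"
      unfolding binomial_ring[symmetric] by (simp add: zero_power)
    finally show "(\<Sum>k\<le>n. g k (n - k)) = (if n = 0 then v else 0)" by simp
  qed simp
  also have "\<dots> = v"
  proof (cases "N = 0")
    case True
    then show ?thesis using N[rule_format, of v] by simp
  qed simp
  finally show ?thesis .
qed

section \<open>Weyl group operators of an \<open>sl\<^sub>2\<close>-triple\<close>

text \<open>The operator \<open>exp e exp(-f) exp e\<close>, which lifts the reflection of the triple to every module.\<close>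

definition weyl_op :: "('g::lie_algebra \<Rightarrow> 'v \<Rightarrow> 'v) \<Rightarrow> 'g \<Rightarrow> 'g \<Rightarrow> 'v \<Rightarrow> 'v::complex_vector" where
  "weyl_op \<rho> e f v = exp_nil (\<rho> e) (exp_nil (\<rho> (- f)) (exp_nil (\<rho> e) v))"

lemma exp_nil_fixed:
  assumes "clinear T" "\<forall>v. (T ^^ N) v = 0" "T v = 0"
  shows "exp_nil T v = v"
proof -
  have "exp_nil T v = (\<Sum>k<1. divided_power T k v)" by (rule exp_nil_eq[OF assms(1,2)]) (simp add: assms)
  then show ?thesis by (simp add: divided_power_def)
qed

lemma exp_nil_two_terms:
  assumes "clinear T" "\<forall>v. (T ^^ N) v = 0" "T (T v) = 0"
  shows "exp_nil T v = v + T v"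
proof -
  have "exp_nil T v = (\<Sum>k<2. divided_power T k v)"
    by (rule exp_nil_eq[OF assms(1,2)]) (simp add: assms numeral_2_eq_2)
  then show ?thesis by (simp add: divided_power_def numeral_2_eq_2)
qed

lemma exp_nil_three_terms:
  assumes "clinear T" "\<forall>v. (T ^^ N) v = 0" "T (T (T v)) = 0"
  shows "exp_nil T v = v + T v + (1/2) *\<^sub>C T (T v)"
proof -
  have "exp_nil T v = (\<Sum>k<3. divided_power T k v)"
    by (rule exp_nil_eq[OF assms(1,2)]) (simp add: assms numeral_3_eq_3)
  then show ?thesis by (simp add: divided_power_def numeral_3_eq_3 fact_numeral)
qed

locale sl2_module = weight_module h \<rho> + ad: weight_module h bracket
  for h :: "'g::lie_algebra set" and \<rho> :: "'g \<Rightarrow> 'v::complex_vector \<Rightarrow> 'v" +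
  fixes \<alpha> :: "'g \<Rightarrow> complex" and e f :: 'g
  assumes abelian: "s \<in> h \<Longrightarrow> t \<in> h \<Longrightarrow> bracket s t = 0"
    and \<alpha>: "\<alpha> \<in> dual_of h"
    and e: "e \<in> root_space h \<alpha>" and f: "f \<in> root_space h (\<lambda>t. - \<alpha> t)"
    and H: "bracket e f \<in> h" and \<alpha>H: "\<alpha> (bracket e f) = 2"
begin

lemma \<alpha>_nonzero: "\<alpha> \<noteq> (\<lambda>_. 0)" "(\<lambda>t. - \<alpha> t) \<noteq> (\<lambda>_. 0)" "(\<lambda>t. - \<alpha> t) \<in> dual_of h"
proof -
  show "\<alpha> \<noteq> (\<lambda>_. 0)" using \<alpha>H by auto
  show "(\<lambda>t. - \<alpha> t) \<noteq> (\<lambda>_. 0)"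
  proof
    assume "(\<lambda>t. - \<alpha> t) = (\<lambda>_. 0)"
    from fun_cong[OF this, of "bracket e f"] show False using \<alpha>H by simp
  qed
  show "(\<lambda>t. - \<alpha> t) \<in> dual_of h" by (rule dual_of_uminus[OF \<alpha>])
qed

lemma f_uminus: "- f \<in> root_space h (\<lambda>t. - \<alpha> t)"
  using f unfolding root_space_def by (auto simp: bracket_simps)

lemma brackets:
  "t \<in> h \<Longrightarrow> bracket t e = \<alpha> t *\<^sub>C e" "t \<in> h \<Longrightarrow> bracket t f = - \<alpha> t *\<^sub>C f"
  "t \<in> h \<Longrightarrow> bracket e t = - (\<alpha> t *\<^sub>C e)" "t \<in> h \<Longrightarrow> bracket f t = \<alpha> t *\<^sub>C f"
  "bracket f e = - bracket e f"
proof -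
  show 1: "t \<in> h \<Longrightarrow> bracket t e = \<alpha> t *\<^sub>C e" "t \<in> h \<Longrightarrow> bracket t f = - \<alpha> t *\<^sub>C f" for t
    using e f unfolding root_space_def by auto
  show "t \<in> h \<Longrightarrow> bracket e t = - (\<alpha> t *\<^sub>C e)" "t \<in> h \<Longrightarrow> bracket f t = \<alpha> t *\<^sub>C f" for t
    using 1 bracket_antisym[of e t] bracket_antisym[of f t] by simp_all
  show "bracket f e = - bracket e f" by (rule bracket_antisym)
qed

lemma nilpotent:
  obtains N where "\<forall>v. (\<rho> e ^^ N) v = 0" "\<forall>v. (\<rho> (- f) ^^ N) v = 0"
    "\<forall>v. (bracket e ^^ N) v = 0" "\<forall>v. (bracket (- f) ^^ N) v = 0"
proof -
  obtain a where a: "\<forall>n\<ge>a. \<forall>v. (\<rho> e ^^ n) v = 0"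
    using root_vector_nilpotent[OF e \<alpha> \<alpha>_nonzero(1)] by auto
  obtain b where b: "\<forall>n\<ge>b. \<forall>v. (\<rho> (- f) ^^ n) v = 0"
    using root_vector_nilpotent[OF f_uminus \<alpha>_nonzero(3,2)] by auto
  obtain c where c: "\<forall>n\<ge>c. \<forall>v. (bracket e ^^ n) v = 0"
    using ad.root_vector_nilpotent[OF e \<alpha> \<alpha>_nonzero(1)] by auto
  obtain d where d: "\<forall>n\<ge>d. \<forall>v. (bracket (- f) ^^ n) v = 0"
    using ad.root_vector_nilpotent[OF f_uminus \<alpha>_nonzero(3,2)] by auto
  show ?thesis using a b c d by (intro that[of "a + b + c + d"]) auto
qed

lemmas lin = lie_module_clinear(1)[OF mod]
lemmas ad_lin = lie_module_clinear(1)[OF adjoint_lie_module]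

lemma weyl_clinear: "clinear (weyl_op \<rho> e f)"
proof -
  have "weyl_op \<rho> e f = (\<lambda>v. exp_nil (\<rho> e) (exp_nil (\<rho> (- f)) (exp_nil (\<rho> e) v)))"
    by (rule ext) (rule weyl_op_def)
  then show ?thesis
    by (simp only: clinear_comp[OF exp_nil_linear[OF lin] clinear_comp[OF exp_nil_linear[OF lin] exp_nil_linear[OF lin]]])
qed

lemma weyl_act: "weyl_op \<rho> e f (\<rho> x v) = \<rho> (weyl_op bracket e f x) (weyl_op \<rho> e f v)"
proof -
  obtain N where N: "\<forall>v. (\<rho> e ^^ N) v = 0" "\<forall>v. (\<rho> (- f) ^^ N) v = 0"
    "\<forall>v. (bracket e ^^ N) v = 0" "\<forall>v. (bracket (- f) ^^ N) v = 0" by (rule nilpotent)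
  show ?thesis unfolding weyl_op_def
    by (simp only: exp_nil_conjugate[OF mod N(1,3)] exp_nil_conjugate[OF mod N(2,4)])
qed

lemma weyl_eq_0: "weyl_op \<rho> e f v = 0 \<Longrightarrow> v = 0"
proof -
  obtain N where N: "\<forall>v. (\<rho> e ^^ N) v = 0" "\<forall>v. (\<rho> (- f) ^^ N) v = 0" by (rule nilpotent)
  assume "weyl_op \<rho> e f v = 0"
  from exp_nil_eq_0[OF lin N(1) exp_nil_eq_0[OF lin N(2) exp_nil_eq_0[OF lin N(1) this[unfolded weyl_op_def]]]]
  show "v = 0" .
qed

lemma exp_values:
  shows "exp_nil (bracket e) e = e" "exp_nil (bracket e) f = f + bracket e f - e"
    "t \<in> h \<Longrightarrow> exp_nil (bracket e) t = t - \<alpha> t *\<^sub>C e"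
    "exp_nil (bracket (- f)) f = f" "exp_nil (bracket (- f)) e = e + bracket e f - f"
    "t \<in> h \<Longrightarrow> exp_nil (bracket (- f)) t = t - \<alpha> t *\<^sub>C f"
proof -
  obtain N where N: "\<forall>v. (bracket e ^^ N) v = 0" "\<forall>v. (bracket (- f) ^^ N) v = 0" by (rule nilpotent)
  show "exp_nil (bracket e) e = e" by (rule exp_nil_fixed[OF ad_lin N(1)]) (rule bracket_self)
  show "exp_nil (bracket (- f)) f = f"
    by (rule exp_nil_fixed[OF ad_lin N(2)]) (simp add: bracket_self bracket_simps)
  show "exp_nil (bracket e) f = f + bracket e f - e"
    by (subst exp_nil_three_terms[OF ad_lin N(1)])
      (simp_all add: brackets(3)[OF H] \<alpha>H bracket_simps bracket_self)
  show "exp_nil (bracket (- f)) e = e + bracket e f - f"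
    by (subst exp_nil_three_terms[OF ad_lin N(2)])
      (simp_all add: brackets(4)[OF H] brackets(5) \<alpha>H bracket_simps bracket_self)
  show "exp_nil (bracket e) t = t - \<alpha> t *\<^sub>C e" if "t \<in> h"
    by (subst exp_nil_two_terms[OF ad_lin N(1)])
      (simp_all add: brackets(3)[OF that] bracket_simps bracket_self)
  show "exp_nil (bracket (- f)) t = t - \<alpha> t *\<^sub>C f" if "t \<in> h"
    by (subst exp_nil_two_terms[OF ad_lin N(2)])
      (simp_all add: brackets(4)[OF that] bracket_simps bracket_self)
qed

lemma weyl_values:
  shows weyl_f: "weyl_op bracket e f f = - e"
    and weyl_h: "t \<in> h \<Longrightarrow> weyl_op bracket e f t = t - \<alpha> t *\<^sub>C bracket e f"
proof -
  note l1 = clinearD[OF exp_nil_linear[OF ad_lin[of e]]]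
  note l2 = clinearD[OF exp_nil_linear[OF ad_lin[of "- f"]]]
  show "weyl_op bracket e f f = - e"
    unfolding weyl_op_def exp_values(2) l2 exp_values(4-5) exp_values(6)[OF H] \<alpha>H
    by (simp add: l1 exp_values(1) cvec.scale_left_distrib[of 1 1, simplified])
  show "weyl_op bracket e f t = t - \<alpha> t *\<^sub>C bracket e f" if t: "t \<in> h"
    unfolding weyl_op_def exp_values(3)[OF t] l2 exp_values(5) exp_values(6)[OF t]
    unfolding l1 cvec.scale_right_distrib cvec.scale_right_diff_distrib
    by (rule functional_separates)
      (simp add: l1 exp_values(1) exp_values(2) exp_values(3)[OF t] exp_values(3)[OF H] \<alpha>H;
        simp add: algebra_simps)
qed

lemma weyl_h_involutive:
  assumes t: "t \<in> h"
  shows "weyl_op bracket e f t \<in> h" "weyl_op bracket e f (weyl_op bracket e f t) = t"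
proof -
  show 1: "weyl_op bracket e f t \<in> h"
    unfolding weyl_h[OF t] by (intro cvec.subspace_diff[OF h_subspace] t cvec.subspace_scale[OF h_subspace] H)
  have "\<alpha> (- (\<alpha> t *\<^sub>C bracket e f)) = - (\<alpha> t * 2)"
    using dual_ofD(2)[OF \<alpha> H, of "- \<alpha> t"] \<alpha>H by simp
  moreover have "\<alpha> (t + - (\<alpha> t *\<^sub>C bracket e f)) = \<alpha> t + \<alpha> (- (\<alpha> t *\<^sub>C bracket e f))"
    by (rule dual_ofD(1)[OF \<alpha> t]) (intro cvec.subspace_neg cvec.subspace_scale h_subspace H)
  ultimately have "\<alpha> (t - \<alpha> t *\<^sub>C bracket e f) = - \<alpha> t" by simp
  then show "weyl_op bracket e f (weyl_op bracket e f t) = t"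
    using weyl_h[OF 1] unfolding weyl_h[OF t] by simp
qed

text \<open>Conjugation by the Weyl operator acts on \<open>h\<close> as the reflection, an involution; so an element
  of \<open>h\<close> may be replaced by its reflection and moved past the operator.\<close>

lemma weyl_weight_space:
  assumes mu: "\<mu> \<in> dual_of h" and v: "v \<in> weight_space \<rho> h \<mu>"
  shows "weyl_op \<rho> e f v \<in> weight_space \<rho> h (\<lambda>t. \<mu> t - \<mu> (bracket e f) * \<alpha> t)"
  unfolding weight_space_def
proof safe
  fix t assume t: "t \<in> h"
  let ?s = "weyl_op bracket e f t"
  have "\<mu> (t + - \<alpha> t *\<^sub>C bracket e f) = \<mu> t + \<mu> (- \<alpha> t *\<^sub>C bracket e f)"
    by (rule dual_ofD(1)[OF mu t]) (intro cvec.subspace_scale h_subspace H)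
  then have s: "\<mu> ?s = \<mu> t - \<mu> (bracket e f) * \<alpha> t"
    using dual_ofD(2)[OF mu H, of "- \<alpha> t"] unfolding weyl_h[OF t] by (simp add: mult.commute)
  have "\<rho> t (weyl_op \<rho> e f v) = weyl_op \<rho> e f (\<rho> ?s v)"
    unfolding weyl_act weyl_h_involutive(2)[OF t] ..
  also have "\<rho> ?s v = \<mu> ?s *\<^sub>C v" by (rule weight_spaceD[OF v weyl_h_involutive(1)[OF t]])
  finally show "\<rho> t (weyl_op \<rho> e f v) = (\<mu> t - \<mu> (bracket e f) * \<alpha> t) *\<^sub>C weyl_op \<rho> e f v"
    unfolding s clinearD(2)[OF weyl_clinear] .
qed

text \<open>The Weyl operator acts on the zero weight line of the simple \<open>sl\<^sub>2\<close>-module with highest weight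
  \<open>2m\<close> by \<open>(-1)\<^sup>m\<close>. On the highest weight vector \<open>w\<close> it yields the lowest one, because
  \<open>exp(-f) w = exp(-e) f\<^bsup>(2m)\<^esup> w\<close>; conjugation turns \<open>f\<close> into \<open>-e\<close>.\<close>

lemma weyl_middle:
  assumes w: "w \<in> weight_space \<rho> h \<mu>" "\<rho> e w = 0" and m: "\<mu> (bracket e f) = 2 * of_nat m"
  shows "weyl_op \<rho> e f ((\<rho> f ^^ m) w) = (-1) ^ m *\<^sub>C (\<rho> f ^^ m) w"
proof -
  obtain N where N: "\<forall>v. (\<rho> e ^^ N) v = 0" "\<forall>v. (\<rho> (- f) ^^ N) v = 0" by (rule nilpotent)
  define D where "D k = divided_power (\<rho> f) k w" for k
  have eD: "\<rho> e (D (Suc k)) = (2 * of_nat m - of_nat k) *\<^sub>C D k" for k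
  proof -
    have "1 / fact (Suc k) * (of_nat (Suc k) * x) = x * (1 / fact k)" for x :: complex
      by (simp add: field_simps del: of_nat_Suc)
    then show ?thesis
      unfolding D_def divided_power_def act raise_lowered[OF e f H w] m \<alpha>H cvec.scale_scale by simp
  qed
  have f0: "(\<rho> f ^^ Suc (2 * m)) w = 0"
  proof (cases "w = 0")
    case True
    then show ?thesis using clinearD(3)[OF clinear_act_funpow, of "Suc (2 * m)" f] by simp
  next
    case False
    then obtain n where n: "2 * \<mu> (bracket e f) = of_nat n * \<alpha> (bracket e f)" "(\<rho> f ^^ Suc n) w = 0"
      using highest_vector_level[OF e f H \<alpha> \<alpha>_nonzero(1) w] by auto
    then have "of_nat (2 * m) = (of_nat n :: complex)" unfolding m \<alpha>H by simp
    then have "n = 2 * m" unfolding of_nat_eq_iff by simp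
    then show ?thesis using n(2) by simp
  qed
  have eD2: "divided_power (\<rho> e) j (D (2 * m)) = D (2 * m - j)" if "j \<le> 2 * m" for j
    using that
  proof (induction j)
    case 0
    then show ?case by (simp add: divided_power_def)
  next
    case (Suc j)
    have j: "2 * m - j = Suc (2 * m - Suc j)" using Suc.prems by simp
    have "of_nat (Suc j) *\<^sub>C divided_power (\<rho> e) (Suc j) (D (2 * m)) = \<rho> e (D (2 * m - j))"
      unfolding divided_power_Suc[OF lin, symmetric] using Suc by simp
    also have "\<dots> = of_nat (Suc j) *\<^sub>C D (2 * m - Suc j)"
      unfolding j eD using Suc.prems by (simp add: of_nat_diff)
    finally show ?case by (simp del: of_nat_Suc)
  qed
  have e_uminus: "(\<lambda>v. - \<rho> e v) = \<rho> (- e)" "(\<lambda>v. - \<rho> f v) = \<rho> (- f)"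
    by (rule ext, simp add: act)+
  have pow_uminus: "(\<rho> (- x) ^^ k) v = (-1) ^ k *\<^sub>C (\<rho> x ^^ k) v" for x k v
    by (induction k) (simp_all add: act)
  have dp_uminus: "divided_power (\<rho> (- x)) k v = (-1) ^ k *\<^sub>C divided_power (\<rho> x) k v" for x k v
    unfolding divided_power_def pow_uminus by (simp add: mult.commute)
  have Ne: "\<forall>v. (\<rho> (- e) ^^ N) v = 0" using N(1) unfolding pow_uminus by simp
  have "(\<rho> e ^^ Suc (2 * m)) (D (2 * m)) = 0"
  proof -
    have "divided_power (\<rho> e) (2 * m) (D (2 * m)) = w"
      using eD2[of "2 * m"] by (simp add: D_def divided_power_def)
    then have "of_nat (Suc (2 * m)) *\<^sub>C divided_power (\<rho> e) (Suc (2 * m)) (D (2 * m)) = 0"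
      unfolding divided_power_Suc[OF lin, symmetric] using w(2) by simp
    then show ?thesis unfolding divided_power_def by (simp del: of_nat_Suc funpow.simps)
  qed
  then have "exp_nil (\<rho> (- e)) (D (2 * m)) = (\<Sum>j<Suc (2 * m). divided_power (\<rho> (- e)) j (D (2 * m)))"
    by (intro exp_nil_eq[OF lin Ne]) (simp add: pow_uminus del: funpow.simps)
  also have "\<dots> = (\<Sum>j<Suc (2 * m). (-1) ^ (Suc (2 * m) - Suc j) *\<^sub>C D (Suc (2 * m) - Suc j))"
  proof (rule sum.cong)
    fix j assume "j \<in> {..<Suc (2 * m)}"
    then have j: "j \<le> 2 * m" by simp
    then have "(-1 :: complex) ^ (2 * m - j) = (-1) ^ j"
      by (simp add: minus_one_power_iff)
    then show "divided_power (\<rho> (- e)) j (D (2 * m)) = (-1) ^ (Suc (2 * m) - Suc j) *\<^sub>C D (Suc (2 * m) - Suc j)"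
      unfolding dp_uminus eD2[OF j] by simp
  qed simp
  also have "\<dots> = (\<Sum>k<Suc (2 * m). (-1) ^ k *\<^sub>C D k)"
    by (rule sum.nat_diff_reindex)
  also have "\<dots> = (\<Sum>k<Suc (2 * m). divided_power (\<rho> (- f)) k w)"
    unfolding dp_uminus D_def ..
  also have "\<dots> = exp_nil (\<rho> (- f)) w"
    by (rule exp_nil_eq[OF lin N(2), symmetric]) (simp add: pow_uminus f0 del: funpow.simps)
  finally have "exp_nil (\<rho> e) (exp_nil (\<rho> (- f)) w) = D (2 * m)"
    using exp_nil_inverse[OF lin N(1)] unfolding e_uminus by metis
  then have nw: "weyl_op \<rho> e f w = D (2 * m)"
    unfolding weyl_op_def exp_nil_fixed[where v = w, OF lin N(1) w(2)] .
  have "weyl_op \<rho> e f ((\<rho> f ^^ k) w) = (\<rho> (- e) ^^ k) (weyl_op \<rho> e f w)" for k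
    by (induction k) (simp_all add: weyl_act weyl_f)
  then have "weyl_op \<rho> e f ((\<rho> f ^^ m) w) = (-1) ^ m *\<^sub>C (\<rho> e ^^ m) (D (2 * m))"
    unfolding nw pow_uminus by simp
  also have "(\<rho> e ^^ m) (D (2 * m)) = fact m *\<^sub>C divided_power (\<rho> e) m (D (2 * m))"
    unfolding divided_power_def by simp
  also have "\<dots> = (\<rho> f ^^ m) w"
    using eD2[of m] by (simp add: D_def divided_power_def)
  finally show ?thesis .
qed

end

section \<open>Simple Lie algebras with a Cartan subalgebra\<close>

subsection \<open>The root decomposition and the Killing form\<close>

locale simple_cartan =
  fixes h :: "'g::lie_algebra set"
  assumes simple: "simple_lie_algebra TYPE('g)" and cartan: "cartan_subalgebra h"
begin

lemma h_props:
  shows h_sub: "cvec.subspace h" and h_abelian: "s \<in> h \<Longrightarrow> t \<in> h \<Longrightarrow> bracket s t = 0"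
    and h_centralizer: "(\<And>t. t \<in> h \<Longrightarrow> bracket t x = 0) \<Longrightarrow> x \<in> h"
    and h_diag: "t \<in> h \<Longrightarrow> cvec.span {x. \<exists>c. bracket t x = c *\<^sub>C x} = UNIV"
  using cartan unfolding cartan_subalgebra_def by auto

lemma g_fd: "finite_dim TYPE('g)"
  using simple unfolding simple_lie_algebra_def by auto

lemma ideal_cases: "lie_ideal (I :: 'g set) \<Longrightarrow> I = {0} \<or> I = UNIV"
  using simple unfolding simple_lie_algebra_def by auto

lemma non_abelian: "\<exists>x y::'g. bracket x y \<noteq> 0"
  using simple unfolding simple_lie_algebra_def by auto

text \<open>The eigenvalues on a joint eigenvector depend linearly on the element of \<open>h\<close>, by uniqueness of
  the eigenvalue of a nonzero vector.\<close>

lemma joint_eigenvector_in_root_space: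
  assumes "\<forall>t\<in>C. \<exists>c. bracket t x = c *\<^sub>C x" "C \<subseteq> h" "h \<subseteq> cvec.span C"
  shows "\<exists>\<mu>\<in>dual_of h. x \<in> root_space h \<mu>"
proof (cases "x = 0")
  case True
  then show ?thesis
    by (intro bexI[of _ "\<lambda>_. 0"] dual_of_zero) (simp add: root_space_def bracket_simps)
next
  case False
  have "cvec.subspace {t. \<exists>c. bracket t x = c *\<^sub>C x}"
    unfolding cvec.subspace_def
  proof safe
    show "\<exists>c. bracket 0 x = c *\<^sub>C x" by (rule exI[of _ 0]) (simp add: bracket_simps)
    show "\<exists>c. bracket (s + t) x = c *\<^sub>C x" if "bracket s x = a *\<^sub>C x" "bracket t x = b *\<^sub>C x" for s t a b
      by (rule exI[of _ "a + b"]) (simp add: bracket_simps that cv_simps)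
    show "\<exists>c. bracket (k *\<^sub>C t) x = c *\<^sub>C x" if "bracket t x = b *\<^sub>C x" for k t b
      by (rule exI[of _ "k * b"]) (simp add: bracket_simps that)
  qed
  moreover have "C \<subseteq> {t. \<exists>c. bracket t x = c *\<^sub>C x}" using assms(1) by auto
  ultimately have "cvec.span C \<subseteq> {t. \<exists>c. bracket t x = c *\<^sub>C x}" by (intro cvec.span_minimal)
  then have "\<forall>t. \<exists>c. t \<in> h \<longrightarrow> bracket t x = c *\<^sub>C x" using assms(3) by auto
  then obtain \<nu> where \<nu>: "\<And>t. t \<in> h \<Longrightarrow> bracket t x = \<nu> t *\<^sub>C x" by metis
  define \<mu> where "\<mu> t = (if t \<in> h then \<nu> t else 0)" for t
  have un: "a = b" if "a *\<^sub>C x = b *\<^sub>C x" for a b using that False by simp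
  have "\<mu> \<in> dual_of h" unfolding dual_of_def
  proof safe
    fix s t assume "s \<in> h" "t \<in> h"
    moreover from this have "s + t \<in> h" using cvec.subspace_add[OF h_sub] by simp
    ultimately show "\<mu> (s + t) = \<mu> s + \<mu> t"
      using \<nu>[of s] \<nu>[of t] \<nu>[of "s + t"] un[of "\<nu> (s + t)" "\<nu> s + \<nu> t"]
      by (simp add: \<mu>_def bracket_simps cv_simps)
  next
    fix c t assume "t \<in> h"
    moreover from this have "c *\<^sub>C t \<in> h" using cvec.subspace_scale[OF h_sub] by simp
    ultimately show "\<mu> (c *\<^sub>C t) = c * \<mu> t"
      using \<nu>[of t] \<nu>[of "c *\<^sub>C t"] False by (auto simp: \<mu>_def bracket_simps)
  qed (simp add: \<mu>_def)
  moreover have "x \<in> root_space h \<mu>" using \<nu> unfolding root_space_def \<mu>_def by simp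
  ultimately show ?thesis by auto
qed

lemma root_spaces_span: "cvec.span (\<Union>\<mu>\<in>dual_of h. root_space h \<mu>) = UNIV"
proof -
  obtain C where C: "C \<subseteq> h" "cvec.independent C" "h \<subseteq> cvec.span C"
    using cvec.maximal_independent_subset[of h] by auto
  have "finite C" by (rule finite_dim_independent[OF g_fd C(2)])
  have "cvec.span {x. \<forall>t\<in>C. \<exists>c. bracket t x = c *\<^sub>C x} = UNIV"
  proof (rule commuting_diagonalizable_joint_eigenvectors[OF \<open>finite C\<close>])
    show "clinear (bracket t)" for t :: 'g by (rule lie_module_clinear(1)[OF adjoint_lie_module])
    show "bracket s (bracket t x) = bracket t (bracket s x)" if "s \<in> C" "t \<in> C" for s t x
      using lie_module_commute[OF adjoint_lie_module, of s t x]
        h_abelian[OF subsetD[OF C(1) that(1)] subsetD[OF C(1) that(2)]]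
      by (simp add: bracket_simps)
    show "cvec.span {x. \<exists>c. bracket t x = c *\<^sub>C x} = UNIV" if "t \<in> C" for t
      using h_diag[of t] that C(1) by auto
  qed
  moreover
  have "{x. \<forall>t\<in>C. \<exists>c. bracket t x = c *\<^sub>C x} \<subseteq> (\<Union>\<mu>\<in>dual_of h. root_space h \<mu>)"
    using joint_eigenvector_in_root_space[OF _ C(1,3)] by auto
  from cvec.span_mono[OF this] calculation show ?thesis by auto
qed

sublocale ad: weight_module h bracket
  by unfold_locales
    (use h_sub adjoint_lie_module g_fd root_spaces_span in \<open>simp_all add: root_space_adjoint\<close>)

lemma root_space_zero: "root_space h (\<lambda>_. 0) = h"
  unfolding root_space_def using h_abelian h_centralizer by auto

lemma root_bracket:
  assumes "x \<in> root_space h \<alpha>" "y \<in> root_space h \<beta>"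
  shows "bracket x y \<in> root_space h (\<lambda>t. \<beta> t + \<alpha> t)"
  using ad.root_vector_act[of x h \<alpha> y \<beta>] assms by (simp add: root_space_adjoint)

lemma opposite_bracket:
  assumes "x \<in> root_space h \<alpha>" "y \<in> root_space h (\<lambda>t. - \<alpha> t)"
  shows "bracket x y \<in> h"
  using root_bracket[OF assms] by (simp add: root_space_zero)

lemma rootsD: "\<alpha> \<in> roots h \<Longrightarrow> \<alpha> \<in> dual_of h" "\<alpha> \<in> roots h \<Longrightarrow> \<alpha> \<noteq> (\<lambda>_. 0)"
  "\<alpha> \<in> roots h \<Longrightarrow> root_space h \<alpha> \<noteq> {0}"
  unfolding roots_def by auto

lemma rootsI:
  assumes "\<alpha> \<in> dual_of h" "\<alpha> \<noteq> (\<lambda>_. 0)" "x \<in> root_space h \<alpha>" "x \<noteq> 0"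
  shows "\<alpha> \<in> roots h"
  using assms unfolding roots_def by auto

lemma root_vector_exists: "\<alpha> \<in> roots h \<Longrightarrow> \<exists>x\<in>root_space h \<alpha>. x \<noteq> 0"
  using rootsD(3) ad.weight_space_0[of \<alpha>] unfolding root_space_adjoint by blast

lemma subspace_eq_UNIV:
  assumes "cvec.subspace U" "h \<subseteq> U" "\<And>\<alpha>. \<alpha> \<in> roots h \<Longrightarrow> root_space h \<alpha> \<subseteq> U"
  shows "U = UNIV"
proof -
  have "root_space h \<mu> \<subseteq> U" if "\<mu> \<in> dual_of h" for \<mu>
  proof (cases "\<mu> = (\<lambda>_. 0)")
    case True
    then show ?thesis using assms(2) root_space_zero by simp
  next
    case False
    then have "\<mu> \<in> roots h" if "root_space h \<mu> \<noteq> {0}"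
      using that \<open>\<mu> \<in> dual_of h\<close> unfolding roots_def by simp
    then show ?thesis
      using assms(3)[of \<mu>] cvec.subspace_0[OF assms(1)] by (cases "root_space h \<mu> = {0}") auto
  qed
  then have "cvec.span (\<Union>\<mu>\<in>dual_of h. root_space h \<mu>) \<subseteq> U"
    by (intro cvec.span_minimal assms(1)) auto
  then show ?thesis unfolding root_spaces_span by auto
qed

lemma ad_subspace: "cvec.subspace {x. bracket y x \<in> U}" if "cvec.subspace U" for U :: "'g set"
  using that unfolding cvec.subspace_def by (auto simp: bracket_simps)

lemma bracket_eq_0_all:
  assumes "\<And>y. y \<in> h \<Longrightarrow> bracket x y = 0" "\<And>\<alpha> y. \<alpha> \<in> roots h \<Longrightarrow> y \<in> root_space h \<alpha> \<Longrightarrow> bracket x y = 0"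
  shows "bracket x y = 0"
proof -
  have "{y. bracket x y \<in> {0}} = UNIV"
    by (rule subspace_eq_UNIV[OF ad_subspace[OF cvec.subspace_single_0]]) (use assms in auto)
  then show ?thesis by auto
qed

lemma center_trivial:
  assumes "\<And>y. bracket x y = (0::'g)"
  shows "x = 0"
proof -
  let ?Z = "{x::'g. \<forall>y. bracket x y = 0}"
  have "lie_ideal ?Z" unfolding lie_ideal_def cvec.subspace_def
  proof safe
    fix x y z :: 'g assume "\<forall>z. bracket y z = 0"
    then have "bracket x y = 0" using bracket_antisym[of x y] by simp
    then show "bracket (bracket x y) z = 0" by (simp add: bracket_simps)
  qed (simp_all add: bracket_simps)
  moreover have "?Z \<noteq> UNIV" using non_abelian by auto
  ultimately have "?Z = {0}" using ideal_cases[of ?Z] by simp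
  then show ?thesis using assms by blast
qed

lemma cartan_element_eq_0:
  assumes t: "t \<in> h" and "\<And>\<alpha>. \<alpha> \<in> roots h \<Longrightarrow> \<alpha> t = 0"
  shows "t = 0"
proof (rule center_trivial, rule bracket_eq_0_all)
  show "bracket t y = 0" if "y \<in> h" for y using h_abelian[OF t that] .
  show "bracket t y = 0" if "\<alpha> \<in> roots h" "y \<in> root_space h \<alpha>" for \<alpha> y
    using that assms(2)[of \<alpha>] t unfolding root_space_def by simp
qed

lemma root_string_integrality:
  assumes x: "x \<in> root_space h \<alpha>" and y: "y \<in> root_space h (\<lambda>t. - \<alpha> t)"
    and al: "\<alpha> \<in> roots h" and be: "\<beta> \<in> roots h"
  shows "\<exists>k::int. 2 * \<beta> (bracket x y) = of_int k * \<alpha> (bracket x y)"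
  by (rule ad.string_integrality[OF x y opposite_bracket[OF x y] rootsD(1,2)[OF al]])
    (use rootsD(3)[OF be] in \<open>simp add: root_space_adjoint\<close>)

text \<open>Some root does not vanish on the brackets of its root vectors with those of the opposite root.
  Otherwise these brackets are central, hence zero, the root spaces span a proper ideal, and the
  algebra is abelian.\<close>

lemma nondegenerate_triple_exists:
  "\<exists>\<alpha>\<in>roots h. \<exists>x\<in>root_space h \<alpha>. \<exists>y\<in>root_space h (\<lambda>t. - \<alpha> t). \<alpha> (bracket x y) \<noteq> 0"
proof (rule ccontr)
  assume neg: "\<not> ?thesis"
  have zero: "bracket x y = 0" if "\<alpha> \<in> roots h" "x \<in> root_space h \<alpha>" "y \<in> root_space h (\<lambda>t. - \<alpha> t)" for \<alpha> x y
  proof (rule cartan_element_eq_0[OF opposite_bracket[OF that(2,3)]])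
    fix \<beta> assume be: "\<beta> \<in> roots h"
    have "\<alpha> (bracket x y) = 0" using neg that by blast
    then show "\<beta> (bracket x y) = 0" using root_string_integrality[OF that(2,3,1) be] by auto
  qed
  define D where "D = cvec.span (\<Union>\<alpha>\<in>roots h. root_space h \<alpha>)"
  have sD: "cvec.subspace D" unfolding D_def by (rule cvec.subspace_span)
  have rD: "root_space h \<alpha> \<subseteq> D" if "\<alpha> \<in> roots h" for \<alpha>
    unfolding D_def using that by (auto intro: cvec.span_base)
  have "bracket x y \<in> D" if y: "y \<in> root_space h \<beta>" "\<beta> \<in> roots h" for x y \<beta>
  proof -
    have "{x. bracket x y \<in> D} = UNIV"
    proof (rule subspace_eq_UNIV)
      show "cvec.subspace {x. bracket x y \<in> D}"
        using sD unfolding cvec.subspace_def by (auto simp: bracket_simps)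
      show "h \<subseteq> {x. bracket x y \<in> D}"
      proof safe
        fix t assume "t \<in> h"
        then have "bracket t y = \<beta> t *\<^sub>C y" using y unfolding root_space_def by auto
        then show "bracket t y \<in> D" using rD[OF y(2)] y(1) sD by (auto intro: cvec.subspace_scale)
      qed
      fix \<alpha> assume al: "\<alpha> \<in> roots h"
      show "root_space h \<alpha> \<subseteq> {x. bracket x y \<in> D}"
      proof safe
        fix x assume x: "x \<in> root_space h \<alpha>"
        let ?s = "\<lambda>t. \<beta> t + \<alpha> t"
        have s: "?s \<in> dual_of h" using al y(2) rootsD(1) dual_of_add by blast
        show "bracket x y \<in> D"
        proof (cases "?s = (\<lambda>_. 0)")
          case True
          then have "\<beta> = (\<lambda>t. - \<alpha> t)" by (auto simp: fun_eq_iff eq_neg_iff_add_eq_0)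
          then show ?thesis using zero[OF al x] y(1) cvec.subspace_0[OF sD] by simp
        next
          case False
          then show ?thesis
            using rootsI[OF s False root_bracket[OF x y(1)]] root_bracket[OF x y(1)] rD[of ?s]
              cvec.subspace_0[OF sD] by (cases "bracket x y = 0") auto
        qed
      qed
    qed
    then show ?thesis by auto
  qed
  then have "(\<Union>\<alpha>\<in>roots h. root_space h \<alpha>) \<subseteq> {y. bracket x y \<in> D}" for x by auto
  then have "D \<subseteq> {y. bracket x y \<in> D}" for x
    unfolding D_def[symmetric] by (subst (1) D_def) (rule cvec.span_minimal[OF _ ad_subspace[OF sD]])
  then have "lie_ideal D" unfolding lie_ideal_def using sD by auto
  then consider "D = {0}" | "D = UNIV" using ideal_cases by auto
  then show False
  proof cases
    case 1
    have "root_space h \<alpha> \<subseteq> h" if "\<alpha> \<in> roots h" for \<alpha>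
      using rD[OF that] 1 cvec.subspace_0[OF h_sub] by auto
    then have "h = UNIV" using subspace_eq_UNIV[OF h_sub] by auto
    then show False using h_abelian non_abelian by auto
  next
    case 2
    have "t = 0" if t: "t \<in> h" for t
    proof -
      have "t \<in> cvec.span ((\<Union>\<alpha>\<in>roots h. root_space h \<alpha>) \<inter> weight_space bracket h (\<lambda>_. 0))"
      proof (rule ad.weight_space_spanned)
        show "(\<Union>\<alpha>\<in>roots h. root_space h \<alpha>) \<subseteq> (\<Union>\<nu>\<in>dual_of h. weight_space bracket h \<nu>)"
          using rootsD(1) by (auto simp: root_space_adjoint)
        show "t \<in> cvec.span (\<Union>\<alpha>\<in>roots h. root_space h \<alpha>)" using 2 unfolding D_def by simp
        show "t \<in> weight_space bracket h (\<lambda>_. 0)" using t root_space_zero by (simp add: root_space_adjoint)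
      qed (rule dual_of_zero)
      moreover have "(\<Union>\<alpha>\<in>roots h. root_space h \<alpha>) \<inter> weight_space bracket h (\<lambda>_. 0) \<subseteq> {0}"
      proof
        fix x assume x: "x \<in> (\<Union>\<alpha>\<in>roots h. root_space h \<alpha>) \<inter> weight_space bracket h (\<lambda>_. 0)"
        then obtain \<alpha> where "\<alpha> \<in> roots h" "x \<in> weight_space bracket h \<alpha>" by (auto simp: root_space_adjoint)
        then show "x \<in> {0}"
          using ad.weight_unique[of x \<alpha> "\<lambda>_. 0"] x rootsD dual_of_zero by auto
      qed
      ultimately show ?thesis using cvec.span_minimal[OF _ cvec.subspace_single_0] by blast
    qed
    then have "h \<subseteq> {0}" by auto
    then have "\<alpha> = (\<lambda>_. 0)" if "\<alpha> \<in> dual_of h" for \<alpha>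
      by (intro dual_of_eqI[OF that dual_of_zero]) (use dual_ofD(2)[OF that, of 0 0] cvec.subspace_0[OF h_sub] in auto)
    then have "roots h = {}" using rootsD by auto
    then have "D = {0}" unfolding D_def by simp
    then show False using 2 non_abelian by (metis UNIV_I bracket_simps(3) singletonD)
  qed
qed

lemma killing_clinear: "clinear (\<lambda>z::'g. bracket x (bracket y z))"
  by (rule clinear_comp[OF lie_module_clinear(1)[OF adjoint_lie_module] lie_module_clinear(1)[OF adjoint_lie_module]])

lemma killing_linear:
  "killing_form (x + x') (y::'g) = killing_form x y + killing_form x' y"
  "killing_form (c *\<^sub>C x) (y::'g) = c * killing_form x y"
proof -
  show "killing_form (x + x') y = killing_form x y + killing_form x' y"
    unfolding killing_form_def bracket_simps(6)
    by (rule trace_end_linear(1)[OF g_fd killing_clinear killing_clinear])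
  show "killing_form (c *\<^sub>C x) y = c * killing_form x y"
    unfolding killing_form_def bracket_simps(7)
    by (rule trace_end_linear(2)[OF g_fd killing_clinear killing_clinear])
qed

lemma killing_sym: "killing_form x y = killing_form y (x::'g)"
  unfolding killing_form_def
  by (rule trace_end_commute[OF g_fd lie_module_clinear(1)[OF adjoint_lie_module]
        lie_module_clinear(1)[OF adjoint_lie_module]])

lemma killing_invariant: "killing_form (bracket x y) z = killing_form x (bracket y (z::'g))"
proof -
  note l = lie_module_clinear(1)[OF adjoint_lie_module]
  have d: "trace_end (\<lambda>w. F w - G w) = trace_end F - trace_end G" if "clinear F" "clinear G"
    for F G :: "'g \<Rightarrow> 'g"
  proof -
    have G: "clinear (\<lambda>w. (-1) *\<^sub>C G w)" using that(2) by (auto intro!: clinearI simp: clinearD[OF that(2)])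
    show ?thesis
      using trace_end_linear(1)[OF g_fd that(1) G] trace_end_linear(2)[OF g_fd that(2,2), of "-1"] by simp
  qed
  have c: "clinear (\<lambda>w. bracket x (bracket y (bracket z w)))" for x y z :: 'g
    by (rule clinear_comp[OF l killing_clinear])
  have "trace_end (\<lambda>w. bracket y (bracket x (bracket z w))) = trace_end (\<lambda>w. bracket x (bracket z (bracket y w)))"
    using trace_end_commute[OF g_fd l[of y] killing_clinear[of x z]] .
  then show ?thesis
    unfolding killing_form_def lie_module_simps(11)[OF adjoint_lie_module] bracket_simps(4)
    by (simp add: d[OF c c])
qed

text \<open>In a basis of root vectors and elements of \<open>h\<close> the operator \<open>ad t ad t\<close> is diagonal.\<close>

lemma killing_weight_basis:
  obtains C \<chi> where "finite C" "C \<subseteq> (\<Union>\<mu>\<in>dual_of h. root_space h \<mu>)" "cvec.span C = UNIV"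
    "\<And>b. b \<in> C \<Longrightarrow> b \<noteq> 0 \<and> \<chi> b \<in> dual_of h \<and> b \<in> root_space h (\<chi> b)"
    "\<And>t. t \<in> h \<Longrightarrow> killing_form t t = (\<Sum>b\<in>C. \<chi> b t * \<chi> b t)"
proof -
  obtain C where C: "C \<subseteq> (\<Union>\<mu>\<in>dual_of h. root_space h \<mu>)" "cvec.independent C"
    "(\<Union>\<mu>\<in>dual_of h. root_space h \<mu>) \<subseteq> cvec.span C"
    using cvec.maximal_independent_subset[of "\<Union>\<mu>\<in>dual_of h. root_space h \<mu>"] by auto
  have fin: "finite C" by (rule finite_dim_independent[OF g_fd C(2)])
  have sp: "cvec.span C = UNIV"
    using cvec.span_minimal[OF C(3) cvec.subspace_span] root_spaces_span by auto
  obtain \<chi> where \<chi>: "\<And>b. b \<in> C \<Longrightarrow> \<chi> b \<in> dual_of h \<and> b \<in> root_space h (\<chi> b)"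
    using C(1) by (metis (no_types, lifting) UN_iff subsetD)
  have nz: "b \<noteq> 0" if "b \<in> C" for b using that C(2) cvec.dependent_zero by blast
  show ?thesis
  proof (rule that[OF fin C(1) sp])
    show "b \<noteq> 0 \<and> \<chi> b \<in> dual_of h \<and> b \<in> root_space h (\<chi> b)" if "b \<in> C" for b using \<chi> nz that by auto
    fix t assume t: "t \<in> h"
    have "killing_form t t = (\<Sum>b\<in>C. cvec.representation C (bracket t (bracket t b)) b)"
      unfolding killing_form_def by (rule trace_end_basis[OF killing_clinear C(2) sp fin])
    also have "\<dots> = (\<Sum>b\<in>C. \<chi> b t * \<chi> b t)"
    proof (rule sum.cong)
      fix b assume b: "b \<in> C"
      have "bracket t b = \<chi> b t *\<^sub>C b" using \<chi>[OF b] t unfolding root_space_def by auto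
      then have "bracket t (bracket t b) = (\<chi> b t * \<chi> b t) *\<^sub>C b" by (simp add: bracket_simps)
      then show "cvec.representation C (bracket t (bracket t b)) b = \<chi> b t * \<chi> b t"
        using b by (simp add: representation_linear(2)[OF C(2) sp] cvec.representation_basis[OF C(2)])
    qed simp
    finally show "killing_form t t = (\<Sum>b\<in>C. \<chi> b t * \<chi> b t)" .
  qed
qed

text \<open>The radical is an ideal, so it is enough that the form does not vanish. Normalize the element
  \<open>[x, y]\<close> of \<open>nondegenerate_triple_exists\<close> to \<open>t\<close> with \<open>\<alpha> t = 2\<close>. All roots take integer values on \<open>t\<close>,
  and the Killing form of \<open>t\<close> with itself is a sum of squares of these integers, among them \<open>2\<close>.\<close>

lemma killing_nondegenerate:
  assumes "\<And>y. killing_form x y = 0"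
  shows "x = (0::'g)"
proof -
  let ?I = "{x::'g. \<forall>y. killing_form x y = 0}"
  have z: "killing_form 0 y = 0" for y :: 'g using killing_linear(2)[of 0 0 y] by simp
  have "lie_ideal ?I" unfolding lie_ideal_def cvec.subspace_def
  proof safe
    fix x y z :: 'g assume "\<forall>z. killing_form y z = 0"
    then have "killing_form (bracket y x) z = 0" unfolding killing_invariant by auto
    then show "killing_form (bracket x y) z = 0"
      using killing_linear(2)[of "-1" "bracket y x" z] bracket_antisym[of x y] by simp
  qed (use z in \<open>auto simp: killing_linear\<close>)
  moreover have "?I \<noteq> UNIV"
  proof
    assume "?I = UNIV"
    then have k0: "killing_form x y = 0" for x y :: 'g by auto
    obtain \<alpha> x y where al: "\<alpha> \<in> roots h" and x: "x \<in> root_space h \<alpha>"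
      and y: "y \<in> root_space h (\<lambda>t. - \<alpha> t)" and nz: "\<alpha> (bracket x y) \<noteq> 0"
      using nondegenerate_triple_exists by auto
    define t where "t = (2 / \<alpha> (bracket x y)) *\<^sub>C bracket x y"
    have xy: "bracket x y \<in> h" by (rule opposite_bracket[OF x y])
    have t: "t \<in> h" unfolding t_def by (rule cvec.subspace_scale[OF h_sub xy])
    have val: "\<exists>r::int. \<beta> t = of_int r" if b: "\<beta> \<in> dual_of h" "b \<noteq> 0" "b \<in> root_space h \<beta>" for \<beta> b
    proof (cases "\<beta> = (\<lambda>_. 0)")
      case True
      then show ?thesis by (intro exI[of _ 0]) simp
    next
      case False
      obtain k :: int where "2 * \<beta> (bracket x y) = of_int k * \<alpha> (bracket x y)"
        using root_string_integrality[OF x y al rootsI[OF b(1) False b(3,2)]] by auto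
      moreover have "\<beta> t = 2 * \<beta> (bracket x y) / \<alpha> (bracket x y)"
        unfolding t_def dual_ofD(2)[OF b(1) xy] by simp
      ultimately have "\<beta> t = of_int k" using nz by (simp add: field_simps)
      then show ?thesis by auto
    qed
    obtain C \<chi> where C: "finite C" "C \<subseteq> (\<Union>\<mu>\<in>dual_of h. root_space h \<mu>)" "cvec.span C = UNIV"
      "\<And>b. b \<in> C \<Longrightarrow> b \<noteq> 0 \<and> \<chi> b \<in> dual_of h \<and> b \<in> root_space h (\<chi> b)"
      "\<And>t. t \<in> h \<Longrightarrow> killing_form t t = (\<Sum>b\<in>C. \<chi> b t * \<chi> b t)"
      by (rule killing_weight_basis, rule that)
    have "\<forall>b\<in>C. \<exists>r::int. \<chi> b t = of_int r" using val C(4) by auto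
    then obtain r :: "'g \<Rightarrow> int" where r: "\<And>b. b \<in> C \<Longrightarrow> \<chi> b t = of_int (r b)" by metis
    have "of_int (\<Sum>b\<in>C. r b * r b) = killing_form t t"
      unfolding C(5)[OF t] of_int_sum by (rule sum.cong) (simp_all add: r)
    then have "(\<Sum>b\<in>C. r b * r b) = 0" using k0 by (simp only: of_int_eq_0_iff)
    then have r0: "r b = 0" if "b \<in> C" for b
      using that C(1) by (simp add: sum_nonneg_eq_0_iff)
    obtain x' where x': "x' \<in> root_space h \<alpha>" "x' \<noteq> 0" using root_vector_exists[OF al] by auto
    have "x' \<in> cvec.span (C \<inter> weight_space bracket h \<alpha>)"
      by (rule ad.weight_space_spanned)
        (use C(2,3) x'(1) rootsD(1)[OF al] in \<open>auto simp: root_space_adjoint\<close>)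
    then have "C \<inter> weight_space bracket h \<alpha> \<noteq> {}" using x'(2) by auto
    then obtain b where b: "b \<in> C" "b \<in> root_space h \<alpha>" by (auto simp: root_space_adjoint)
    then have "\<chi> b = \<alpha>"
      using ad.weight_unique[of b "\<chi> b" \<alpha>] C(4)[OF b(1)] rootsD(1)[OF al] by (simp add: root_space_adjoint)
    then have "\<alpha> t = 0" using r[OF b(1)] r0[OF b(1)] by simp
    moreover have "\<alpha> t = 2" unfolding t_def dual_ofD(2)[OF rootsD(1)[OF al] xy] using nz by simp
    ultimately show False by simp
  qed
  ultimately have "?I = {0}" using ideal_cases[of ?I] by simp
  then show ?thesis using assms by auto
qed

end

subsection \<open>Coroots\<close>

locale cartan_form = simple_cartan h for h :: "'g::lie_algebra set" +
  fixes B :: "'g \<Rightarrow> 'g \<Rightarrow> complex"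
  assumes killing_multiple: "killing_multiple B"
begin

lemma form_linear:
  "B (x + x') y = B x y + B x' y" "B (c *\<^sub>C x) y = c * B x y" "B (x - x') y = B x y - B x' y"
  and form_sym: "B x y = B y x" and form_invariant: "B (bracket x y) z = B x (bracket y z)"
  and form_nondegenerate: "(\<And>y. B x y = 0) \<Longrightarrow> x = 0"
proof -
  obtain k where k: "k \<noteq> 0" "B = (\<lambda>x y. k * killing_form x y)"
    using killing_multiple unfolding killing_multiple_def by auto
  show 1: "B (x + x') y = B x y + B x' y" "B (c *\<^sub>C x) y = c * B x y" for x x' y c
    unfolding k(2) by (simp_all add: killing_linear algebra_simps)
  show "B (x - x') y = B x y - B x' y"
    using 1(1)[of x "(-1) *\<^sub>C x'" y] 1(2)[of "-1" x' y] by simp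
  show "B x y = B y x" unfolding k(2) by (simp add: killing_sym[of x y])
  show "B (bracket x y) z = B x (bracket y z)" unfolding k(2) by (simp add: killing_invariant)
  show "x = 0" if "\<And>y. B x y = 0"
    by (rule killing_nondegenerate) (use that k in simp)
qed

lemma form_linear_right:
  "B y (x + x') = B y x + B y x'" "B y (c *\<^sub>C x) = c * B y x" "B y (x - x') = B y x - B y x'"
  using form_linear(1)[of x x' y] form_linear(2)[of c x y] form_linear(3)[of x x' y]
  unfolding form_sym[of _ y] by this+

lemma form_orthogonal:
  assumes "x \<in> root_space h \<alpha>" "y \<in> root_space h \<beta>" "t \<in> h" "\<alpha> t + \<beta> t \<noteq> 0"
  shows "B x y = 0"
proof -
  have "bracket t x = \<alpha> t *\<^sub>C x" "bracket t y = \<beta> t *\<^sub>C y" using assms unfolding root_space_def by auto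
  moreover have "B (bracket x t) y = B x (bracket t y)" by (rule form_invariant)
  moreover have "bracket x t = (-1) *\<^sub>C bracket t x" using bracket_antisym[of x t] by simp
  ultimately have "- (\<alpha> t * B x y) = \<beta> t * B x y"
    by (simp add: form_linear(2)[of "- \<alpha> t", simplified] form_linear_right(2))
  then have b: "\<beta> t * B x y = - (\<alpha> t * B x y)" by simp
  have "(\<alpha> t + \<beta> t) * B x y = 0" unfolding semiring_class.distrib_right b by (rule right_minus)
  then show ?thesis using assms(4) by simp
qed

text \<open>By invariance the form pairs a root space only with the opposite one.\<close>

lemma form_pairs_opposite:
  assumes mu: "\<mu> \<in> dual_of h" and x: "x \<in> root_space h \<mu>"
    and zero: "\<And>y. y \<in> root_space h (\<lambda>t. - \<mu> t) \<Longrightarrow> B x y = 0"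
  shows "x = 0"
proof (rule form_nondegenerate)
  fix y
  have "cvec.subspace {y. B x y = 0}"
    unfolding cvec.subspace_def using form_linear_right(2)[of x 0 0] by (auto simp: form_linear_right)
  moreover have "(\<Union>\<nu>\<in>dual_of h. root_space h \<nu>) \<subseteq> {y. B x y = 0}"
  proof safe
    fix \<nu> y assume nu: "\<nu> \<in> dual_of h" and y: "y \<in> root_space h \<nu>"
    show "B x y = 0"
    proof (cases "\<exists>t\<in>h. \<mu> t + \<nu> t \<noteq> 0")
      case True
      then show ?thesis using form_orthogonal[OF x y] by auto
    next
      case False
      have "\<nu> = (\<lambda>t. - \<mu> t)"
        by (rule dual_of_eqI[OF nu dual_of_uminus[OF mu]]) (use False in \<open>auto simp: eq_neg_iff_add_eq_0 add.commute\<close>)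
      then show ?thesis using zero y by simp
    qed
  qed
  ultimately have "cvec.span (\<Union>\<nu>\<in>dual_of h. root_space h \<nu>) \<subseteq> {y. B x y = 0}"
    by (rule cvec.span_minimal[rotated])
  then show "B x y = 0" unfolding root_spaces_span by auto
qed

lemma root_pairing:
  assumes al: "\<alpha> \<in> roots h" and x: "x \<in> root_space h \<alpha>" "x \<noteq> 0"
  shows "\<exists>y\<in>root_space h (\<lambda>t. - \<alpha> t). B x y = 1"
proof -
  obtain y where y: "y \<in> root_space h (\<lambda>t. - \<alpha> t)" "B x y \<noteq> 0"
    using form_pairs_opposite[OF rootsD(1)[OF al] x(1)] x(2) by auto
  have "(1 / B x y) *\<^sub>C y \<in> root_space h (\<lambda>t. - \<alpha> t)"
    using y(1) unfolding root_space_adjoint by (rule cvec.subspace_scale[OF ad.weight_space_subspace])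
  moreover have "B x ((1 / B x y) *\<^sub>C y) = 1" using y(2) by (simp add: form_linear_right)
  ultimately show ?thesis by auto
qed

lemma opposite_root:
  assumes al: "\<alpha> \<in> roots h"
  shows "(\<lambda>t. - \<alpha> t) \<in> roots h"
proof -
  obtain x where x: "x \<in> root_space h \<alpha>" "x \<noteq> 0" using root_vector_exists[OF al] by auto
  obtain y where y: "y \<in> root_space h (\<lambda>t. - \<alpha> t)" "B x y = 1" using root_pairing[OF al x] by auto
  have "(\<lambda>t. - \<alpha> t) \<noteq> (\<lambda>_. 0)" using rootsD(2)[OF al] by (auto simp: fun_eq_iff)
  moreover have "y \<noteq> 0" using y(2) form_linear_right(2)[of x 0 0] by auto
  ultimately show ?thesis using rootsI[OF dual_of_uminus[OF rootsD(1)[OF al]]] y(1) by blast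
qed

lemma form_cartan_nondegenerate:
  assumes t: "t \<in> h" and "\<And>s. s \<in> h \<Longrightarrow> B t s = 0"
  shows "t = 0"
  by (rule form_pairs_opposite[OF dual_of_zero]) (use assms in \<open>simp_all add: root_space_zero\<close>)

lemma form_dual_eqI:
  assumes t: "t \<in> h" "\<And>s. s \<in> h \<Longrightarrow> B t s = \<mu> s"
  shows "form_dual B h \<mu> = t"
  unfolding form_dual_def
proof (rule the_equality)
  fix t' assume t': "t' \<in> h \<and> (\<forall>s\<in>h. B t' s = \<mu> s)"
  have "t' - t = 0"
    by (rule form_cartan_nondegenerate) (use t t' in \<open>auto simp: form_linear intro: cvec.subspace_diff[OF h_sub]\<close>)
  then show "t' = t" by simp
qed (use t in auto)

lemma bracket_form:
  assumes x: "x \<in> root_space h \<alpha>" and y: "y \<in> root_space h (\<lambda>t. - \<alpha> t)" and s: "s \<in> h"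
  shows "B (bracket x y) s = B x y * \<alpha> s"
proof -
  have "bracket s y = - \<alpha> s *\<^sub>C y" using y s unfolding root_space_def by auto
  then have "bracket y s = \<alpha> s *\<^sub>C y" using bracket_antisym[of y s] by simp
  then show ?thesis unfolding form_invariant by (simp add: form_linear_right)
qed

text \<open>The dual vector is realized as a bracket: \<open>\<langle>[x, y], s\<rangle> = \<langle>x, y\<rangle> \<alpha> s\<close> for \<open>x\<close> and \<open>y\<close> in opposite root
  spaces.\<close>

lemma root_form_dual:
  assumes al: "\<alpha> \<in> roots h"
  shows "form_dual B h \<alpha> \<in> h" "s \<in> h \<Longrightarrow> B (form_dual B h \<alpha>) s = \<alpha> s"
proof -
  obtain x where x: "x \<in> root_space h \<alpha>" "x \<noteq> 0" using root_vector_exists[OF al] by auto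
  obtain y where y: "y \<in> root_space h (\<lambda>t. - \<alpha> t)" "B x y = 1" using root_pairing[OF al x] by auto
  have *: "B (bracket x y) s = \<alpha> s" if "s \<in> h" for s using bracket_form[OF x(1) y(1) that] y(2) by simp
  have "form_dual B h \<alpha> = bracket x y"
    by (rule form_dual_eqI[OF opposite_bracket[OF x(1) y(1)] *])
  then show "form_dual B h \<alpha> \<in> h" "s \<in> h \<Longrightarrow> B (form_dual B h \<alpha>) s = \<alpha> s"
    using opposite_bracket[OF x(1) y(1)] * by simp_all
qed

lemma bracket_opposite:
  assumes al: "\<alpha> \<in> roots h" and x: "x \<in> root_space h \<alpha>" and y: "y \<in> root_space h (\<lambda>t. - \<alpha> t)"
  shows "bracket x y = B x y *\<^sub>C form_dual B h \<alpha>"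
proof -
  have "bracket x y - B x y *\<^sub>C form_dual B h \<alpha> = 0"
  proof (rule form_cartan_nondegenerate)
    show "bracket x y - B x y *\<^sub>C form_dual B h \<alpha> \<in> h"
      by (intro cvec.subspace_diff cvec.subspace_scale h_sub opposite_bracket[OF x y] root_form_dual(1)[OF al])
  qed (simp add: form_linear bracket_form[OF x y] root_form_dual(2)[OF al])
  then show ?thesis by simp
qed

lemma dual_form_root:
  assumes "\<alpha> \<in> roots h" "\<beta> \<in> roots h"
  shows "dual_form B h \<alpha> \<beta> = \<alpha> (form_dual B h \<beta>)"
  unfolding dual_form_def using root_form_dual assms by auto

text \<open>If \<open>\<langle>\<alpha>, \<alpha>\<rangle> = 0\<close>, the integrality along \<open>\<alpha>\<close>-strings makes every root vanish on the dual vector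
  of \<open>\<alpha>\<close>, which is then zero.\<close>

lemma dual_form_nonzero:
  assumes al: "\<alpha> \<in> roots h"
  shows "dual_form B h \<alpha> \<alpha> \<noteq> 0"
proof
  assume 0: "dual_form B h \<alpha> \<alpha> = 0"
  obtain x where x: "x \<in> root_space h \<alpha>" "x \<noteq> 0" using root_vector_exists[OF al] by auto
  obtain y where y: "y \<in> root_space h (\<lambda>t. - \<alpha> t)" "B x y = 1" using root_pairing[OF al x] by auto
  have t: "bracket x y = form_dual B h \<alpha>" using bracket_opposite[OF al x(1) y(1)] y(2) by simp
  have "form_dual B h \<alpha> = 0"
  proof (rule cartan_element_eq_0[OF root_form_dual(1)[OF al]])
    fix \<beta> assume "\<beta> \<in> roots h"
    then show "\<beta> (form_dual B h \<alpha>) = 0"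
      using root_string_integrality[OF x(1) y(1) al] 0 unfolding t dual_form_root[OF al al] by auto
  qed
  then have "\<alpha> s = 0" if "s \<in> h" for s
    using root_form_dual(2)[OF al that] form_linear(2)[of 0 0 s] by simp
  then have "\<alpha> = (\<lambda>_. 0)" by (intro dual_of_eqI[OF rootsD(1)[OF al] dual_of_zero]) auto
  then show False using rootsD(2)[OF al] by simp
qed

lemma coroot_mem: "\<alpha> \<in> roots h \<Longrightarrow> coroot B h \<alpha> \<in> h"
  unfolding coroot_def by (intro cvec.subspace_scale[OF h_sub] root_form_dual(1))

lemma root_coroot:
  assumes "\<alpha> \<in> roots h" "\<beta> \<in> roots h"
  shows "\<beta> (coroot B h \<alpha>) = 2 * dual_form B h \<alpha> \<beta> / dual_form B h \<alpha> \<alpha>"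
proof -
  have "dual_form B h \<alpha> \<beta> = dual_form B h \<beta> \<alpha>" unfolding dual_form_def by (rule form_sym)
  then show ?thesis unfolding coroot_def dual_form_root[OF assms(2,1)]
    using dual_ofD(2)[OF rootsD(1)[OF assms(2)] root_form_dual(1)[OF assms(1)]] by simp
qed

lemma root_coroot_self: "\<alpha> \<in> roots h \<Longrightarrow> \<alpha> (coroot B h \<alpha>) = 2"
  using root_coroot[of \<alpha> \<alpha>] dual_form_nonzero[of \<alpha>] by simp

end

subsection \<open>Root vectors, multiples of roots and reflections\<close>

locale cartan_roots = cartan_form h B for h :: "'g::lie_algebra set" and B +
  fixes e f :: "('g \<Rightarrow> complex) \<Rightarrow> 'g"
  assumes root_vectors: "root_vectors B h e f"
begin

lemma root_vectorsD:
  assumes "\<alpha> \<in> roots h"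
  shows "e \<alpha> \<in> root_space h \<alpha>" "f \<alpha> \<in> root_space h (\<lambda>t. - \<alpha> t)"
    "bracket (e \<alpha>) (f \<alpha>) = coroot B h \<alpha>" "bracket (f \<alpha>) (e \<alpha>) = - coroot B h \<alpha>"
  using root_vectors assms bracket_antisym[of "f \<alpha>" "e \<alpha>"] unfolding root_vectors_def by auto

lemma sl2_module_of_root:
  assumes mod: "weight_module h \<rho>" and al: "\<alpha> \<in> roots h"
  shows "sl2_module h \<rho> \<alpha> (e \<alpha>) (f \<alpha>)"
proof -
  interpret weight_module h \<rho> by (rule mod)
  show ?thesis
    by unfold_locales
      (use h_abelian rootsD(1)[OF al] root_vectorsD[OF al] coroot_mem[OF al] root_coroot_self[OF al] in auto)
qed

lemma root_vectors_nonzero: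
  assumes al: "\<alpha> \<in> roots h"
  shows "e \<alpha> \<noteq> 0" "f \<alpha> \<noteq> 0"
proof -
  have "coroot B h \<alpha> \<noteq> 0"
    using root_coroot_self[OF al] dual_ofD(2)[OF rootsD(1)[OF al], of 0 0] cvec.subspace_0[OF h_sub] by auto
  then show "e \<alpha> \<noteq> 0" "f \<alpha> \<noteq> 0" using root_vectorsD(3)[OF al] by (auto simp: bracket_simps)
qed

text \<open>A vector of weight \<open>\<alpha>\<close> that is orthogonal to \<open>f \<alpha>\<close> is killed by \<open>f \<alpha>\<close>. A nonzero vector killed
  by \<open>f \<alpha>\<close> has weight \<open>\<le> 0\<close> for the triple, whereas \<open>\<alpha>\<close> takes the value \<open>2\<close>.\<close>

lemma root_space_line:
  assumes al: "\<alpha> \<in> roots h" and x: "x \<in> root_space h \<alpha>"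
  shows "\<exists>c. x = c *\<^sub>C e \<alpha>"
proof -
  note rv = root_vectorsD[OF al]
  have nz: "B (e \<alpha>) (f \<alpha>) \<noteq> 0"
  proof
    assume "B (e \<alpha>) (f \<alpha>) = 0"
    then have "coroot B h \<alpha> = 0" using bracket_opposite[OF al rv(1,2)] rv(3) by simp
    then show False
      using root_coroot_self[OF al] dual_ofD(2)[OF rootsD(1)[OF al], of 0 0] cvec.subspace_0[OF h_sub] by auto
  qed
  define y where "y = x - (B x (f \<alpha>) / B (e \<alpha>) (f \<alpha>)) *\<^sub>C e \<alpha>"
  have y: "y \<in> root_space h \<alpha>" unfolding y_def root_space_adjoint
    by (intro cvec.subspace_diff cvec.subspace_scale ad.weight_space_subspace)
      (use x rv(1) in \<open>simp_all add: root_space_adjoint\<close>)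
  have "B y (f \<alpha>) = 0" unfolding y_def using nz by (simp add: form_linear)
  then have "bracket y (f \<alpha>) = 0" using bracket_opposite[OF al y rv(2)] by simp
  then have fy: "bracket (f \<alpha>) y = 0" using bracket_antisym[of "f \<alpha>" y] by simp
  have "y = 0"
  proof (rule ccontr)
    assume "y \<noteq> 0"
    have "\<exists>n. 2 * \<alpha> (bracket (f \<alpha>) (e \<alpha>)) = of_nat n * - \<alpha> (bracket (f \<alpha>) (e \<alpha>))
        \<and> (\<forall>k\<le>n. (bracket (e \<alpha>) ^^ k) y \<noteq> 0) \<and> (bracket (e \<alpha>) ^^ Suc n) y = 0"
      by (rule ad.highest_vector_level[of "f \<alpha>" "\<lambda>t. - \<alpha> t" "e \<alpha>" y \<alpha>])
        (use rv y fy \<open>y \<noteq> 0\<close> rootsD(1,2)[OF opposite_root[OF al]] coroot_mem[OF al] cvec.subspace_neg[OF h_sub] in \<open>auto simp: root_space_adjoint\<close>)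
    then obtain n where n: "2 * \<alpha> (- coroot B h \<alpha>) = of_nat n * - \<alpha> (- coroot B h \<alpha>)"
      unfolding rv(4) by auto
    have "\<alpha> (- coroot B h \<alpha>) = - 2"
      using dual_ofD(2)[OF rootsD(1)[OF al] coroot_mem[OF al], of "-1"] root_coroot_self[OF al] by simp
    then have "of_nat n = (- 2 :: complex)" using n by simp
    then have "complex_of_nat (n + 2) = 0" by simp
    then show False unfolding of_nat_eq_0_iff by simp
  qed
  then show ?thesis unfolding y_def by (intro exI[of _ "B x (f \<alpha>) / B (e \<alpha>) (f \<alpha>)"]) simp
qed

lemma opposite_root_space_line:
  assumes al: "\<alpha> \<in> roots h" and x: "x \<in> root_space h (\<lambda>t. - \<alpha> t)"
  shows "\<exists>c. x = c *\<^sub>C f \<alpha>"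
proof -
  obtain a where a: "x = a *\<^sub>C e (\<lambda>t. - \<alpha> t)" using root_space_line[OF opposite_root[OF al] x] by auto
  obtain b where b: "f \<alpha> = b *\<^sub>C e (\<lambda>t. - \<alpha> t)"
    using root_space_line[OF opposite_root[OF al] root_vectorsD(2)[OF al]] by auto
  then have "b \<noteq> 0" using root_vectors_nonzero(2)[OF al] by auto
  then show ?thesis using a b by (intro exI[of _ "a / b"]) simp
qed

text \<open>The Weyl operator of \<open>\<alpha>\<close> in the adjoint representation carries root vectors for \<open>\<beta>\<close> to root
  vectors for the reflected root.\<close>

lemma reflected_root:
  assumes al: "\<alpha> \<in> roots h" and be: "\<beta> \<in> roots h"
  shows "(\<lambda>t. \<beta> t - \<beta> (coroot B h \<alpha>) * \<alpha> t) \<in> roots h" (is "?\<gamma> \<in> _")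
proof -
  interpret s: sl2_module h bracket \<alpha> "e \<alpha>" "f \<alpha>"
    by (rule sl2_module_of_root[OF _ al]) unfold_locales
  obtain x where x: "x \<in> root_space h \<beta>" "x \<noteq> 0" using root_vector_exists[OF be] by auto
  let ?y = "weyl_op bracket (e \<alpha>) (f \<alpha>) x"
  have y: "?y \<in> root_space h ?\<gamma>"
    using s.weyl_weight_space[OF rootsD(1)[OF be]] x(1) root_vectorsD(3)[OF al] by (simp add: root_space_adjoint)
  have g: "?\<gamma> \<in> dual_of h"
    using dual_of_add[OF rootsD(1)[OF be] dual_of_scale[OF rootsD(1)[OF al], of "- \<beta> (coroot B h \<alpha>)"]] by simp
  have "?\<gamma> \<noteq> (\<lambda>_. 0)"
  proof
    assume "?\<gamma> = (\<lambda>_. 0)"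
    then have b: "\<beta> t = \<beta> (coroot B h \<alpha>) * \<alpha> t" for t by (auto dest: fun_cong[of _ _ t])
    then have "\<beta> (coroot B h \<alpha>) = \<beta> (coroot B h \<alpha>) * 2"
      using root_coroot_self[OF al] by metis
    then have "\<beta> (coroot B h \<alpha>) = 0" by simp
    then have "\<beta> t = 0" for t using b[of t] by simp
    then show False using rootsD(2)[OF be] by (auto simp: fun_eq_iff)
  qed
  then show ?thesis using rootsI[OF g _ y] s.weyl_eq_0[of x] x(2) by auto
qed

text \<open>If \<open>k \<alpha>\<close> with \<open>k \<ge> 2\<close> were a root, lowering a highest weight vector of weight \<open>m \<alpha>\<close> with
  \<open>m \<ge> k\<close> to weight \<open>\<alpha>\<close> would give a multiple of \<open>e \<alpha>\<close>, which \<open>e \<alpha>\<close> kills; but raising such a vector never gives zero.\<close>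

lemma multiple_not_root:
  assumes al: "\<alpha> \<in> roots h" and k: "k \<ge> 2"
  shows "(\<lambda>t. of_nat k * \<alpha> t) \<notin> roots h"
proof
  assume r: "(\<lambda>t. of_nat k * \<alpha> t) \<in> roots h"
  note rv = root_vectorsD[OF al]
  obtain x where x: "x \<in> root_space h (\<lambda>t. of_nat k * \<alpha> t)" "x \<noteq> 0" using root_vector_exists[OF r] by auto
  obtain n where n: "(bracket (e \<alpha>) ^^ n) x \<noteq> 0" "bracket (e \<alpha>) ((bracket (e \<alpha>) ^^ n) x) = 0"
    using ad.root_vector_top[OF rv(1) rootsD(1,2)[OF al] x(2)] by auto
  define w where "w = (bracket (e \<alpha>) ^^ n) x"
  define m where "m = k + n"
  have "(\<lambda>t. of_nat k * \<alpha> t + of_nat n * \<alpha> t) = (\<lambda>t. of_nat m * \<alpha> t)" by (simp add: m_def algebra_simps)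
  then have w: "w \<in> weight_space bracket h (\<lambda>t. of_nat m * \<alpha> t)"
    using ad.root_vector_funpow[OF rv(1), of x "\<lambda>t. of_nat k * \<alpha> t" n] x(1)
    by (simp add: w_def root_space_adjoint)
  have w0: "bracket (e \<alpha>) w = 0" "w \<noteq> 0" using n by (auto simp: w_def)
  have H: "bracket (e \<alpha>) (f \<alpha>) \<in> h" using rv(3) coroot_mem[OF al] by simp
  have v: "\<alpha> (bracket (e \<alpha>) (f \<alpha>)) = 2" using rv(3) root_coroot_self[OF al] by simp
  obtain N where N: "2 * (of_nat m * \<alpha> (bracket (e \<alpha>) (f \<alpha>))) = of_nat N * \<alpha> (bracket (e \<alpha>) (f \<alpha>))"
    "\<forall>j\<le>N. (bracket (f \<alpha>) ^^ j) w \<noteq> 0"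
    using ad.highest_vector_level[OF rv(1,2) H rootsD(1,2)[OF al] w w0] by auto
  have "complex_of_nat N = of_nat (2 * m)" using N(1) unfolding v by simp
  then have N2: "N = 2 * m" unfolding of_nat_eq_iff .
  define j where "j = m - 2"
  have j: "Suc j = m - 1" using k unfolding j_def m_def by simp
  have "(bracket (f \<alpha>) ^^ Suc j) w \<in> weight_space bracket h (\<lambda>t. of_nat m * \<alpha> t + of_nat (Suc j) * - \<alpha> t)"
    by (rule ad.root_vector_funpow[OF rv(2) w])
  also have "(\<lambda>t. of_nat m * \<alpha> t + of_nat (Suc j) * - \<alpha> t) = \<alpha>"
    unfolding j using k by (auto simp: m_def of_nat_diff algebra_simps)
  finally obtain c where c: "(bracket (f \<alpha>) ^^ Suc j) w = c *\<^sub>C e \<alpha>"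
    using root_space_line[OF al] by (auto simp: root_space_adjoint)
  have "bracket (e \<alpha>) ((bracket (f \<alpha>) ^^ Suc j) w)
    = (of_nat (Suc j) * (of_nat m * 2 - of_nat j * 2 / 2)) *\<^sub>C (bracket (f \<alpha>) ^^ j) w"
    using ad.raise_lowered[OF rv(1,2) H w w0(1), of j] unfolding v .
  moreover have "bracket (e \<alpha>) ((bracket (f \<alpha>) ^^ Suc j) w) = 0" unfolding c by (simp add: bracket_simps bracket_self)
  moreover have "(bracket (f \<alpha>) ^^ j) w \<noteq> 0" using N(2) N2 unfolding j_def by simp
  ultimately have "of_nat (Suc j) * (of_nat m * 2 - of_nat j * 2 / 2) = (0 :: complex)" by simp
  then have "of_nat m * 2 - of_nat j = (0 :: complex)" by (simp del: of_nat_Suc)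
  then have "complex_of_nat (m * 2) = of_nat j" by simp
  then have "m * 2 = j" unfolding of_nat_eq_iff .
  then show False using k unfolding j_def m_def by simp
qed

end

subsection \<open>The roots of a simple Lie algebra of type \<open>G\<^sub>2\<close>\<close>

text \<open>The coordinates of the positive roots with respect to the simple roots.\<close>

definition g2_pairs :: "(int \<times> int) set" where
  "g2_pairs = {(1, 0), (0, 1), (1, 1), (2, 1), (3, 1), (3, 2)}"

locale g2_algebra = cartan_roots h B e f for h :: "'g::lie_algebra set" and B e f +
  fixes \<alpha>\<^sub>1 \<alpha>\<^sub>2 :: "'g \<Rightarrow> complex"
  assumes g2_base: "g2_base B h \<alpha>\<^sub>1 \<alpha>\<^sub>2"
begin

definition rt :: "int \<Rightarrow> int \<Rightarrow> 'g \<Rightarrow> complex" where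
  "rt m n t = of_int m * \<alpha>\<^sub>1 t + of_int n * \<alpha>\<^sub>2 t"

definition h1 where "h1 = coroot B h \<alpha>\<^sub>1"
definition h2 where "h2 = coroot B h \<alpha>\<^sub>2"

lemma base_roots: "\<alpha>\<^sub>1 \<in> roots h" "\<alpha>\<^sub>2 \<in> roots h"
  using g2_base unfolding g2_base_def simple_roots_def by auto

lemma rt_base: "rt 1 0 = \<alpha>\<^sub>1" "rt 0 1 = \<alpha>\<^sub>2"
  unfolding rt_def by auto

lemma rt_dual: "rt m n \<in> dual_of h"
  using dual_of_add[OF dual_of_scale dual_of_scale] base_roots rootsD(1) unfolding rt_def[abs_def] by blast

lemma rt_add: "(\<lambda>t. rt m n t + rt m' n' t) = rt (m + m') (n + n')"
  and rt_uminus: "(\<lambda>t. - rt m n t) = rt (- m) (- n)"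
  unfolding rt_def by (auto simp: algebra_simps)

lemma h_mem: "h1 \<in> h" "h2 \<in> h"
  unfolding h1_def h2_def using coroot_mem base_roots by auto

lemma cartan_matrix: "\<alpha>\<^sub>1 h1 = 2" "\<alpha>\<^sub>1 h2 = -1" "\<alpha>\<^sub>2 h1 = -3" "\<alpha>\<^sub>2 h2 = 2"
  using g2_base root_coroot_self[OF base_roots(1)] root_coroot_self[OF base_roots(2)]
  unfolding g2_base_def h1_def h2_def by auto

lemma rt_values: "rt m n h1 = 2 * of_int m - 3 * of_int n" "rt m n h2 = 2 * of_int n - of_int m"
  unfolding rt_def cartan_matrix by simp_all

lemma rt_eq_iff: "rt m n = rt m' n' \<longleftrightarrow> m = m' \<and> n = n'"
proof
  assume eq: "rt m n = rt m' n'"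
  have "of_int (2 * m - 3 * n) = (of_int (2 * m' - 3 * n') :: complex)"
    using fun_cong[OF eq, of h1] by (simp add: rt_values)
  then have "2 * m - 3 * n = 2 * m' - 3 * n'" unfolding of_int_eq_iff .
  moreover have "of_int (2 * n - m) = (of_int (2 * n' - m') :: complex)"
    using fun_cong[OF eq, of h2] by (simp add: rt_values)
  then have "2 * n - m = 2 * n' - m'" unfolding of_int_eq_iff .
  ultimately show "m = m' \<and> n = n'" by presburger
qed auto

lemma root_is_rt:
  assumes "\<alpha> \<in> roots h"
  obtains m n where "\<alpha> = rt m n" "m \<ge> 0 \<and> n \<ge> 0 \<or> m \<le> 0 \<and> n \<le> 0"
proof -
  have "\<alpha> \<in> positive_roots h \<alpha>\<^sub>1 \<alpha>\<^sub>2 \<or> (\<lambda>t. - \<alpha> t) \<in> positive_roots h \<alpha>\<^sub>1 \<alpha>\<^sub>2"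
    using g2_base assms unfolding g2_base_def simple_roots_def by auto
  then show ?thesis
  proof
    assume "\<alpha> \<in> positive_roots h \<alpha>\<^sub>1 \<alpha>\<^sub>2"
    then obtain m n :: nat where "\<alpha> = (\<lambda>t. of_nat m * \<alpha>\<^sub>1 t + of_nat n * \<alpha>\<^sub>2 t)"
      unfolding positive_roots_def by auto
    then show ?thesis by (intro that[of "int m" "int n"]) (auto simp: rt_def)
  next
    assume "(\<lambda>t. - \<alpha> t) \<in> positive_roots h \<alpha>\<^sub>1 \<alpha>\<^sub>2"
    then obtain m n :: nat where "(\<lambda>t. - \<alpha> t) = (\<lambda>t. of_nat m * \<alpha>\<^sub>1 t + of_nat n * \<alpha>\<^sub>2 t)"
      unfolding positive_roots_def by auto
    then have "- \<alpha> t = of_nat m * \<alpha>\<^sub>1 t + of_nat n * \<alpha>\<^sub>2 t" for t by (auto dest: fun_cong[of _ _ t])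
    then have "\<alpha> t = - (of_nat m * \<alpha>\<^sub>1 t + of_nat n * \<alpha>\<^sub>2 t)" for t by (metis minus_minus)
    then have "\<alpha> t = rt (- int m) (- int n) t" for t unfolding rt_def by simp
    then show ?thesis by (intro that[of "- int m" "- int n"]) auto
  qed
qed

lemma rt_root_sign: "rt m n \<in> roots h \<Longrightarrow> m \<ge> 0 \<and> n \<ge> 0 \<or> m \<le> 0 \<and> n \<le> 0"
  by (erule root_is_rt) (simp add: rt_eq_iff)

lemma reflected_rt:
  assumes "rt m n \<in> roots h"
  shows "rt (3 * n - m) n \<in> roots h" "rt m (m - n) \<in> roots h"
proof -
  have "(\<lambda>t. rt m n t - rt m n (coroot B h \<alpha>\<^sub>1) * \<alpha>\<^sub>1 t) = rt (3 * n - m) n"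
    by (rule ext) (simp add: rt_values[unfolded h1_def h2_def], simp add: rt_def algebra_simps)
  then show "rt (3 * n - m) n \<in> roots h" using reflected_root[OF base_roots(1) assms] by simp
  have "(\<lambda>t. rt m n t - rt m n (coroot B h \<alpha>\<^sub>2) * \<alpha>\<^sub>2 t) = rt m (m - n)"
    by (rule ext) (simp add: rt_values[unfolded h1_def h2_def], simp add: rt_def algebra_simps)
  then show "rt m (m - n) \<in> roots h" using reflected_root[OF base_roots(2) assms] by simp
qed

lemma g2_pairs_roots: "(m, n) \<in> g2_pairs \<Longrightarrow> rt m n \<in> roots h"
proof -
  have 1: "rt 1 0 \<in> roots h" "rt 0 1 \<in> roots h" using base_roots unfolding rt_base .
  have 2: "rt 3 1 \<in> roots h" "rt 1 1 \<in> roots h" using reflected_rt(1)[OF 1(2)] reflected_rt(2)[OF 1(1)] by simp_all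
  have 3: "rt 2 1 \<in> roots h" "rt 3 2 \<in> roots h" using reflected_rt(1)[OF 2(2)] reflected_rt(2)[OF 2(1)] by simp_all
  assume "(m, n) \<in> g2_pairs"
  then show ?thesis using 1 2 3 unfolding g2_pairs_def by auto
qed

text \<open>A positive root that is not a multiple of a simple one has positive value on \<open>h1\<close> or \<open>h2\<close>, so
  a simple reflection turns it into a positive root of smaller height.\<close>

lemma positive_root_pairs:
  assumes "rt m n \<in> roots h" "m \<ge> 0" "n \<ge> 0"
  shows "(m, n) \<in> g2_pairs"
  using assms
proof (induction "nat (m + n)" arbitrary: m n rule: less_induct)
  case less
  have no_mult: "\<not> k \<ge> 2" if "rt k 0 \<in> roots h \<or> rt 0 k \<in> roots h" for k :: int
  proof
    assume k: "k \<ge> 2"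
    then have "rt k 0 = (\<lambda>t. of_nat (nat k) * \<alpha>\<^sub>1 t)" "rt 0 k = (\<lambda>t. of_nat (nat k) * \<alpha>\<^sub>2 t)"
      unfolding rt_def by auto
    then show False
      using that multiple_not_root[OF base_roots(1), of "nat k"] multiple_not_root[OF base_roots(2), of "nat k"] k
      by auto
  qed
  have nz: "m \<noteq> 0 \<or> n \<noteq> 0"
  proof (rule ccontr)
    assume "\<not> ?thesis"
    then have "rt m n = (\<lambda>_. 0)" unfolding rt_def by auto
    then show False using rootsD(2)[OF less.prems(1)] by simp
  qed
  consider "n = 0" | "m = 0" | "m > 0" "n > 0" "2 * m > 3 * n" | "m > 0" "n > 0" "2 * n > m"
    using less.prems nz by linarith
  then show ?case
  proof cases
    case 1
    then have "m = 1" using no_mult[of m] less.prems nz by auto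
    then show ?thesis using 1 unfolding g2_pairs_def by simp
  next
    case 2
    then have "n = 1" using no_mult[of n] less.prems nz by auto
    then show ?thesis using 2 unfolding g2_pairs_def by simp
  next
    case 3
    have r: "rt (3 * n - m) n \<in> roots h" using reflected_rt(1)[OF less.prems(1)] .
    then have "3 * n - m \<ge> 0" using rt_root_sign[OF r] 3 by auto
    then have "(3 * n - m, n) \<in> g2_pairs" using less.hyps[OF _ r] 3 by auto
    then show ?thesis using 3 unfolding g2_pairs_def by auto
  next
    case 4
    have r: "rt m (m - n) \<in> roots h" using reflected_rt(2)[OF less.prems(1)] .
    then have "m - n \<ge> 0" using rt_root_sign[OF r] 4 by auto
    then have "(m, m - n) \<in> g2_pairs" using less.hyps[OF _ r] 4 by auto
    then show ?thesis using 4 unfolding g2_pairs_def by auto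
  qed
qed

lemma root_pairs: "rt m n \<in> roots h \<longleftrightarrow> (m, n) \<in> g2_pairs \<or> (- m, - n) \<in> g2_pairs"
proof
  assume r: "rt m n \<in> roots h"
  then have r': "rt (- m) (- n) \<in> roots h" using opposite_root[OF r] by (simp add: rt_uminus)
  show "(m, n) \<in> g2_pairs \<or> (- m, - n) \<in> g2_pairs"
    using rt_root_sign[OF r] positive_root_pairs[OF r] positive_root_pairs[OF r'] by auto
next
  assume "(m, n) \<in> g2_pairs \<or> (- m, - n) \<in> g2_pairs"
  then show "rt m n \<in> roots h"
    using g2_pairs_roots[of m n] g2_pairs_roots[of "- m" "- n"] opposite_root[of "rt (- m) (- n)"]
    by (auto simp: rt_uminus)
qed

lemma positive_roots_pairs: "positive_roots h \<alpha>\<^sub>1 \<alpha>\<^sub>2 = (\<lambda>(m, n). rt m n) ` g2_pairs"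
proof safe
  fix \<alpha> assume "\<alpha> \<in> positive_roots h \<alpha>\<^sub>1 \<alpha>\<^sub>2"
  then obtain m n :: nat where a: "\<alpha> \<in> roots h" "\<alpha> = (\<lambda>t. of_nat m * \<alpha>\<^sub>1 t + of_nat n * \<alpha>\<^sub>2 t)"
    unfolding positive_roots_def by auto
  then have "\<alpha> = rt (int m) (int n)" unfolding rt_def by auto
  then show "\<alpha> \<in> (\<lambda>(m, n). rt m n) ` g2_pairs"
    using positive_root_pairs[of "int m" "int n"] a(1) by auto
next
  fix m n assume mn: "(m, n) \<in> g2_pairs"
  then have "rt m n = (\<lambda>t. of_nat (nat m) * \<alpha>\<^sub>1 t + of_nat (nat n) * \<alpha>\<^sub>2 t)"
    unfolding rt_def g2_pairs_def by auto
  then show "rt m n \<in> positive_roots h \<alpha>\<^sub>1 \<alpha>\<^sub>2"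
    unfolding positive_roots_def using g2_pairs_roots[OF mn] by auto
qed

lemma cartan_eqI:
  assumes s: "s \<in> h" and t: "t \<in> h" and "\<alpha>\<^sub>1 s = \<alpha>\<^sub>1 t" "\<alpha>\<^sub>2 s = \<alpha>\<^sub>2 t"
  shows "s = t"
proof -
  have "s - t = 0"
  proof (rule cartan_element_eq_0)
    show st: "s - t \<in> h" by (rule cvec.subspace_diff[OF h_sub s t])
    fix \<alpha> assume al: "\<alpha> \<in> roots h"
    then obtain m n where mn: "\<alpha> = rt m n" by (rule root_is_rt)
    have "\<alpha> ((s - t) + t) = \<alpha> (s - t) + \<alpha> t" by (rule dual_ofD(1)[OF rootsD(1)[OF al] st t])
    then show "\<alpha> (s - t) = 0" using assms(3,4) unfolding mn rt_def by simp
  qed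
  then show ?thesis by simp
qed

text \<open>The coefficients are those of the inverse Cartan matrix.\<close>

lemma cartan_basis:
  assumes t: "t \<in> h"
  shows "t = (2 * \<alpha>\<^sub>1 t + \<alpha>\<^sub>2 t) *\<^sub>C h1 + (3 * \<alpha>\<^sub>1 t + 2 * \<alpha>\<^sub>2 t) *\<^sub>C h2" (is "t = ?s")
proof (rule cartan_eqI[OF t])
  have m: "a *\<^sub>C h1 \<in> h" "b *\<^sub>C h2 \<in> h" for a b using h_mem cvec.subspace_scale[OF h_sub] by auto
  show "?s \<in> h" by (rule cvec.subspace_add[OF h_sub m])
  have v: "\<mu> (a *\<^sub>C h1 + b *\<^sub>C h2) = a * \<mu> h1 + b * \<mu> h2" if "\<mu> \<in> dual_of h" for \<mu> a b
    using dual_ofD(1)[OF that m] dual_ofD(2)[OF that] h_mem by simp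
  show "\<alpha>\<^sub>1 t = \<alpha>\<^sub>1 ?s" "\<alpha>\<^sub>2 t = \<alpha>\<^sub>2 ?s"
    unfolding v[OF rootsD(1)[OF base_roots(1)]] v[OF rootsD(1)[OF base_roots(2)]] cartan_matrix
    by (simp_all add: algebra_simps)
qed

lemma dual_of_h_eqI:
  assumes "\<mu> \<in> dual_of h" "\<nu> \<in> dual_of h" "\<mu> h1 = \<nu> h1" "\<mu> h2 = \<nu> h2"
  shows "\<mu> = \<nu>"
proof (rule dual_of_eqI[OF assms(1,2)])
  fix t assume t: "t \<in> h"
  have m: "a *\<^sub>C h1 \<in> h" "b *\<^sub>C h2 \<in> h" for a b using h_mem cvec.subspace_scale[OF h_sub] by auto
  have v: "\<mu> (a *\<^sub>C h1 + b *\<^sub>C h2) = a * \<mu> h1 + b * \<mu> h2" if "\<mu> \<in> dual_of h" for \<mu> a b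
    using dual_ofD(1)[OF that m] dual_ofD(2)[OF that] h_mem by simp
  show "\<mu> t = \<nu> t" using v[OF assms(1)] v[OF assms(2)] assms(3,4) cartan_basis[OF t] by metis
qed

text \<open>The highest root \<open>\<theta> = 3\<alpha>\<^sub>1 + 2\<alpha>\<^sub>2\<close> is long and orthogonal to the short simple root \<open>\<alpha>\<^sub>1\<close>.\<close>

definition \<theta> where "\<theta> = rt 3 2"

lemma \<theta>_root: "\<theta> \<in> roots h"
  unfolding \<theta>_def by (rule g2_pairs_roots) (simp add: g2_pairs_def)

text \<open>With \<open>\<langle>\<alpha>\<^sub>1, \<alpha>\<^sub>1\<rangle> = a\<close> the Cartan matrix gives \<open>\<langle>\<alpha>\<^sub>1, \<alpha>\<^sub>2\<rangle> = - 3 a / 2\<close> and \<open>\<langle>\<alpha>\<^sub>2, \<alpha>\<^sub>2\<rangle> = 3 a\<close>, hence also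
  \<open>\<langle>\<theta>, \<theta>\<rangle> = 3 a\<close>.\<close>

lemma \<theta>_coroot: "coroot B h \<theta> = h1 + 2 *\<^sub>C h2"
proof -
  define t1 t2 where "t1 = form_dual B h \<alpha>\<^sub>1" and "t2 = form_dual B h \<alpha>\<^sub>2"
  note fd = root_form_dual[OF base_roots(1), folded t1_def] root_form_dual[OF base_roots(2), folded t2_def]
  define a b c where "a = B t1 t1" and "b = B t1 t2" and "c = B t2 t2"
  have nz: "a \<noteq> 0" "c \<noteq> 0"
    using dual_form_nonzero[OF base_roots(1)] dual_form_nonzero[OF base_roots(2)]
    unfolding a_def c_def dual_form_def t1_def t2_def by auto
  have h: "h1 = (2 / a) *\<^sub>C t1" "h2 = (2 / c) *\<^sub>C t2"
    unfolding h1_def h2_def coroot_def dual_form_def a_def c_def t1_def t2_def by auto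
  have "\<alpha>\<^sub>2 h1 = 2 * b / a" "\<alpha>\<^sub>1 h2 = 2 * b / c"
    using root_coroot[OF base_roots(1,2)] root_coroot[OF base_roots(2,1)]
    unfolding h1_def h2_def dual_form_def a_def b_def c_def t1_def t2_def by (simp_all add: form_sym)
  then have "2 * b = - 3 * a" "2 * b = - c" using cartan_matrix nz by (auto simp: field_simps)
  then have bc: "b = - 3 / 2 * a" "c = 3 * a" by (auto simp: field_simps)
  have mem: "3 *\<^sub>C t1 + 2 *\<^sub>C t2 \<in> h"
    using fd h_sub cvec.subspace_add cvec.subspace_scale by metis
  have t: "form_dual B h \<theta> = 3 *\<^sub>C t1 + 2 *\<^sub>C t2"
    by (rule form_dual_eqI[OF mem]) (simp add: form_linear fd \<theta>_def rt_def)
  have "dual_form B h \<theta> \<theta> = 9 * a + 12 * b + 4 * c"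
    unfolding dual_form_def t a_def b_def c_def
    by (simp add: form_linear form_linear_right form_sym[of t2 t1])
  also have "\<dots> = 3 * a" unfolding bc by simp
  finally have d: "dual_form B h \<theta> \<theta> = 3 * a" .
  show ?thesis unfolding coroot_def d t h bc(2) using nz(1) by (simp add: cv_simps field_simps)
qed

end

section \<open>Modules over a Lie algebra of type \<open>G\<^sub>2\<close>\<close>

subsection \<open>Generation by the simple root vectors\<close>

text \<open>Words are lists of booleans; \<open>True\<close> stands for \<open>F\<close> and \<open>False\<close> for \<open>G\<close>.\<close>

primrec word_act :: "('v \<Rightarrow> 'v) \<Rightarrow> ('v \<Rightarrow> 'v) \<Rightarrow> bool list \<Rightarrow> 'v \<Rightarrow> 'v" where
  "word_act F G [] x = x"
| "word_act F G (i # l) x = (if i then F else G) (word_act F G l x)"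

context cartan_roots
begin

text \<open>A vector killed by \<open>f\<close> is the lowest one of its string, whose length its weight determines.\<close>

lemma raise_lowest:
  assumes al: "\<alpha> \<in> roots h" and be: "\<beta> \<in> dual_of h" and x: "x \<in> root_space h \<beta>" "x \<noteq> 0"
    and fx: "bracket (f \<alpha>) x = 0" and p: "\<beta> (coroot B h \<alpha>) = - of_nat p" and k: "k \<le> p"
  shows "(bracket (e \<alpha>) ^^ k) x \<noteq> 0"
proof -
  note rv = root_vectorsD[OF al]
  have "\<exists>n. 2 * \<beta> (bracket (f \<alpha>) (e \<alpha>)) = of_nat n * - \<alpha> (bracket (f \<alpha>) (e \<alpha>))
      \<and> (\<forall>k\<le>n. (bracket (e \<alpha>) ^^ k) x \<noteq> 0) \<and> (bracket (e \<alpha>) ^^ Suc n) x = 0"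
    by (rule ad.highest_vector_level[of "f \<alpha>" "\<lambda>t. - \<alpha> t" "e \<alpha>" x \<beta>])
      (use rv x fx rootsD(1,2)[OF opposite_root[OF al]] coroot_mem[OF al] cvec.subspace_neg[OF h_sub] in \<open>auto simp: root_space_adjoint\<close>)
  then obtain n where n: "2 * \<beta> (- coroot B h \<alpha>) = of_nat n * - \<alpha> (- coroot B h \<alpha>)"
    "\<forall>k\<le>n. (bracket (e \<alpha>) ^^ k) x \<noteq> 0" unfolding rv(4) by auto
  have neg: "\<mu> (- coroot B h \<alpha>) = - \<mu> (coroot B h \<alpha>)" if "\<mu> \<in> dual_of h" for \<mu>
    using dual_ofD(2)[OF that coroot_mem[OF al], of "-1"] by simp
  have "complex_of_nat n = of_nat p"
    using n(1) unfolding neg[OF be] neg[OF rootsD(1)[OF al]] p root_coroot_self[OF al] by simp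
  then show ?thesis using n(2) k by simp
qed

lemma lower_highest:
  assumes al: "\<alpha> \<in> roots h" and x: "x \<in> root_space h \<beta>" "x \<noteq> 0"
    and ex: "bracket (e \<alpha>) x = 0" and p: "\<beta> (coroot B h \<alpha>) = of_nat p" and k: "k \<le> p"
  shows "(bracket (f \<alpha>) ^^ k) x \<noteq> 0"
proof -
  note rv = root_vectorsD[OF al]
  have "\<exists>n. 2 * \<beta> (bracket (e \<alpha>) (f \<alpha>)) = of_nat n * \<alpha> (bracket (e \<alpha>) (f \<alpha>))
      \<and> (\<forall>k\<le>n. (bracket (f \<alpha>) ^^ k) x \<noteq> 0) \<and> (bracket (f \<alpha>) ^^ Suc n) x = 0"
    by (rule ad.highest_vector_level[of "e \<alpha>" \<alpha> "f \<alpha>" x \<beta>])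
      (use rv x ex rootsD(1,2)[OF al] coroot_mem[OF al] in \<open>auto simp: root_space_adjoint\<close>)
  then obtain n where n: "2 * \<beta> (coroot B h \<alpha>) = of_nat n * \<alpha> (coroot B h \<alpha>)"
    "\<forall>k\<le>n. (bracket (f \<alpha>) ^^ k) x \<noteq> 0" unfolding rv(3) by auto
  then have "complex_of_nat n = of_nat p" using root_coroot_self[OF al] p by simp
  then show ?thesis using n(2) k by simp
qed

lemma root_space_subset:
  assumes "cvec.subspace U" "x \<in> U" "x \<noteq> 0" "\<alpha> \<in> roots h" "x \<in> root_space h \<alpha>"
  shows "root_space h \<alpha> \<subseteq> U"
proof
  fix y assume "y \<in> root_space h \<alpha>"
  then obtain a where a: "y = a *\<^sub>C e \<alpha>" using root_space_line[OF assms(4)] by auto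
  obtain b where b: "x = b *\<^sub>C e \<alpha>" using root_space_line[OF assms(4,5)] by auto
  then have "y = (a / b) *\<^sub>C x" using a assms(3) by auto
  then show "y \<in> U" using cvec.subspace_scale[OF assms(1,2)] by simp
qed

end

context g2_algebra
begin

abbreviation "e1 \<equiv> e \<alpha>\<^sub>1"
abbreviation "e2 \<equiv> e \<alpha>\<^sub>2"
abbreviation "f1 \<equiv> f \<alpha>\<^sub>1"
abbreviation "f2 \<equiv> f \<alpha>\<^sub>2"

lemma simple_root_vectors:
  "e1 \<in> root_space h (rt 1 0)" "e2 \<in> root_space h (rt 0 1)"
  "f1 \<in> root_space h (rt (-1) 0)" "f2 \<in> root_space h (rt 0 (-1))"
  using root_vectorsD[OF base_roots(1)] root_vectorsD[OF base_roots(2)] rt_uminus[of 1 0] rt_uminus[of 0 1]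
  by (simp_all add: rt_base)

lemma no_root_vectors:
  assumes x: "x \<in> root_space h (rt m n)" and "(m, n) \<noteq> (0, 0)" "(m, n) \<notin> g2_pairs" "(- m, - n) \<notin> g2_pairs"
  shows "x = 0"
proof (rule ccontr)
  assume "x \<noteq> 0"
  have "rt m n \<noteq> (\<lambda>_. 0)" using rt_eq_iff[of m n 0 0] assms(2) unfolding rt_def[of 0 0, abs_def] by auto
  then have "rt m n \<in> roots h" using rootsI[OF rt_dual _ x \<open>x \<noteq> 0\<close>] by simp
  then show False using root_pairs assms(3,4) by simp
qed

lemma rt_bracket:
  assumes "x \<in> root_space h (rt m n)" "y \<in> root_space h (rt m' n')"
  shows "bracket x y \<in> root_space h (rt (m' + m) (n' + n))"
  using root_bracket[OF assms] by (simp add: rt_add)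

lemma simple_brackets:
  "bracket e1 f1 = h1" "bracket e2 f2 = h2" "bracket e1 f2 = 0" "bracket e2 f1 = 0"
  "bracket f1 e2 = 0" "bracket f2 e1 = 0"
proof -
  show "bracket e1 f1 = h1" "bracket e2 f2 = h2"
    using root_vectorsD(3) base_roots unfolding h1_def h2_def by auto
  show "bracket e1 f2 = 0"
    by (rule no_root_vectors[OF rt_bracket[OF simple_root_vectors(1,4)]]) (simp_all add: g2_pairs_def)
  show "bracket e2 f1 = 0"
    by (rule no_root_vectors[OF rt_bracket[OF simple_root_vectors(2,3)]]) (simp_all add: g2_pairs_def)
  show "bracket f1 e2 = 0"
    by (rule no_root_vectors[OF rt_bracket[OF simple_root_vectors(3,2)]]) (simp_all add: g2_pairs_def)
  show "bracket f2 e1 = 0"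
    by (rule no_root_vectors[OF rt_bracket[OF simple_root_vectors(4,1)]]) (simp_all add: g2_pairs_def)
qed

text \<open>Iterated brackets of \<open>e1\<close> and \<open>e2\<close> reach every positive root; they do not vanish by the
  \<open>sl\<^sub>2\<close>-theory of root strings. Root spaces are lines, so this is enough.\<close>

lemma subalgebra_eq_UNIV:
  assumes U: "cvec.subspace U" "\<And>x y. x \<in> U \<Longrightarrow> y \<in> U \<Longrightarrow> bracket x y \<in> U"
    and hU: "h1 \<in> U" "h2 \<in> U" and gen: "e1 \<in> U" "e2 \<in> U" "f1 \<in> U" "f2 \<in> U"
  shows "U = UNIV"
proof (rule subspace_eq_UNIV[OF U(1)])
  show "h \<subseteq> U"
  proof
    fix t assume "t \<in> h"
    show "t \<in> U" by (subst cartan_basis[OF \<open>t \<in> h\<close>])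
        (intro cvec.subspace_add cvec.subspace_scale U(1) hU)
  qed
  note nz = root_vectors_nonzero[OF base_roots(1)] root_vectors_nonzero[OF base_roots(2)]
  define x1 x2 x3 x4 where "x1 = bracket e1 e2" and "x2 = bracket e1 x1" and "x3 = bracket e1 x2" and "x4 = bracket e2 x3"
  define y1 y2 y3 y4 where "y1 = bracket f1 f2" and "y2 = bracket f1 y1" and "y3 = bracket f1 y2" and "y4 = bracket f2 y3"
  have xU: "x1 \<in> U" "x2 \<in> U" "x3 \<in> U" "x4 \<in> U" "y1 \<in> U" "y2 \<in> U" "y3 \<in> U" "y4 \<in> U"
    unfolding x1_def x2_def x3_def x4_def y1_def y2_def y3_def y4_def by (simp_all add: U(2) gen)
  have xr: "x1 \<in> root_space h (rt 1 1)" "x2 \<in> root_space h (rt 2 1)" "x3 \<in> root_space h (rt 3 1)" "x4 \<in> root_space h (rt 3 2)"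
    "y1 \<in> root_space h (rt (-1) (-1))" "y2 \<in> root_space h (rt (-2) (-1))" "y3 \<in> root_space h (rt (-3) (-1))" "y4 \<in> root_space h (rt (-3) (-2))"
  proof -
    show 1: "x1 \<in> root_space h (rt 1 1)" unfolding x1_def using rt_bracket[OF simple_root_vectors(1,2)] by simp
    show 2: "x2 \<in> root_space h (rt 2 1)" unfolding x2_def using rt_bracket[OF simple_root_vectors(1) 1] by simp
    show 3: "x3 \<in> root_space h (rt 3 1)" unfolding x3_def using rt_bracket[OF simple_root_vectors(1) 2] by simp
    show 4: "x4 \<in> root_space h (rt 3 2)" unfolding x4_def using rt_bracket[OF simple_root_vectors(2) 3] by simp
    show 1: "y1 \<in> root_space h (rt (-1) (-1))" unfolding y1_def using rt_bracket[OF simple_root_vectors(3,4)] by simp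
    show 2: "y2 \<in> root_space h (rt (-2) (-1))" unfolding y2_def using rt_bracket[OF simple_root_vectors(3) 1] by simp
    show 3: "y3 \<in> root_space h (rt (-3) (-1))" unfolding y3_def using rt_bracket[OF simple_root_vectors(3) 2] by simp
    show 4: "y4 \<in> root_space h (rt (-3) (-2))" unfolding y4_def using rt_bracket[OF simple_root_vectors(4) 3] by simp
  qed
  have up: "(bracket e1 ^^ k) e2 \<noteq> 0" if "k \<le> 3" for k
    by (rule raise_lowest[OF base_roots(1) rt_dual simple_root_vectors(2) nz(3) simple_brackets(5) _ that])
      (simp add: rt_values flip: h1_def)
  have dn: "(bracket f1 ^^ k) f2 \<noteq> 0" if "k \<le> 3" for k
    by (rule lower_highest[OF base_roots(1) simple_root_vectors(4) nz(4) simple_brackets(3) _ that])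
      (simp add: rt_values flip: h1_def)
  have x3nz: "x1 \<noteq> 0" "x2 \<noteq> 0" "x3 \<noteq> 0" "y1 \<noteq> 0" "y2 \<noteq> 0" "y3 \<noteq> 0"
    using up[of 1] up[of 2] up[of 3] dn[of 1] dn[of 2] dn[of 3]
    unfolding x1_def x2_def x3_def y1_def y2_def y3_def by (simp_all add: numeral_2_eq_2 numeral_3_eq_3)
  have "bracket f2 x3 = 0" "bracket e2 y3 = 0"
    using no_root_vectors[OF rt_bracket[OF simple_root_vectors(4) xr(3)]]
      no_root_vectors[OF rt_bracket[OF simple_root_vectors(2) xr(7)]] by (simp_all add: g2_pairs_def)
  then have x4nz: "x4 \<noteq> 0" "y4 \<noteq> 0"
    using raise_lowest[OF base_roots(2) rt_dual xr(3) x3nz(3), of 1 1]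
      lower_highest[OF base_roots(2) xr(7) x3nz(6), of 1 1]
    unfolding x4_def y4_def by (simp_all add: rt_values flip: h2_def)
  fix \<alpha> assume al: "\<alpha> \<in> roots h"
  obtain m n where mn: "\<alpha> = rt m n" using root_is_rt[OF al] by metis
  have "\<exists>x\<in>U. x \<noteq> 0 \<and> x \<in> root_space h (rt m n)"
  proof -
    have "m = 1 \<and> n = 0 \<or> m = 0 \<and> n = 1 \<or> m = 1 \<and> n = 1 \<or> m = 2 \<and> n = 1 \<or> m = 3 \<and> n = 1 \<or> m = 3 \<and> n = 2
      \<or> m = -1 \<and> n = 0 \<or> m = 0 \<and> n = -1 \<or> m = -1 \<and> n = -1 \<or> m = -2 \<and> n = -1 \<or> m = -3 \<and> n = -1 \<or> m = -3 \<and> n = -2"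
      using al unfolding mn root_pairs g2_pairs_def insert_iff empty_iff prod.inject by presburger
    then show ?thesis
      using xU xr x3nz x4nz gen nz simple_root_vectors by (elim disjE) auto
  qed
  then show "root_space h \<alpha> \<subseteq> U" using root_space_subset[OF U(1)] al unfolding mn by auto
qed

lemma stable_under_generators:
  assumes mod: "lie_module \<rho>" and D: "cvec.subspace D"
    and st: "\<And>w. w \<in> D \<Longrightarrow> \<rho> h1 w \<in> D" "\<And>w. w \<in> D \<Longrightarrow> \<rho> h2 w \<in> D"
      "\<And>w. w \<in> D \<Longrightarrow> \<rho> e1 w \<in> D" "\<And>w. w \<in> D \<Longrightarrow> \<rho> e2 w \<in> D"
      "\<And>w. w \<in> D \<Longrightarrow> \<rho> f1 w \<in> D" "\<And>w. w \<in> D \<Longrightarrow> \<rho> f2 w \<in> D"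
    and w: "w \<in> D"
  shows "\<rho> x w \<in> D"
proof -
  note act = lie_module_simps[OF mod]
  have "{x. \<forall>w\<in>D. \<rho> x w \<in> D} = UNIV"
  proof (rule subalgebra_eq_UNIV)
    show "cvec.subspace {x. \<forall>w\<in>D. \<rho> x w \<in> D}"
      unfolding cvec.subspace_def
      by (auto simp: act cvec.subspace_0[OF D] intro: cvec.subspace_add[OF D] cvec.subspace_scale[OF D])
    show "bracket x y \<in> {x. \<forall>w\<in>D. \<rho> x w \<in> D}" if "x \<in> {x. \<forall>w\<in>D. \<rho> x w \<in> D}" "y \<in> {x. \<forall>w\<in>D. \<rho> x w \<in> D}" for x y
      using that by (auto simp: act intro: cvec.subspace_diff[OF D])
  qed (use st in auto)
  then show ?thesis using w by auto
qed

text \<open>For a weight vector \<open>x\<close> that \<open>e1\<close> and \<open>e2\<close> kill this is the submodule generated by \<open>x\<close>.\<close>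

definition lowered_span :: "('g \<Rightarrow> 'v \<Rightarrow> 'v) \<Rightarrow> 'v \<Rightarrow> 'v::complex_vector set" where
  "lowered_span \<rho> x = cvec.span (range (\<lambda>l. word_act (\<rho> f1) (\<rho> f2) l x))"

text \<open>The weight \<open>\<mu> - m \<alpha>\<^sub>1 - n \<alpha>\<^sub>2\<close>.\<close>

definition below :: "('g \<Rightarrow> complex) \<Rightarrow> int \<Rightarrow> int \<Rightarrow> 'g \<Rightarrow> complex" where
  "below \<mu> m n t = \<mu> t - rt m n t"

lemma below_dual: "\<mu> \<in> dual_of h \<Longrightarrow> below \<mu> m n \<in> dual_of h"
  using dual_of_add[OF _ dual_of_uminus[OF rt_dual], of \<mu>] unfolding below_def[abs_def] by simp

lemma below_eq_iff: "below \<mu> m n = below \<mu> m' n' \<longleftrightarrow> m = m' \<and> n = n'"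
proof -
  have "below \<mu> m n = below \<mu> m' n' \<longleftrightarrow> rt m n = rt m' n'"
    unfolding below_def fun_eq_iff by auto
  then show ?thesis unfolding rt_eq_iff .
qed

lemma below_0: "below \<mu> 0 0 = \<mu>"
  unfolding below_def rt_def by auto

lemma below_below: "below (below \<mu> m n) m' n' = below \<mu> (m + m') (n + n')"
  unfolding below_def rt_def by (auto simp: algebra_simps)

lemma below_values: "below \<mu> m n h1 = \<mu> h1 - (2 * of_int m - 3 * of_int n)"
  "below \<mu> m n h2 = \<mu> h2 - (2 * of_int n - of_int m)"
  unfolding below_def rt_values by simp_all

lemma simple_act_below:
  assumes mod: "lie_module \<rho>" and x: "x \<in> weight_space \<rho> h (below \<mu> m n)"
  shows "\<rho> e1 x \<in> weight_space \<rho> h (below \<mu> (m - 1) n)" "\<rho> e2 x \<in> weight_space \<rho> h (below \<mu> m (n - 1))"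
    "\<rho> f1 x \<in> weight_space \<rho> h (below \<mu> (m + 1) n)" "\<rho> f2 x \<in> weight_space \<rho> h (below \<mu> m (n + 1))"
proof -
  have *: "(\<lambda>t. below \<mu> m n t + rt i j t) = below \<mu> (m - i) (n - j)" for i j
    unfolding below_def rt_def by (auto simp: algebra_simps)
  show "\<rho> e1 x \<in> weight_space \<rho> h (below \<mu> (m - 1) n)" "\<rho> e2 x \<in> weight_space \<rho> h (below \<mu> m (n - 1))"
    "\<rho> f1 x \<in> weight_space \<rho> h (below \<mu> (m + 1) n)" "\<rho> f2 x \<in> weight_space \<rho> h (below \<mu> m (n + 1))"
    using root_vector_shifts_weight[OF mod simple_root_vectors(1) x] root_vector_shifts_weight[OF mod simple_root_vectors(2) x]
      root_vector_shifts_weight[OF mod simple_root_vectors(3) x] root_vector_shifts_weight[OF mod simple_root_vectors(4) x]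
    unfolding * by simp_all
qed

lemma word_weight:
  assumes mod: "lie_module \<rho>" and x: "x \<in> weight_space \<rho> h \<mu>"
  shows "word_act (\<rho> f1) (\<rho> f2) l x
    \<in> weight_space \<rho> h (below \<mu> (int (count_list l True)) (int (count_list l False)))"
proof (induction l)
  case Nil
  then show ?case using x by (simp add: below_0)
next
  case (Cons i l)
  then show ?case using simple_act_below(3,4)[OF mod Cons] by (cases i) (simp_all add: add.commute)
qed

lemma lowered_span_submodule:
  assumes mod: "lie_module \<rho>" and x: "x \<in> weight_space \<rho> h \<mu>" "\<rho> e1 x = 0" "\<rho> e2 x = 0"
    and w: "w \<in> lowered_span \<rho> x"
  shows "\<rho> y w \<in> lowered_span \<rho> x"
proof -
  note act = lie_module_simps[OF mod]
  define W where "W l = word_act (\<rho> f1) (\<rho> f2) l x" for l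
  define D where "D = cvec.span (range W)"
  have D: "cvec.subspace D" unfolding D_def by (rule cvec.subspace_span)
  have WD: "W l \<in> D" for l unfolding D_def by (rule cvec.span_base) auto
  have ext: "\<rho> z u \<in> D" if "\<And>l. \<rho> z (W l) \<in> D" "u \<in> D" for z u
  proof -
    have "cvec.subspace {u. \<rho> z u \<in> D}"
      unfolding cvec.subspace_def
      by (auto simp: act cvec.subspace_0[OF D] intro: cvec.subspace_add[OF D] cvec.subspace_scale[OF D])
    then have "D \<subseteq> {u. \<rho> z u \<in> D}" unfolding D_def
      by (intro cvec.span_minimal) (use that(1) in \<open>auto simp: D_def\<close>)
    then show ?thesis using that(2) by auto
  qed
  have Wc: "W (True # l) = \<rho> f1 (W l)" "W (False # l) = \<rho> f2 (W l)" for l unfolding W_def by auto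
  have hW: "\<rho> t (W l) \<in> D" if "t \<in> h" for t l
    using word_weight[OF mod x(1), of l] that WD[of l] cvec.subspace_scale[OF D]
    unfolding weight_space_def W_def by auto
  have eW: "\<rho> e1 (W l) \<in> D \<and> \<rho> e2 (W l) \<in> D" for l
  proof (induction l)
    case Nil
    then show ?case using x cvec.subspace_0[OF D] unfolding W_def by simp
  next
    case (Cons i l)
    have fD: "\<rho> f1 u \<in> D" "\<rho> f2 u \<in> D" if "u \<in> D" for u
      using ext[OF _ that, of f1] ext[OF _ that, of f2] WD Wc by metis+
    have "\<rho> e1 (\<rho> f1 (W l)) = \<rho> f1 (\<rho> e1 (W l)) + \<rho> h1 (W l)" "\<rho> e2 (\<rho> f2 (W l)) = \<rho> f2 (\<rho> e2 (W l)) + \<rho> h2 (W l)"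
      "\<rho> e1 (\<rho> f2 (W l)) = \<rho> f2 (\<rho> e1 (W l))" "\<rho> e2 (\<rho> f1 (W l)) = \<rho> f1 (\<rho> e2 (W l))"
      using lie_module_commute[OF mod, of e1 f1] lie_module_commute[OF mod, of e2 f2]
        lie_module_commute[OF mod, of e1 f2] lie_module_commute[OF mod, of e2 f1]
      by (simp_all add: simple_brackets act(8))
    then show ?case using Cons fD hW h_mem cvec.subspace_add[OF D] by (cases i) (auto simp: Wc)
  qed
  have "\<rho> y w \<in> D"
  proof (rule stable_under_generators[OF mod D])
    show "w \<in> D" using w unfolding lowered_span_def D_def W_def .
    fix u assume u: "u \<in> D"
    show "\<rho> h1 u \<in> D" "\<rho> h2 u \<in> D" by (rule ext[OF hW[OF h_mem(1)] u], rule ext[OF hW[OF h_mem(2)] u])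
    show "\<rho> e1 u \<in> D" "\<rho> e2 u \<in> D" by (rule ext[OF conjunct1[OF eW] u], rule ext[OF conjunct2[OF eW] u])
    show "\<rho> f1 u \<in> D" by (rule ext[OF _ u]) (simp add: WD flip: Wc)
    show "\<rho> f2 u \<in> D" by (rule ext[OF _ u]) (simp add: WD flip: Wc)
  qed
  then show ?thesis unfolding lowered_span_def D_def W_def .
qed

end

subsection \<open>Weights and highest weight vectors of simple modules\<close>

locale g2_simple_module = g2_algebra h B e f \<alpha>\<^sub>1 \<alpha>\<^sub>2
  for h :: "'g::lie_algebra set" and B e f \<alpha>\<^sub>1 \<alpha>\<^sub>2 +
  fixes \<rho> :: "'g \<Rightarrow> 'v::complex_vector \<Rightarrow> 'v"
  assumes V_fd: "finite_dim TYPE('v)" and V_simple: "simple_module \<rho>"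
begin

lemma V_mod: "lie_module \<rho>"
  using V_simple unfolding simple_module_def by auto

lemma V_nonzero: "\<exists>v::'v. v \<noteq> 0"
  using V_simple unfolding simple_module_def by auto

lemma submodule_cases:
  assumes "cvec.subspace W" "\<And>x w. w \<in> W \<Longrightarrow> \<rho> x w \<in> W"
  shows "W = {0} \<or> W = UNIV"
  using V_simple assms unfolding simple_module_def by auto

text \<open>The two commuting operators of \<open>h1\<close> and \<open>h2\<close> have a common eigenvector.\<close>

lemma weight_exists: "\<exists>\<mu>\<in>dual_of h. weight_space \<rho> h \<mu> \<noteq> {0}"
proof -
  note act = lie_module_simps[OF V_mod]
  have "(UNIV :: 'v set) \<noteq> {0}" using V_nonzero by auto
  then obtain c1 v1 where v1: "v1 \<noteq> 0" "\<rho> h1 v1 = c1 *\<^sub>C v1"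
    using eigenvector_exists[OF V_fd lie_module_clinear(1)[OF V_mod, of h1] cvec.subspace_UNIV] by auto
  let ?U = "{v. \<rho> h1 v = c1 *\<^sub>C v}"
  have "\<exists>c. \<exists>v\<in>?U. v \<noteq> 0 \<and> \<rho> h2 v = c *\<^sub>C v"
  proof (rule eigenvector_exists[OF V_fd lie_module_clinear(1)[OF V_mod]])
    show "cvec.subspace ?U" by (rule eigenspace_subspace[OF lie_module_clinear(1)[OF V_mod]])
    show "\<rho> h2 v \<in> ?U" if "v \<in> ?U" for v
      using lie_module_commute[OF V_mod, of h1 h2 v] h_abelian[OF h_mem] that by (simp add: act)
    show "?U \<noteq> {0}" using v1 by auto
  qed
  then obtain c2 v where v: "v \<noteq> 0" "\<rho> h1 v = c1 *\<^sub>C v" "\<rho> h2 v = c2 *\<^sub>C v" by auto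
  (* The coefficients come from the inverse Cartan matrix and give \<mu> h1 = c1 and \<mu> h2 = c2. *)
  define \<mu> where "\<mu> t = (2 * c1 + 3 * c2) * \<alpha>\<^sub>1 t + (c1 + 2 * c2) * \<alpha>\<^sub>2 t" for t
  have mu: "\<mu> \<in> dual_of h"
    unfolding \<mu>_def[abs_def] using dual_of_add[OF dual_of_scale dual_of_scale] base_roots rootsD(1) by blast
  have "v \<in> weight_space \<rho> h \<mu>" unfolding weight_space_def
  proof safe
    fix t assume t: "t \<in> h"
    have "\<rho> t v = (2 * \<alpha>\<^sub>1 t + \<alpha>\<^sub>2 t) *\<^sub>C \<rho> h1 v + (3 * \<alpha>\<^sub>1 t + 2 * \<alpha>\<^sub>2 t) *\<^sub>C \<rho> h2 v"
      by (subst cartan_basis[OF t]) (simp only: act)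
    also have "\<dots> = ((2 * \<alpha>\<^sub>1 t + \<alpha>\<^sub>2 t) * c1 + (3 * \<alpha>\<^sub>1 t + 2 * \<alpha>\<^sub>2 t) * c2) *\<^sub>C v"
      unfolding v by (simp only: cvec.scale_scale cvec.scale_left_distrib)
    also have "(2 * \<alpha>\<^sub>1 t + \<alpha>\<^sub>2 t) * c1 + (3 * \<alpha>\<^sub>1 t + 2 * \<alpha>\<^sub>2 t) * c2 = \<mu> t"
      unfolding \<mu>_def by (simp add: algebra_simps)
    finally show "\<rho> t v = \<mu> t *\<^sub>C v" .
  qed
  then show ?thesis using v(1) mu by auto
qed

sublocale V: weight_module h \<rho>
proof
  let ?D = "cvec.span (\<Union>\<mu>\<in>dual_of h. weight_space \<rho> h \<mu>)"
  note act = lie_module_simps[OF V_mod]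
  have D: "cvec.subspace ?D" by (rule cvec.subspace_span)
  have st: "\<rho> x w \<in> ?D" if x: "x \<in> root_space h \<beta>" "\<beta> \<in> dual_of h" and w: "w \<in> ?D" for x w \<beta>
  proof -
    have "cvec.subspace {w. \<rho> x w \<in> ?D}" unfolding cvec.subspace_def
      by (auto simp: act cvec.subspace_0[OF D] intro: cvec.subspace_add[OF D] cvec.subspace_scale[OF D])
    moreover have "(\<Union>\<mu>\<in>dual_of h. weight_space \<rho> h \<mu>) \<subseteq> {w. \<rho> x w \<in> ?D}"
      using root_vector_shifts_weight[OF V_mod x(1)] dual_of_add[OF _ x(2)]
      by (auto intro!: cvec.span_base)
    ultimately have "?D \<subseteq> {w. \<rho> x w \<in> ?D}" by (intro cvec.span_minimal)
    then show ?thesis using w by auto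
  qed
  have "{x. \<forall>w\<in>?D. \<rho> x w \<in> ?D} = UNIV"
  proof (rule subspace_eq_UNIV)
    show "cvec.subspace {x. \<forall>w\<in>?D. \<rho> x w \<in> ?D}" unfolding cvec.subspace_def
      by (auto simp: act cvec.subspace_0[OF D] intro: cvec.subspace_add[OF D] cvec.subspace_scale[OF D])
    show "h \<subseteq> {x. \<forall>w\<in>?D. \<rho> x w \<in> ?D}" using st[OF _ dual_of_zero] root_space_zero by auto
    show "root_space h \<alpha> \<subseteq> {x. \<forall>w\<in>?D. \<rho> x w \<in> ?D}" if "\<alpha> \<in> roots h" for \<alpha>
      using st[OF _ rootsD(1)[OF that]] by auto
  qed
  then have "?D = {0} \<or> ?D = UNIV" by (intro submodule_cases[OF D]) auto
  moreover have "?D \<noteq> {0}"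
  proof
    assume 0: "?D = {0}"
    obtain \<mu> v where "\<mu> \<in> dual_of h" "v \<in> weight_space \<rho> h \<mu>" "v \<noteq> 0"
      using weight_exists root_vector_shifts_weight[OF V_mod] cvec.subspace_0 lie_module_simps(3)[OF V_mod]
      by (auto simp: weight_space_def)
    then have "v \<in> ?D" by (intro cvec.span_base) auto
    then show False using 0 \<open>v \<noteq> 0\<close> by auto
  qed
  ultimately show "?D = UNIV" by auto
qed (use h_sub V_mod V_fd in auto)

lemma sl2_integral:
  assumes al: "\<alpha> \<in> roots h" and w: "w \<in> weight_space \<rho> h \<mu>" "w \<noteq> 0" "\<rho> (e \<alpha>) w = 0"
  shows "\<exists>n. \<mu> (coroot B h \<alpha>) = of_nat n \<and> (\<forall>k\<le>n. (\<rho> (f \<alpha>) ^^ k) w \<noteq> 0)"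
proof -
  note rv = root_vectorsD[OF al]
  have "\<exists>n. 2 * \<mu> (bracket (e \<alpha>) (f \<alpha>)) = of_nat n * \<alpha> (bracket (e \<alpha>) (f \<alpha>))
      \<and> (\<forall>k\<le>n. (\<rho> (f \<alpha>) ^^ k) w \<noteq> 0) \<and> (\<rho> (f \<alpha>) ^^ Suc n) w = 0"
    by (rule V.highest_vector_level[OF rv(1,2) _ rootsD(1,2)[OF al] w(1,3,2)])
      (simp add: rv(3) coroot_mem[OF al])
  then show ?thesis unfolding rv(3) root_coroot_self[OF al] by auto
qed

text \<open>Take a weight whose value at a suitable element \<open>t\<close> of \<open>h\<close> has the largest real part.\<close>

lemma highest_vector_exists:
  "\<exists>\<Lambda>\<in>dual_of h. \<exists>v\<in>weight_space \<rho> h \<Lambda>. v \<noteq> 0 \<and>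
     (\<forall>\<alpha>\<in>positive_roots h \<alpha>\<^sub>1 \<alpha>\<^sub>2. \<forall>x\<in>root_space h \<alpha>. \<rho> x v = 0)"
proof -
  let ?P = "{\<mu> \<in> dual_of h. weight_space \<rho> h \<mu> \<noteq> {0}}"
  (* Both simple roots take the value 1 at t. *)
  define t where "t = 3 *\<^sub>C h1 + 5 *\<^sub>C h2"
  have t: "t \<in> h" unfolding t_def by (intro cvec.subspace_add cvec.subspace_scale h_sub h_mem)
  have rt_t: "rt m n t = of_int (m + n)" for m n
  proof -
    have "\<mu> t = 3 * \<mu> h1 + 5 * \<mu> h2" if "\<mu> \<in> dual_of h" for \<mu>
      using dual_ofD(1)[OF that, of "3 *\<^sub>C h1" "5 *\<^sub>C h2"] dual_ofD(2)[OF that] h_mem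
        cvec.subspace_scale[OF h_sub] unfolding t_def by simp
    from this[OF rt_dual, of m n] show ?thesis by (simp add: rt_values)
  qed
  have "finite ?P" "?P \<noteq> {}" using V.finite_weights weight_exists by auto
  then have "Max ((\<lambda>\<mu>. Re (\<mu> t)) ` ?P) \<in> (\<lambda>\<mu>. Re (\<mu> t)) ` ?P" by (intro Max_in) auto
  then obtain \<Lambda> where lam: "\<Lambda> \<in> ?P" "Max ((\<lambda>\<mu>. Re (\<mu> t)) ` ?P) = Re (\<Lambda> t)" by auto
  have max: "Re (\<mu> t) \<le> Re (\<Lambda> t)" if "\<mu> \<in> ?P" for \<mu>
    unfolding lam(2)[symmetric] using \<open>finite ?P\<close> that by (intro Max_ge) auto
  then obtain v where v: "v \<in> weight_space \<rho> h \<Lambda>" "v \<noteq> 0"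
    using lam(1) V.weight_space_0[of \<Lambda>] by auto
  have "\<rho> x v = 0" if al: "\<alpha> \<in> positive_roots h \<alpha>\<^sub>1 \<alpha>\<^sub>2" and x: "x \<in> root_space h \<alpha>" for \<alpha> x
  proof (rule ccontr)
    assume nz: "\<rho> x v \<noteq> 0"
    obtain m n where mn: "\<alpha> = rt m n" "m + n > 0"
      using al unfolding positive_roots_pairs g2_pairs_def by auto
    let ?\<mu> = "\<lambda>t. \<Lambda> t + \<alpha> t"
    have "?\<mu> \<in> dual_of h" using dual_of_add[OF _ rt_dual] lam unfolding mn by auto
    moreover have "\<rho> x v \<in> weight_space \<rho> h ?\<mu>" by (rule V.root_vector_act[OF x v(1)])
    ultimately have "Re (\<Lambda> t + \<alpha> t) \<le> Re (\<Lambda> t)" using nz max[of ?\<mu>] by auto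
    then show False using mn(2) unfolding mn(1) rt_t by simp
  qed
  then show ?thesis
    by (intro bexI[of _ \<Lambda>] bexI[of _ v] conjI ballI) (use lam(1) v in simp_all)
qed

end

subsection \<open>Highest weight modules\<close>

locale g2_highest = g2_simple_module h B e f \<alpha>\<^sub>1 \<alpha>\<^sub>2 \<rho>
  for h :: "'g::lie_algebra set" and B e f \<alpha>\<^sub>1 \<alpha>\<^sub>2 and \<rho> :: "'g \<Rightarrow> 'v::complex_vector \<Rightarrow> 'v" +
  fixes \<Lambda> :: "'g \<Rightarrow> complex" and v :: 'v and a b :: nat
  assumes \<Lambda>: "\<Lambda> \<in> dual_of h" and v: "v \<in> weight_space \<rho> h \<Lambda>" "v \<noteq> 0"
    and v_highest: "\<rho> (e \<alpha>\<^sub>1) v = 0" "\<rho> (e \<alpha>\<^sub>2) v = 0"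
    and \<Lambda>_values: "\<Lambda> (coroot B h \<alpha>\<^sub>1) = of_nat a" "\<Lambda> (coroot B h \<alpha>\<^sub>2) = of_nat b"
begin

lemmas act = lie_module_simps[OF V_mod]

abbreviation "E1 \<equiv> \<rho> e1"
abbreviation "E2 \<equiv> \<rho> e2"
abbreviation "F1 \<equiv> \<rho> f1"
abbreviation "F2 \<equiv> \<rho> f2"

definition W :: "int \<Rightarrow> int \<Rightarrow> 'v set" where
  "W m n = weight_space \<rho> h (below \<Lambda> m n)"

lemma W_subspace: "cvec.subspace (W m n)"
  unfolding W_def by (rule V.weight_space_subspace)

lemma W_mem:
  "x \<in> W m n \<Longrightarrow> E1 x \<in> W (m - 1) n" "x \<in> W m n \<Longrightarrow> E2 x \<in> W m (n - 1)"
  "x \<in> W m n \<Longrightarrow> F1 x \<in> W (m + 1) n" "x \<in> W m n \<Longrightarrow> F2 x \<in> W m (n + 1)"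
  "v \<in> W 0 0" "0 \<in> W m n"
  unfolding W_def using simple_act_below[OF V_mod] v V.weight_space_0 by (simp_all add: below_0)

lemma W_disjoint: "x \<in> W m n \<Longrightarrow> x \<in> W m' n' \<Longrightarrow> x \<noteq> 0 \<Longrightarrow> m = m' \<and> n = n'"
  using V.weight_unique[OF _ _ below_dual[OF \<Lambda>] below_dual[OF \<Lambda>]] below_eq_iff unfolding W_def by metis

lemma W_h: "x \<in> W m n \<Longrightarrow> \<rho> h1 x = (of_nat a - 2 * of_int m + 3 * of_int n) *\<^sub>C x"
  "x \<in> W m n \<Longrightarrow> \<rho> h2 x = (of_nat b + of_int m - 2 * of_int n) *\<^sub>C x"
  using V.weight_spaceD[OF _ h_mem(1), of x "below \<Lambda> m n"] V.weight_spaceD[OF _ h_mem(2), of x "below \<Lambda> m n"]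
    \<Lambda>_values[folded h1_def h2_def] unfolding W_def below_values by (simp_all add: diff_diff_eq2)

lemma ops:
  "E1 (F1 x) = F1 (E1 x) + \<rho> h1 x" "E2 (F2 x) = F2 (E2 x) + \<rho> h2 x"
  "E1 (F2 x) = F2 (E1 x)" "E2 (F1 x) = F1 (E2 x)"
  using lie_module_commute[OF V_mod, of e1 f1 x] lie_module_commute[OF V_mod, of e2 f2 x]
    lie_module_commute[OF V_mod, of e1 f2 x] lie_module_commute[OF V_mod, of e2 f1 x]
  by (simp_all add: simple_brackets act(8))

lemma h_ops:
  "\<rho> h1 (F1 x) = F1 (\<rho> h1 x) - 2 *\<^sub>C F1 x" "\<rho> h1 (F2 x) = F2 (\<rho> h1 x) + 3 *\<^sub>C F2 x"
  "\<rho> h2 (F1 x) = F1 (\<rho> h2 x) + F1 x" "\<rho> h2 (F2 x) = F2 (\<rho> h2 x) - 2 *\<^sub>C F2 x"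
proof -
  have "bracket h1 f1 = (-2) *\<^sub>C f1" "bracket h1 f2 = 3 *\<^sub>C f2" "bracket h2 f1 = f1" "bracket h2 f2 = (-2) *\<^sub>C f2"
    using simple_root_vectors(3,4) h_mem unfolding root_space_def by (simp_all add: rt_values)
  then show "\<rho> h1 (F1 x) = F1 (\<rho> h1 x) - 2 *\<^sub>C F1 x" "\<rho> h1 (F2 x) = F2 (\<rho> h1 x) + 3 *\<^sub>C F2 x"
    "\<rho> h2 (F1 x) = F1 (\<rho> h2 x) + F1 x" "\<rho> h2 (F2 x) = F2 (\<rho> h2 x) - 2 *\<^sub>C F2 x"
    using lie_module_commute[OF V_mod, of h1 f1 x] lie_module_commute[OF V_mod, of h1 f2 x]
      lie_module_commute[OF V_mod, of h2 f1 x] lie_module_commute[OF V_mod, of h2 f2 x]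
    by (simp_all add: act)
qed

lemma v_ops: "E1 v = 0" "E2 v = 0" "\<rho> h1 v = of_nat a *\<^sub>C v" "\<rho> h2 v = of_nat b *\<^sub>C v"
  using v_highest W_h[OF W_mem(5)] by simp_all

lemmas word_simps = ops h_ops v_ops act(1-5)

lemma lowered_span_eq_UNIV:
  assumes x: "x \<in> W m n" "E1 x = 0" "E2 x = 0" "x \<noteq> 0"
  shows "lowered_span \<rho> x = UNIV"
proof -
  have "x \<in> lowered_span \<rho> x"
    unfolding lowered_span_def by (rule cvec.span_base) (auto intro!: image_eqI[of _ _ "[]"])
  moreover have "lowered_span \<rho> x = {0} \<or> lowered_span \<rho> x = UNIV"
    by (rule submodule_cases)
      (use lowered_span_submodule[OF V_mod x(1)[unfolded W_def] x(2,3)] in \<open>auto simp: lowered_span_def cvec.subspace_span\<close>)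
  ultimately show ?thesis using x(4) by auto
qed

text \<open>A singular vector \<open>x\<close> generates the simple module by lowering, and the words of the right
  weight suffice for a given weight space.\<close>

lemma lowered_words_span:
  assumes x: "x \<in> W i j" "E1 x = 0" "E2 x = 0" "x \<noteq> 0" and y: "y \<in> W m n"
  shows "y \<in> cvec.span {word_act F1 F2 l x | l. i + int (count_list l True) = m \<and> j + int (count_list l False) = n}"
    (is "y \<in> cvec.span ?S")
proof -
  let ?R = "range (\<lambda>l. word_act F1 F2 l x)"
  have wt: "word_act F1 F2 l x \<in> W (i + int (count_list l True)) (j + int (count_list l False))" for l
    using word_weight[OF V_mod x(1)[unfolded W_def], of l] unfolding W_def below_below .
  have "y \<in> cvec.span (?R \<inter> weight_space \<rho> h (below \<Lambda> m n))"
  proof (rule V.weight_space_spanned)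
    show "?R \<subseteq> (\<Union>\<nu>\<in>dual_of h. weight_space \<rho> h \<nu>)"
      using wt below_dual[OF \<Lambda>] unfolding W_def by blast
    show "y \<in> cvec.span ?R" using lowered_span_eq_UNIV[OF x] unfolding lowered_span_def by simp
  qed (use below_dual[OF \<Lambda>] y in \<open>auto simp: W_def\<close>)
  moreover have "?R \<inter> weight_space \<rho> h (below \<Lambda> m n) \<subseteq> cvec.span ?S"
  proof
    fix z assume "z \<in> ?R \<inter> weight_space \<rho> h (below \<Lambda> m n)"
    then obtain l where z: "z = word_act F1 F2 l x" "z \<in> W m n" unfolding W_def by auto
    show "z \<in> cvec.span ?S"
    proof (cases "z = 0")
      case True
      then show ?thesis by (simp add: cvec.span_zero)
    next
      case False
      then have "i + int (count_list l True) = m \<and> j + int (count_list l False) = n"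
        using W_disjoint[OF wt[of l], of m n] z by simp
      then show ?thesis using z(1) by (intro cvec.span_base) auto
    qed
  qed
  ultimately show ?thesis using cvec.span_minimal[OF _ cvec.subspace_span] by blast
qed

lemma W_negative: "x \<in> W m n \<Longrightarrow> m < 0 \<or> n < 0 \<Longrightarrow> x = 0"
proof -
  assume x: "x \<in> W m n" and neg: "m < 0 \<or> n < 0"
  have "{word_act F1 F2 l v | l. 0 + int (count_list l True) = m \<and> 0 + int (count_list l False) = n} = {}"
    using neg by auto
  then have "x \<in> cvec.span {}"
    using lowered_words_span[OF W_mem(5) v_highest v(2) x] by metis
  then show "x = 0" by simp
qed

text \<open>A vector of lower weight than \<open>v\<close> that \<open>e1\<close> and \<open>e2\<close> kill would generate a submodule without
  \<open>v\<close>. All relations between lowering words are derived from this fact.\<close>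

lemma singular_zero:
  assumes x: "x \<in> W m n" "E1 x = 0" "E2 x = 0" and mn: "(m, n) \<noteq> (0, 0)"
  shows "x = 0"
proof (rule ccontr)
  assume nz: "x \<noteq> 0"
  then have "\<not> (m < 0 \<or> n < 0)" using W_negative[OF x(1)] by blast
  then have "m \<ge> 0" "n \<ge> 0" by auto
  then have "{word_act F1 F2 l x | l. m + int (count_list l True) = 0 \<and> n + int (count_list l False) = 0} = {}"
    using mn by auto
  then have "v \<in> cvec.span {}" using lowered_words_span[OF x nz W_mem(5)] by metis
  then show False using v(2) by simp
qed

lemma W_00: "x \<in> W 0 0 \<Longrightarrow> \<exists>c. x = c *\<^sub>C v"
proof -
  assume x: "x \<in> W 0 0"
  have "l = []" if "0 + int (count_list l True) = 0 \<and> 0 + int (count_list l False) = 0" for l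
    using that by (cases l) (auto split: if_splits)
  then have "{word_act F1 F2 l v | l. 0 + int (count_list l True) = 0 \<and> 0 + int (count_list l False) = 0} \<subseteq> {v}"
    by force
  from subsetD[OF cvec.span_mono[OF this] lowered_words_span[OF W_mem(5) v_highest v(2) x]]
  show ?thesis by (auto simp: cvec.span_singleton)
qed

lemma W_step:
  assumes x: "x \<in> W m n" and mn: "(m, n) \<noteq> (0, 0)"
  shows "\<exists>y\<in>W (m - 1) n. \<exists>z\<in>W m (n - 1). x = F1 y + F2 z"
proof -
  let ?T = "{u. \<exists>y\<in>W (m - 1) n. \<exists>z\<in>W m (n - 1). u = F1 y + F2 z}"
  have "cvec.subspace ?T" unfolding cvec.subspace_def
  proof (intro conjI ballI allI)
    show "0 \<in> ?T" using W_mem(6) by (auto intro!: bexI[of _ 0] simp: act)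
  next
    fix x y assume "x \<in> ?T" "y \<in> ?T"
    then obtain p q r s where *: "p \<in> W (m - 1) n" "q \<in> W m (n - 1)" "x = F1 p + F2 q"
      "r \<in> W (m - 1) n" "s \<in> W m (n - 1)" "y = F1 r + F2 s" by auto
    show "x + y \<in> ?T" unfolding *(3,6) mem_Collect_eq
      by (intro bexI[of _ "p + r"] bexI[of _ "q + s"])
        (use * in \<open>auto simp: act intro: cvec.subspace_add[OF W_subspace]\<close>)
  next
    fix c x assume "x \<in> ?T"
    then obtain p q where *: "p \<in> W (m - 1) n" "q \<in> W m (n - 1)" "x = F1 p + F2 q" by auto
    show "c *\<^sub>C x \<in> ?T" unfolding *(3) mem_Collect_eq
      by (intro bexI[of _ "c *\<^sub>C p"] bexI[of _ "c *\<^sub>C q"])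
        (use * in \<open>auto simp: act cv_simps intro: cvec.subspace_scale[OF W_subspace]\<close>)
  qed
  moreover have "{word_act F1 F2 l v | l. 0 + int (count_list l True) = m \<and> 0 + int (count_list l False) = n} \<subseteq> ?T"
  proof safe
    fix l assume m: "m = 0 + int (count_list l True)" and n: "n = 0 + int (count_list l False)"
    have wt: "word_act F1 F2 l v \<in> W (int (count_list l True)) (int (count_list l False))" for l
      using word_weight[OF V_mod v(1), of l] unfolding W_def .
    show "\<exists>y\<in>W (0 + int (count_list l True) - 1) (0 + int (count_list l False)).
       \<exists>z\<in>W (0 + int (count_list l True)) (0 + int (count_list l False) - 1). word_act F1 F2 l v = F1 y + F2 z"
    proof (cases l)
      case Nil
      then show ?thesis using mn m n by simp
    next
      case (Cons i k)
      show ?thesis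
      proof (cases i)
        case True
        then show ?thesis unfolding Cons using wt[of k] W_mem(6)
          by (intro bexI[of _ "word_act F1 F2 k v"] bexI[of _ 0]) (simp_all add: act)
      next
        case False
        then show ?thesis unfolding Cons using wt[of k] W_mem(6)
          by (intro bexI[of _ 0] bexI[of _ "word_act F1 F2 k v"]) (simp_all add: act)
      qed
    qed
  qed
  ultimately have "cvec.span {word_act F1 F2 l v | l. 0 + int (count_list l True) = m \<and> 0 + int (count_list l False) = n} \<subseteq> ?T"
    by (rule cvec.span_minimal[rotated])
  then show ?thesis using lowered_words_span[OF W_mem(5) v_highest v(2) x] by auto
qed

lemma zero_weight: "below \<Lambda> (2 * int a + 3 * int b) (int a + 2 * int b) = (\<lambda>_. 0)"
  by (rule dual_of_h_eqI[OF below_dual[OF \<Lambda>] dual_of_zero])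
    (simp_all add: below_values \<Lambda>_values[folded h1_def h2_def])

definition V0 :: "'v set" where "V0 = weight_space \<rho> h (\<lambda>_. 0)"

lemma V0_W: "V0 = W (2 * int a + 3 * int b) (int a + 2 * int b)"
  unfolding V0_def W_def zero_weight ..

lemma trivial_if_zero:
  assumes "a = 0" "b = 0"
  shows "\<not> nontrivial_module \<rho>"
proof -
  have "F1 v = 0"
    by (rule singular_zero[OF W_mem(3)[OF W_mem(5)]]) (simp_all add: word_simps assms)
  moreover have "F2 v = 0"
    by (rule singular_zero[OF W_mem(4)[OF W_mem(5)]]) (simp_all add: word_simps assms)
  ultimately have "{x. \<rho> x v = 0} = UNIV"
    by (intro subalgebra_eq_UNIV) (auto simp: cvec.subspace_def act v_ops assms)
  then have "v \<in> {w. \<forall>x. \<rho> x w = 0}" by auto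
  moreover have "{w. \<forall>x. \<rho> x w = 0} = {0} \<or> {w. \<forall>x. \<rho> x w = 0} = UNIV"
    by (rule submodule_cases) (auto simp: cvec.subspace_def act)
  ultimately have "{w. \<forall>x. \<rho> x w = 0} = UNIV" using v(2) by auto
  then show ?thesis unfolding nontrivial_module_def by auto
qed

subsection \<open>The commuting triples of \<open>\<alpha>\<^sub>1\<close> and \<open>\<theta>\<close> and the parity operator\<close>

abbreviation "E\<theta> \<equiv> \<rho> (e \<theta>)"
abbreviation "F\<theta> \<equiv> \<rho> (f \<theta>)"

lemma \<theta>_vectors: "e \<theta> \<in> root_space h (rt 3 2)" "f \<theta> \<in> root_space h (rt (-3) (-2))"
  using root_vectorsD(1,2)[OF \<theta>_root] rt_uminus[of 3 2] by (simp_all add: \<theta>_def)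

lemma \<theta>_brackets: "bracket (e \<theta>) e1 = 0" "bracket (e \<theta>) f1 = 0" "bracket e1 (f \<theta>) = 0" "bracket (- f1) (f \<theta>) = 0"
proof -
  show "bracket (e \<theta>) e1 = 0"
    by (rule no_root_vectors[OF rt_bracket[OF \<theta>_vectors(1) simple_root_vectors(1)]]) (simp_all add: g2_pairs_def)
  show "bracket (e \<theta>) f1 = 0"
    by (rule no_root_vectors[OF rt_bracket[OF \<theta>_vectors(1) simple_root_vectors(3)]]) (simp_all add: g2_pairs_def)
  show "bracket e1 (f \<theta>) = 0"
    by (rule no_root_vectors[OF rt_bracket[OF simple_root_vectors(1) \<theta>_vectors(2)]]) (simp_all add: g2_pairs_def)
  have "bracket f1 (f \<theta>) = 0"
    by (rule no_root_vectors[OF rt_bracket[OF simple_root_vectors(3) \<theta>_vectors(2)]]) (simp_all add: g2_pairs_def)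
  then show "bracket (- f1) (f \<theta>) = 0" by (simp add: bracket_simps)
qed

lemma \<theta>_ops: "E\<theta> (E1 x) = E1 (E\<theta> x)" "E\<theta> (F1 x) = F1 (E\<theta> x)"
  using lie_module_commute[OF V_mod, of "e \<theta>" e1 x] lie_module_commute[OF V_mod, of "e \<theta>" f1 x]
  by (simp_all add: \<theta>_brackets act(8))

lemma E\<theta>_mem: "x \<in> W m n \<Longrightarrow> E\<theta> x \<in> W (m - 3) (n - 2)"
proof -
  have *: "(\<lambda>t. below \<Lambda> m n t + rt 3 2 t) = below \<Lambda> (m - 3) (n - 2)"
    unfolding below_def rt_def by (auto simp: algebra_simps)
  show "x \<in> W m n \<Longrightarrow> E\<theta> x \<in> W (m - 3) (n - 2)"
    using V.root_vector_act[OF \<theta>_vectors(1), of x "below \<Lambda> m n"] unfolding W_def * .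
qed

lemma F\<theta>_mem: "x \<in> W m n \<Longrightarrow> F\<theta> x \<in> W (m + 3) (n + 2)"
proof -
  have *: "(\<lambda>t. below \<Lambda> m n t + rt (-3) (-2) t) = below \<Lambda> (m + 3) (n + 2)"
    unfolding below_def rt_def by (auto simp: algebra_simps)
  show "x \<in> W m n \<Longrightarrow> F\<theta> x \<in> W (m + 3) (n + 2)"
    using V.root_vector_act[OF \<theta>_vectors(2), of x "below \<Lambda> m n"] unfolding W_def * .
qed

sublocale s1: sl2_module h \<rho> \<alpha>\<^sub>1 e1 f1
  by (rule sl2_module_of_root[OF V.weight_module_axioms base_roots(1)])

sublocale s\<theta>: sl2_module h \<rho> \<theta> "e \<theta>" "f \<theta>"
  by (rule sl2_module_of_root[OF V.weight_module_axioms \<theta>_root])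

text \<open>Since \<open>\<alpha>\<^sub>1\<close> and \<open>\<theta>\<close> are orthogonal, the product of their Weyl operators represents the
  element \<open>-1\<close> of the Weyl group.\<close>

definition parity :: "'v \<Rightarrow> 'v" where
  "parity x = weyl_op \<rho> (e \<theta>) (f \<theta>) (weyl_op \<rho> e1 f1 x)"

text \<open>The automorphism of the Lie algebra that conjugation by the parity operator induces.\<close>

definition flip :: "'g \<Rightarrow> 'g" where
  "flip x = weyl_op bracket (e \<theta>) (f \<theta>) (weyl_op bracket e1 f1 x)"

lemma parity_clinear: "clinear parity"
  unfolding parity_def[abs_def] by (rule clinear_comp[OF s\<theta>.weyl_clinear s1.weyl_clinear])

lemma parity_act: "parity (\<rho> x y) = \<rho> (flip x) (parity y)"
  unfolding parity_def flip_def s1.weyl_act s\<theta>.weyl_act ..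

lemma parity_eq_0: "parity x = 0 \<Longrightarrow> x = 0"
  unfolding parity_def using s1.weyl_eq_0 s\<theta>.weyl_eq_0 by blast

lemma \<theta>_values: "\<theta> h1 = 0" "\<theta> h2 = 1"
  by (simp_all add: \<theta>_def rt_values)

lemma flip_weight:
  assumes mu: "\<mu> \<in> dual_of h"
  shows "(\<lambda>t. (\<mu> t - \<mu> h1 * \<alpha>\<^sub>1 t) - (\<mu> (coroot B h \<theta>) - \<mu> h1 * \<alpha>\<^sub>1 (coroot B h \<theta>)) * \<theta> t) = (\<lambda>t. - \<mu> t)"
    and "(\<lambda>t. \<mu> t - \<mu> h1 * \<alpha>\<^sub>1 t) \<in> dual_of h"
proof -
  have d: "\<nu> (coroot B h \<theta>) = \<nu> h1 + 2 * \<nu> h2" if "\<nu> \<in> dual_of h" for \<nu>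
    unfolding \<theta>_coroot using dual_ofD(1)[OF that h_mem(1), of "2 *\<^sub>C h2"] dual_ofD(2)[OF that h_mem(2)]
      cvec.subspace_scale[OF h_sub h_mem(2)] by simp
  note r1 = rootsD(1)[OF base_roots(1)]
  have m1: "(\<lambda>t. \<nu> t - c * \<alpha> t) \<in> dual_of h" if "\<nu> \<in> dual_of h" "\<alpha> \<in> dual_of h" for \<nu> \<alpha> and c :: complex
    using dual_of_add[OF that(1) dual_of_scale[OF that(2), of "- c"]] by simp
  show "(\<lambda>t. \<mu> t - \<mu> h1 * \<alpha>\<^sub>1 t) \<in> dual_of h" by (rule m1[OF mu r1])
  show "(\<lambda>t. (\<mu> t - \<mu> h1 * \<alpha>\<^sub>1 t) - (\<mu> (coroot B h \<theta>) - \<mu> h1 * \<alpha>\<^sub>1 (coroot B h \<theta>)) * \<theta> t) = (\<lambda>t. - \<mu> t)"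
    by (rule dual_of_h_eqI[OF m1[OF m1[OF mu r1] rootsD(1)[OF \<theta>_root]] dual_of_uminus[OF mu]])
      (simp_all add: d[OF mu] d[OF r1] cartan_matrix \<theta>_values)
qed

lemma parity_weight:
  assumes mu: "\<mu> \<in> dual_of h" and x: "x \<in> weight_space \<rho> h \<mu>"
  shows "parity x \<in> weight_space \<rho> h (\<lambda>t. - \<mu> t)"
  using s\<theta>.weyl_weight_space[OF flip_weight(2)[OF mu] s1.weyl_weight_space[OF mu x, folded h1_def, unfolded simple_brackets]]
    flip_weight(1)[OF mu]
  unfolding parity_def[symmetric] root_vectorsD(3)[OF \<theta>_root] by simp

sublocale a1: sl2_module h bracket \<alpha>\<^sub>1 e1 f1
  by (rule sl2_module_of_root[OF ad.weight_module_axioms base_roots(1)])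

sublocale a\<theta>: sl2_module h bracket \<theta> "e \<theta>" "f \<theta>"
  by (rule sl2_module_of_root[OF ad.weight_module_axioms \<theta>_root])

lemma flip_bracket: "flip (bracket x y) = bracket (flip x) (flip y)"
  unfolding flip_def a1.weyl_act a\<theta>.weyl_act ..

lemma flip_root_space:
  assumes mu: "\<mu> \<in> dual_of h" and x: "x \<in> root_space h \<mu>"
  shows "flip x \<in> root_space h (\<lambda>t. - \<mu> t)"
  using a\<theta>.weyl_weight_space[OF flip_weight(2)[OF mu]
      a1.weyl_weight_space[OF mu x[unfolded root_space_adjoint], folded h1_def, unfolded simple_brackets]]
    flip_weight(1)[OF mu]
  unfolding flip_def[symmetric] root_vectorsD(3)[OF \<theta>_root] root_space_adjoint by simp

lemma flip_cartan:
  assumes t: "t \<in> h"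
  shows "flip t = - t"
proof -
  define s where "s = weyl_op bracket e1 f1 t"
  have s: "s = t - \<alpha>\<^sub>1 t *\<^sub>C h1" unfolding s_def a1.weyl_h[OF t] simple_brackets ..
  have sh: "s \<in> h" unfolding s_def by (rule a1.weyl_h_involutive(1)[OF t])
  have f: "flip t = s - \<theta> s *\<^sub>C (h1 + 2 *\<^sub>C h2)"
    unfolding flip_def s_def[symmetric] a\<theta>.weyl_h[OF sh] root_vectorsD(3)[OF \<theta>_root] \<theta>_coroot ..
  have fh: "flip t \<in> h" unfolding flip_def s_def[symmetric] by (rule a\<theta>.weyl_h_involutive(1)[OF sh])
  have lin: "\<mu> (x - c *\<^sub>C y) = \<mu> x - c * \<mu> y" if "\<mu> \<in> dual_of h" "x \<in> h" "y \<in> h" for \<mu> x y c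
    using dual_ofD(1)[OF that(1,2), of "(- c) *\<^sub>C y"] dual_ofD(2)[OF that(1,3), of "- c"]
      cvec.subspace_scale[OF h_sub that(3), of "- c"] by simp
  have hh: "h1 + 2 *\<^sub>C h2 \<in> h" by (intro cvec.subspace_add cvec.subspace_scale h_sub h_mem)
  have hv: "\<mu> (h1 + 2 *\<^sub>C h2) = \<mu> h1 + 2 * \<mu> h2" if "\<mu> \<in> dual_of h" for \<mu>
    using dual_ofD(1)[OF that h_mem(1), of "2 *\<^sub>C h2"] dual_ofD(2)[OF that h_mem(2)]
      cvec.subspace_scale[OF h_sub h_mem(2)] by simp
  have r: "\<alpha>\<^sub>1 \<in> dual_of h" "\<alpha>\<^sub>2 \<in> dual_of h" using base_roots rootsD(1) by auto
  have sv: "\<alpha>\<^sub>1 s = - \<alpha>\<^sub>1 t" "\<alpha>\<^sub>2 s = \<alpha>\<^sub>2 t + 3 * \<alpha>\<^sub>1 t"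
    unfolding s lin[OF r(1) t h_mem(1)] lin[OF r(2) t h_mem(1)] cartan_matrix by simp_all
  have \<theta>s: "\<theta> s = 3 * \<alpha>\<^sub>1 t + 2 * \<alpha>\<^sub>2 t" unfolding \<theta>_def rt_def sv by simp
  have neg: "\<mu> (- t) = - \<mu> t" if "\<mu> \<in> dual_of h" for \<mu>
    using dual_ofD(2)[OF that t, of "-1"] by simp
  show ?thesis
  proof (rule cartan_eqI[OF fh cvec.subspace_neg[OF h_sub t]])
    show "\<alpha>\<^sub>1 (flip t) = \<alpha>\<^sub>1 (- t)" "\<alpha>\<^sub>2 (flip t) = \<alpha>\<^sub>2 (- t)"
      unfolding f lin[OF r(1) sh hh] lin[OF r(2) sh hh] hv[OF r(1)] hv[OF r(2)] cartan_matrix sv \<theta>s neg[OF r(1)] neg[OF r(2)]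
      by simp_all
  qed
qed

definition kap :: "('g \<Rightarrow> complex) \<Rightarrow> 'v \<Rightarrow> 'v" where
  "kap \<alpha> x = \<rho> (e \<alpha>) (\<rho> (f \<alpha>) x) + \<rho> (f \<alpha>) (\<rho> (e \<alpha>) x)"

text \<open>Conjugation by the parity operator exchanges the lines of \<open>e \<alpha>\<close> and \<open>f \<alpha>\<close>, with factors whose
  product is \<open>1\<close> because it maps the coroot to its negative.\<close>

lemma parity_kap:
  assumes al: "\<alpha> \<in> roots h"
  shows "parity (kap \<alpha> x) = kap \<alpha> (parity x)"
proof -
  note rv = root_vectorsD[OF al]
  obtain c where c: "flip (e \<alpha>) = c *\<^sub>C f \<alpha>"
    using opposite_root_space_line[OF al flip_root_space[OF rootsD(1)[OF al] rv(1)]] by auto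
  have "flip (f \<alpha>) \<in> root_space h \<alpha>"
    using flip_root_space[OF dual_of_uminus[OF rootsD(1)[OF al]] rv(2)] by simp
  then obtain d where d: "flip (f \<alpha>) = d *\<^sub>C e \<alpha>" using root_space_line[OF al] by auto
  have "- coroot B h \<alpha> = flip (bracket (e \<alpha>) (f \<alpha>))" unfolding rv(3) flip_cartan[OF coroot_mem[OF al]] ..
  also have "\<dots> = - ((c * d) *\<^sub>C coroot B h \<alpha>)"
    unfolding flip_bracket c d by (simp add: bracket_simps rv(4))
  finally have "(1 - c * d) *\<^sub>C coroot B h \<alpha> = 0" by (simp add: cvec.scale_left_diff_distrib)
  moreover have "coroot B h \<alpha> \<noteq> 0"
    using root_coroot_self[OF al] dual_ofD(2)[OF rootsD(1)[OF al], of 0 0] cvec.subspace_0[OF h_sub] by auto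
  ultimately have cd: "c * d = 1" by simp
  have "parity (kap \<alpha> x) = \<rho> (c *\<^sub>C f \<alpha>) (\<rho> (d *\<^sub>C e \<alpha>) (parity x)) + \<rho> (d *\<^sub>C e \<alpha>) (\<rho> (c *\<^sub>C f \<alpha>) (parity x))"
    unfolding kap_def clinearD(1)[OF parity_clinear] parity_act c d ..
  also have "\<dots> = (c * d) *\<^sub>C kap \<alpha> (parity x)"
    unfolding kap_def by (simp add: act cv_simps mult.commute add.commute)
  finally show ?thesis unfolding cd by simp
qed

lemma kap_clinear: "clinear (kap \<alpha>)"
  by (rule clinearI) (simp_all add: kap_def act cv_simps add.commute add.left_commute)

text \<open>Let \<open>w\<close> be singular for the commuting triples of \<open>\<alpha>\<^sub>1\<close> and \<open>\<theta>\<close>, of weights \<open>2 j\<close> and \<open>2 i\<close>. It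
  generates a simple module of the product of the two triples, whose zero weight vector is
  \<open>f\<^sub>\<theta>\<^sup>i f\<^sub>1\<^sup>j w\<close>. The Weyl operators act on it by \<open>(-1)\<^sup>i\<close> and \<open>(-1)\<^sup>j\<close>.\<close>

lemma parity_middle:
  assumes w: "w \<in> W m n" "E1 w = 0" "E\<theta> w = 0" "w \<noteq> 0"
    and j: "int a - 2 * m + 3 * n = 2 * int j" and i: "int a + 2 * int b - n = 2 * int i"
  shows "\<exists>u\<in>V0. u \<noteq> 0 \<and> parity u = (-1) ^ (i + j) *\<^sub>C u"
proof -
  have b1: "below \<Lambda> m n h1 = 2 * of_nat j"
  proof -
    have "below \<Lambda> m n h1 = of_int (int a - 2 * m + 3 * n)"
      unfolding below_values \<Lambda>_values[folded h1_def] by simp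
    then show ?thesis unfolding j by simp
  qed
  define w1 where "w1 = (F1 ^^ j) w"
  have w1: "w1 \<in> W (m + int j) n"
  proof -
    have "(F1 ^^ k) w \<in> W (m + int k) n" for k
    proof (induction k)
      case (Suc k)
      have eq: "m + int (Suc k) = m + int k + 1" by simp
      show ?case unfolding eq using W_mem(3)[OF Suc] by simp
    qed (simp add: w(1))
    then show ?thesis unfolding w1_def .
  qed
  have bc: "below \<Lambda> (m + int j) n (coroot B h \<theta>) = 2 * of_nat i"
  proof -
    have "below \<Lambda> (m + int j) n (coroot B h \<theta>) = below \<Lambda> (m + int j) n h1 + 2 * below \<Lambda> (m + int j) n h2"
      unfolding \<theta>_coroot using dual_ofD(1)[OF below_dual[OF \<Lambda>] h_mem(1), of "2 *\<^sub>C h2"]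
        dual_ofD(2)[OF below_dual[OF \<Lambda>] h_mem(2)] cvec.subspace_scale[OF h_sub h_mem(2)] by simp
    also have "\<dots> = of_int (int a + 2 * int b - n)"
      unfolding below_values \<Lambda>_values[folded h1_def h2_def] by simp
    finally show ?thesis unfolding i by simp
  qed
  obtain p where p: "below \<Lambda> m n h1 = of_nat p" "\<forall>k\<le>p. (F1 ^^ k) w \<noteq> 0"
    using sl2_integral[OF base_roots(1) w(1)[unfolded W_def] w(4,2)] unfolding h1_def by auto
  have "of_nat p = (of_nat (2 * j) :: complex)" using p(1) unfolding b1 by simp
  then have "p = 2 * j" unfolding of_nat_eq_iff .
  then have w1nz: "w1 \<noteq> 0" using p(2) unfolding w1_def by simp
  have E\<theta>w1: "E\<theta> w1 = 0"
  proof -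
    have "E\<theta> ((F1 ^^ k) w) = 0" for k by (induction k) (simp_all add: w(3) \<theta>_ops act)
    then show ?thesis unfolding w1_def .
  qed
  define u where "u = (F\<theta> ^^ i) w1"
  obtain q where q: "below \<Lambda> (m + int j) n (coroot B h \<theta>) = of_nat q" "\<forall>k\<le>q. (F\<theta> ^^ k) w1 \<noteq> 0"
    using sl2_integral[OF \<theta>_root w1[unfolded W_def] w1nz E\<theta>w1] by auto
  have "of_nat q = (of_nat (2 * i) :: complex)" using q(1) unfolding bc by simp
  then have "q = 2 * i" unfolding of_nat_eq_iff .
  then have unz: "u \<noteq> 0" using q(2) unfolding u_def by simp
  have u: "u \<in> V0"
  proof -
    have "(F\<theta> ^^ k) w1 \<in> W (m + int j + 3 * int k) (n + 2 * int k)" for k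
    proof (induction k)
      case (Suc k)
      have eq: "m + int j + 3 * int (Suc k) = m + int j + 3 * int k + 3" "n + 2 * int (Suc k) = n + 2 * int k + 2" by simp_all
      show ?case unfolding eq using F\<theta>_mem[OF Suc] by simp
    qed (simp add: w1)
    then have "u \<in> W (m + int j + 3 * int i) (n + 2 * int i)" unfolding u_def .
    moreover have "m + int j + 3 * int i = 2 * int a + 3 * int b" "n + 2 * int i = int a + 2 * int b"
      using i j by linarith+
    ultimately show ?thesis unfolding V0_W by simp
  qed
  (* The triples commute, so the first Weyl operator passes through the powers of f \<theta>. *)
  have fix\<theta>: "weyl_op bracket e1 f1 (f \<theta>) = f \<theta>"
  proof -
    obtain N where N: "\<forall>v. (bracket e1 ^^ N) v = 0" "\<forall>v. (bracket (- f1) ^^ N) v = 0" by (rule a1.nilpotent)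
    show ?thesis unfolding weyl_op_def
      by (simp add: exp_nil_fixed[OF a1.ad_lin N(1) \<theta>_brackets(3)] exp_nil_fixed[OF a1.ad_lin N(2) \<theta>_brackets(4)])
  qed
  have "weyl_op \<rho> e1 f1 ((F\<theta> ^^ k) w1) = (F\<theta> ^^ k) (weyl_op \<rho> e1 f1 w1)" for k
    by (induction k) (simp_all add: s1.weyl_act fix\<theta>)
  then have "weyl_op \<rho> e1 f1 u = (F\<theta> ^^ i) (weyl_op \<rho> e1 f1 w1)" unfolding u_def .
  also have "weyl_op \<rho> e1 f1 w1 = (-1) ^ j *\<^sub>C w1"
    unfolding w1_def by (rule s1.weyl_middle[OF w(1)[unfolded W_def] w(2)]) (simp add: simple_brackets b1)
  also have "(F\<theta> ^^ i) ((-1) ^ j *\<^sub>C w1) = (-1) ^ j *\<^sub>C u"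
    unfolding u_def by (rule clinearD(2)[OF V.clinear_act_funpow])
  finally have "parity u = weyl_op \<rho> (e \<theta>) (f \<theta>) ((-1) ^ j *\<^sub>C u)" unfolding parity_def by simp
  also have "\<dots> = (-1) ^ j *\<^sub>C weyl_op \<rho> (e \<theta>) (f \<theta>) u" by (rule clinearD(2)[OF s\<theta>.weyl_clinear])
  also have "weyl_op \<rho> (e \<theta>) (f \<theta>) u = (-1) ^ i *\<^sub>C u"
    unfolding u_def by (rule s\<theta>.weyl_middle[OF w1[unfolded W_def] E\<theta>w1]) (simp add: root_vectorsD(3)[OF \<theta>_root] bc)
  finally have "parity u = (-1) ^ (i + j) *\<^sub>C u" by (simp add: power_add mult.commute)
  then show ?thesis using u unz by auto
qed

subsection \<open>Invariant subspaces of the zero weight space\<close>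

lemma uea_act_kappa:
  "uea_act \<rho> (kappa B h e f \<alpha>) x = (dual_form B h \<alpha> \<alpha> / 2) *\<^sub>C kap \<alpha> x"
  unfolding kappa_def kap_def by (simp add: uea_act_simps[OF V_mod])

text \<open>The elements of the enveloping algebra that preserve \<open>U\<close> form a subalgebra.\<close>

lemma invariant_subspaceI:
  assumes U: "cvec.subspace U" "U \<subseteq> V0" and kap: "\<And>\<alpha> x. \<alpha> \<in> roots h \<Longrightarrow> x \<in> U \<Longrightarrow> kap \<alpha> x \<in> U"
  shows "invariant_subspace (casimir_algebra B h e f) \<rho> U"
proof -
  let ?A = "{c. \<forall>w\<in>U. uea_act \<rho> c w \<in> U}"
  have z: "uea_act \<rho> 0 w = 0" for w using uea_act_simps(5)[OF V_mod, of 0 0 w] by simp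
  have "unital_subalgebra ?A"
    unfolding unital_subalgebra_def cvec.subspace_def
    by (auto simp: uea_act_simps[OF V_mod] z cvec.subspace_0[OF U(1)] intro: cvec.subspace_add[OF U(1)] cvec.subspace_scale[OF U(1)])
  moreover have "kappa B h e f ` roots h \<union> \<iota> ` h \<subseteq> ?A"
  proof safe
    fix \<alpha> w assume "\<alpha> \<in> roots h" "w \<in> U"
    then show "uea_act \<rho> (kappa B h e f \<alpha>) w \<in> U"
      unfolding uea_act_kappa by (intro cvec.subspace_scale[OF U(1)] kap)
  next
    fix t w assume "t \<in> h" "w \<in> U"
    then have "\<rho> t w = 0" using U(2) unfolding V0_def weight_space_def by auto
    then show "uea_act \<rho> (\<iota> t) w \<in> U" by (simp add: uea_act_simps[OF V_mod] cvec.subspace_0[OF U(1)])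
  qed
  ultimately have "casimir_algebra B h e f \<subseteq> ?A"
    unfolding casimir_algebra_def generated_subalgebra_def by (intro Inter_lower) simp
  then show ?thesis unfolding invariant_subspace_def using U(1) by auto
qed

lemma invariant_subspaceD:
  assumes U: "invariant_subspace (casimir_algebra B h e f) \<rho> U"
  shows "cvec.subspace U" "\<alpha> \<in> roots h \<Longrightarrow> x \<in> U \<Longrightarrow> kap \<alpha> x \<in> U"
proof -
  show sub: "cvec.subspace U" using U unfolding invariant_subspace_def by auto
  assume al: "\<alpha> \<in> roots h" and x: "x \<in> U"
  have "kappa B h e f \<alpha> \<in> casimir_algebra B h e f"
    unfolding casimir_algebra_def generated_subalgebra_def using al by auto
  then have "uea_act \<rho> (kappa B h e f \<alpha>) x \<in> U" using U x unfolding invariant_subspace_def by auto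
  then have "(2 / dual_form B h \<alpha> \<alpha>) *\<^sub>C uea_act \<rho> (kappa B h e f \<alpha>) x \<in> U"
    by (rule cvec.subspace_scale[OF sub])
  then show "kap \<alpha> x \<in> U" unfolding uea_act_kappa using dual_form_nonzero[OF al] by simp
qed

lemma V0_subspace: "cvec.subspace V0"
  unfolding V0_def by (rule V.weight_space_subspace)

lemma kap_V0:
  assumes al: "\<alpha> \<in> roots h" and x: "x \<in> V0"
  shows "kap \<alpha> x \<in> V0"
proof -
  note rv = root_vectorsD[OF al]
  have 1: "\<rho> (e \<alpha>) (\<rho> (f \<alpha>) x) \<in> V0"
    using V.root_vector_act[OF rv(1) V.root_vector_act[OF rv(2) x[unfolded V0_def]]] unfolding V0_def by simp
  have 2: "\<rho> (f \<alpha>) (\<rho> (e \<alpha>) x) \<in> V0"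
    using V.root_vector_act[OF rv(2) V.root_vector_act[OF rv(1) x[unfolded V0_def]]] unfolding V0_def by simp
  show ?thesis unfolding kap_def by (rule cvec.subspace_add[OF V0_subspace 1 2])
qed

lemma V0_invariant: "invariant_subspace (casimir_algebra B h e f) \<rho> V0"
  by (rule invariant_subspaceI[OF V0_subspace]) (use kap_V0 in auto)

text \<open>The parity operator commutes with the elements \<open>\<kappa>\<close> on the zero weight space, so each of its
  eigenspaces there is invariant.\<close>

lemma not_irreducible:
  assumes u: "u \<in> V0" "u \<noteq> 0" "parity u = (-1) ^ i *\<^sub>C u"
    and u': "u' \<in> V0" "u' \<noteq> 0" "parity u' = (-1) ^ Suc i *\<^sub>C u'"
  shows "\<not> irreducible_under (casimir_algebra B h e f) \<rho> V0"
proof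
  assume irr: "irreducible_under (casimir_algebra B h e f) \<rho> V0"
  let ?U = "V0 \<inter> {x. parity x = (-1) ^ i *\<^sub>C x}"
  have "cvec.subspace ?U"
    by (rule cvec.subspace_inter[OF V0_subspace eigenspace_subspace[OF parity_clinear]])
  then have "invariant_subspace (casimir_algebra B h e f) \<rho> ?U"
    by (rule invariant_subspaceI) (auto simp: kap_V0 parity_kap clinearD(2)[OF kap_clinear])
  then have "?U = {0} \<or> ?U = V0" using irr unfolding irreducible_under_def by auto
  then have "?U = V0" using u by auto
  then have "parity u' = (-1) ^ i *\<^sub>C u'" using u'(1) by auto
  then have "((-1) ^ i - (-1) ^ Suc i) *\<^sub>C u' = 0" using u'(3) by (simp only: cvec.scale_left_diff_distrib) simp
  then show False using u'(2) by simp
qed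

end

subsection \<open>Reducible zero weight spaces\<close>

text \<open>Cramer's rule for two coefficients, with the equations read off along nonzero vectors.\<close>

lemma independent_pair:
  fixes s t p1 q1 p2 q2 :: complex
  assumes "(s * p1 + t * q1) *\<^sub>C x = 0" "(s * p2 + t * q2) *\<^sub>C y = 0" "x \<noteq> 0" "y \<noteq> 0"
    and "p1 * q2 - p2 * q1 \<noteq> 0"
  shows "s = 0 \<and> t = 0"
proof -
  have "s * (p1 * q2 - p2 * q1) = (s * p1 + t * q1) * q2 - (s * p2 + t * q2) * q1" by (simp add: algebra_simps)
  moreover have "t * (p1 * q2 - p2 * q1) = (s * p2 + t * q2) * p1 - (s * p1 + t * q1) * p2" by (simp add: algebra_simps)
  ultimately show ?thesis using assms by auto
qed

context g2_highest
begin

lemma reducible_if_parities_differ: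
  assumes w: "w \<in> W m n" "E1 w = 0" "E\<theta> w = 0" "w \<noteq> 0"
    and ji: "int a - 2 * m + 3 * n = 2 * int j" "int a + 2 * int b - n = 2 * int i"
    and w': "w' \<in> W m' n'" "E1 w' = 0" "E\<theta> w' = 0" "w' \<noteq> 0"
    and ji': "int a - 2 * m' + 3 * n' = 2 * int j'" "int a + 2 * int b - n' = 2 * int i'"
    and "i' + j' = Suc (i + j)"
  shows "\<not> irreducible_under (casimir_algebra B h e f) \<rho> V0"
  using parity_middle[OF w ji] parity_middle[OF w' ji'] not_irreducible assms(13) by metis

lemma E\<theta>_zero: "w \<in> W m n \<Longrightarrow> m < 3 \<or> n < 2 \<Longrightarrow> E\<theta> w = 0"
  by (rule W_negative[OF E\<theta>_mem]) auto

lemma W_linear: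
  "x \<in> W m n \<Longrightarrow> y \<in> W m n \<Longrightarrow> x + y \<in> W m n" "x \<in> W m n \<Longrightarrow> y \<in> W m n \<Longrightarrow> x - y \<in> W m n"
  "x \<in> W m n \<Longrightarrow> c *\<^sub>C x \<in> W m n"
  using W_subspace by (auto intro: cvec.subspace_add cvec.subspace_diff cvec.subspace_scale)

lemma W_F: "x \<in> W (m - 1) n \<Longrightarrow> F1 x \<in> W m n" "x \<in> W m (n - 1) \<Longrightarrow> F2 x \<in> W m n"
  using W_mem(3)[of x "m - 1" n] W_mem(4)[of x m "n - 1"] by simp_all

lemmas W_intros = W_linear W_F W_mem(5)

lemma nonzero_if_raised:
  assumes "\<rho> x w = c *\<^sub>C u" "c \<noteq> 0" "u \<noteq> 0"
  shows "w \<noteq> 0"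
  using assms by (auto simp: act)

lemma F1_v_nonzero: "a \<ge> 1 \<Longrightarrow> F1 v \<noteq> 0"
  by (rule nonzero_if_raised[of e1 _ "of_nat a" v]) (simp_all add: word_simps v)

lemma F2_v_nonzero: "b \<ge> 1 \<Longrightarrow> F2 v \<noteq> 0"
  by (rule nonzero_if_raised[of e2 _ "of_nat b" v]) (simp_all add: word_simps v)

lemma F1_v_zero: "a = 0 \<Longrightarrow> F1 v = 0"
  by (rule singular_zero[of _ 1 0]) (auto intro!: W_intros simp: word_simps)

lemma F2_v_zero: "b = 0 \<Longrightarrow> F2 v = 0"
  by (rule singular_zero[of _ 0 1]) (auto intro!: W_intros simp: word_simps)

lemma weight_sum_nonzero: "of_nat a + 3 * of_nat b + 3 \<noteq> (0 :: complex)"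
proof -
  have eq: "of_nat a + 3 * of_nat b + 3 = (of_nat (a + 3 * b + 3) :: complex)" by simp
  show ?thesis unfolding eq of_nat_eq_0_iff by simp
qed

text \<open>For odd \<open>a\<close> the vector \<open>v\<close> has odd \<open>\<alpha>\<^sub>1\<close>-weight, and one passes to \<open>f2 v\<close> and to the vector of weight
  \<open>\<Lambda> - \<alpha>\<^sub>1 - \<alpha>\<^sub>2\<close> that \<open>e1\<close> kills. The parities of the two are opposite. Raising by \<open>\<theta>\<close>
  leads outside the weights below \<open>\<Lambda>\<close>, so \<open>e\<^sub>\<theta>\<close> kills both.\<close>

lemma reducible_odd:
  assumes "odd a" "b \<ge> 1"
  shows "\<not> irreducible_under (casimir_algebra B h e f) \<rho> V0"
proof -
  obtain k where k: "a = 2 * k + 1" using assms(1) by (auto elim: oddE)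
  define A where "A = (of_nat a :: complex)"
  define C where "C = (of_nat b :: complex)"
  note nf = word_simps A_def[symmetric] C_def[symmetric]
  define w where "w = A *\<^sub>C F1 (F2 v) - (A + 3) *\<^sub>C F2 (F1 v)"
  have "E1 w = 0"
    unfolding w_def by (rule functional_separates) (simp add: nf; simp add: algebra_simps)
  moreover have E2: "E2 w = (- (A + 3 * C + 3)) *\<^sub>C F1 v"
    unfolding w_def by (rule functional_separates) (simp add: nf; simp add: algebra_simps)
  have "- (A + 3 * C + 3) \<noteq> 0"
    using weight_sum_nonzero unfolding A_def C_def neg_equal_0_iff_equal .
  then have "w \<noteq> 0" using nonzero_if_raised[OF E2] F1_v_nonzero k by auto
  moreover have wW: "w \<in> W 1 1" unfolding w_def by (intro W_intros) (simp_all add: W_mem(5))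
  moreover have "F2 v \<in> W 0 1" by (intro W_intros) (simp_all add: W_mem(5))
  moreover have "E1 (F2 v) = 0" by (simp add: word_simps)
  ultimately show ?thesis
    by (intro reducible_if_parities_differ[of w 1 1 "k + 1" "k + b" "F2 v" 0 1 "k + 2" "k + b"])
      (use k assms F2_v_nonzero E\<theta>_zero in auto)
qed

text \<open>As \<open>f2 v = 0\<close> here, the comparison takes place one step lower: between \<open>f2 f1 v\<close> and the vector
  of weight \<open>\<Lambda> - 2 \<alpha>\<^sub>1 - \<alpha>\<^sub>2\<close> that \<open>e1\<close> kills. The latter requires \<open>f1\<^sup>2 v \<noteq> 0\<close>.\<close>

lemma reducible_odd_short:
  assumes "odd a" "a \<ge> 3" "b = 0"
  shows "\<not> irreducible_under (casimir_algebra B h e f) \<rho> V0"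
proof -
  obtain k where k: "a = 2 * k + 1" using assms(1) by (auto elim: oddE)
  define A where "A = (of_nat a :: complex)"
  note nf = word_simps A_def[symmetric] F2_v_zero[OF assms(3)] assms(3)
  define w where "w = (2 * (A - 1)) *\<^sub>C F1 (F2 (F1 v)) - (A + 1) *\<^sub>C F2 (F1 (F1 v))"
  have "E1 w = 0"
    unfolding w_def by (rule functional_separates) (simp add: nf; simp add: algebra_simps)
  moreover have E2: "E2 w = (- 4) *\<^sub>C F1 (F1 v)"
    unfolding w_def by (rule functional_separates) (simp add: nf; simp add: algebra_simps)
  have "E1 (F1 (F1 v)) = (2 * (A - 1)) *\<^sub>C F1 v"
    by (rule functional_separates) (simp add: nf; simp add: algebra_simps)
  then have "F1 (F1 v) \<noteq> 0"
    by (rule nonzero_if_raised) (use assms F1_v_nonzero in \<open>auto simp: A_def\<close>)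
  then have "w \<noteq> 0" using nonzero_if_raised[OF E2] by simp
  moreover have wW: "w \<in> W 2 1" unfolding w_def by (intro W_intros) (simp_all add: W_mem(5))
  moreover have "F2 (F1 v) \<in> W 1 1" by (intro W_intros) (simp_all add: W_mem(5))
  moreover have "E1 (F2 (F1 v)) = 0" by (simp add: nf)
  moreover have "F2 (F1 v) \<noteq> 0"
    by (rule nonzero_if_raised[of e2 _ 1 "F1 v"]) (use F1_v_nonzero assms in \<open>simp_all add: nf\<close>)
  ultimately show ?thesis
    by (intro reducible_if_parities_differ[of w 2 1 k k "F2 (F1 v)" 1 1 "k + 1" k])
      (use k assms E\<theta>_zero in auto)
qed

text \<open>The comparison is between \<open>v\<close> and the vector of weight \<open>\<Lambda> - \<alpha>\<^sub>1 - 2 \<alpha>\<^sub>2\<close> that \<open>e1\<close> kills.\<close>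

lemma reducible_even_mixed:
  assumes "even a" "a \<ge> 2" "b \<ge> 1"
  shows "\<not> irreducible_under (casimir_algebra B h e f) \<rho> V0"
proof -
  obtain k where k: "a = 2 * k" using assms(1) by (auto elim: evenE)
  define A where "A = (of_nat a :: complex)"
  define C where "C = (of_nat b :: complex)"
  note nf = word_simps A_def[symmetric] C_def[symmetric]
  define w where "w = (A + 3) *\<^sub>C F1 (F2 (F2 v)) - (A + 6) *\<^sub>C F2 (F1 (F2 v))"
  have "E1 w = 0"
    unfolding w_def by (rule functional_separates) (simp add: nf; simp add: algebra_simps)
  moreover have E2: "E2 (E2 w) = (- (2 * C * (A + 3 * C + 3))) *\<^sub>C F1 v"
    unfolding w_def by (rule functional_separates) (simp add: nf; simp add: algebra_simps)
  have "- (2 * C * (A + 3 * C + 3)) \<noteq> 0"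
    using weight_sum_nonzero assms(3) unfolding A_def C_def by simp
  then have "E2 w \<noteq> 0" using nonzero_if_raised[OF E2] F1_v_nonzero assms by auto
  then have "w \<noteq> 0" by (auto simp: act)
  moreover have wW: "w \<in> W 1 2" unfolding w_def by (intro W_intros) (simp_all add: W_mem(5))
  ultimately show ?thesis
    by (intro reducible_if_parities_differ[of v 0 0 k "k + b" w 1 2 "k + 2" "k + b - 1"])
      (use k assms E\<theta>_zero v v_ops W_mem(5) \<open>E1 w = 0\<close> in auto)
qed

text \<open>A dimension count: two independent vectors that \<open>e1\<close> kills and that \<open>e\<^sub>\<theta>\<close> maps into one line.\<close>

lemma kernel_of_E\<theta>:
  assumes p: "p \<in> W m n" "E1 p = 0" "E\<theta> p = x *\<^sub>C z" and q: "q \<in> W m n" "E1 q = 0" "E\<theta> q = y *\<^sub>C z"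
    and ind: "\<And>s t. s *\<^sub>C p + t *\<^sub>C q = 0 \<Longrightarrow> s = 0 \<and> t = 0"
  shows "\<exists>w\<in>W m n. E1 w = 0 \<and> E\<theta> w = 0 \<and> w \<noteq> 0"
proof (cases "x = 0")
  case True
  then have "E\<theta> p = 0" using p by simp
  moreover have "p \<noteq> 0" using ind[of 1 0] by auto
  ultimately show ?thesis using p by auto
next
  case False
  let ?w = "y *\<^sub>C p + (- x) *\<^sub>C q"
  have "?w \<in> W m n" by (intro W_linear p q)
  moreover have "E1 ?w = 0" "E\<theta> ?w = 0" using p q by (simp_all only: act) (simp_all add: mult.commute)
  moreover have "?w \<noteq> 0" using ind[of y "- x"] False by auto
  ultimately show ?thesis by auto
qed

text \<open>For even \<open>a\<close> the vector \<open>v\<close> gives parity \<open>1\<close>, and a singular vector of weight \<open>\<Lambda> - \<theta>\<close> gives parity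
  \<open>-1\<close>. In that weight \<open>e\<^sub>\<theta>\<close> takes values in the line of \<open>v\<close>, and \<open>e1\<close> kills the two vectors \<open>p\<close> and \<open>q\<close>, which
  solve the linear equation \<open>e1 x = 0\<close> among the words of this weight. Raising \<open>p\<close> and \<open>q\<close> in two
  ways to lines gives a determinant with the factors \<open>a - 1\<close> and \<open>a - 2\<close>; \<open>p\<close> and \<open>q\<close> are independent
  as soon as it does not vanish.\<close>

lemma second_parity_short:
  assumes "a \<ge> 3" "b = 0"
  shows "\<exists>w\<in>W 3 2. E1 w = 0 \<and> E\<theta> w = 0 \<and> w \<noteq> 0"
proof -
  define A where "A = (of_nat a :: complex)"
  note nf = word_simps A_def[symmetric] F2_v_zero[OF assms(2)] assms(2)
  define p where "p = (A ^ 2 + A) *\<^sub>C (F1 (F1 (F2 (F2 (F1 v))))) + (- 2 * A ^ 2 - 6 * A) *\<^sub>C (F1 (F2 (F1 (F2 (F1 v))))) + (A ^ 2 + 5 * A + 6) *\<^sub>C (F2 (F1 (F1 (F2 (F1 v)))))"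
  define q where "q = (2 * A ^ 2 - 4 * A + 2) *\<^sub>C (F1 (F2 (F1 (F2 (F1 v))))) + (- 1 * A ^ 2 + 1) *\<^sub>C (F1 (F2 (F2 (F1 (F1 v))))) + (- 2 * A ^ 2 - 2 * A + 4) *\<^sub>C (F2 (F1 (F1 (F2 (F1 v))))) + (A ^ 2 + 3 * A + 2) *\<^sub>C (F2 (F1 (F2 (F1 (F1 v)))))"
  have p_1: "E1 p = 0"
    unfolding p_def by (rule functional_separates) (simp add: nf; simp add: algebra_simps power2_eq_square power3_eq_cube)
  have p_2: "E2 p = (A ^ 2 + 5 * A + 6) *\<^sub>C (F1 (F1 (F2 (F1 v)))) + (- 2 * A ^ 2 - 6 * A) *\<^sub>C (F1 (F2 (F1 (F1 v)))) + (A ^ 2 + 5 * A + 6) *\<^sub>C (F2 (F1 (F1 (F1 v))))"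
    unfolding p_def by (rule functional_separates) (simp add: nf; simp add: algebra_simps power2_eq_square power3_eq_cube)
  have p_21: "E1 (E2 p) = (- 2 * A ^ 3 + 2 * A ^ 2 + 24 * A) *\<^sub>C (F1 (F2 (F1 v))) + (A ^ 3 + 5 * A ^ 2 - 6 * A - 36) *\<^sub>C (F2 (F1 (F1 v)))"
    unfolding p_2 by (rule functional_separates) (simp add: nf; simp add: algebra_simps power2_eq_square power3_eq_cube)
  have p_211: "E1 (E1 (E2 p)) = (8 * A ^ 3 + 4 * A ^ 2 - 36 * A + 72) *\<^sub>C (F2 (F1 v))"
    unfolding p_21 by (rule functional_separates) (simp add: nf; simp add: algebra_simps power2_eq_square power3_eq_cube)
  have p_212: "E2 (E1 (E2 p)) = (12 * A ^ 2 + 12 * A - 72) *\<^sub>C (F1 (F1 v))"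
    unfolding p_21 by (rule functional_separates) (simp add: nf; simp add: algebra_simps power2_eq_square power3_eq_cube)
  have p_2121: "E1 (E2 (E1 (E2 p))) = (24 * A ^ 3 - 168 * A + 144) *\<^sub>C (F1 v)"
    unfolding p_212 by (rule functional_separates) (simp add: nf; simp add: algebra_simps power2_eq_square power3_eq_cube)
  have q_1: "E1 q = 0"
    unfolding q_def by (rule functional_separates) (simp add: nf; simp add: algebra_simps power2_eq_square power3_eq_cube)
  have q_2: "E2 q = (- 2 * A ^ 2 - 2 * A + 4) *\<^sub>C (F1 (F1 (F2 (F1 v)))) + (A ^ 2 - A + 6) *\<^sub>C (F1 (F2 (F1 (F1 v)))) + (4 * A + 8) *\<^sub>C (F2 (F1 (F1 (F1 v))))"
    unfolding q_def by (rule functional_separates) (simp add: nf; simp add: algebra_simps power2_eq_square power3_eq_cube)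
  have q_21: "E1 (E2 q) = (- 2 * A ^ 3 - 8 * A ^ 2 + 22 * A - 12) *\<^sub>C (F1 (F2 (F1 v))) + (A ^ 3 + 10 * A ^ 2 + 7 * A - 54) *\<^sub>C (F2 (F1 (F1 v)))"
    unfolding q_2 by (rule functional_separates) (simp add: nf; simp add: algebra_simps power2_eq_square power3_eq_cube)
  have q_211: "E1 (E1 (E2 q)) = (8 * A ^ 3 + 8 * A ^ 2 - 112 * A + 96) *\<^sub>C (F2 (F1 v))"
    unfolding q_21 by (rule functional_separates) (simp add: nf; simp add: algebra_simps power2_eq_square power3_eq_cube)
  have q_212: "E2 (E1 (E2 q)) = (12 * A ^ 2 + 36 * A - 120) *\<^sub>C (F1 (F1 v))"
    unfolding q_21 by (rule functional_separates) (simp add: nf; simp add: algebra_simps power2_eq_square power3_eq_cube)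
  have q_2121: "E1 (E2 (E1 (E2 q))) = (24 * A ^ 3 + 48 * A ^ 2 - 312 * A + 240) *\<^sub>C (F1 v)"
    unfolding q_212 by (rule functional_separates) (simp add: nf; simp add: algebra_simps power2_eq_square power3_eq_cube)
  have mem: "p \<in> W 3 2" "q \<in> W 3 2"
    unfolding p_def q_def by (intro W_intros; simp add: W_mem(5))+
  have "E\<theta> p \<in> W 0 0" "E\<theta> q \<in> W 0 0" using E\<theta>_mem[OF mem(1)] E\<theta>_mem[OF mem(2)] by simp_all
  then obtain x y where xy: "E\<theta> p = x *\<^sub>C v" "E\<theta> q = y *\<^sub>C v" using W_00 by metis
  have F1: "F1 v \<noteq> 0" using F1_v_nonzero assms by simp
  have F21: "F2 (F1 v) \<noteq> 0"
    by (rule nonzero_if_raised[of e2 _ 1 "F1 v"]) (use F1 in \<open>simp_all add: nf\<close>)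
  show ?thesis
  proof (rule kernel_of_E\<theta>[OF mem(1) p_1 xy(1) mem(2) q_1 xy(2)])
    fix s t assume st: "s *\<^sub>C p + t *\<^sub>C q = 0"
    have 1: "(s * (8 * A ^ 3 + 4 * A ^ 2 - 36 * A + 72) + t * (8 * A ^ 3 + 8 * A ^ 2 - 112 * A + 96)) *\<^sub>C F2 (F1 v) = 0"
      using arg_cong[OF st, of "\<lambda>u. E1 (E1 (E2 u))"] by (simp only: act p_211 q_211 cvec.scale_scale cvec.scale_left_distrib[symmetric])
    have 2: "(s * (24 * A ^ 3 - 168 * A + 144) + t * (24 * A ^ 3 + 48 * A ^ 2 - 312 * A + 240)) *\<^sub>C F1 v = 0"
      using arg_cong[OF st, of "\<lambda>u. E1 (E2 (E1 (E2 u)))"] by (simp only: act p_2121 q_2121 cvec.scale_scale cvec.scale_left_distrib[symmetric])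
    have det: "(8 * A ^ 3 + 4 * A ^ 2 - 36 * A + 72) * (24 * A ^ 3 + 48 * A ^ 2 - 312 * A + 240)
        - (24 * A ^ 3 - 168 * A + 144) * (8 * A ^ 3 + 8 * A ^ 2 - 112 * A + 96)
        = 288 * ((A + 3) * (A + 2) * (A + 1) * (A - 1) * (A - 2))"
      by (simp add: algebra_simps power2_eq_square power3_eq_cube)
    have "A + of_nat (Suc k) \<noteq> 0" for k
      unfolding A_def of_nat_add[symmetric] of_nat_eq_0_iff by simp
    from this[of 0] this[of 1] this[of 2] have "A + 1 \<noteq> 0" "A + 2 \<noteq> 0" "A + 3 \<noteq> 0" by simp_all
    moreover have "A \<noteq> 1" "A \<noteq> 2"
      using assms(1) of_nat_eq_iff[of a 1, where 'a = complex] of_nat_eq_iff[of a 2, where 'a = complex]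
      unfolding A_def by auto
    ultimately have "288 * ((A + 3) * (A + 2) * (A + 1) * (A - 1) * (A - 2)) \<noteq> 0" by simp
    then show "s = 0 \<and> t = 0"
      unfolding det[symmetric] by (rule independent_pair[OF 1 2 F21 F1])
  qed
qed

text \<open>The same count in weight \<open>\<Lambda> - 3 \<alpha>\<^sub>1 - 4 \<alpha>\<^sub>2\<close>, which \<open>e\<^sub>\<theta>\<close> maps to the line of \<open>f2\<^sup>2 v\<close>. The
  condition \<open>b \<ge> 3\<close> guarantees \<open>f2\<^sup>3 v \<noteq> 0\<close>, one of the two vectors on which independence is read off.\<close>

lemma second_parity_long:
  assumes "a = 0" "b \<ge> 3"
  shows "\<exists>w\<in>W 3 4. E1 w = 0 \<and> E\<theta> w = 0 \<and> w \<noteq> 0"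
proof -
  define A where "A = (of_nat b :: complex)"
  note nf = word_simps A_def[symmetric] F1_v_zero[OF assms(1)] assms(1)
  define p where "p = (84) *\<^sub>C (F1 (F1 (F1 (F2 (F2 (F2 (F2 v))))))) + (- 280) *\<^sub>C (F1 (F1 (F2 (F1 (F2 (F2 (F2 v))))))) + (315) *\<^sub>C (F1 (F2 (F1 (F1 (F2 (F2 (F2 v))))))) + (- 120) *\<^sub>C (F2 (F1 (F1 (F1 (F2 (F2 (F2 v)))))))"
  define q where "q = (75) *\<^sub>C (F1 (F2 (F1 (F1 (F2 (F2 (F2 v))))))) + (- 200) *\<^sub>C (F1 (F2 (F1 (F2 (F1 (F2 (F2 v))))))) + (140) *\<^sub>C (F1 (F2 (F2 (F1 (F1 (F2 (F2 v))))))) + (- 120) *\<^sub>C (F2 (F1 (F1 (F1 (F2 (F2 (F2 v))))))) + (320) *\<^sub>C (F2 (F1 (F1 (F2 (F1 (F2 (F2 v))))))) + (- 224) *\<^sub>C (F2 (F1 (F2 (F1 (F1 (F2 (F2 v)))))))"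
  have p_1: "E1 p = 0"
    unfolding p_def by (rule functional_separates) (simp add: nf; simp add: algebra_simps power2_eq_square power3_eq_cube)
  have p_2: "E2 p = (251 * A - 508) *\<^sub>C (F1 (F1 (F1 (F2 (F2 (F2 v)))))) + (- 840 * A + 1680) *\<^sub>C (F1 (F1 (F2 (F1 (F2 (F2 v)))))) + (945 * A - 1890) *\<^sub>C (F1 (F2 (F1 (F1 (F2 (F2 v)))))) + (- 360 * A + 720) *\<^sub>C (F2 (F1 (F1 (F1 (F2 (F2 v))))))"
    unfolding p_def by (rule functional_separates) (simp add: nf; simp add: algebra_simps power2_eq_square power3_eq_cube)
  have p_21: "E1 (E2 p) = (231 * A - 588) *\<^sub>C (F1 (F1 (F2 (F2 (F2 v))))) + (- 630 * A + 1260) *\<^sub>C (F1 (F2 (F1 (F2 (F2 v))))) + (405 * A - 810) *\<^sub>C (F2 (F1 (F1 (F2 (F2 v)))))"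
    unfolding p_2 by (rule functional_separates) (simp add: nf; simp add: algebra_simps power2_eq_square power3_eq_cube)
  have p_211: "E1 (E1 (E2 p)) = (- 84 * A - 1848) *\<^sub>C (F1 (F2 (F2 (F2 v)))) + (- 360 * A + 720) *\<^sub>C (F2 (F1 (F2 (F2 v))))"
    unfolding p_21 by (rule functional_separates) (simp add: nf; simp add: algebra_simps power2_eq_square power3_eq_cube)
  have p_2111: "E1 (E1 (E1 (E2 p))) = (- 2916 * A - 12312) *\<^sub>C (F2 (F2 (F2 v)))"
    unfolding p_211 by (rule functional_separates) (simp add: nf; simp add: algebra_simps power2_eq_square power3_eq_cube)
  have p_212: "E2 (E1 (E2 p)) = (468 * A ^ 2 - 1620 * A + 1368) *\<^sub>C (F1 (F1 (F2 (F2 v)))) + (- 1260 * A ^ 2 + 3780 * A - 2520) *\<^sub>C (F1 (F2 (F1 (F2 v)))) + (810 * A ^ 2 - 2430 * A + 1620) *\<^sub>C (F2 (F1 (F1 (F2 v))))"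
    unfolding p_21 by (rule functional_separates) (simp add: nf; simp add: algebra_simps power2_eq_square power3_eq_cube)
  have p_2121: "E1 (E2 (E1 (E2 p))) = (900 * A ^ 2 - 4860 * A + 6120) *\<^sub>C (F1 (F2 (F2 v))) + (- 1800 * A ^ 2 + 5400 * A - 3600) *\<^sub>C (F2 (F1 (F2 v)))"
    unfolding p_212 by (rule functional_separates) (simp add: nf; simp add: algebra_simps power2_eq_square power3_eq_cube)
  have p_21211: "E1 (E1 (E2 (E1 (E2 p)))) = (- 12960 * A + 25920) *\<^sub>C (F2 (F2 v))"
    unfolding p_2121 by (rule functional_separates) (simp add: nf; simp add: algebra_simps power2_eq_square power3_eq_cube)
  have q_1: "E1 q = 0"
    unfolding q_def by (rule functional_separates) (simp add: nf; simp add: algebra_simps power2_eq_square power3_eq_cube)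
  have q_2: "E2 q = (- 45 * A + 60) *\<^sub>C (F1 (F1 (F1 (F2 (F2 (F2 v)))))) + (120 * A - 160) *\<^sub>C (F1 (F1 (F2 (F1 (F2 (F2 v)))))) + (81 * A - 18) *\<^sub>C (F1 (F2 (F1 (F1 (F2 (F2 v)))))) + (- 400 * A + 400) *\<^sub>C (F1 (F2 (F1 (F2 (F1 (F2 v)))))) + (280 * A - 280) *\<^sub>C (F1 (F2 (F2 (F1 (F1 (F2 v)))))) + (- 264 * A + 208) *\<^sub>C (F2 (F1 (F1 (F1 (F2 (F2 v)))))) + (640 * A - 640) *\<^sub>C (F2 (F1 (F1 (F2 (F1 (F2 v)))))) + (- 448 * A + 448) *\<^sub>C (F2 (F1 (F2 (F1 (F1 (F2 v))))))"
    unfolding q_def by (rule functional_separates) (simp add: nf; simp add: algebra_simps power2_eq_square power3_eq_cube)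
  have q_21: "E1 (E2 q) = (- 225 * A + 300) *\<^sub>C (F1 (F1 (F2 (F2 (F2 v))))) + (1050 * A - 900) *\<^sub>C (F1 (F2 (F1 (F2 (F2 v))))) + (- 480 * A + 480) *\<^sub>C (F1 (F2 (F2 (F1 (F2 v))))) + (- 843 * A + 486) *\<^sub>C (F2 (F1 (F1 (F2 (F2 v))))) + (48 * A - 48) *\<^sub>C (F2 (F1 (F2 (F1 (F2 v))))) + (504 * A - 504) *\<^sub>C (F2 (F2 (F1 (F1 (F2 v)))))"
    unfolding q_2 by (rule functional_separates) (simp add: nf; simp add: algebra_simps power2_eq_square power3_eq_cube)
  have q_211: "E1 (E1 (E2 q)) = (1260 * A + 840) *\<^sub>C (F1 (F2 (F2 (F2 v)))) + (- 936 * A - 1584) *\<^sub>C (F2 (F1 (F2 (F2 v)))) + (- 1152 * A + 1152) *\<^sub>C (F2 (F2 (F1 (F2 v))))"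
    unfolding q_21 by (rule functional_separates) (simp add: nf; simp add: algebra_simps power2_eq_square power3_eq_cube)
  have q_2111: "E1 (E1 (E1 (E2 q))) = (2268 * A + 1512) *\<^sub>C (F2 (F2 (F2 v)))"
    unfolding q_211 by (rule functional_separates) (simp add: nf; simp add: algebra_simps power2_eq_square power3_eq_cube)
  have q_212: "E2 (E1 (E2 q)) = (- 468 * A ^ 2 + 372 * A - 72) *\<^sub>C (F1 (F1 (F2 (F2 v)))) + (1188 * A ^ 2 - 1164 * A - 24) *\<^sub>C (F1 (F2 (F1 (F2 v)))) + (- 630 * A ^ 2 + 546 * A + 84) *\<^sub>C (F2 (F1 (F1 (F2 v))))"
    unfolding q_21 by (rule functional_separates) (simp add: nf; simp add: algebra_simps power2_eq_square power3_eq_cube)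
  have q_2121: "E1 (E2 (E1 (E2 q))) = (- 1116 * A ^ 2 + 228 * A - 792) *\<^sub>C (F1 (F2 (F2 v))) + (2232 * A ^ 2 - 2472 * A + 240) *\<^sub>C (F2 (F1 (F2 v)))"
    unfolding q_212 by (rule functional_separates) (simp add: nf; simp add: algebra_simps power2_eq_square power3_eq_cube)
  have q_21211: "E1 (E1 (E2 (E1 (E2 q)))) = (- 6048 * A - 4032) *\<^sub>C (F2 (F2 v))"
    unfolding q_2121 by (rule functional_separates) (simp add: nf; simp add: algebra_simps power2_eq_square power3_eq_cube)
  have mem: "p \<in> W 3 4" "q \<in> W 3 4"
    unfolding p_def q_def by (intro W_intros; simp add: W_mem(5))+
  have W02: "\<exists>c. x = c *\<^sub>C F2 (F2 v)" if x: "x \<in> W 0 2" for x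
  proof -
    obtain y z where yz: "y \<in> W (-1) 2" "z \<in> W 0 1" "x = F1 y + F2 z" using W_step[OF x] by auto
    obtain y' z' where yz': "y' \<in> W (-1) 1" "z' \<in> W 0 0" "z = F1 y' + F2 z'" using W_step[OF yz(2)] by auto
    obtain c where "z' = c *\<^sub>C v" using W_00[OF yz'(2)] by auto
    then show ?thesis using yz yz' W_negative[OF yz(1)] W_negative[OF yz'(1)] by (auto simp: act)
  qed
  have "E\<theta> p \<in> W 0 2" "E\<theta> q \<in> W 0 2" using E\<theta>_mem[OF mem(1)] E\<theta>_mem[OF mem(2)] by simp_all
  then obtain x y where xy: "E\<theta> p = x *\<^sub>C F2 (F2 v)" "E\<theta> q = y *\<^sub>C F2 (F2 v)" using W02 by metis
  have "A \<noteq> 1" "A \<noteq> 2"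
    using assms(2) of_nat_eq_iff[of b 1, where 'a = complex] of_nat_eq_iff[of b 2, where 'a = complex]
    unfolding A_def by auto
  have F2: "F2 v \<noteq> 0" using F2_v_nonzero assms by simp
  have F22: "F2 (F2 v) \<noteq> 0"
  proof (rule nonzero_if_raised[of e2 _ "2 * (A - 1)" "F2 v"])
    show "E2 (F2 (F2 v)) = (2 * (A - 1)) *\<^sub>C F2 v"
      by (rule functional_separates) (simp add: nf; simp add: algebra_simps)
  qed (use F2 \<open>A \<noteq> 1\<close> in simp_all)
  have F222: "F2 (F2 (F2 v)) \<noteq> 0"
  proof (rule nonzero_if_raised[of e2 _ "3 * (A - 2)" "F2 (F2 v)"])
    show "E2 (F2 (F2 (F2 v))) = (3 * (A - 2)) *\<^sub>C F2 (F2 v)"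
      by (rule functional_separates) (simp add: nf; simp add: algebra_simps)
  qed (use F22 \<open>A \<noteq> 2\<close> in simp_all)
  show ?thesis
  proof (rule kernel_of_E\<theta>[OF mem(1) p_1 xy(1) mem(2) q_1 xy(2)])
    fix s t assume st: "s *\<^sub>C p + t *\<^sub>C q = 0"
    have 1: "(s * (- 2916 * A - 12312) + t * (2268 * A + 1512)) *\<^sub>C F2 (F2 (F2 v)) = 0"
      using arg_cong[OF st, of "\<lambda>u. E1 (E1 (E1 (E2 u)))"] by (simp only: act p_2111 q_2111 cvec.scale_scale cvec.scale_left_distrib[symmetric])
    have 2: "(s * (- 12960 * A + 25920) + t * (- 6048 * A - 4032)) *\<^sub>C F2 (F2 v) = 0"
      using arg_cong[OF st, of "\<lambda>u. E1 (E1 (E2 (E1 (E2 u))))"] by (simp only: act p_21211 q_21211 cvec.scale_scale cvec.scale_left_distrib[symmetric])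
    have det: "(- 2916 * A - 12312) * (- 6048 * A - 4032) - (- 12960 * A + 25920) * (2268 * A + 1512)
        = 5225472 * ((3 * A + 2) * (3 * A + 1))"
      by (simp add: algebra_simps power2_eq_square)
    have "of_nat (3 * b + Suc k) \<noteq> (0 :: complex)" for k unfolding of_nat_eq_0_iff by simp
    from this[of 0] this[of 1] have "3 * A + 1 \<noteq> 0" "3 * A + 2 \<noteq> 0" unfolding A_def by (simp_all add: add.commute)
    then have "5225472 * ((3 * A + 2) * (3 * A + 1)) \<noteq> 0" by simp
    then show "s = 0 \<and> t = 0"
      unfolding det[symmetric] by (rule independent_pair[OF 1 2 F222 F22])
  qed
qed

lemma reducible:
  assumes "(a, b) \<noteq> (0, 0)" "(a, b) \<noteq> (1, 0)" "(a, b) \<noteq> (0, 1)" "(a, b) \<noteq> (2, 0)" "(a, b) \<noteq> (0, 2)"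
  shows "\<not> irreducible_under (casimir_algebra B h e f) \<rho> V0"
proof -
  have "odd a \<and> b \<ge> 1 \<or> odd a \<and> a \<ge> 3 \<and> b = 0 \<or> even a \<and> a \<ge> 2 \<and> b \<ge> 1
      \<or> even a \<and> a \<ge> 4 \<and> b = 0 \<or> a = 0 \<and> b \<ge> 3"
    using assms unfolding prod.inject by presburger
  then consider "odd a" "b \<ge> 1" | "odd a" "a \<ge> 3" "b = 0" | "even a" "a \<ge> 2" "b \<ge> 1"
    | "even a" "a \<ge> 4" "b = 0" | "a = 0" "b \<ge> 3" by blast
  then show ?thesis
  proof cases
    case 4
    obtain k where k: "a = 2 * k" using 4(1) by (auto elim: evenE)
    obtain w where w: "w \<in> W 3 2" "E1 w = 0" "E\<theta> w = 0" "w \<noteq> 0" using second_parity_short 4 by auto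
    show ?thesis
      by (rule reducible_if_parities_differ[of w 3 2 k "k - 1" v 0 0 k k])
        (use k 4 w v v_ops W_mem(5) E\<theta>_zero[OF W_mem(5)] in auto)
  next
    case 5
    obtain w where w: "w \<in> W 3 4" "E1 w = 0" "E\<theta> w = 0" "w \<noteq> 0" using second_parity_long 5 by auto
    show ?thesis
      by (rule reducible_if_parities_differ[of v 0 0 0 b w 3 4 3 "b - 2"])
        (use 5 w v v_ops W_mem(5) E\<theta>_zero[OF W_mem(5)] in auto)
  qed (use reducible_odd reducible_odd_short reducible_even_mixed in auto)
qed

text \<open>Some singular vector of the two triples has even weights for both.\<close>

lemma V0_nonzero: "\<exists>u\<in>V0. u \<noteq> 0"
proof -
  have "\<exists>m n w i j. w \<in> W m n \<and> E1 w = 0 \<and> E\<theta> w = 0 \<and> w \<noteq> 0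
    \<and> int a - 2 * m + 3 * n = 2 * int j \<and> int a + 2 * int b - n = 2 * int i"
  proof (cases "even a")
    case True
    then obtain k where k: "a = 2 * k" by (auto elim: evenE)
    show ?thesis
      by (rule exI[of _ 0], rule exI[of _ 0], rule exI[of _ v], rule exI[of _ "k + b"], rule exI[of _ k])
        (use k v v_ops W_mem(5) E\<theta>_zero[OF W_mem(5)] in auto)
  next
    case False
    then obtain k where k: "a = 2 * k + 1" by (auto elim: oddE)
    show ?thesis
    proof (cases "b = 0")
      case True
      have m: "F2 (F1 v) \<in> W 1 1" by (intro W_intros) (simp_all add: W_mem(5))
      have nz: "F2 (F1 v) \<noteq> 0"
        by (rule nonzero_if_raised[of e2 _ 1 "F1 v"]) (use F1_v_nonzero k True in \<open>simp_all add: word_simps\<close>)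
      show ?thesis
        by (rule exI[of _ 1], rule exI[of _ 1], rule exI[of _ "F2 (F1 v)"], rule exI[of _ k], rule exI[of _ "k + 1"])
          (use k True m nz E\<theta>_zero[OF m] F2_v_zero in \<open>auto simp: word_simps\<close>)
    next
      case False
      have m: "F2 v \<in> W 0 1" by (intro W_intros) (simp_all add: W_mem(5))
      show ?thesis
        by (rule exI[of _ 0], rule exI[of _ 1], rule exI[of _ "F2 v"], rule exI[of _ "k + b"], rule exI[of _ "k + 2"])
          (use k False m E\<theta>_zero[OF m] F2_v_nonzero in \<open>auto simp: word_simps\<close>)
    qed
  qed
  then obtain m n w i j where "w \<in> W m n" "E1 w = 0" "E\<theta> w = 0" "w \<noteq> 0"
    "int a - 2 * m + 3 * n = 2 * int j" "int a + 2 * int b - n = 2 * int i" by auto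
  from parity_middle[OF this] show ?thesis by auto
qed

end

section \<open>Self-duality\<close>

text \<open>The direct sum of two spaces, needed for the sum of a module and its dual.\<close>

instantiation prod :: (complex_vector, complex_vector) complex_vector
begin

definition scaleC_prod :: "complex \<Rightarrow> 'a \<times> 'b \<Rightarrow> 'a \<times> 'b" where
  "scaleC_prod c p = (c *\<^sub>C fst p, c *\<^sub>C snd p)"

instance
  by standard (simp_all add: scaleC_prod_def scaleC_add_right scaleC_add_left scaleC_scaleC scaleC_one)

end

lemma linear_functional_on_basis:
  fixes \<phi> :: "'v::complex_vector \<Rightarrow> complex"
  assumes C: "cvec.independent C" "cvec.span C = UNIV" "finite C"
    and \<phi>: "\<And>u w. \<phi> (u + w) = \<phi> u + \<phi> w" "\<And>c u. \<phi> (c *\<^sub>C u) = c * \<phi> u"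
  shows "\<phi> u = (\<Sum>c\<in>C. cvec.representation C u c * \<phi> c)"
proof -
  have 0: "\<phi> 0 = 0" using \<phi>(2)[of 0 0] by simp
  have s: "\<phi> (\<Sum>c\<in>I. g c) = (\<Sum>c\<in>I. \<phi> (g c))" for g :: "'v \<Rightarrow> 'v" and I
    by (induction I rule: infinite_finite_induct) (simp_all add: 0 \<phi>)
  have "\<phi> u = \<phi> (\<Sum>c\<in>C. cvec.representation C u c *\<^sub>C c)"
    using representation_sum_basis[OF C] by simp
  then show ?thesis by (simp add: s \<phi>)
qed

text \<open>The coefficient of \<open>z\<close> in a basis of weight vectors that contains \<open>z\<close>.\<close>

lemma (in weight_module) weight_functional:
  assumes nu: "\<nu> \<in> dual_of h" and z: "z \<in> weight_space \<rho> h \<nu>" "z \<noteq> 0"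
  obtains \<phi> :: "'v \<Rightarrow> complex" where "\<And>u w. \<phi> (u + w) = \<phi> u + \<phi> w" "\<And>c u. \<phi> (c *\<^sub>C u) = c * \<phi> u" "\<phi> z = 1"
    "\<And>\<mu> u. \<mu> \<in> dual_of h \<Longrightarrow> \<mu> \<noteq> \<nu> \<Longrightarrow> u \<in> weight_space \<rho> h \<mu> \<Longrightarrow> \<phi> u = 0"
proof -
  let ?S = "\<Union>\<mu>\<in>dual_of h. weight_space \<rho> h \<mu>"
  have "cvec.independent {z}" using z(2) by (simp add: cvec.independent_insert)
  moreover have "{z} \<subseteq> ?S" using nu z by auto
  ultimately obtain C where C: "{z} \<subseteq> C" "C \<subseteq> ?S" "cvec.independent C" "?S \<subseteq> cvec.span C"
    using cvec.maximal_independent_subset_extend[of "{z}" ?S] by metis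
  have sp: "cvec.span C = UNIV"
    using cvec.span_minimal[OF C(4) cvec.subspace_span] weights_span by auto
  define \<phi> where "\<phi> u = cvec.representation C u z" for u
  have add: "\<phi> (u + w) = \<phi> u + \<phi> w" for u w unfolding \<phi>_def by (rule representation_linear(1)[OF C(3) sp])
  have scale: "\<phi> (c *\<^sub>C u) = c * \<phi> u" for c u unfolding \<phi>_def by (rule representation_linear(2)[OF C(3) sp])
  have basis: "\<phi> b = (if b = z then 1 else 0)" if "b \<in> C" for b
    unfolding \<phi>_def using cvec.representation_basis[OF C(3) that] by simp
  have "\<phi> u = 0" if mu: "\<mu> \<in> dual_of h" "\<mu> \<noteq> \<nu>" and u: "u \<in> weight_space \<rho> h \<mu>" for \<mu> u
  proof -
    have "u \<in> cvec.span (C \<inter> weight_space \<rho> h \<mu>)"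
      by (rule weight_space_spanned[OF C(2) _ mu(1) u]) (simp add: sp)
    moreover have "C \<inter> weight_space \<rho> h \<mu> \<subseteq> {u. \<phi> u = 0}"
      using basis weight_unique[of z \<mu> \<nu>] z nu mu by auto
    moreover have "cvec.subspace {u. \<phi> u = 0}"
      unfolding cvec.subspace_def using scale[of 0 0] by (auto simp: add scale)
    ultimately show ?thesis using cvec.span_minimal[of "C \<inter> weight_space \<rho> h \<mu>" "{u. \<phi> u = 0}"] by auto
  qed
  then show ?thesis by (intro that[of \<phi>] add scale) (use basis C(1) in auto)
qed

text \<open>The dual module is modelled on \<open>'v\<close> itself, through the symmetric pairing for which a fixed
  basis \<open>C\<close> is orthonormal.\<close>

locale dual_pairing =
  fixes C :: "'v::complex_vector set" and \<rho> :: "'g::lie_algebra \<Rightarrow> 'v \<Rightarrow> 'v"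
  assumes C: "cvec.independent C" "cvec.span C = UNIV" "finite C" and pmod: "lie_module \<rho>"
begin

definition pair :: "'v \<Rightarrow> 'v \<Rightarrow> complex" where
  "pair x y = (\<Sum>c\<in>C. cvec.representation C x c * cvec.representation C y c)"

definition rep_of :: "('v \<Rightarrow> complex) \<Rightarrow> 'v" where
  "rep_of \<phi> = (\<Sum>c\<in>C. \<phi> c *\<^sub>C c)"

lemma pair_linear:
  "pair (x + x') y = pair x y + pair x' y" "pair (c *\<^sub>C x) y = c * pair x y"
  "pair x (y + y') = pair x y + pair x y'" "pair x (c *\<^sub>C y) = c * pair x y"
  unfolding pair_def
  by (simp_all add: representation_linear[OF C(1,2)] sum.distrib sum_distrib_left algebra_simps)

lemma pair_rep_of:
  assumes "\<And>u w. \<phi> (u + w) = \<phi> u + \<phi> w" "\<And>c u. \<phi> (c *\<^sub>C u) = c * \<phi> u"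
  shows "pair (rep_of \<phi>) u = \<phi> u"
proof -
  have "cvec.representation C (rep_of \<phi>) c = \<phi> c" if "c \<in> C" for c
    unfolding rep_of_def representation_linear(3)[OF C(1,2)] representation_linear(2)[OF C(1,2)]
    using that C(3) by (simp add: cvec.representation_basis[OF C(1)] if_distrib[of "\<lambda>x. _ * x"] cong: if_cong)
  then have "pair (rep_of \<phi>) u = (\<Sum>c\<in>C. cvec.representation C u c * \<phi> c)"
    unfolding pair_def by (intro sum.cong) (simp_all add: mult.commute)
  also have "\<dots> = \<phi> u" by (rule linear_functional_on_basis[OF C assms, symmetric])
  finally show ?thesis .
qed

lemma pair_eqI:
  assumes "\<And>u. pair x u = pair y u"
  shows "x = y"
proof -
  have "cvec.representation C x c = cvec.representation C y c" if c: "c \<in> C" for c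
  proof -
    have "pair z c = cvec.representation C z c" for z
      unfolding pair_def using c C(3) by (simp add: cvec.representation_basis[OF C(1)] if_distrib[of "\<lambda>x. _ * x"] cong: if_cong)
    then show ?thesis using assms[of c] by simp
  qed
  then have "(\<Sum>c\<in>C. cvec.representation C x c *\<^sub>C c) = (\<Sum>c\<in>C. cvec.representation C y c *\<^sub>C c)"
    by (intro sum.cong) simp_all
  then show ?thesis using representation_sum_basis[OF C] by simp
qed

definition dual_act :: "'g \<Rightarrow> 'v \<Rightarrow> 'v" where
  "dual_act x \<psi> = rep_of (\<lambda>u. - pair \<psi> (\<rho> x u))"

lemma pair_dual_act: "pair (dual_act x \<psi>) u = - pair \<psi> (\<rho> x u)"
  unfolding dual_act_def
  by (rule pair_rep_of) (simp_all add: lie_module_simps[OF pmod] pair_linear)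

definition pair_act :: "'g \<Rightarrow> 'v \<times> 'v \<Rightarrow> 'v \<times> 'v" where
  "pair_act x p = (\<rho> x (fst p), dual_act x (snd p))"

lemma pair_minus: "pair (x - x') y = pair x y - pair x' y" "pair x (y - y') = pair x y - pair x y'"
proof -
  have *: "a - b = a + (-1) *\<^sub>C b" for a b :: 'v by simp
  show "pair (x - x') y = pair x y - pair x' y" "pair x (y - y') = pair x y - pair x y'"
    unfolding * pair_linear by simp_all
qed

lemma pair_act_module: "lie_module pair_act"
proof -
  note act = lie_module_simps[OF pmod]
  have d: "dual_act x (u + w) = dual_act x u + dual_act x w" "dual_act x (c *\<^sub>C u) = c *\<^sub>C dual_act x u"
    "dual_act (x + y) u = dual_act x u + dual_act y u" "dual_act (c *\<^sub>C x) u = c *\<^sub>C dual_act x u"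
    "dual_act (bracket x y) u = dual_act x (dual_act y u) - dual_act y (dual_act x u)" for x y u w c
  proof -
    show "dual_act x (u + w) = dual_act x u + dual_act x w"
      by (rule pair_eqI) (simp add: pair_dual_act pair_linear)
    show "dual_act x (c *\<^sub>C u) = c *\<^sub>C dual_act x u"
      by (rule pair_eqI) (simp add: pair_dual_act pair_linear)
    show "dual_act (x + y) u = dual_act x u + dual_act y u"
      by (rule pair_eqI) (simp add: pair_dual_act pair_linear act)
    show "dual_act (c *\<^sub>C x) u = c *\<^sub>C dual_act x u"
      by (rule pair_eqI) (simp add: pair_dual_act pair_linear act)
    show "dual_act (bracket x y) u = dual_act x (dual_act y u) - dual_act y (dual_act x u)"
      by (rule pair_eqI) (simp add: pair_dual_act pair_linear pair_minus act)
  qed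
  show ?thesis unfolding lie_module_def
  proof (intro conjI allI)
    show "clinear (pair_act x)" for x
      by (rule clinearI) (simp_all add: pair_act_def scaleC_prod_def d act)
    show "clinear (\<lambda>x. pair_act x p)" for p
      by (rule clinearI) (simp_all add: pair_act_def scaleC_prod_def d act)
    show "pair_act (bracket x y) p = pair_act x (pair_act y p) - pair_act y (pair_act x p)" for x y p
      by (simp add: pair_act_def d act)
  qed
qed

end

context g2_highest
begin

text \<open>Let \<open>z\<close> be a vector of weight \<open>-\<Lambda>\<close> and \<open>\<phi>\<close> the functional that reads off its coefficient. In
  the sum of \<open>V\<close> and its dual, the submodule generated by \<open>(v, \<phi>)\<close> is the graph of an isomorphism.\<close>

lemma self_dual_module: "self_dual \<rho>"
proof -
  obtain C :: "'v set" where C: "cvec.independent C" "cvec.span C = UNIV" "finite C"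
    using finite_dim_basis[OF V_fd] .
  interpret dual_pairing C \<rho> by unfold_locales (use C V_mod in auto)
  define z where "z = parity v"
  have z: "z \<in> weight_space \<rho> h (\<lambda>t. - \<Lambda> t)" "z \<noteq> 0"
    unfolding z_def using parity_weight[OF \<Lambda> v(1)] parity_eq_0 v(2) by auto
  (* The parity operator reflects weights, so that none lies below - \<Lambda>. *)
  have no_lower: "u = 0" if "u \<in> weight_space \<rho> h (\<lambda>t. - \<Lambda> t - rt m n t)" "m > 0 \<or> n > 0" for u m n
  proof -
    have d: "(\<lambda>t. - \<Lambda> t - rt m n t) \<in> dual_of h"
      using dual_of_uminus[OF dual_of_add[OF \<Lambda> rt_dual, of m n]] by simp
    have "(\<lambda>t. - (- \<Lambda> t - rt m n t)) = below \<Lambda> (- m) (- n)"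
      unfolding below_def rt_def by auto
    then have "parity u \<in> W (- m) (- n)" using parity_weight[OF d that(1)] unfolding W_def by simp
    then have "parity u = 0" by (rule W_negative) (use that(2) in auto)
    then show ?thesis by (rule parity_eq_0)
  qed
  obtain \<phi> where \<phi>: "\<And>u w. \<phi> (u + w) = \<phi> u + \<phi> w" "\<And>c u. \<phi> (c *\<^sub>C u) = c * \<phi> u" "\<phi> z = 1"
    "\<And>\<mu> u. \<mu> \<in> dual_of h \<Longrightarrow> \<mu> \<noteq> (\<lambda>t. - \<Lambda> t) \<Longrightarrow> u \<in> weight_space \<rho> h \<mu> \<Longrightarrow> \<phi> u = 0"
    by (rule V.weight_functional[OF dual_of_uminus[OF \<Lambda>] z], rule that)
  obtain \<chi> where \<chi>: "\<And>u w. \<chi> (u + w) = \<chi> u + \<chi> w" "\<And>c u. \<chi> (c *\<^sub>C u) = c * \<chi> u" "\<chi> v = 1"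
    "\<And>\<mu> u. \<mu> \<in> dual_of h \<Longrightarrow> \<mu> \<noteq> \<Lambda> \<Longrightarrow> u \<in> weight_space \<rho> h \<mu> \<Longrightarrow> \<chi> u = 0"
    by (rule V.weight_functional[OF \<Lambda> v], rule that)
  have \<phi>_neg: "\<phi> (- u) = - \<phi> u" for u using \<phi>(2)[of "-1" u] by simp
  define x0 where "x0 = (v, rep_of \<phi>)"
  have fun_eq: "f = g" if "\<And>u w. f (u + w) = f u + f w" "\<And>u w. g (u + w) = g u + g w"
    "\<And>\<mu> u. \<mu> \<in> dual_of h \<Longrightarrow> u \<in> weight_space \<rho> h \<mu> \<Longrightarrow> f u = g u"
    "\<And>c u. f (c *\<^sub>C u) = c * f u" "\<And>c u. g (c *\<^sub>C u) = c * g u" for f g :: "'v \<Rightarrow> complex"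
  proof
    fix u
    have "cvec.subspace {u. f u = g u}"
      unfolding cvec.subspace_def using that(4)[of 0 0] that(5)[of 0 0] by (auto simp: that)
    then have "cvec.span (\<Union>\<mu>\<in>dual_of h. weight_space \<rho> h \<mu>) \<subseteq> {u. f u = g u}"
      by (intro cvec.span_minimal) (use that(3) in auto)
    then show "f u = g u" unfolding V.weights_span by auto
  qed
  have \<phi>_act: "dual_act x (rep_of \<phi>) = rep_of g"
    if "\<And>u w. g (u + w) = g u + g w" "\<And>c u. g (c *\<^sub>C u) = c * g u"
      "\<And>\<mu> u. \<mu> \<in> dual_of h \<Longrightarrow> u \<in> weight_space \<rho> h \<mu> \<Longrightarrow> - \<phi> (\<rho> x u) = g u" for x g
  proof -
    have "(\<lambda>u. - \<phi> (\<rho> x u)) = g"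
      by (rule fun_eq) (use that \<phi> in \<open>simp_all add: act\<close>)
    then show ?thesis unfolding dual_act_def pair_rep_of[OF \<phi>(1,2)] by simp
  qed
  have zero_rep: "rep_of (\<lambda>_. 0) = 0" unfolding rep_of_def by simp
  have x0: "x0 \<in> weight_space pair_act h \<Lambda>" "pair_act e1 x0 = 0" "pair_act e2 x0 = 0"
  proof -
    show "x0 \<in> weight_space pair_act h \<Lambda>" unfolding weight_space_def
    proof safe
      fix t assume t: "t \<in> h"
      have "dual_act t (rep_of \<phi>) = rep_of (\<lambda>u. \<Lambda> t * \<phi> u)"
      proof (rule \<phi>_act)
        fix \<mu> u assume mu: "\<mu> \<in> dual_of h" and u: "u \<in> weight_space \<rho> h \<mu>"
        show "- \<phi> (\<rho> t u) = \<Lambda> t * \<phi> u"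
          using \<phi>(4)[OF mu _ u] V.weight_spaceD[OF u t] by (cases "\<mu> = (\<lambda>t. - \<Lambda> t)") (simp_all add: \<phi>(2) \<phi>_neg)
      qed (simp_all add: \<phi> algebra_simps)
      also have "\<dots> = \<Lambda> t *\<^sub>C rep_of \<phi>" unfolding rep_of_def by (simp add: cvec.scale_sum_right)
      finally show "pair_act t x0 = \<Lambda> t *\<^sub>C x0"
        using V.weight_spaceD[OF v(1) t] unfolding pair_act_def x0_def scaleC_prod_def by simp
    qed
    have e0: "dual_act x (rep_of \<phi>) = 0" if x: "x \<in> root_space h (rt m n)" "m > 0 \<or> n > 0" for x m n
    proof -
      have "dual_act x (rep_of \<phi>) = rep_of (\<lambda>_. 0)"
      proof (rule \<phi>_act)
        fix \<mu> u assume mu: "\<mu> \<in> dual_of h" and u: "u \<in> weight_space \<rho> h \<mu>"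
        have s: "\<rho> x u \<in> weight_space \<rho> h (\<lambda>t. \<mu> t + rt m n t)" by (rule V.root_vector_act[OF x(1) u])
        show "- \<phi> (\<rho> x u) = 0"
        proof (cases "(\<lambda>t. \<mu> t + rt m n t) = (\<lambda>t. - \<Lambda> t)")
          case True
          then have "\<mu> t = - \<Lambda> t - rt m n t" for t by (metis add_diff_cancel_right')
          then have "\<mu> = (\<lambda>t. - \<Lambda> t - rt m n t)" by (rule ext)
          then have "u = 0" using no_lower[OF _ x(2)] u by simp
          then show ?thesis using \<phi>(2)[of 0 0] by (simp add: act)
        next
          case False
          then show ?thesis using \<phi>(4)[OF dual_of_add[OF mu rt_dual] _ s] by simp
        qed
      qed simp_all
      then show ?thesis unfolding zero_rep .
    qed
    show "pair_act e1 x0 = 0" "pair_act e2 x0 = 0"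
      using e0[OF simple_root_vectors(1)] e0[OF simple_root_vectors(2)]
      unfolding pair_act_def x0_def zero_prod_def by (simp_all add: v_ops)
  qed
  define D where "D = lowered_span pair_act x0"
  have D_act: "pair_act x p \<in> D" if "p \<in> D" for x p
    using lowered_span_submodule[OF pair_act_module x0] that unfolding D_def .
  have D_sub: "cvec.subspace D" unfolding D_def lowered_span_def by (rule cvec.subspace_span)
  have x0D: "x0 \<in> D"
    unfolding D_def lowered_span_def by (rule cvec.span_base) (auto intro!: image_eqI[of _ _ "[]"])
  have D_add: "(u, p) \<in> D \<Longrightarrow> (u', p') \<in> D \<Longrightarrow> (u + u', p + p') \<in> D" for u p u' p'
    using cvec.subspace_add[OF D_sub, of "(u, p)" "(u', p')"] by simp
  have D_scale: "(u, p) \<in> D \<Longrightarrow> (c *\<^sub>C u, c *\<^sub>C p) \<in> D" for u p c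
    using cvec.subspace_scale[OF D_sub, of "(u, p)" c] by (simp add: scaleC_prod_def)
  have D_rho: "(u, p) \<in> D \<Longrightarrow> (\<rho> x u, dual_act x p) \<in> D" for u p x
    using D_act[of "(u, p)" x] by (simp add: pair_act_def)
  (* Compares the coefficient of v in the first component with the value of the second one at z. *)
  have coeff: "\<chi> u = pair p z" if "(u, p) \<in> D" for u p
  proof -
    let ?K = "{q :: 'v \<times> 'v. \<chi> (fst q) = pair (snd q) z}"
    have "cvec.subspace ?K" unfolding cvec.subspace_def
      using \<chi>(2)[of 0 0] pair_linear(2)[of 0 0 z] by (auto simp: scaleC_prod_def \<chi> pair_linear)
    moreover have "word_act (pair_act f1) (pair_act f2) l x0 \<in> ?K" for l
    proof (cases l)
      case Nil
      then show ?thesis by (simp add: x0_def \<chi>(3) pair_rep_of[OF \<phi>(1,2)] \<phi>(3))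
    next
      case (Cons i k)
      have fst_word: "fst (word_act (pair_act f1) (pair_act f2) l x0) = word_act F1 F2 l v" for l
        by (induction l) (simp_all add: x0_def pair_act_def)
      have "\<chi> (word_act F1 F2 l v) = 0"
      proof (rule \<chi>(4)[OF below_dual[OF \<Lambda>] _ word_weight[OF V_mod v(1)]])
        show "below \<Lambda> (int (count_list l True)) (int (count_list l False)) \<noteq> \<Lambda>"
          using below_eq_iff[of \<Lambda> "int (count_list l True)" "int (count_list l False)" 0 0] unfolding Cons below_0
          by (cases i) auto
      qed
      moreover have "F1 z = 0" "F2 z = 0"
      proof -
        have eq: "(\<lambda>t. - \<Lambda> t + rt (- m) (- n) t) = (\<lambda>t. - \<Lambda> t - rt m n t)" for m n
          unfolding rt_def by auto
        show "F1 z = 0"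
          using no_lower[of _ 1 0] V.root_vector_act[OF simple_root_vectors(3) z(1)] eq[of 1 0] by simp
        show "F2 z = 0"
          using no_lower[of _ 0 1] V.root_vector_act[OF simple_root_vectors(4) z(1)] eq[of 0 1] by simp
      qed
      then have "pair (snd (word_act (pair_act f1) (pair_act f2) l x0)) z = 0"
        unfolding Cons using pair_linear(4)[of _ 0 0] by (cases i) (simp_all add: pair_act_def pair_dual_act)
      ultimately show ?thesis by (simp add: fst_word)
    qed
    ultimately have "D \<subseteq> ?K" unfolding D_def lowered_span_def by (intro cvec.span_minimal) auto
    then show ?thesis using that by auto
  qed
  (* The vectors paired with 0 form a submodule without v. *)
  have inj1: "u = 0" if "(u, 0) \<in> D" for u
  proof -
    have "{u. (u, 0) \<in> D} = {0} \<or> {u. (u, 0) \<in> D} = UNIV"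
    proof (rule submodule_cases)
      show "cvec.subspace {u. (u, 0) \<in> D}" unfolding cvec.subspace_def
        using cvec.subspace_0[OF D_sub] D_add[of _ 0 _ 0] D_scale[of _ 0] by (auto simp: zero_prod_def)
      have "dual_act x 0 = 0" for x
        using lie_module_simps(3)[OF pair_act_module, of x] by (simp add: pair_act_def zero_prod_def)
      then show "\<rho> x w \<in> {u. (u, 0) \<in> D}" if "w \<in> {u. (u, 0) \<in> D}" for x w
        using D_rho[of w 0 x] that by simp
    qed
    moreover have "v \<notin> {u. (u, 0) \<in> D}" using coeff[of v 0] \<chi>(3) pair_linear(2)[of 0 0 z] by auto
    ultimately show ?thesis using that by auto
  qed
  (* The common kernel of the functionals paired with 0 is a submodule, and it contains z. *)
  have inj2: "p = 0" if "(0, p) \<in> D" for p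
  proof -
    let ?U = "{u. \<forall>p. (0, p) \<in> D \<longrightarrow> pair p u = 0}"
    have "?U = {0} \<or> ?U = UNIV"
    proof (rule submodule_cases)
      show "cvec.subspace ?U" unfolding cvec.subspace_def
        using pair_linear(4)[of _ 0 0] by (auto simp: pair_linear)
      show "\<rho> x w \<in> ?U" if "w \<in> ?U" for x w
        using that D_rho[of 0 _ x] pair_dual_act[of x _ w] by (fastforce simp: act)
    qed
    moreover have "z \<in> ?U" using coeff[of 0] \<chi>(2)[of 0 0] by auto
    ultimately have "?U = UNIV" using z(2) by auto
    then show ?thesis using that pair_linear(2)[of 0 0] by (intro pair_eqI) auto
  qed
  have total: "\<exists>p. (u, p) \<in> D" for u
  proof -
    have "{u. \<exists>p. (u, p) \<in> D} = {0} \<or> {u. \<exists>p. (u, p) \<in> D} = UNIV"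
    proof (rule submodule_cases)
      show "cvec.subspace {u. \<exists>p. (u, p) \<in> D}" unfolding cvec.subspace_def
        using cvec.subspace_0[OF D_sub] D_add D_scale by (fastforce simp: zero_prod_def)
      show "\<rho> x w \<in> {u. \<exists>p. (u, p) \<in> D}" if "w \<in> {u. \<exists>p. (u, p) \<in> D}" for x w
        using D_rho[of w _ x] that by auto
    qed
    moreover have "v \<in> {u. \<exists>p. (u, p) \<in> D}" using x0D unfolding x0_def by auto
    ultimately show ?thesis using v(2) by auto
  qed
  then obtain T where T: "\<And>u. (u, T u) \<in> D" by metis
  have T_eq: "T u = p" if "(u, p) \<in> D" for u p
  proof -
    have "(u + (-1) *\<^sub>C u, T u + (-1) *\<^sub>C p) \<in> D" by (rule D_add[OF T D_scale[OF that]])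
    then have "T u - p = 0" by (intro inj2) simp
    then show ?thesis by simp
  qed
  have T_lin: "T (u + w) = T u + T w" "T (c *\<^sub>C u) = c *\<^sub>C T u" "T (\<rho> x u) = dual_act x (T u)" for u w c x
    by (rule T_eq, rule D_add[OF T T], rule T_eq, rule D_scale[OF T], rule T_eq, rule D_rho[OF T])
  have cT: "clinear T" by (rule clinearI[OF T_lin(1,2)])
  have T_inj: "inj T"
  proof (rule injI)
    fix u w assume "T u = T w"
    then have "T (u - w) = 0" by (simp add: clinearD(4)[OF cT])
    then have "u - w = 0" using T[of "u - w"] by (intro inj1) simp
    then show "u = w" by simp
  qed
  interpret finite_dimensional_vector_space "scaleC :: complex \<Rightarrow> 'v \<Rightarrow> 'v" C
    by unfold_locales (use C in auto)
  have T_surj: "surj T"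
    by (rule linear_inj_imp_surj[OF _ T_inj]) (use cT in \<open>simp add: clinear_def\<close>)
  show ?thesis unfolding self_dual_def
  proof (intro exI[of _ "\<lambda>u. pair (T u)"] conjI allI)
    show "bij_betw (\<lambda>u. pair (T u)) UNIV linear_functionals"
      unfolding bij_betw_def
    proof
      show "inj (\<lambda>u. pair (T u))"
      proof (rule injI)
        fix u w assume "pair (T u) = pair (T w)"
        then have "T u = T w" by (intro pair_eqI) simp
        then show "u = w" using T_inj by (simp add: inj_def)
      qed
      show "range (\<lambda>u. pair (T u)) = linear_functionals"
      proof
        show "range (\<lambda>u. pair (T u)) \<subseteq> linear_functionals"
        proof
          fix f assume "f \<in> range (\<lambda>u. pair (T u))"
          then obtain u where f: "f = pair (T u)" by auto
          have "Vector_Spaces.linear scaleC (*) (pair (T u))"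
            by unfold_locales (simp_all add: pair_linear algebra_simps)
          then show "f \<in> linear_functionals" unfolding linear_functionals_def f by simp
        qed
        show "linear_functionals \<subseteq> range (\<lambda>u. pair (T u))"
        proof
          fix f :: "'v \<Rightarrow> complex" assume "f \<in> linear_functionals"
          then interpret Vector_Spaces.linear "scaleC :: complex \<Rightarrow> 'v \<Rightarrow> 'v" "(*)" f
            unfolding linear_functionals_def by simp
          obtain u where u: "rep_of f = T u" using T_surj by auto
          have "pair (T u) w = f w" for w unfolding u[symmetric] by (rule pair_rep_of) (simp_all add: add scale)
          then have "f = pair (T u)" by (intro ext) simp
          then show "f \<in> range (\<lambda>u. pair (T u))" by auto
        qed
      qed
    qed
  qed (simp_all add: T_lin pair_linear pair_dual_act)
qed

end

section \<open>Irreducible zero weight spaces\<close>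

context g2_highest
begin

text \<open>With this the relations between lowering words follow from the values of \<open>e1\<close> and \<open>e2\<close> on them.\<close>

lemma eq_by_raising:
  assumes "(m, n) \<noteq> (0, 0)" "x - y \<in> W m n" "E1 x = E1 y" "E2 x = E2 y"
  shows "x = y"
proof -
  have "x - y = 0"
    by (rule singular_zero[OF assms(2) _ _ assms(1)]) (simp_all add: act assms)
  then show ?thesis by simp
qed

lemmas span_intros = cvec.span_add cvec.span_scale cvec.span_base cvec.span_zero cvec.span_diff cvec.span_neg

lemma W_step_span:
  assumes "W m' n \<subseteq> cvec.span S" "W m n' \<subseteq> cvec.span S'" "m' = m - 1" "n' = n - 1" "(m, n) \<noteq> (0, 0)"
    and "\<forall>s\<in>S. F1 s \<in> cvec.span R" "\<forall>s\<in>S'. F2 s \<in> cvec.span R"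
  shows "W m n \<subseteq> cvec.span R"
proof
  fix x assume "x \<in> W m n"
  then obtain y z where yz: "y \<in> W (m - 1) n" "z \<in> W m (n - 1)" "x = F1 y + F2 z" using W_step assms(5) by blast
  have im: "\<rho> g u \<in> cvec.span R" if "u \<in> cvec.span Q" "\<forall>s\<in>Q. \<rho> g s \<in> cvec.span R" for g u Q
  proof -
    have "cvec.subspace {u. \<rho> g u \<in> cvec.span R}"
      unfolding cvec.subspace_def by (auto simp: act span_intros)
    then have "cvec.span Q \<subseteq> {u. \<rho> g u \<in> cvec.span R}"
      by (intro cvec.span_minimal) (use that(2) in auto)
    then show ?thesis using that(1) by auto
  qed
  show "x \<in> cvec.span R"
    unfolding yz(3) using yz(1,2) assms(1,2,6,7) unfolding assms(3,4) by (intro cvec.span_add im) auto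
qed

lemma span_insert_iff:
  fixes x :: 'v
  shows "x \<in> cvec.span (insert p S) \<longleftrightarrow> (\<exists>c y. y \<in> cvec.span S \<and> x = c *\<^sub>C p + y)"
  unfolding cvec.span_breakdown_eq by (metis add.commute add_diff_cancel_right' diff_add_cancel)

lemma W_negative_span: "m < 0 \<or> n < 0 \<Longrightarrow> W m n \<subseteq> cvec.span {}"
  using W_negative by auto

lemma W_00_span: "W 0 0 \<subseteq> cvec.span {v}"
  using W_00 by (auto simp: cvec.span_singleton)

text \<open>Irreducibility already holds under the elements \<open>\<kappa>\<close> of the simple roots. As \<open>h\<close> kills the zero
  weight space, they act there as multiples of \<open>f1 e1\<close> and \<open>f2 e2\<close>.\<close>

lemma irreducibleI:
  assumes "\<And>U. cvec.subspace U \<Longrightarrow> U \<subseteq> V0 \<Longrightarrow> (\<And>x. x \<in> U \<Longrightarrow> F1 (E1 x) \<in> U) \<Longrightarrow>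
      (\<And>x. x \<in> U \<Longrightarrow> F2 (E2 x) \<in> U) \<Longrightarrow> (\<exists>x\<in>U. x \<noteq> 0) \<Longrightarrow> V0 \<subseteq> U"
  shows "irreducible_under (casimir_algebra B h e f) \<rho> V0"
  unfolding irreducible_under_def
proof (intro conjI allI impI)
  show "invariant_subspace (casimir_algebra B h e f) \<rho> V0" by (rule V0_invariant)
  show "V0 \<noteq> {0}" using V0_nonzero by auto
  fix U assume U: "U \<subseteq> V0" "invariant_subspace (casimir_algebra B h e f) \<rho> U"
  note D = invariant_subspaceD[OF U(2)]
  have h0: "\<rho> t x = 0" if "t \<in> h" "x \<in> U" for t x
    using that U(1) unfolding V0_def weight_space_def by auto
  have half: "x \<in> U" if "x + x \<in> U" for x
  proof -
    have "(1 / 2) *\<^sub>C (x + x) \<in> U" using that by (rule cvec.subspace_scale[OF D(1)])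
    also have "(1 / 2) *\<^sub>C (x + x) = x"
      unfolding cvec.scale_right_distrib cvec.scale_left_distrib[symmetric] by simp
    finally show ?thesis .
  qed
  have "F1 (E1 x) \<in> U" "F2 (E2 x) \<in> U" if x: "x \<in> U" for x
    using D(2)[OF base_roots(1) x] D(2)[OF base_roots(2) x] h0[OF h_mem(1) x] h0[OF h_mem(2) x]
    unfolding kap_def ops by (auto intro: half)
  then have "(\<exists>x\<in>U. x \<noteq> 0) \<Longrightarrow> V0 \<subseteq> U" using assms[of U] D(1) U(1) by auto
  then show "U = {0} \<or> U = V0" using U(1) cvec.subspace_0[OF D(1)] by auto
qed

text \<open>Four is the largest number of eigenvalues of \<open>f1 e1\<close> that occurs below; shorter decompositions are
  filled up with zero vectors.\<close>

lemma eigen_split: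
  fixes l1 l2 l3 l4 :: complex
  assumes U: "cvec.subspace U" "\<And>x. x \<in> U \<Longrightarrow> F1 (E1 x) \<in> U" and dis: "distinct [l1, l2, l3, l4]"
    and y: "F1 (E1 y1) = l1 *\<^sub>C y1" "F1 (E1 y2) = l2 *\<^sub>C y2" "F1 (E1 y3) = l3 *\<^sub>C y3" "F1 (E1 y4) = l4 *\<^sub>C y4"
    and mem: "y1 + y2 + y3 + y4 \<in> U"
  shows "y1 \<in> U" "y2 \<in> U" "y3 \<in> U" "y4 \<in> U"
proof -
  let ?y = "\<lambda>k. [y1, y2, y3, y4] ! k" and ?l = "\<lambda>k. [l1, l2, l3, l4] ! k"
  have four: "{..<4} = {0, 1, 2, 3 :: nat}" by auto
  have "\<forall>k\<in>{..<4}. ?y k \<in> U"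
  proof (rule joint_eigencomponents_in_subspace[where I = "UNIV :: unit set" and T = "\<lambda>_ x. F1 (E1 x)" and \<chi> = "\<lambda>k _. ?l k"])
    show "clinear (\<lambda>x. F1 (E1 x))" by (rule clinear_comp[OF lie_module_clinear(1)[OF V_mod] lie_module_clinear(1)[OF V_mod]])
    show "F1 (E1 (?y k)) = ?l k *\<^sub>C ?y k" if "k \<in> {..<4}" for k using that y unfolding four by auto
    show "\<exists>i\<in>UNIV. ?l j \<noteq> ?l k" if "j \<in> {..<4}" "k \<in> {..<4}" "j \<noteq> k" for j k
      using nth_eq_iff_index_eq[OF dis, of j k] that by simp
    show "(\<Sum>k\<in>{..<4}. ?y k) \<in> U" unfolding four using mem by (simp add: add.assoc numeral_2_eq_2 numeral_3_eq_3)
  qed (use U in auto)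
  then show "y1 \<in> U" "y2 \<in> U" "y3 \<in> U" "y4 \<in> U" unfolding four by (simp_all add: numeral_2_eq_2 numeral_3_eq_3)
qed

lemma unscale: "cvec.subspace U \<Longrightarrow> c *\<^sub>C x \<in> U \<Longrightarrow> c \<noteq> 0 \<Longrightarrow> x \<in> U"
  using cvec.subspace_scale[of U "c *\<^sub>C x" "1 / c"] by simp

text \<open>In this lemma and the next three the weight spaces between the highest weight and zero are
  computed one after another. The vector \<open>xmn\<close>, with a letter in case of several, belongs to a basis
  of \<open>W m n\<close> that consists of lowering words; the fact \<open>Smn\<close> says that it spans, and \<open>T\<close> collects the
  values of \<open>f1\<close>, \<open>f2\<close>, \<open>e1\<close> and \<open>e2\<close> found so far. In the zero weight space the basis consists of
  eigenvectors of \<open>f1 e1\<close>.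

  For highest weight \<open>\<varpi>\<^sub>1\<close> the zero weight space is a line.\<close>

lemma irreducible_first:
  assumes ab: "a = 1" "b = 0"
  shows "irreducible_under (casimir_algebra B h e f) \<rho> V0"
proof (rule irreducibleI)
  note T = v_ops[unfolded ab, simplified] W_mem(5,6) ops act
  have "F2 v = 0"
    by (rule eq_by_raising[of 0 1], simp, (intro W_intros; simp add: T), (rule functional_separates; simp add: T; (simp add: field_simps)?)+)
  note T = T this
  have S01: "W 0 1 \<subseteq> cvec.span {}"
    by (rule W_step_span[OF W_negative_span[of "-1" "1"] W_00_span]) (simp_all add: T span_intros)
  define x10 where "x10 = F1 v"
  have x10: "x10 \<in> W 1 0" unfolding x10_def by (intro W_intros; simp add: T)
  have "E1 x10 = v" "E2 x10 = 0" unfolding x10_def by (rule functional_separates; simp add: T; (simp add: field_simps)?)+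
  note T = T x10_def[symmetric] x10 W_h[OF x10, unfolded ab, simplified] this
  have S10: "W 1 0 \<subseteq> cvec.span {x10}"
    by (rule W_step_span[OF W_00_span W_negative_span[of "1" "-1"]]) (simp_all add: T span_intros)
  define x11 where "x11 = F2 x10"
  have x11: "x11 \<in> W 1 1" unfolding x11_def by (intro W_intros; simp add: T)
  have "E1 x11 = 0" "E2 x11 = x10" unfolding x11_def by (rule functional_separates; simp add: T; (simp add: field_simps)?)+
  note T = T x11_def[symmetric] x11 W_h[OF x11, unfolded ab, simplified] this
  have S11: "W 1 1 \<subseteq> cvec.span {x11}"
    by (rule W_step_span[OF S01 S10]) (simp_all add: T span_intros)
  have "F1 x10 = 0"
    by (rule eq_by_raising[of 2 0], simp, (intro W_intros; simp add: T), (rule functional_separates; simp add: T; (simp add: field_simps)?)+)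
  note T = T this
  have S20: "W 2 0 \<subseteq> cvec.span {}"
    by (rule W_step_span[OF S10 W_negative_span[of "2" "-1"]]) (simp_all add: T span_intros)
  define u where "u = (F1 x11)"
  have u: "u \<in> W 2 1" unfolding u_def by (intro W_intros; simp add: T)
  have "E1 u = 2 *\<^sub>C x11" "E2 u = 0" unfolding u_def by (rule functional_separates; simp add: T; (simp add: field_simps)?)+
  note T = T u W_h[OF u, unfolded ab, simplified] this
  have "F1 x11 = u"
    by (rule eq_by_raising[of 2 1], simp, (intro W_intros; simp add: T), (rule functional_separates; simp add: T; (simp add: field_simps)?)+)
  note T = T this
  have S21: "W 2 1 \<subseteq> cvec.span {u}"
    by (rule W_step_span[OF S11 S20]) (simp_all add: T span_intros)
  have X_u: "F1 (E1 u) = 2 *\<^sub>C u" by (rule functional_separates; simp add: T; (simp add: field_simps)?)+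
  have Y_u: "F2 (E2 u) = 0" by (rule functional_separates; simp add: T; (simp add: field_simps)?)+
  fix U assume U: "cvec.subspace U" "U \<subseteq> V0" and nz: "\<exists>x\<in>U. x \<noteq> 0"
  have V0: "V0 \<subseteq> cvec.span {u}" unfolding V0_W ab using S21 by simp
  obtain x where x: "x \<in> U" "x \<noteq> 0" using nz by auto
  then obtain c where c: "x = c *\<^sub>C u" using U(2) V0 by (auto simp: cvec.span_singleton)
  then have "u \<in> U" using x unscale[OF U(1)] by auto
  then show "V0 \<subseteq> U" using V0 cvec.span_minimal[of "{u}" U] U(1) by auto
qed

text \<open>The eigenvalues of \<open>f1 e1\<close> on \<open>p\<close> and \<open>q\<close> are \<open>2\<close> and \<open>0\<close>, hence an invariant subspace contains
  \<open>p\<close> or \<open>q\<close>; all entries of the matrix of \<open>f2 e2\<close> are nonzero, which yields the other one.\<close>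

lemma irreducible_second:
  assumes ab: "a = 0" "b = 1"
  shows "irreducible_under (casimir_algebra B h e f) \<rho> V0"
proof (rule irreducibleI)
  note T = v_ops[unfolded ab, simplified] W_mem(5,6) ops act
  define x01 where "x01 = F2 v"
  have x01: "x01 \<in> W 0 1" unfolding x01_def by (intro W_intros; simp add: T)
  have "E1 x01 = 0" "E2 x01 = v" unfolding x01_def by (rule functional_separates; simp add: T; (simp add: field_simps)?)+
  note T = T x01_def[symmetric] x01 W_h[OF x01, unfolded ab, simplified] this
  have S01: "W 0 1 \<subseteq> cvec.span {x01}"
    by (rule W_step_span[OF W_negative_span[of "-1" "1"] W_00_span]) (simp_all add: T span_intros)
  have "F1 v = 0"
    by (rule eq_by_raising[of 1 0], simp, (intro W_intros; simp add: T), (rule functional_separates; simp add: T; (simp add: field_simps)?)+)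
  note T = T this
  have S10: "W 1 0 \<subseteq> cvec.span {}"
    by (rule W_step_span[OF W_00_span W_negative_span[of "1" "-1"]]) (simp_all add: T span_intros)
  have "F2 x01 = 0"
    by (rule eq_by_raising[of 0 2], simp, (intro W_intros; simp add: T), (rule functional_separates; simp add: T; (simp add: field_simps)?)+)
  note T = T this
  have S02: "W 0 2 \<subseteq> cvec.span {}"
    by (rule W_step_span[OF W_negative_span[of "-1" "2"] S01]) (simp_all add: T span_intros)
  define x11 where "x11 = F1 x01"
  have x11: "x11 \<in> W 1 1" unfolding x11_def by (intro W_intros; simp add: T)
  have "E1 x11 = 3 *\<^sub>C x01" "E2 x11 = 0" unfolding x11_def by (rule functional_separates; simp add: T; (simp add: field_simps)?)+
  note T = T x11_def[symmetric] x11 W_h[OF x11, unfolded ab, simplified] this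
  have S11: "W 1 1 \<subseteq> cvec.span {x11}"
    by (rule W_step_span[OF S01 S10]) (simp_all add: T span_intros)
  have S20: "W 2 0 \<subseteq> cvec.span {}"
    by (rule W_step_span[OF S10 W_negative_span[of "2" "-1"]]) (simp_all add: T span_intros)
  have "F2 x11 = 0"
    by (rule eq_by_raising[of 1 2], simp, (intro W_intros; simp add: T), (rule functional_separates; simp add: T; (simp add: field_simps)?)+)
  note T = T this
  have S12: "W 1 2 \<subseteq> cvec.span {}"
    by (rule W_step_span[OF S02 S11]) (simp_all add: T span_intros)
  define x21 where "x21 = F1 x11"
  have x21: "x21 \<in> W 2 1" unfolding x21_def by (intro W_intros; simp add: T)
  have "E1 x21 = 4 *\<^sub>C x11" "E2 x21 = 0" unfolding x21_def by (rule functional_separates; simp add: T; (simp add: field_simps)?)+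
  note T = T x21_def[symmetric] x21 W_h[OF x21, unfolded ab, simplified] this
  have S21: "W 2 1 \<subseteq> cvec.span {x21}"
    by (rule W_step_span[OF S11 S20]) (simp_all add: T span_intros)
  have S30: "W 3 0 \<subseteq> cvec.span {}"
    by (rule W_step_span[OF S20 W_negative_span[of "3" "-1"]]) (simp_all add: T span_intros)
  define x22 where "x22 = F2 x21"
  have x22: "x22 \<in> W 2 2" unfolding x22_def by (intro W_intros; simp add: T)
  have "E1 x22 = 0" "E2 x22 = x21" unfolding x22_def by (rule functional_separates; simp add: T; (simp add: field_simps)?)+
  note T = T x22_def[symmetric] x22 W_h[OF x22, unfolded ab, simplified] this
  have S22: "W 2 2 \<subseteq> cvec.span {x22}"
    by (rule W_step_span[OF S12 S21]) (simp_all add: T span_intros)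
  define x31 where "x31 = F1 x21"
  have x31: "x31 \<in> W 3 1" unfolding x31_def by (intro W_intros; simp add: T)
  have "E1 x31 = 3 *\<^sub>C x21" "E2 x31 = 0" unfolding x31_def by (rule functional_separates; simp add: T; (simp add: field_simps)?)+
  note T = T x31_def[symmetric] x31 W_h[OF x31, unfolded ab, simplified] this
  have S31: "W 3 1 \<subseteq> cvec.span {x31}"
    by (rule W_step_span[OF S21 S30]) (simp_all add: T span_intros)
  define p where "p = (F1 x22)"
  have p: "p \<in> W 3 2" unfolding p_def by (intro W_intros; simp add: T)
  have "E1 p = 2 *\<^sub>C x22" "E2 p = x31" unfolding p_def by (rule functional_separates; simp add: T; (simp add: field_simps)?)+
  note T = T p W_h[OF p, unfolded ab, simplified] this
  define q where "q = (-3) *\<^sub>C (F1 x22) + 2 *\<^sub>C (F2 x31)"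
  have q: "q \<in> W 3 2" unfolding q_def by (intro W_intros; simp add: T)
  have "E1 q = 0" "E2 q = x31" unfolding q_def by (rule functional_separates; simp add: T; (simp add: field_simps)?)+
  note T = T q W_h[OF q, unfolded ab, simplified] this
  have "F1 x22 = p"
    by (rule eq_by_raising[of 3 2], simp, (intro W_intros; simp add: T), (rule functional_separates; simp add: T; (simp add: field_simps)?)+)
  note T = T this
  have "F2 x31 = (3 / 2) *\<^sub>C p + (1 / 2) *\<^sub>C q"
    by (rule eq_by_raising[of 3 2], simp, (intro W_intros; simp add: T), (rule functional_separates; simp add: T; (simp add: field_simps)?)+)
  note T = T this
  have S32: "W 3 2 \<subseteq> cvec.span {p, q}"
    by (rule W_step_span[OF S22 S31]) (simp_all add: T span_intros)
  have X_p: "F1 (E1 p) = 2 *\<^sub>C p" by (rule functional_separates; simp add: T; (simp add: field_simps)?)+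
  have Y_p: "F2 (E2 p) = (3 / 2) *\<^sub>C p + (1 / 2) *\<^sub>C q" by (rule functional_separates; simp add: T; (simp add: field_simps)?)+
  have X_q: "F1 (E1 q) = 0" by (rule functional_separates; simp add: T; (simp add: field_simps)?)+
  have Y_q: "F2 (E2 q) = (3 / 2) *\<^sub>C p + (1 / 2) *\<^sub>C q" by (rule functional_separates; simp add: T; (simp add: field_simps)?)+
  fix U assume U: "cvec.subspace U" "U \<subseteq> V0" and X: "\<And>x. x \<in> U \<Longrightarrow> F1 (E1 x) \<in> U"
    and Y: "\<And>x. x \<in> U \<Longrightarrow> F2 (E2 x) \<in> U" and nz: "\<exists>x\<in>U. x \<noteq> 0"
  have V0: "V0 \<subseteq> cvec.span {p, q}" unfolding V0_W ab using S32 by simp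
  have split: "c *\<^sub>C p \<in> U" "d *\<^sub>C q \<in> U" if "c *\<^sub>C p + d *\<^sub>C q \<in> U" for c d
    using eigen_split[OF U(1) X, of 2 0 1 3 "c *\<^sub>C p" "d *\<^sub>C q" 0 0] that
    by (simp_all add: act X_p X_q cvec.scale_left_commute)
  have p: "q \<in> U" if "p \<in> U" using Y[OF that] split(2) unscale[OF U(1)] unfolding Y_p by fastforce
  have q: "p \<in> U" if "q \<in> U" using Y[OF that] split(1) unscale[OF U(1)] unfolding Y_q by fastforce
  obtain x where x: "x \<in> U" "x \<noteq> 0" using nz by auto
  have "x \<in> cvec.span {p, q}" using x(1) U(2) V0 by auto
  then have "\<exists>c d. x = c *\<^sub>C p + d *\<^sub>C q"
    unfolding span_insert_iff cvec.span_empty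
    by (elim exE conjE) (simp only: singleton_iff add_0_right add.assoc, blast)
  then obtain c d where x_eq: "x = c *\<^sub>C p + d *\<^sub>C q" by auto
  have "c \<noteq> 0 \<or> d \<noteq> 0" using x(2) x_eq by auto
  then have "p \<in> U \<or> q \<in> U" using split[of c d] x(1) x_eq unscale[OF U(1)] by auto
  then have "{p, q} \<subseteq> U" using p q by blast
  then show "V0 \<subseteq> U" using V0 cvec.span_minimal[of "{p, q}" U] U(1) by auto
qed

text \<open>The same argument with the eigenvalues \<open>6\<close>, \<open>2\<close> and \<open>0\<close>.\<close>

lemma irreducible_twice_first:
  assumes ab: "a = 2" "b = 0"
  shows "irreducible_under (casimir_algebra B h e f) \<rho> V0"
proof (rule irreducibleI)
  note T = v_ops[unfolded ab, simplified] W_mem(5,6) ops act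
  have "F2 v = 0"
    by (rule eq_by_raising[of 0 1], simp, (intro W_intros; simp add: T), (rule functional_separates; simp add: T; (simp add: field_simps)?)+)
  note T = T this
  have S01: "W 0 1 \<subseteq> cvec.span {}"
    by (rule W_step_span[OF W_negative_span[of "-1" "1"] W_00_span]) (simp_all add: T span_intros)
  define x10 where "x10 = F1 v"
  have x10: "x10 \<in> W 1 0" unfolding x10_def by (intro W_intros; simp add: T)
  have "E1 x10 = 2 *\<^sub>C v" "E2 x10 = 0" unfolding x10_def by (rule functional_separates; simp add: T; (simp add: field_simps)?)+
  note T = T x10_def[symmetric] x10 W_h[OF x10, unfolded ab, simplified] this
  have S10: "W 1 0 \<subseteq> cvec.span {x10}"
    by (rule W_step_span[OF W_00_span W_negative_span[of "1" "-1"]]) (simp_all add: T span_intros)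
  have S02: "W 0 2 \<subseteq> cvec.span {}"
    by (rule W_step_span[OF W_negative_span[of "-1" "2"] S01]) (simp_all add: T span_intros)
  define x11 where "x11 = F2 x10"
  have x11: "x11 \<in> W 1 1" unfolding x11_def by (intro W_intros; simp add: T)
  have "E1 x11 = 0" "E2 x11 = x10" unfolding x11_def by (rule functional_separates; simp add: T; (simp add: field_simps)?)+
  note T = T x11_def[symmetric] x11 W_h[OF x11, unfolded ab, simplified] this
  have S11: "W 1 1 \<subseteq> cvec.span {x11}"
    by (rule W_step_span[OF S01 S10]) (simp_all add: T span_intros)
  define x20 where "x20 = F1 x10"
  have x20: "x20 \<in> W 2 0" unfolding x20_def by (intro W_intros; simp add: T)
  have "E1 x20 = 2 *\<^sub>C x10" "E2 x20 = 0" unfolding x20_def by (rule functional_separates; simp add: T; (simp add: field_simps)?)+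
  note T = T x20_def[symmetric] x20 W_h[OF x20, unfolded ab, simplified] this
  have S20: "W 2 0 \<subseteq> cvec.span {x20}"
    by (rule W_step_span[OF S10 W_negative_span[of "2" "-1"]]) (simp_all add: T span_intros)
  have "F2 x11 = 0"
    by (rule eq_by_raising[of 1 2], simp, (intro W_intros; simp add: T), (rule functional_separates; simp add: T; (simp add: field_simps)?)+)
  note T = T this
  have S12: "W 1 2 \<subseteq> cvec.span {}"
    by (rule W_step_span[OF S02 S11]) (simp_all add: T span_intros)
  define x21a where "x21a = F1 x11"
  have x21a: "x21a \<in> W 2 1" unfolding x21a_def by (intro W_intros; simp add: T)
  have "E1 x21a = 3 *\<^sub>C x11" "E2 x21a = x20" unfolding x21a_def by (rule functional_separates; simp add: T; (simp add: field_simps)?)+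
  note T = T x21a_def[symmetric] x21a W_h[OF x21a, unfolded ab, simplified] this
  define x21b where "x21b = F2 x20"
  have x21b: "x21b \<in> W 2 1" unfolding x21b_def by (intro W_intros; simp add: T)
  have "E1 x21b = 2 *\<^sub>C x11" "E2 x21b = 2 *\<^sub>C x20" unfolding x21b_def by (rule functional_separates; simp add: T; (simp add: field_simps)?)+
  note T = T x21b_def[symmetric] x21b W_h[OF x21b, unfolded ab, simplified] this
  have S21: "W 2 1 \<subseteq> cvec.span {x21a, x21b}"
    by (rule W_step_span[OF S11 S20]) (simp_all add: T span_intros)
  have "F1 x20 = 0"
    by (rule eq_by_raising[of 3 0], simp, (intro W_intros; simp add: T), (rule functional_separates; simp add: T; (simp add: field_simps)?)+)
  note T = T this
  have S30: "W 3 0 \<subseteq> cvec.span {}"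
    by (rule W_step_span[OF S20 W_negative_span[of "3" "-1"]]) (simp_all add: T span_intros)
  define x22 where "x22 = F2 x21a"
  have x22: "x22 \<in> W 2 2" unfolding x22_def by (intro W_intros; simp add: T)
  have "E1 x22 = 0" "E2 x22 = x21b" unfolding x22_def by (rule functional_separates; simp add: T; (simp add: field_simps)?)+
  note T = T x22_def[symmetric] x22 W_h[OF x22, unfolded ab, simplified] this
  have "F2 x21b = 2 *\<^sub>C x22"
    by (rule eq_by_raising[of 2 2], simp, (intro W_intros; simp add: T), (rule functional_separates; simp add: T; (simp add: field_simps)?)+)
  note T = T this
  have S22: "W 2 2 \<subseteq> cvec.span {x22}"
    by (rule W_step_span[OF S12 S21]) (simp_all add: T span_intros)
  define x31a where "x31a = F1 x21a"
  have x31a: "x31a \<in> W 3 1" unfolding x31a_def by (intro W_intros; simp add: T)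
  have "E1 x31a = 4 *\<^sub>C x21a" "E2 x31a = 0" unfolding x31a_def by (rule functional_separates; simp add: T; (simp add: field_simps)?)+
  note T = T x31a_def[symmetric] x31a W_h[OF x31a, unfolded ab, simplified] this
  define x31b where "x31b = F1 x21b"
  have x31b: "x31b \<in> W 3 1" unfolding x31b_def by (intro W_intros; simp add: T)
  have "E1 x31b = 2 *\<^sub>C x21a + x21b" "E2 x31b = 0" unfolding x31b_def by (rule functional_separates; simp add: T; (simp add: field_simps)?)+
  note T = T x31b_def[symmetric] x31b W_h[OF x31b, unfolded ab, simplified] this
  have S31: "W 3 1 \<subseteq> cvec.span {x31a, x31b}"
    by (rule W_step_span[OF S21 S30]) (simp_all add: T span_intros)
  have S40: "W 4 0 \<subseteq> cvec.span {}"
    by (rule W_step_span[OF S30 W_negative_span[of "4" "-1"]]) (simp_all add: T span_intros)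
  define x32a where "x32a = F1 x22"
  have x32a: "x32a \<in> W 3 2" unfolding x32a_def by (intro W_intros; simp add: T)
  have "E1 x32a = 4 *\<^sub>C x22" "E2 x32a = x31b" unfolding x32a_def by (rule functional_separates; simp add: T; (simp add: field_simps)?)+
  note T = T x32a_def[symmetric] x32a W_h[OF x32a, unfolded ab, simplified] this
  define x32b where "x32b = F2 x31a"
  have x32b: "x32b \<in> W 3 2" unfolding x32b_def by (intro W_intros; simp add: T)
  have "E1 x32b = 4 *\<^sub>C x22" "E2 x32b = x31a" unfolding x32b_def by (rule functional_separates; simp add: T; (simp add: field_simps)?)+
  note T = T x32b_def[symmetric] x32b W_h[OF x32b, unfolded ab, simplified] this
  have "F2 x31b = x32a"
    by (rule eq_by_raising[of 3 2], simp, (intro W_intros; simp add: T), (rule functional_separates; simp add: T; (simp add: field_simps)?)+)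
  note T = T this
  have S32: "W 3 2 \<subseteq> cvec.span {x32a, x32b}"
    by (rule W_step_span[OF S22 S31]) (simp_all add: T span_intros)
  define x41 where "x41 = F1 x31a"
  have x41: "x41 \<in> W 4 1" unfolding x41_def by (intro W_intros; simp add: T)
  have "E1 x41 = 3 *\<^sub>C x31a" "E2 x41 = 0" unfolding x41_def by (rule functional_separates; simp add: T; (simp add: field_simps)?)+
  note T = T x41_def[symmetric] x41 W_h[OF x41, unfolded ab, simplified] this
  have "F1 x31b = (2 / 3) *\<^sub>C x41"
    by (rule eq_by_raising[of 4 1], simp, (intro W_intros; simp add: T), (rule functional_separates; simp add: T; (simp add: field_simps)?)+)
  note T = T this
  have S41: "W 4 1 \<subseteq> cvec.span {x41}"
    by (rule W_step_span[OF S31 S40]) (simp_all add: T span_intros)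
  define p where "p = (F1 x32a)"
  have p: "p \<in> W 4 2" unfolding p_def by (intro W_intros; simp add: T)
  have "E1 p = 6 *\<^sub>C x32a" "E2 p = (2 / 3) *\<^sub>C x41" unfolding p_def by (rule functional_separates; simp add: T; (simp add: field_simps)?)+
  note T = T p W_h[OF p, unfolded ab, simplified] this
  define q where "q = (-1) *\<^sub>C (F1 x32a) + (F1 x32b)"
  have q: "q \<in> W 4 2" unfolding q_def by (intro W_intros; simp add: T)
  have "E1 q = (-2) *\<^sub>C x32a + 2 *\<^sub>C x32b" "E2 q = (1 / 3) *\<^sub>C x41" unfolding q_def by (rule functional_separates; simp add: T; (simp add: field_simps)?)+
  note T = T q W_h[OF q, unfolded ab, simplified] this
  define r where "r = 2 *\<^sub>C (F1 x32a) + (-3) *\<^sub>C (F1 x32b) + 2 *\<^sub>C (F2 x41)"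
  have r: "r \<in> W 4 2" unfolding r_def by (intro W_intros; simp add: T)
  have "E1 r = 0" "E2 r = (7 / 3) *\<^sub>C x41" unfolding r_def by (rule functional_separates; simp add: T; (simp add: field_simps)?)+
  note T = T r W_h[OF r, unfolded ab, simplified] this
  have "F1 x32a = p"
    by (rule eq_by_raising[of 4 2], simp, (intro W_intros; simp add: T), (rule functional_separates; simp add: T; (simp add: field_simps)?)+)
  note T = T this
  have "F1 x32b = p + q"
    by (rule eq_by_raising[of 4 2], simp, (intro W_intros; simp add: T), (rule functional_separates; simp add: T; (simp add: field_simps)?)+)
  note T = T this
  have "F2 x41 = (1 / 2) *\<^sub>C p + (3 / 2) *\<^sub>C q + (1 / 2) *\<^sub>C r"
    by (rule eq_by_raising[of 4 2], simp, (intro W_intros; simp add: T), (rule functional_separates; simp add: T; (simp add: field_simps)?)+)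
  note T = T this
  have S42: "W 4 2 \<subseteq> cvec.span {p, q, r}"
    by (rule W_step_span[OF S32 S41]) (simp_all add: T span_intros)
  have X_p: "F1 (E1 p) = 6 *\<^sub>C p" by (rule functional_separates; simp add: T; (simp add: field_simps)?)+
  have Y_p: "F2 (E2 p) = (1 / 3) *\<^sub>C p + q + (1 / 3) *\<^sub>C r" by (rule functional_separates; simp add: T; (simp add: field_simps)?)+
  have X_q: "F1 (E1 q) = 2 *\<^sub>C q" by (rule functional_separates; simp add: T; (simp add: field_simps)?)+
  have Y_q: "F2 (E2 q) = (1 / 6) *\<^sub>C p + (1 / 2) *\<^sub>C q + (1 / 6) *\<^sub>C r" by (rule functional_separates; simp add: T; (simp add: field_simps)?)+
  have X_r: "F1 (E1 r) = 0" by (rule functional_separates; simp add: T; (simp add: field_simps)?)+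
  have Y_r: "F2 (E2 r) = (7 / 6) *\<^sub>C p + (7 / 2) *\<^sub>C q + (7 / 6) *\<^sub>C r" by (rule functional_separates; simp add: T; (simp add: field_simps)?)+
  fix U assume U: "cvec.subspace U" "U \<subseteq> V0" and X: "\<And>x. x \<in> U \<Longrightarrow> F1 (E1 x) \<in> U"
    and Y: "\<And>x. x \<in> U \<Longrightarrow> F2 (E2 x) \<in> U" and nz: "\<exists>x\<in>U. x \<noteq> 0"
  have V0: "V0 \<subseteq> cvec.span {p, q, r}" unfolding V0_W ab using S42 by simp
  have split: "c *\<^sub>C p \<in> U" "d *\<^sub>C q \<in> U" "k *\<^sub>C r \<in> U" if "c *\<^sub>C p + d *\<^sub>C q + k *\<^sub>C r \<in> U" for c d k
    using eigen_split[OF U(1) X, of 6 2 0 1 "c *\<^sub>C p" "d *\<^sub>C q" "k *\<^sub>C r" 0] that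
    by (simp_all add: act X_p X_q X_r cvec.scale_left_commute)
  have full: "p \<in> U \<and> q \<in> U \<and> r \<in> U" if "c *\<^sub>C p + d *\<^sub>C q + k *\<^sub>C r \<in> U" "c \<noteq> 0" "d \<noteq> 0" "k \<noteq> 0" for c d k
    using unscale[OF U(1) split(1)[OF that(1)]] unscale[OF U(1) split(2)[OF that(1)]]
      unscale[OF U(1) split(3)[OF that(1)]] that(2-) by simp
  have any_p: "p \<in> U \<and> q \<in> U \<and> r \<in> U" if "p \<in> U"
    using full[of "1 / 3" 1 "1 / 3"] Y[OF that] unfolding Y_p by simp
  have any_q: "p \<in> U \<and> q \<in> U \<and> r \<in> U" if "q \<in> U"
    using full[of "1 / 6" "1 / 2" "1 / 6"] Y[OF that] unfolding Y_q by simp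
  have any_r: "p \<in> U \<and> q \<in> U \<and> r \<in> U" if "r \<in> U"
    using full[of "7 / 6" "7 / 2" "7 / 6"] Y[OF that] unfolding Y_r by simp
  obtain x where x: "x \<in> U" "x \<noteq> 0" using nz by auto
  have "x \<in> cvec.span {p, q, r}" using x(1) U(2) V0 by auto
  then have "\<exists>c d k. x = c *\<^sub>C p + d *\<^sub>C q + k *\<^sub>C r"
    unfolding span_insert_iff cvec.span_empty
    by (elim exE conjE) (simp only: singleton_iff add_0_right add.assoc, blast)
  then obtain c d k where x_eq: "x = c *\<^sub>C p + d *\<^sub>C q + k *\<^sub>C r" by auto
  have "c \<noteq> 0 \<or> d \<noteq> 0 \<or> k \<noteq> 0" using x(2) x_eq by auto
  then have "p \<in> U \<or> q \<in> U \<or> r \<in> U" using split[of c d k] x(1) x_eq unscale[OF U(1), of c p] unscale[OF U(1), of d q]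
      unscale[OF U(1), of k r] by auto
  then have "{p, q, r} \<subseteq> U" using any_p any_q any_r by blast
  then show "V0 \<subseteq> U" using V0 cvec.span_minimal[of "{p, q, r}" U] U(1) by auto
qed

text \<open>The eigenvalues are \<open>12\<close>, \<open>6\<close>, \<open>2\<close> and \<open>0\<close>, the last one twice, on \<open>s\<close> and \<open>t\<close>. From each
  eigenvector, \<open>f2 e2\<close> leads to \<open>p\<close>, and from \<open>p\<close> to the other basis vectors. For a combination of
  \<open>s\<close> and \<open>t\<close> this holds because its components along \<open>p\<close> and \<open>q\<close> do not vanish both.\<close>

lemma irreducible_twice_second:
  assumes ab: "a = 0" "b = 2"
  shows "irreducible_under (casimir_algebra B h e f) \<rho> V0"
proof (rule irreducibleI)
  note T = v_ops[unfolded ab, simplified] W_mem(5,6) ops act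
  define x01 where "x01 = F2 v"
  have x01: "x01 \<in> W 0 1" unfolding x01_def by (intro W_intros; simp add: T)
  have "E1 x01 = 0" "E2 x01 = 2 *\<^sub>C v" unfolding x01_def by (rule functional_separates; simp add: T; (simp add: field_simps)?)+
  note T = T x01_def[symmetric] x01 W_h[OF x01, unfolded ab, simplified] this
  have S01: "W 0 1 \<subseteq> cvec.span {x01}"
    by (rule W_step_span[OF W_negative_span[of "-1" "1"] W_00_span]) (simp_all add: T span_intros)
  have "F1 v = 0"
    by (rule eq_by_raising[of 1 0], simp, (intro W_intros; simp add: T), (rule functional_separates; simp add: T; (simp add: field_simps)?)+)
  note T = T this
  have S10: "W 1 0 \<subseteq> cvec.span {}"
    by (rule W_step_span[OF W_00_span W_negative_span[of "1" "-1"]]) (simp_all add: T span_intros)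
  define x02 where "x02 = F2 x01"
  have x02: "x02 \<in> W 0 2" unfolding x02_def by (intro W_intros; simp add: T)
  have "E1 x02 = 0" "E2 x02 = 2 *\<^sub>C x01" unfolding x02_def by (rule functional_separates; simp add: T; (simp add: field_simps)?)+
  note T = T x02_def[symmetric] x02 W_h[OF x02, unfolded ab, simplified] this
  have S02: "W 0 2 \<subseteq> cvec.span {x02}"
    by (rule W_step_span[OF W_negative_span[of "-1" "2"] S01]) (simp_all add: T span_intros)
  define x11 where "x11 = F1 x01"
  have x11: "x11 \<in> W 1 1" unfolding x11_def by (intro W_intros; simp add: T)
  have "E1 x11 = 3 *\<^sub>C x01" "E2 x11 = 0" unfolding x11_def by (rule functional_separates; simp add: T; (simp add: field_simps)?)+
  note T = T x11_def[symmetric] x11 W_h[OF x11, unfolded ab, simplified] this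
  have S11: "W 1 1 \<subseteq> cvec.span {x11}"
    by (rule W_step_span[OF S01 S10]) (simp_all add: T span_intros)
  have S20: "W 2 0 \<subseteq> cvec.span {}"
    by (rule W_step_span[OF S10 W_negative_span[of "2" "-1"]]) (simp_all add: T span_intros)
  have "F2 x02 = 0"
    by (rule eq_by_raising[of 0 3], simp, (intro W_intros; simp add: T), (rule functional_separates; simp add: T; (simp add: field_simps)?)+)
  note T = T this
  have S03: "W 0 3 \<subseteq> cvec.span {}"
    by (rule W_step_span[OF W_negative_span[of "-1" "3"] S02]) (simp_all add: T span_intros)
  define x12 where "x12 = F1 x02"
  have x12: "x12 \<in> W 1 2" unfolding x12_def by (intro W_intros; simp add: T)
  have "E1 x12 = 6 *\<^sub>C x02" "E2 x12 = 2 *\<^sub>C x11" unfolding x12_def by (rule functional_separates; simp add: T; (simp add: field_simps)?)+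
  note T = T x12_def[symmetric] x12 W_h[OF x12, unfolded ab, simplified] this
  have "F2 x11 = (1 / 2) *\<^sub>C x12"
    by (rule eq_by_raising[of 1 2], simp, (intro W_intros; simp add: T), (rule functional_separates; simp add: T; (simp add: field_simps)?)+)
  note T = T this
  have S12: "W 1 2 \<subseteq> cvec.span {x12}"
    by (rule W_step_span[OF S02 S11]) (simp_all add: T span_intros)
  define x21 where "x21 = F1 x11"
  have x21: "x21 \<in> W 2 1" unfolding x21_def by (intro W_intros; simp add: T)
  have "E1 x21 = 4 *\<^sub>C x11" "E2 x21 = 0" unfolding x21_def by (rule functional_separates; simp add: T; (simp add: field_simps)?)+
  note T = T x21_def[symmetric] x21 W_h[OF x21, unfolded ab, simplified] this
  have S21: "W 2 1 \<subseteq> cvec.span {x21}"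
    by (rule W_step_span[OF S11 S20]) (simp_all add: T span_intros)
  have S30: "W 3 0 \<subseteq> cvec.span {}"
    by (rule W_step_span[OF S20 W_negative_span[of "3" "-1"]]) (simp_all add: T span_intros)
  have S04: "W 0 4 \<subseteq> cvec.span {}"
    by (rule W_step_span[OF W_negative_span[of "-1" "4"] S03]) (simp_all add: T span_intros)
  have "F2 x12 = 0"
    by (rule eq_by_raising[of 1 3], simp, (intro W_intros; simp add: T), (rule functional_separates; simp add: T; (simp add: field_simps)?)+)
  note T = T this
  have S13: "W 1 3 \<subseteq> cvec.span {}"
    by (rule W_step_span[OF S03 S12]) (simp_all add: T span_intros)
  define x22a where "x22a = F1 x12"
  have x22a: "x22a \<in> W 2 2" unfolding x22a_def by (intro W_intros; simp add: T)
  have "E1 x22a = 10 *\<^sub>C x12" "E2 x22a = 2 *\<^sub>C x21" unfolding x22a_def by (rule functional_separates; simp add: T; (simp add: field_simps)?)+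
  note T = T x22a_def[symmetric] x22a W_h[OF x22a, unfolded ab, simplified] this
  define x22b where "x22b = F2 x21"
  have x22b: "x22b \<in> W 2 2" unfolding x22b_def by (intro W_intros; simp add: T)
  have "E1 x22b = 2 *\<^sub>C x12" "E2 x22b = 2 *\<^sub>C x21" unfolding x22b_def by (rule functional_separates; simp add: T; (simp add: field_simps)?)+
  note T = T x22b_def[symmetric] x22b W_h[OF x22b, unfolded ab, simplified] this
  have S22: "W 2 2 \<subseteq> cvec.span {x22a, x22b}"
    by (rule W_step_span[OF S12 S21]) (simp_all add: T span_intros)
  define x31 where "x31 = F1 x21"
  have x31: "x31 \<in> W 3 1" unfolding x31_def by (intro W_intros; simp add: T)
  have "E1 x31 = 3 *\<^sub>C x21" "E2 x31 = 0" unfolding x31_def by (rule functional_separates; simp add: T; (simp add: field_simps)?)+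
  note T = T x31_def[symmetric] x31 W_h[OF x31, unfolded ab, simplified] this
  have S31: "W 3 1 \<subseteq> cvec.span {x31}"
    by (rule W_step_span[OF S21 S30]) (simp_all add: T span_intros)
  have S40: "W 4 0 \<subseteq> cvec.span {}"
    by (rule W_step_span[OF S30 W_negative_span[of "4" "-1"]]) (simp_all add: T span_intros)
  have S14: "W 1 4 \<subseteq> cvec.span {}"
    by (rule W_step_span[OF S04 S13]) (simp_all add: T span_intros)
  define x23 where "x23 = F2 x22a"
  have x23: "x23 \<in> W 2 3" unfolding x23_def by (intro W_intros; simp add: T)
  have "E1 x23 = 0" "E2 x23 = 2 *\<^sub>C x22b" unfolding x23_def by (rule functional_separates; simp add: T; (simp add: field_simps)?)+
  note T = T x23_def[symmetric] x23 W_h[OF x23, unfolded ab, simplified] this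
  have "F2 x22b = x23"
    by (rule eq_by_raising[of 2 3], simp, (intro W_intros; simp add: T), (rule functional_separates; simp add: T; (simp add: field_simps)?)+)
  note T = T this
  have S23: "W 2 3 \<subseteq> cvec.span {x23}"
    by (rule W_step_span[OF S13 S22]) (simp_all add: T span_intros)
  define x32a where "x32a = F1 x22a"
  have x32a: "x32a \<in> W 3 2" unfolding x32a_def by (intro W_intros; simp add: T)
  have "E1 x32a = 12 *\<^sub>C x22a" "E2 x32a = 2 *\<^sub>C x31" unfolding x32a_def by (rule functional_separates; simp add: T; (simp add: field_simps)?)+
  note T = T x32a_def[symmetric] x32a W_h[OF x32a, unfolded ab, simplified] this
  define x32b where "x32b = F1 x22b"
  have x32b: "x32b \<in> W 3 2" unfolding x32b_def by (intro W_intros; simp add: T)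
  have "E1 x32b = 2 *\<^sub>C x22a + 2 *\<^sub>C x22b" "E2 x32b = 2 *\<^sub>C x31" unfolding x32b_def by (rule functional_separates; simp add: T; (simp add: field_simps)?)+
  note T = T x32b_def[symmetric] x32b W_h[OF x32b, unfolded ab, simplified] this
  define x32c where "x32c = F2 x31"
  have x32c: "x32c \<in> W 3 2" unfolding x32c_def by (intro W_intros; simp add: T)
  have "E1 x32c = 3 *\<^sub>C x22b" "E2 x32c = 3 *\<^sub>C x31" unfolding x32c_def by (rule functional_separates; simp add: T; (simp add: field_simps)?)+
  note T = T x32c_def[symmetric] x32c W_h[OF x32c, unfolded ab, simplified] this
  have S32: "W 3 2 \<subseteq> cvec.span {x32a, x32b, x32c}"
    by (rule W_step_span[OF S22 S31]) (simp_all add: T span_intros)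
  have "F1 x31 = 0"
    by (rule eq_by_raising[of 4 1], simp, (intro W_intros; simp add: T), (rule functional_separates; simp add: T; (simp add: field_simps)?)+)
  note T = T this
  have S41: "W 4 1 \<subseteq> cvec.span {}"
    by (rule W_step_span[OF S31 S40]) (simp_all add: T span_intros)
  have S50: "W 5 0 \<subseteq> cvec.span {}"
    by (rule W_step_span[OF S40 W_negative_span[of "5" "-1"]]) (simp_all add: T span_intros)
  have "F2 x23 = 0"
    by (rule eq_by_raising[of 2 4], simp, (intro W_intros; simp add: T), (rule functional_separates; simp add: T; (simp add: field_simps)?)+)
  note T = T this
  have S24: "W 2 4 \<subseteq> cvec.span {}"
    by (rule W_step_span[OF S14 S23]) (simp_all add: T span_intros)
  define x33a where "x33a = F1 x23"
  have x33a: "x33a \<in> W 3 3" unfolding x33a_def by (intro W_intros; simp add: T)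
  have "E1 x33a = 5 *\<^sub>C x23" "E2 x33a = 2 *\<^sub>C x32b" unfolding x33a_def by (rule functional_separates; simp add: T; (simp add: field_simps)?)+
  note T = T x33a_def[symmetric] x33a W_h[OF x33a, unfolded ab, simplified] this
  define x33b where "x33b = F2 x32a"
  have x33b: "x33b \<in> W 3 3" unfolding x33b_def by (intro W_intros; simp add: T)
  have "E1 x33b = 12 *\<^sub>C x23" "E2 x33b = x32a + 2 *\<^sub>C x32c" unfolding x33b_def by (rule functional_separates; simp add: T; (simp add: field_simps)?)+
  note T = T x33b_def[symmetric] x33b W_h[OF x33b, unfolded ab, simplified] this
  define x33c where "x33c = F2 x32b"
  have x33c: "x33c \<in> W 3 3" unfolding x33c_def by (intro W_intros; simp add: T)
  have "E1 x33c = 4 *\<^sub>C x23" "E2 x33c = x32b + 2 *\<^sub>C x32c" unfolding x33c_def by (rule functional_separates; simp add: T; (simp add: field_simps)?)+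
  note T = T x33c_def[symmetric] x33c W_h[OF x33c, unfolded ab, simplified] this
  have "F2 x32c = (-1) *\<^sub>C x33a + 2 *\<^sub>C x33c"
    by (rule eq_by_raising[of 3 3], simp, (intro W_intros; simp add: T), (rule functional_separates; simp add: T; (simp add: field_simps)?)+)
  note T = T this
  have S33: "W 3 3 \<subseteq> cvec.span {x33a, x33b, x33c}"
    by (rule W_step_span[OF S23 S32]) (simp_all add: T span_intros)
  define x42a where "x42a = F1 x32a"
  have x42a: "x42a \<in> W 4 2" unfolding x42a_def by (intro W_intros; simp add: T)
  have "E1 x42a = 12 *\<^sub>C x32a" "E2 x42a = 0" unfolding x42a_def by (rule functional_separates; simp add: T; (simp add: field_simps)?)+
  note T = T x42a_def[symmetric] x42a W_h[OF x42a, unfolded ab, simplified] this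
  define x42b where "x42b = F1 x32b"
  have x42b: "x42b \<in> W 4 2" unfolding x42b_def by (intro W_intros; simp add: T)
  have "E1 x42b = 2 *\<^sub>C x32a + 2 *\<^sub>C x32b" "E2 x42b = 0" unfolding x42b_def by (rule functional_separates; simp add: T; (simp add: field_simps)?)+
  note T = T x42b_def[symmetric] x42b W_h[OF x42b, unfolded ab, simplified] this
  have "F1 x32c = (-1 / 4) *\<^sub>C x42a + (3 / 2) *\<^sub>C x42b"
    by (rule eq_by_raising[of 4 2], simp, (intro W_intros; simp add: T), (rule functional_separates; simp add: T; (simp add: field_simps)?)+)
  note T = T this
  have S42: "W 4 2 \<subseteq> cvec.span {x42a, x42b}"
    by (rule W_step_span[OF S32 S41]) (simp_all add: T span_intros)
  have S51: "W 5 1 \<subseteq> cvec.span {}"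
    by (rule W_step_span[OF S41 S50]) (simp_all add: T span_intros)
  have S60: "W 6 0 \<subseteq> cvec.span {}"
    by (rule W_step_span[OF S50 W_negative_span[of "6" "-1"]]) (simp_all add: T span_intros)
  define x34 where "x34 = F2 x33a"
  have x34: "x34 \<in> W 3 4" unfolding x34_def by (intro W_intros; simp add: T)
  have "E1 x34 = 0" "E2 x34 = (-1) *\<^sub>C x33a + 2 *\<^sub>C x33c" unfolding x34_def by (rule functional_separates; simp add: T; (simp add: field_simps)?)+
  note T = T x34_def[symmetric] x34 W_h[OF x34, unfolded ab, simplified] this
  have "F2 x33b = 2 *\<^sub>C x34"
    by (rule eq_by_raising[of 3 4], simp, (intro W_intros; simp add: T), (rule functional_separates; simp add: T; (simp add: field_simps)?)+)
  note T = T this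
  have "F2 x33c = 2 *\<^sub>C x34"
    by (rule eq_by_raising[of 3 4], simp, (intro W_intros; simp add: T), (rule functional_separates; simp add: T; (simp add: field_simps)?)+)
  note T = T this
  have S34: "W 3 4 \<subseteq> cvec.span {x34}"
    by (rule W_step_span[OF S24 S33]) (simp_all add: T span_intros)
  define x43a where "x43a = F1 x33a"
  have x43a: "x43a \<in> W 4 3" unfolding x43a_def by (intro W_intros; simp add: T)
  have "E1 x43a = 8 *\<^sub>C x33a" "E2 x43a = 2 *\<^sub>C x42b" unfolding x43a_def by (rule functional_separates; simp add: T; (simp add: field_simps)?)+
  note T = T x43a_def[symmetric] x43a W_h[OF x43a, unfolded ab, simplified] this
  define x43b where "x43b = F1 x33b"
  have x43b: "x43b \<in> W 4 3" unfolding x43b_def by (intro W_intros; simp add: T)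
  have "E1 x43b = 12 *\<^sub>C x33a + 3 *\<^sub>C x33b" "E2 x43b = (1 / 2) *\<^sub>C x42a + 3 *\<^sub>C x42b" unfolding x43b_def by (rule functional_separates; simp add: T; (simp add: field_simps)?)+
  note T = T x43b_def[symmetric] x43b W_h[OF x43b, unfolded ab, simplified] this
  define x43c where "x43c = F1 x33c"
  have x43c: "x43c \<in> W 4 3" unfolding x43c_def by (intro W_intros; simp add: T)
  have "E1 x43c = 4 *\<^sub>C x33a + 3 *\<^sub>C x33c" "E2 x43c = (-1 / 2) *\<^sub>C x42a + 4 *\<^sub>C x42b" unfolding x43c_def by (rule functional_separates; simp add: T; (simp add: field_simps)?)+
  note T = T x43c_def[symmetric] x43c W_h[OF x43c, unfolded ab, simplified] this
  have "F2 x42a = (-6) *\<^sub>C x43a + 4 *\<^sub>C x43b"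
    by (rule eq_by_raising[of 4 3], simp, (intro W_intros; simp add: T), (rule functional_separates; simp add: T; (simp add: field_simps)?)+)
  note T = T this
  have "F2 x42b = (-4 / 3) *\<^sub>C x43a + (2 / 3) *\<^sub>C x43b + (2 / 3) *\<^sub>C x43c"
    by (rule eq_by_raising[of 4 3], simp, (intro W_intros; simp add: T), (rule functional_separates; simp add: T; (simp add: field_simps)?)+)
  note T = T this
  have S43: "W 4 3 \<subseteq> cvec.span {x43a, x43b, x43c}"
    by (rule W_step_span[OF S33 S42]) (simp_all add: T span_intros)
  define x52 where "x52 = F1 x42a"
  have x52: "x52 \<in> W 5 2" unfolding x52_def by (intro W_intros; simp add: T)
  have "E1 x52 = 10 *\<^sub>C x42a" "E2 x52 = 0" unfolding x52_def by (rule functional_separates; simp add: T; (simp add: field_simps)?)+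
  note T = T x52_def[symmetric] x52 W_h[OF x52, unfolded ab, simplified] this
  have "F1 x42b = (1 / 5) *\<^sub>C x52"
    by (rule eq_by_raising[of 5 2], simp, (intro W_intros; simp add: T), (rule functional_separates; simp add: T; (simp add: field_simps)?)+)
  note T = T this
  have S52: "W 5 2 \<subseteq> cvec.span {x52}"
    by (rule W_step_span[OF S42 S51]) (simp_all add: T span_intros)
  have S61: "W 6 1 \<subseteq> cvec.span {}"
    by (rule W_step_span[OF S51 S60]) (simp_all add: T span_intros)
  define x44a where "x44a = F1 x34"
  have x44a: "x44a \<in> W 4 4" unfolding x44a_def by (intro W_intros; simp add: T)
  have "E1 x44a = 6 *\<^sub>C x34" "E2 x44a = (-1) *\<^sub>C x43a + 2 *\<^sub>C x43c" unfolding x44a_def by (rule functional_separates; simp add: T; (simp add: field_simps)?)+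
  note T = T x44a_def[symmetric] x44a W_h[OF x44a, unfolded ab, simplified] this
  define x44b where "x44b = F2 x43a"
  have x44b: "x44b \<in> W 4 4" unfolding x44b_def by (intro W_intros; simp add: T)
  have "E1 x44b = 8 *\<^sub>C x34" "E2 x44b = (-8 / 3) *\<^sub>C x43a + (4 / 3) *\<^sub>C x43b + (4 / 3) *\<^sub>C x43c" unfolding x44b_def by (rule functional_separates; simp add: T; (simp add: field_simps)?)+
  note T = T x44b_def[symmetric] x44b W_h[OF x44b, unfolded ab, simplified] this
  have "F2 x43b = (-1) *\<^sub>C x44a + 3 *\<^sub>C x44b"
    by (rule eq_by_raising[of 4 4], simp, (intro W_intros; simp add: T), (rule functional_separates; simp add: T; (simp add: field_simps)?)+)
  note T = T this
  have "F2 x43c = x44a + (1 / 2) *\<^sub>C x44b"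
    by (rule eq_by_raising[of 4 4], simp, (intro W_intros; simp add: T), (rule functional_separates; simp add: T; (simp add: field_simps)?)+)
  note T = T this
  have S44: "W 4 4 \<subseteq> cvec.span {x44a, x44b}"
    by (rule W_step_span[OF S34 S43]) (simp_all add: T span_intros)
  define x53a where "x53a = F1 x43a"
  have x53a: "x53a \<in> W 5 3" unfolding x53a_def by (intro W_intros; simp add: T)
  have "E1 x53a = 9 *\<^sub>C x43a" "E2 x53a = (2 / 5) *\<^sub>C x52" unfolding x53a_def by (rule functional_separates; simp add: T; (simp add: field_simps)?)+
  note T = T x53a_def[symmetric] x53a W_h[OF x53a, unfolded ab, simplified] this
  define x53b where "x53b = F1 x43b"
  have x53b: "x53b \<in> W 5 3" unfolding x53b_def by (intro W_intros; simp add: T)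
  have "E1 x53b = 12 *\<^sub>C x43a + 4 *\<^sub>C x43b" "E2 x53b = (11 / 10) *\<^sub>C x52" unfolding x53b_def by (rule functional_separates; simp add: T; (simp add: field_simps)?)+
  note T = T x53b_def[symmetric] x53b W_h[OF x53b, unfolded ab, simplified] this
  define x53c where "x53c = F1 x43c"
  have x53c: "x53c \<in> W 5 3" unfolding x53c_def by (intro W_intros; simp add: T)
  have "E1 x53c = 4 *\<^sub>C x43a + 4 *\<^sub>C x43c" "E2 x53c = (3 / 10) *\<^sub>C x52" unfolding x53c_def by (rule functional_separates; simp add: T; (simp add: field_simps)?)+
  note T = T x53c_def[symmetric] x53c W_h[OF x53c, unfolded ab, simplified] this
  have "F2 x52 = (-20) *\<^sub>C x53a + 10 *\<^sub>C x53b"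
    by (rule eq_by_raising[of 5 3], simp, (intro W_intros; simp add: T), (rule functional_separates; simp add: T; (simp add: field_simps)?)+)
  note T = T this
  have S53: "W 5 3 \<subseteq> cvec.span {x53a, x53b, x53c}"
    by (rule W_step_span[OF S43 S52]) (simp_all add: T span_intros)
  define x62 where "x62 = F1 x52"
  have x62: "x62 \<in> W 6 2" unfolding x62_def by (intro W_intros; simp add: T)
  have "E1 x62 = 6 *\<^sub>C x52" "E2 x62 = 0" unfolding x62_def by (rule functional_separates; simp add: T; (simp add: field_simps)?)+
  note T = T x62_def[symmetric] x62 W_h[OF x62, unfolded ab, simplified] this
  have S62: "W 6 2 \<subseteq> cvec.span {x62}"
    by (rule W_step_span[OF S52 S61]) (simp_all add: T span_intros)
  define x54a where "x54a = F1 x44a"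
  have x54a: "x54a \<in> W 5 4" unfolding x54a_def by (intro W_intros; simp add: T)
  have "E1 x54a = 10 *\<^sub>C x44a" "E2 x54a = (-1) *\<^sub>C x53a + 2 *\<^sub>C x53c" unfolding x54a_def by (rule functional_separates; simp add: T; (simp add: field_simps)?)+
  note T = T x54a_def[symmetric] x54a W_h[OF x54a, unfolded ab, simplified] this
  define x54b where "x54b = F1 x44b"
  have x54b: "x54b \<in> W 5 4" unfolding x54b_def by (intro W_intros; simp add: T)
  have "E1 x54b = 8 *\<^sub>C x44a + 4 *\<^sub>C x44b" "E2 x54b = (-8 / 3) *\<^sub>C x53a + (4 / 3) *\<^sub>C x53b + (4 / 3) *\<^sub>C x53c" unfolding x54b_def by (rule functional_separates; simp add: T; (simp add: field_simps)?)+
  note T = T x54b_def[symmetric] x54b W_h[OF x54b, unfolded ab, simplified] this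
  define x54c where "x54c = F2 x53a"
  have x54c: "x54c \<in> W 5 4" unfolding x54c_def by (intro W_intros; simp add: T)
  have "E1 x54c = 9 *\<^sub>C x44b" "E2 x54c = (-7) *\<^sub>C x53a + 4 *\<^sub>C x53b" unfolding x54c_def by (rule functional_separates; simp add: T; (simp add: field_simps)?)+
  note T = T x54c_def[symmetric] x54c W_h[OF x54c, unfolded ab, simplified] this
  have "F2 x53b = 2 *\<^sub>C x54a + (-3) *\<^sub>C x54b + 4 *\<^sub>C x54c"
    by (rule eq_by_raising[of 5 4], simp, (intro W_intros; simp add: T), (rule functional_separates; simp add: T; (simp add: field_simps)?)+)
  note T = T this
  have "F2 x53c = x54a + (-3 / 4) *\<^sub>C x54b + x54c"
    by (rule eq_by_raising[of 5 4], simp, (intro W_intros; simp add: T), (rule functional_separates; simp add: T; (simp add: field_simps)?)+)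
  note T = T this
  have S54: "W 5 4 \<subseteq> cvec.span {x54a, x54b, x54c}"
    by (rule W_step_span[OF S44 S53]) (simp_all add: T span_intros)
  define x63a where "x63a = F1 x53a"
  have x63a: "x63a \<in> W 6 3" unfolding x63a_def by (intro W_intros; simp add: T)
  have "E1 x63a = 8 *\<^sub>C x53a" "E2 x63a = (2 / 5) *\<^sub>C x62" unfolding x63a_def by (rule functional_separates; simp add: T; (simp add: field_simps)?)+
  note T = T x63a_def[symmetric] x63a W_h[OF x63a, unfolded ab, simplified] this
  define x63b where "x63b = F1 x53b"
  have x63b: "x63b \<in> W 6 3" unfolding x63b_def by (intro W_intros; simp add: T)
  have "E1 x63b = 12 *\<^sub>C x53a + 3 *\<^sub>C x53b" "E2 x63b = (11 / 10) *\<^sub>C x62" unfolding x63b_def by (rule functional_separates; simp add: T; (simp add: field_simps)?)+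
  note T = T x63b_def[symmetric] x63b W_h[OF x63b, unfolded ab, simplified] this
  define x63c where "x63c = F1 x53c"
  have x63c: "x63c \<in> W 6 3" unfolding x63c_def by (intro W_intros; simp add: T)
  have "E1 x63c = 4 *\<^sub>C x53a + 3 *\<^sub>C x53c" "E2 x63c = (3 / 10) *\<^sub>C x62" unfolding x63c_def by (rule functional_separates; simp add: T; (simp add: field_simps)?)+
  note T = T x63c_def[symmetric] x63c W_h[OF x63c, unfolded ab, simplified] this
  have "F2 x62 = (-45) *\<^sub>C x63a + 20 *\<^sub>C x63b"
    by (rule eq_by_raising[of 6 3], simp, (intro W_intros; simp add: T), (rule functional_separates; simp add: T; (simp add: field_simps)?)+)
  note T = T this
  have S63: "W 6 3 \<subseteq> cvec.span {x63a, x63b, x63c}"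
    by (rule W_step_span[OF S53 S62]) (simp_all add: T span_intros)
  define p where "p = (F1 x54a)"
  have p: "p \<in> W 6 4" unfolding p_def by (intro W_intros; simp add: T)
  have "E1 p = 12 *\<^sub>C x54a" "E2 p = (-1) *\<^sub>C x63a + 2 *\<^sub>C x63c" unfolding p_def by (rule functional_separates; simp add: T; (simp add: field_simps)?)+
  note T = T p W_h[OF p, unfolded ab, simplified] this
  define q where "q = (-4) *\<^sub>C (F1 x54a) + 3 *\<^sub>C (F1 x54b)"
  have q: "q \<in> W 6 4" unfolding q_def by (intro W_intros; simp add: T)
  have "E1 q = (-24) *\<^sub>C x54a + 18 *\<^sub>C x54b" "E2 q = (-4) *\<^sub>C x63a + 4 *\<^sub>C x63b + (-4) *\<^sub>C x63c" unfolding q_def by (rule functional_separates; simp add: T; (simp add: field_simps)?)+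
  note T = T q W_h[OF q, unfolded ab, simplified] this
  define r where "r = 36 *\<^sub>C (F1 x54a) + (-45) *\<^sub>C (F1 x54b) + 20 *\<^sub>C (F1 x54c)"
  have r: "r \<in> W 6 4" unfolding r_def by (intro W_intros; simp add: T)
  have "E1 r = 72 *\<^sub>C x54a + (-90) *\<^sub>C x54b + 40 *\<^sub>C x54c" "E2 r = (-56) *\<^sub>C x63a + 20 *\<^sub>C x63b + 12 *\<^sub>C x63c" unfolding r_def by (rule functional_separates; simp add: T; (simp add: field_simps)?)+
  note T = T r W_h[OF r, unfolded ab, simplified] this
  define s where "s = (-27) *\<^sub>C (F1 x54a) + 39 *\<^sub>C (F1 x54b) + (-24) *\<^sub>C (F1 x54c) + 2 *\<^sub>C (F2 x63b)"
  have s: "s \<in> W 6 4" unfolding s_def by (intro W_intros; simp add: T)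
  have "E1 s = 0" "E2 s = (-8) *\<^sub>C x63a + 4 *\<^sub>C x63b + (-2) *\<^sub>C x63c" unfolding s_def by (rule functional_separates; simp add: T; (simp add: field_simps)?)+
  note T = T s W_h[OF s, unfolded ab, simplified] this
  define t where "t = (-32) *\<^sub>C (F1 x54a) + 45 *\<^sub>C (F1 x54b) + (-28) *\<^sub>C (F1 x54c) + 8 *\<^sub>C (F2 x63c)"
  have t: "t \<in> W 6 4" unfolding t_def by (intro W_intros; simp add: T)
  have "E1 t = 0" "E2 t = (-4) *\<^sub>C x63b + 12 *\<^sub>C x63c" unfolding t_def by (rule functional_separates; simp add: T; (simp add: field_simps)?)+
  note T = T t W_h[OF t, unfolded ab, simplified] this
  have "F1 x54a = p"
    by (rule eq_by_raising[of 6 4], simp, (intro W_intros; simp add: T), (rule functional_separates; simp add: T; (simp add: field_simps)?)+)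
  note T = T this
  have "F1 x54b = (4 / 3) *\<^sub>C p + (1 / 3) *\<^sub>C q"
    by (rule eq_by_raising[of 6 4], simp, (intro W_intros; simp add: T), (rule functional_separates; simp add: T; (simp add: field_simps)?)+)
  note T = T this
  have "F1 x54c = (6 / 5) *\<^sub>C p + (3 / 4) *\<^sub>C q + (1 / 20) *\<^sub>C r"
    by (rule eq_by_raising[of 6 4], simp, (intro W_intros; simp add: T), (rule functional_separates; simp add: T; (simp add: field_simps)?)+)
  note T = T this
  have "F2 x63a = (4 / 5) *\<^sub>C p + q + (1 / 5) *\<^sub>C r"
    by (rule eq_by_raising[of 6 4], simp, (intro W_intros; simp add: T), (rule functional_separates; simp add: T; (simp add: field_simps)?)+)
  note T = T this
  have "F2 x63b = (19 / 10) *\<^sub>C p + (5 / 2) *\<^sub>C q + (3 / 5) *\<^sub>C r + (1 / 2) *\<^sub>C s"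
    by (rule eq_by_raising[of 6 4], simp, (intro W_intros; simp add: T), (rule functional_separates; simp add: T; (simp add: field_simps)?)+)
  note T = T this
  have "F2 x63c = (7 / 10) *\<^sub>C p + (3 / 4) *\<^sub>C q + (7 / 40) *\<^sub>C r + (1 / 8) *\<^sub>C t"
    by (rule eq_by_raising[of 6 4], simp, (intro W_intros; simp add: T), (rule functional_separates; simp add: T; (simp add: field_simps)?)+)
  note T = T this
  have S64: "W 6 4 \<subseteq> cvec.span {p, q, r, s, t}"
    by (rule W_step_span[OF S54 S63]) (simp_all add: T span_intros)
  have X_p: "F1 (E1 p) = 12 *\<^sub>C p" by (rule functional_separates; simp add: T; (simp add: field_simps)?)+
  have Y_p: "F2 (E2 p) = (3 / 5) *\<^sub>C p + (1 / 2) *\<^sub>C q + (3 / 20) *\<^sub>C r + (1 / 4) *\<^sub>C t" by (rule functional_separates; simp add: T; (simp add: field_simps)?)+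
  have X_q: "F1 (E1 q) = 6 *\<^sub>C q" by (rule functional_separates; simp add: T; (simp add: field_simps)?)+
  have Y_q: "F2 (E2 q) = (8 / 5) *\<^sub>C p + 3 *\<^sub>C q + (9 / 10) *\<^sub>C r + 2 *\<^sub>C s + (-1 / 2) *\<^sub>C t" by (rule functional_separates; simp add: T; (simp add: field_simps)?)+
  have X_r: "F1 (E1 r) = 2 *\<^sub>C r" by (rule functional_separates; simp add: T; (simp add: field_simps)?)+
  have Y_r: "F2 (E2 r) = (8 / 5) *\<^sub>C p + 3 *\<^sub>C q + (29 / 10) *\<^sub>C r + 10 *\<^sub>C s + (3 / 2) *\<^sub>C t" by (rule functional_separates; simp add: T; (simp add: field_simps)?)+
  have X_s: "F1 (E1 s) = 0" by (rule functional_separates; simp add: T; (simp add: field_simps)?)+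
  have Y_s: "F2 (E2 s) = (-1 / 5) *\<^sub>C p + (1 / 2) *\<^sub>C q + (9 / 20) *\<^sub>C r + 2 *\<^sub>C s + (-1 / 4) *\<^sub>C t" by (rule functional_separates; simp add: T; (simp add: field_simps)?)+
  have X_t: "F1 (E1 t) = 0" by (rule functional_separates; simp add: T; (simp add: field_simps)?)+
  have Y_t: "F2 (E2 t) = (4 / 5) *\<^sub>C p + (-1) *\<^sub>C q + (-3 / 10) *\<^sub>C r + (-2) *\<^sub>C s + (3 / 2) *\<^sub>C t" by (rule functional_separates; simp add: T; (simp add: field_simps)?)+
  fix U assume U: "cvec.subspace U" "U \<subseteq> V0" and X: "\<And>x. x \<in> U \<Longrightarrow> F1 (E1 x) \<in> U"
    and Y: "\<And>x. x \<in> U \<Longrightarrow> F2 (E2 x) \<in> U" and nz: "\<exists>x\<in>U. x \<noteq> 0"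
  have V0: "V0 \<subseteq> cvec.span {p, q, r, s, t}" unfolding V0_W ab using S64 by simp
  have split: "c *\<^sub>C p \<in> U" "d *\<^sub>C q \<in> U" "k *\<^sub>C r \<in> U" "m *\<^sub>C s + n *\<^sub>C t \<in> U"
    if "c *\<^sub>C p + d *\<^sub>C q + k *\<^sub>C r + m *\<^sub>C s + n *\<^sub>C t \<in> U" for c d k m n
    using eigen_split[OF U(1) X, of 12 6 2 0 "c *\<^sub>C p" "d *\<^sub>C q" "k *\<^sub>C r" "m *\<^sub>C s + n *\<^sub>C t"] that
    by (simp_all add: act X_p X_q X_r X_s X_t cvec.scale_left_commute add.assoc)
  have Yp: "(3 / 5) *\<^sub>C p + (1 / 2) *\<^sub>C q + (3 / 20) *\<^sub>C r + 0 *\<^sub>C s + (1 / 4) *\<^sub>C t \<in> U" if "p \<in> U"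
    using Y[OF that] unfolding Y_p by simp
  have all: "{p, q, r, s, t} \<subseteq> U" if p: "p \<in> U"
  proof -
    have "(1 / 2) *\<^sub>C q \<in> U" "(3 / 20) *\<^sub>C r \<in> U" "0 *\<^sub>C s + (1 / 4) *\<^sub>C t \<in> U" by (rule split[OF Yp[OF p]])+
    then have q: "q \<in> U" and r: "r \<in> U" and t: "t \<in> U"
      using unscale[OF U(1), of "1 / 2" q] unscale[OF U(1), of "3 / 20" r] unscale[OF U(1), of "1 / 4" t] by simp_all
    have "2 *\<^sub>C s + (- 1 / 2) *\<^sub>C t \<in> U" using split(4)[OF Y[OF q, unfolded Y_q]] .
    from cvec.subspace_diff[OF U(1) this cvec.subspace_scale[OF U(1) t, of "- 1 / 2"]]
    have "s \<in> U" using unscale[OF U(1), of 2 s] by simp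
    then show ?thesis using p q r t by auto
  qed
  have q: "p \<in> U" if "q \<in> U" by (rule unscale[OF U(1) split(1)[OF Y[OF that, unfolded Y_q]]]) simp
  have r: "p \<in> U" if "r \<in> U" by (rule unscale[OF U(1) split(1)[OF Y[OF that, unfolded Y_r]]]) simp
  have st: "p \<in> U" if st: "m *\<^sub>C s + n *\<^sub>C t \<in> U" "m \<noteq> 0 \<or> n \<noteq> 0" for m n
  proof -
    have "F2 (E2 (m *\<^sub>C s + n *\<^sub>C t)) = ((4 * n - m) / 5) *\<^sub>C p + ((m - 2 * n) / 2) *\<^sub>C q
        + ((9 * m - 6 * n) / 20) *\<^sub>C r + (2 * m - 2 * n) *\<^sub>C s + ((6 * n - m) / 4) *\<^sub>C t"
      by (rule functional_separates) (simp add: act Y_s Y_t; simp add: field_simps)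
    then have "((4 * n - m) / 5) *\<^sub>C p \<in> U" "((m - 2 * n) / 2) *\<^sub>C q \<in> U"
      using split[of "(4 * n - m) / 5" "(m - 2 * n) / 2"] Y[OF st(1)] by simp_all
    then have "4 * n - m \<noteq> 0 \<Longrightarrow> p \<in> U" "m - 2 * n \<noteq> 0 \<Longrightarrow> q \<in> U"
      using unscale[OF U(1), of "(4 * n - m) / 5" p] unscale[OF U(1), of "(m - 2 * n) / 2" q] by simp_all
    moreover have "4 * n - m \<noteq> 0 \<or> m - 2 * n \<noteq> 0" using st(2) by auto
    ultimately show ?thesis using q by auto
  qed
  obtain x where x: "x \<in> U" "x \<noteq> 0" using nz by auto
  have "x \<in> cvec.span {p, q, r, s, t}" using x(1) U(2) V0 by auto
  then have "\<exists>c d k m n. x = c *\<^sub>C p + d *\<^sub>C q + k *\<^sub>C r + m *\<^sub>C s + n *\<^sub>C t"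
    unfolding span_insert_iff cvec.span_empty
    by (elim exE conjE) (simp only: singleton_iff add_0_right add.assoc, blast)
  then obtain c d k m n where x_eq: "x = c *\<^sub>C p + d *\<^sub>C q + k *\<^sub>C r + m *\<^sub>C s + n *\<^sub>C t" by auto
  have "c \<noteq> 0 \<or> d \<noteq> 0 \<or> k \<noteq> 0 \<or> m \<noteq> 0 \<or> n \<noteq> 0" using x(2) x_eq by auto
  then have "p \<in> U"
    using split[of c d k m n] x(1) x_eq unscale[OF U(1), of c p] unscale[OF U(1), of d q] unscale[OF U(1), of k r]
      q r st[of m n] by auto
  then have "{p, q, r, s, t} \<subseteq> U" by (rule all)
  then show "V0 \<subseteq> U" using V0 cvec.span_minimal[of "{p, q, r, s, t}" U] U(1) by auto
qed

end

section \<open>The criterion\<close>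

theorem theorem1p7:
  fixes h :: "'g::lie_algebra set"
    and B :: "'g \<Rightarrow> 'g \<Rightarrow> complex"
    and \<alpha>\<^sub>1 \<alpha>\<^sub>2 \<omega>\<^sub>1 \<omega>\<^sub>2 :: "'g \<Rightarrow> complex"
    and e f :: "('g \<Rightarrow> complex) \<Rightarrow> 'g"
    and \<rho> :: "'g \<Rightarrow> 'v::complex_vector \<Rightarrow> 'v"
  assumes "simple_lie_algebra TYPE('g)"
    and "cartan_subalgebra h"
    and "killing_multiple B"
    and "g2_base B h \<alpha>\<^sub>1 \<alpha>\<^sub>2"
    and "fundamental_weights B h \<alpha>\<^sub>1 \<alpha>\<^sub>2 \<omega>\<^sub>1 \<omega>\<^sub>2"
    and "root_vectors B h e f"
    and "finite_dim TYPE('v)"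
    and "simple_module \<rho>"
    and "nontrivial_module \<rho>"
  shows "self_dual \<rho> \<and>
    weight_space \<rho> h (\<lambda>_. 0) \<noteq> {0} \<and>
    (irreducible_under (casimir_algebra B h e f) \<rho> (weight_space \<rho> h (\<lambda>_. 0)) \<longleftrightarrow>
      (\<exists>\<mu> \<in> {\<omega>\<^sub>1, \<omega>\<^sub>2, (\<lambda>t. 2 * \<omega>\<^sub>1 t), (\<lambda>t. 2 * \<omega>\<^sub>2 t)}.
         has_highest_weight \<rho> h \<alpha>\<^sub>1 \<alpha>\<^sub>2 \<mu>))"
proof -
  interpret g2_simple_module h B e f \<alpha>\<^sub>1 \<alpha>\<^sub>2 \<rho>
    using assms by unfold_locales
  have simple: "\<alpha>\<^sub>1 \<in> positive_roots h \<alpha>\<^sub>1 \<alpha>\<^sub>2" "\<alpha>\<^sub>2 \<in> positive_roots h \<alpha>\<^sub>1 \<alpha>\<^sub>2"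
    unfolding positive_roots_def using base_roots
    by (auto intro: exI[of _ "1::nat"] exI[of _ "0::nat"] exI[of _ "0::nat", THEN exI[of _ "1::nat"]]
        simp: fun_eq_iff)
  have e_simple: "e \<alpha>\<^sub>1 \<in> root_space h \<alpha>\<^sub>1" "e \<alpha>\<^sub>2 \<in> root_space h \<alpha>\<^sub>2"
    using root_vectorsD(1) base_roots by auto
  have fw: "\<omega>\<^sub>1 \<in> dual_of h" "\<omega>\<^sub>2 \<in> dual_of h"
      "\<omega>\<^sub>1 (coroot B h \<alpha>\<^sub>1) = 1" "\<omega>\<^sub>1 (coroot B h \<alpha>\<^sub>2) = 0"
      "\<omega>\<^sub>2 (coroot B h \<alpha>\<^sub>1) = 0" "\<omega>\<^sub>2 (coroot B h \<alpha>\<^sub>2) = 1"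
    using assms(5) unfolding fundamental_weights_def by auto
  obtain \<Lambda> v where \<Lambda>: "\<Lambda> \<in> dual_of h" and v: "v \<in> weight_space \<rho> h \<Lambda>" "v \<noteq> 0"
    and hw: "\<forall>\<alpha>\<in>positive_roots h \<alpha>\<^sub>1 \<alpha>\<^sub>2. \<forall>x\<in>root_space h \<alpha>. \<rho> x v = 0"
    using highest_vector_exists by auto
  have ev: "\<rho> (e \<alpha>\<^sub>1) v = 0" "\<rho> (e \<alpha>\<^sub>2) v = 0" using hw simple e_simple by auto
  obtain a b where ab: "\<Lambda> (coroot B h \<alpha>\<^sub>1) = of_nat a" "\<Lambda> (coroot B h \<alpha>\<^sub>2) = of_nat b"
    using sl2_integral[OF base_roots(1) v ev(1)] sl2_integral[OF base_roots(2) v ev(2)] by auto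
  interpret V: g2_highest h B e f \<alpha>\<^sub>1 \<alpha>\<^sub>2 \<rho> \<Lambda> v a b
    using \<Lambda> v ev ab by unfold_locales
  let ?irr = "irreducible_under (casimir_algebra B h e f) \<rho> (weight_space \<rho> h (\<lambda>_. 0))"
  have "weight_space \<rho> h (\<lambda>_. 0) \<noteq> {0}" using V.V0_nonzero unfolding V.V0_def by auto
  moreover have "\<exists>\<mu> \<in> {\<omega>\<^sub>1, \<omega>\<^sub>2, (\<lambda>t. 2 * \<omega>\<^sub>1 t), (\<lambda>t. 2 * \<omega>\<^sub>2 t)}. has_highest_weight \<rho> h \<alpha>\<^sub>1 \<alpha>\<^sub>2 \<mu>"
    if irr: ?irr
  proof
    have "(a, b) \<in> {(0, 0), (1, 0), (0, 1), (2, 0), (0, 2)}"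
      using V.reducible irr unfolding V.V0_def by blast
    then have cases: "(a, b) \<in> {(1, 0), (0, 1), (2, 0), (0, 2)}"
      using V.trivial_if_zero assms(9) by blast
    have eq: "\<Lambda> = \<mu>" if "\<mu> \<in> dual_of h" "\<mu> (coroot B h \<alpha>\<^sub>1) = of_nat a" "\<mu> (coroot B h \<alpha>\<^sub>2) = of_nat b" for \<mu>
      by (rule dual_of_h_eqI[OF \<Lambda> that(1)]) (simp_all add: h1_def h2_def ab that)
    show "\<Lambda> \<in> {\<omega>\<^sub>1, \<omega>\<^sub>2, (\<lambda>t. 2 * \<omega>\<^sub>1 t), (\<lambda>t. 2 * \<omega>\<^sub>2 t)}"
      using cases eq[of \<omega>\<^sub>1] eq[of \<omega>\<^sub>2] eq[OF dual_of_scale[OF fw(1)], of 2] eq[OF dual_of_scale[OF fw(2)], of 2] fw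
      by auto
    show "has_highest_weight \<rho> h \<alpha>\<^sub>1 \<alpha>\<^sub>2 \<Lambda>" unfolding has_highest_weight_def using \<Lambda> v hw by auto
  qed
  moreover have ?irr
    if mu: "\<mu> \<in> {\<omega>\<^sub>1, \<omega>\<^sub>2, (\<lambda>t. 2 * \<omega>\<^sub>1 t), (\<lambda>t. 2 * \<omega>\<^sub>2 t)}" "has_highest_weight \<rho> h \<alpha>\<^sub>1 \<alpha>\<^sub>2 \<mu>" for \<mu>
  proof -
    obtain w where w: "w \<in> weight_space \<rho> h \<mu>" "w \<noteq> 0" "\<mu> \<in> dual_of h"
      and hw': "\<forall>\<alpha>\<in>positive_roots h \<alpha>\<^sub>1 \<alpha>\<^sub>2. \<forall>x\<in>root_space h \<alpha>. \<rho> x w = 0"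
      using mu(2) unfolding has_highest_weight_def by auto
    have ew: "\<rho> (e \<alpha>\<^sub>1) w = 0" "\<rho> (e \<alpha>\<^sub>2) w = 0" using hw' simple e_simple by auto
    have H: "g2_highest h B e f \<alpha>\<^sub>1 \<alpha>\<^sub>2 \<rho> \<mu> w i j"
      if "\<mu> (coroot B h \<alpha>\<^sub>1) = of_nat i" "\<mu> (coroot B h \<alpha>\<^sub>2) = of_nat j" for i j
      using w ew that by unfold_locales
    consider "\<mu> = \<omega>\<^sub>1" | "\<mu> = \<omega>\<^sub>2" | "\<mu> = (\<lambda>t. 2 * \<omega>\<^sub>1 t)" | "\<mu> = (\<lambda>t. 2 * \<omega>\<^sub>2 t)" using mu(1) by auto
    then show ?thesis
    proof cases
      case 1
      interpret g2_highest h B e f \<alpha>\<^sub>1 \<alpha>\<^sub>2 \<rho> \<mu> w 1 0 by (rule H) (simp_all add: 1 fw)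
      show ?thesis using irreducible_first unfolding V0_def by simp
    next
      case 2
      interpret g2_highest h B e f \<alpha>\<^sub>1 \<alpha>\<^sub>2 \<rho> \<mu> w 0 1 by (rule H) (simp_all add: 2 fw)
      show ?thesis using irreducible_second unfolding V0_def by simp
    next
      case 3
      interpret g2_highest h B e f \<alpha>\<^sub>1 \<alpha>\<^sub>2 \<rho> \<mu> w 2 0 by (rule H) (simp_all add: 3 fw)
      show ?thesis using irreducible_twice_first unfolding V0_def by simp
    next
      case 4
      interpret g2_highest h B e f \<alpha>\<^sub>1 \<alpha>\<^sub>2 \<rho> \<mu> w 0 2 by (rule H) (simp_all add: 4 fw)
      show ?thesis using irreducible_twice_second unfolding V0_def by simp
    qed
  qed
  ultimately show ?thesis using V.self_dual_module by blast
qed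

end
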